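(* Let $N_c\ge 2$ and $1\le N_f\le N_c-1$ be integers, let $0\le t,\tilde t<1$, and let $x,y$ be $SU(N_f)$ fugacities. Then the Hilbert series of $SU(N_c)$ SQCD with $N_f$ flavours equals that of $U(N_c)$ SQCD with $N_f$ flavours and is given by $$g_{N_f,SU(N_c)}(t,\tilde t,x,y)=\mathrm{PE}\big[[1,0,\dots,0;0,\dots,0,1]_{x;y}\,t\tilde t\,\big]=\frac{1}{1-(t\tilde t)^{N_f}}\sum_{n_1,\dots,n_{N_f-1}=0}^\infty[n_1,n_2,\dots,n_{N_f-1};n_{N_f-1},\dots,n_2,n_1]_{x;y}\,(t\tilde t)^{\sum_{j=1}^{N_f-1}jn_j}.$$ In particular, setting all $x$'s and $y$'s to $1$, $g_{N_f,SU(N_c)}(t,\tilde t)=\dfrac{1}{(1-t\tilde t)^{N_f^2}}$.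
   Context: Fugacities: $x=(x_1,\dots,x_{N_f-1})$ and $y=(y_1,\dots,y_{N_f-1})$ are complex numbers of modulus $1$. Put $\xi_1=x_1$, $\xi_k=x_k/x_{k-1}$ for $2\le k\le N_f-1$, $\xi_{N_f}=1/x_{N_f-1}$, and define $\eta_1,\dots,\eta_{N_f}$ from $y$ in the same way (for $N_f=1$: $\xi_1=\eta_1=1$). Characters: $[a_1,\dots,a_{N_f-1};b_1,\dots,b_{N_f-1}]_{x;y}$ is the character of the irreducible representation of $SU(N_f)\times SU(N_f)$ with Dynkin labels $[a_1,\dots,a_{N_f-1}]$ and $[b_1,\dots,b_{N_f-1}]$, evaluated at $(\mathrm{diag}(\xi_i),\mathrm{diag}(\eta_j))$; the fundamental is $[1,0,\dots,0]$ with character $\sum_i\xi_i$ and the antifundamental is $[0,\dots,0,1]$ with character $\sum_j\eta_j^{-1}$ in the $y$ variables. (For $N_f=1$ the groups are trivial, all characters are $1$ and the sum is the single term $1$.) The plethystic exponential is $\mathrm{PE}[g(t_1,\dots,t_n)]=\exp\big(\sum_{r\ge1}\frac1r g(t_1^r,\dots,t_n^r)\big)$, taken over all variables including $x,y$; thus $\mathrm{PE}\big[[1,0,\dots,0;0,\dots,0,1]_{x;y}t\tilde t\big]=\prod_{i,j=1}^{N_f}\frac{1}{1-t\tilde t\,\xi_i\eta_j^{-1}}$. Hilbert series: with $\phi(z)=\prod_{i=1}^{N_f}\frac{1}{1-t\xi_i z^{-1}}\prod_{j=1}^{N_f}\frac{1}{1-\tilde t\eta_j^{-1}z}$, for $G=U(N_c)$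 or $SU(N_c)$, $g_{N_f,G}(t,\tilde t,x,y)=\int_G\prod_{a=1}^{N_c}\phi(z_a)\,d\mu_G$, where $\mu_G$ is the normalised Haar measure and $z_1,\dots,z_{N_c}$ are the eigenvalues of the group element. *)

theory Defs
  imports
    "HOL-Analysis.Bochner_Integration"
    "HOL-Analysis.Abstract_Topology"
    "HOL-Analysis.Infinite_Sum"
    "HOL-Probability.Probability_Measure"
    "HOL-Algebra.Group"
    "Jordan_Normal_Form.Schur_Decomposition"
begin

section \<open>Matrix groups and Haar measure\<close>

definition unitary_group :: "nat \<Rightarrow> complex mat monoid" where
  "unitary_group n =
    \<lparr>carrier = {A \<in> carrier_mat n n. mat_adjoint A * A = 1\<^sub>m n}, monoid.mult = (*), one = 1\<^sub>m n\<rparr>"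

definition special_unitary_group :: "nat \<Rightarrow> complex mat monoid" where
  "special_unitary_group n =
    \<lparr>carrier = {A \<in> carrier (unitary_group n). Determinant.det A = 1},
     monoid.mult = (*), one = 1\<^sub>m n\<rparr>"

definition general_linear_group :: "nat \<Rightarrow> complex mat monoid" where
  "general_linear_group n =
    \<lparr>carrier = {A \<in> carrier_mat n n. invertible_mat A}, monoid.mult = (*), one = 1\<^sub>m n\<rparr>"

text \<open>The usual topology of the space of complex \<open>n \<times> n\<close> matrices, i.e. that of entrywise convergence.
  The type \<open>mat\<close> carries no topology of its own.\<close>

definition mat_topology :: "nat \<Rightarrow> complex mat topology" where
  "mat_topology n =
    pullback_topology (carrier_mat n n) (\<lambda>A. \<lambda>ij\<in>{..<n} \<times> {..<n}. A $$ ij)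
      (product_topology (\<lambda>_. euclidean) ({..<n} \<times> {..<n}))"

definition group_topology :: "nat \<Rightarrow> complex mat monoid \<Rightarrow> complex mat topology" where
  "group_topology n G = subtopology (mat_topology n) (carrier G)"

definition normalised_haar_measure ::
    "nat \<Rightarrow> complex mat monoid \<Rightarrow> complex mat measure \<Rightarrow> bool" where
  "normalised_haar_measure n G \<mu> \<longleftrightarrow>
    prob_space \<mu> \<and>
    space \<mu> = carrier G \<and>
    sets \<mu> = sigma_sets (carrier G) {S. openin (group_topology n G) S} \<and>
    (\<forall>g\<in>carrier G. \<forall>S\<in>sets \<mu>. emeasure \<mu> ((\<lambda>h. g \<otimes>\<^bsub>G\<^esub> h) ` S) = emeasure \<mu> S)"

section \<open>Fugacities\<close>

text \<open>A fugacity vector \<open>x\<^sub>1, \<dots>, x\<^bsub>N-1\<^esub>\<close> is a function on \<open>nat\<close> of which only the values on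
  \<open>{1..<N}\<close> matter; \<open>torus_coord N x k\<close> is \<open>x\<^sub>k / x\<^bsub>k-1\<^esub>\<close> with the convention
  \<open>x\<^sub>0 = x\<^sub>N = 1\<close>.\<close>

definition fugacities :: "nat \<Rightarrow> (nat \<Rightarrow> complex) \<Rightarrow> bool" where
  "fugacities N x \<longleftrightarrow> (\<forall>k\<in>{1..<N}. cmod (x k) = 1)"

definition torus_coord :: "nat \<Rightarrow> (nat \<Rightarrow> complex) \<Rightarrow> nat \<Rightarrow> complex" where
  "torus_coord N x k = (if k < N then x k else 1) / (if k = 1 then 1 else x (k - 1))"

definition torus_element :: "nat \<Rightarrow> (nat \<Rightarrow> complex) \<Rightarrow> complex mat" where
  "torus_element N x = mat_diag N (\<lambda>i. torus_coord N x (Suc i))"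

section \<open>Irreducible representations of SU(N) x SU(N)\<close>

text \<open>A finite-dimensional continuous complex representation of \<open>SU(N) \<times> SU(N)\<close>
  on \<open>\<complex>\<^sup>d\<close>.\<close>

definition representation ::
    "nat \<Rightarrow> nat \<Rightarrow> (complex mat \<times> complex mat \<Rightarrow> complex mat) \<Rightarrow> bool" where
  "representation N d \<rho> \<longleftrightarrow>
    \<rho> \<in> hom (special_unitary_group N \<times>\<times> special_unitary_group N) (general_linear_group d) \<and>
    continuous_map
      (prod_topology (group_topology N (special_unitary_group N))
                     (group_topology N (special_unitary_group N)))
      (group_topology d (general_linear_group d)) \<rho>"

definition invariant_subspace ::
    "nat \<Rightarrow> nat \<Rightarrow> (complex mat \<times> complex mat \<Rightarrow> complex mat) \<Rightarrow> complex vec set \<Rightarrow> bool" where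
  "invariant_subspace N d \<rho> W \<longleftrightarrow>
    W \<subseteq> carrier_vec d \<and> 0\<^sub>v d \<in> W \<and>
    (\<forall>v\<in>W. \<forall>w\<in>W. v + w \<in> W) \<and>
    (\<forall>c. \<forall>v\<in>W. c \<cdot>\<^sub>v v \<in> W) \<and>
    (\<forall>g\<in>carrier (special_unitary_group N \<times>\<times> special_unitary_group N). \<forall>v\<in>W. \<rho> g *\<^sub>v v \<in> W)"

definition irreducible_representation ::
    "nat \<Rightarrow> nat \<Rightarrow> (complex mat \<times> complex mat \<Rightarrow> complex mat) \<Rightarrow> bool" where
  "irreducible_representation N d \<rho> \<longleftrightarrow>
    representation N d \<rho> \<and> d > 0 \<and>
    (\<forall>W. invariant_subspace N d \<rho> W \<longrightarrow> W = {0\<^sub>v d} \<or> W = carrier_vec d)"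

text \<open>Weights are written in the basis of fundamental weights: since
  \<open>x\<^sub>k = \<xi>\<^sub>1 \<cdots> \<xi>\<^sub>k\<close> is the \<open>k\<close>-th fundamental weight of the maximal torus, the weight with
  coordinates \<open>m\<close> is the character \<open>\<Prod>k\<in>{1..<N}. x k powi m k\<close>.\<close>

definition is_weight ::
    "nat \<Rightarrow> nat \<Rightarrow> (complex mat \<times> complex mat \<Rightarrow> complex mat) \<Rightarrow> (nat \<Rightarrow> int) \<Rightarrow> (nat \<Rightarrow> int) \<Rightarrow> bool"
  where
  "is_weight N d \<rho> m l \<longleftrightarrow>
    (\<exists>v\<in>carrier_vec d. v \<noteq> 0\<^sub>v d \<and>
      (\<forall>x y. fugacities N x \<longrightarrow> fugacities N y \<longrightarrow>
        \<rho> (torus_element N x, torus_element N y) *\<^sub>v v =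
          ((\<Prod>k\<in>{1..<N}. x k powi m k) * (\<Prod>k\<in>{1..<N}. y k powi l k)) \<cdot>\<^sub>v v))"

text \<open>Cartan matrix of \<open>SU(N)\<close>; row \<open>k\<close> is the \<open>k\<close>-th simple root
  \<open>\<xi>\<^sub>k / \<xi>\<^bsub>k+1\<^esub>\<close> in the basis of fundamental weights.\<close>

definition cartan :: "nat \<Rightarrow> nat \<Rightarrow> int" where
  "cartan k j = (if j = k then 2 else if j = Suc k \<or> k = Suc j then -1 else 0)"

definition weight_le :: "nat \<Rightarrow> (nat \<Rightarrow> int) \<Rightarrow> (nat \<Rightarrow> int) \<Rightarrow> bool" where
  "weight_le N m a \<longleftrightarrow>
    (\<exists>c :: nat \<Rightarrow> nat. \<forall>j\<in>{1..<N}. m j = a j - (\<Sum>k\<in>{1..<N}. int (c k) * cartan k j))"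

text \<open>The Dynkin labels of an irreducible representation are the coordinates of its highest weight.
  Only the labels with index in \<open>{1..<N}\<close> matter.\<close>

definition irrep_with_dynkin_labels ::
    "nat \<Rightarrow> (nat \<Rightarrow> nat) \<Rightarrow> (nat \<Rightarrow> nat) \<Rightarrow> (complex mat \<times> complex mat \<Rightarrow> complex mat) \<Rightarrow> bool"
  where
  "irrep_with_dynkin_labels N a b \<rho> \<longleftrightarrow>
    (\<exists>d. irreducible_representation N d \<rho> \<and>
      is_weight N d \<rho> (\<lambda>k. int (a k)) (\<lambda>k. int (b k)) \<and>
      (\<forall>m l. is_weight N d \<rho> m l \<longrightarrow>
        weight_le N m (\<lambda>k. int (a k)) \<and> weight_le N l (\<lambda>k. int (b k))))"

definition mat_trace :: "complex mat \<Rightarrow> complex" where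
  "mat_trace A = (\<Sum>i<dim_row A. A $$ (i, i))"

definition rep_character ::
    "nat \<Rightarrow> (complex mat \<times> complex mat \<Rightarrow> complex mat) \<Rightarrow>
      (nat \<Rightarrow> complex) \<Rightarrow> (nat \<Rightarrow> complex) \<Rightarrow> complex" where
  "rep_character N \<rho> x y = mat_trace (\<rho> (torus_element N x, torus_element N y))"

definition fundamental_label :: "nat \<Rightarrow> nat" where
  "fundamental_label k = (if k = 1 then 1 else 0)"

definition antifundamental_label :: "nat \<Rightarrow> nat \<Rightarrow> nat" where
  "antifundamental_label N k = (if k = N - 1 then 1 else 0)"

section \<open>Plethystic exponential and Hilbert series\<close>

definition PE ::
    "(complex \<Rightarrow> complex \<Rightarrow> (nat \<Rightarrow> complex) \<Rightarrow> (nat \<Rightarrow> complex) \<Rightarrow> complex) \<Rightarrow>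
      complex \<Rightarrow> complex \<Rightarrow> (nat \<Rightarrow> complex) \<Rightarrow> (nat \<Rightarrow> complex) \<Rightarrow> complex" where
  "PE g t u x y =
    exp (\<Sum>r. g (t ^ Suc r) (u ^ Suc r) (\<lambda>k. x k ^ Suc r) (\<lambda>k. y k ^ Suc r) / of_nat (Suc r))"

definition flavour_factor ::
    "nat \<Rightarrow> complex \<Rightarrow> complex \<Rightarrow> (nat \<Rightarrow> complex) \<Rightarrow> (nat \<Rightarrow> complex) \<Rightarrow> complex \<Rightarrow> complex" where
  "flavour_factor Nf t u x y z =
    (\<Prod>i=1..Nf. 1 / (1 - t * torus_coord Nf x i * inverse z)) *
    (\<Prod>j=1..Nf. 1 / (1 - u * inverse (torus_coord Nf y j) * z))"

text \<open>The product is over the eigenvalues of \<open>U\<close> with their algebraic multiplicities.\<close>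

definition hilbert_series ::
    "complex mat measure \<Rightarrow> nat \<Rightarrow> complex \<Rightarrow> complex \<Rightarrow> (nat \<Rightarrow> complex) \<Rightarrow> (nat \<Rightarrow> complex) \<Rightarrow> complex"
  where
  "hilbert_series \<mu> Nf t u x y =
    (LINT U|\<mu>. (\<Prod>z\<in>#proots (char_poly U). flavour_factor Nf t u x y z))"

end

theory Submission
  imports Defs "HOL-Complex_Analysis.Complex_Analysis"
begin

text \<open>Expanding the quark factors in powers of the fugacities turns the Haar integral into traces of the
  averaging projection on spaces of polynomials in \<open>N\<^sub>f\<close> vectors and \<open>N\<^sub>f\<close> covectors. For \<open>N\<^sub>f < N\<^sub>c\<close>
  an \<open>SU(N\<^sub>c)\<close>-invariant polynomial is a polynomial in the mesons: on a generic point the group moves the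
  quarks to a normal form determined by the mesons alone. The mesons are algebraically independent, so
  the trace counts nonnegative integer \<open>N\<^sub>f \<times> N\<^sub>f\<close> matrices with prescribed row and column sums, which
  gives \<open>\<Prod> 1 / (1 - t u \<xi>\<^sub>i / \<eta>\<^sub>j)\<close> for \<open>SU(N\<^sub>c)\<close> and \<open>U(N\<^sub>c)\<close> alike.

  The same count with \<open>N\<^sub>f = N\<^sub>c\<close> shows that Schur functions are orthonormal on \<open>SU(N)\<close>. The Weyl
  symmetry of the weights makes an irreducible character of \<open>SU(N) \<times> SU(N)\<close> an integer combination of
  products of two Schur functions; as the character has norm one, it is the product belonging
  to the highest weight. The sum over representations is then the Cauchy identity, with the first columns
  of length \<open>N\<^sub>f\<close> summed to the factor \<open>1 / (1 - (t u)\<^bsup>N\<^sub>f\<^esup>)\<close>.\<close>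

section \<open>Polynomial functions in finitely many variables\<close>

text \<open>Both groups enter only through left translations by SU(n), so one argument covers them
  and yields equal series. No Weyl integration formula is used: the integrand is expanded into
  traces, and each trace is counted through invariants. The generic normal form needs a complex
  matrix of determinant one, while invariance is known for unitary matrices only; polar
  decomposition and analytic continuation along positive diagonal matrices bridge the gap. With as
  many flavours as colours the determinant of the quarks is a further invariant. Requiring equal
  total degrees in quarks and antiquarks excludes it by upgrading the symmetry to GL(n); for Schur
  functions of different degrees the centre of SU(n) makes the integral vanish. Orthogonality of
  irreducible characters lives on SU(N_f), but the hypotheses supply Haar measures for N_c. The one
  for N_f is built from the Haar measure of SU(N_c). Weights are represented by natural exponents in
  a window of length N, which keeps Schur functions polynomial and all degrees close enough for the
  centre argument.\<close>

definition mon :: "'x set => ('x => nat) => ('x => complex) => complex" where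
  "mon X m v = (\<Prod>x\<in>X. v x ^ m x)"

text \<open>Polynomials are treated as functions, not as formal objects; over the complex numbers
  nothing is lost, and \<open>mcoeff\<close> recovers the coefficients.\<close>

inductive polyfun :: "'x set => (('x => complex) => complex) => bool" for X where
  polyfun_const: "polyfun X (\<lambda>v. c)"
| polyfun_var: "x \<in> X ==> polyfun X (\<lambda>v. v x)"
| polyfun_add: "polyfun X p ==> polyfun X q ==> polyfun X (\<lambda>v. p v + q v)"
| polyfun_mult: "polyfun X p ==> polyfun X q ==> polyfun X (\<lambda>v. p v * q v)"

lemma polyfun_sum:
  assumes "!!i. i \<in> I ==> polyfun X (p i)"
  shows "polyfun X (\<lambda>v. \<Sum>i\<in>I. p i v)"
  using assms
  by (induction I rule: infinite_finite_induct) (auto intro: polyfun.intros)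

lemma polyfun_prod:
  assumes "!!i. i \<in> I ==> polyfun X (p i)"
  shows "polyfun X (\<lambda>v. \<Prod>i\<in>I. p i v)"
  using assms
  by (induction I rule: infinite_finite_induct) (auto intro: polyfun.intros)

lemma polyfun_power: "polyfun X p ==> polyfun X (\<lambda>v. p v ^ n)"
  by (induction n) (auto intro: polyfun.intros)

lemma polyfun_mon: "polyfun X (mon X m)"
  unfolding mon_def[abs_def] by (intro polyfun_prod polyfun_power polyfun_var)

lemma polyfun_compose:
  assumes "polyfun X p" and "!!x. x \<in> X ==> polyfun Y (\<lambda>v. f v x)"
  shows "polyfun Y (\<lambda>v. p (f v))"
  using assms by (induction rule: polyfun.induct) (auto intro: polyfun.intros)

lemma polyfun_cong_vars:
  assumes "polyfun X p" and "!!x. x \<in> X ==> v x = w x"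
  shows "p v = p w"
  using assms by (induction rule: polyfun.induct) auto

lemma mon_cong: "(!!x. x \<in> X ==> v x = w x) ==> mon X m v = mon X m w"
  by (auto simp: mon_def)

text \<open>Coefficient extraction by averaging over \<open>D\<close>-th roots of unity.\<close>

definition roots_pt :: "nat => ('x => nat) => 'x => complex" where
  "roots_pt D w x = cis (2 * pi * real (w x) / real D)"

definition mcoeff :: "'x set => nat => ('x => nat) => (('x => complex) => complex) => complex" where
  "mcoeff X D m f =
    (\<Sum>w\<in>X \<rightarrow>\<^sub>E {..<D}. f (roots_pt D w) * cnj (mon X m (roots_pt D w))) / of_nat D ^ card X"

lemma mcoeff_sum: "mcoeff X D m (\<lambda>v. \<Sum>i\<in>I. c i * f i v) = (\<Sum>i\<in>I. c i * mcoeff X D m (f i))"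
proof -
  have "(\<Sum>w\<in>X \<rightarrow>\<^sub>E {..<D}. (\<Sum>i\<in>I. c i * f i (roots_pt D w)) * cnj (mon X m (roots_pt D w)))
    = (\<Sum>i\<in>I. c i * (\<Sum>w\<in>X \<rightarrow>\<^sub>E {..<D}. f i (roots_pt D w) * cnj (mon X m (roots_pt D w))))"
    by (simp add: sum_distrib_right sum_distrib_left mult.assoc) (rule sum.swap)
  thus ?thesis by (simp only: mcoeff_def times_divide_eq_right sum_divide_distrib[symmetric])
qed

text \<open>Orthogonality of the characters of the cyclic group of order D. Bounding the exponents
  by D keeps distinct ones distinct modulo D.\<close>

lemma sum_cis_roots:
  assumes "a < D" "b < D"
  shows "(\<Sum>j<D. cis (2 * pi * real j / real D) ^ a * cnj (cis (2 * pi * real j / real D) ^ b))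
    = (if a = b then of_nat D else 0)"
proof -
  define r where "r k = cis (2 * pi * real k / real D)" for k
  define c where "c = r a * cnj (r b)"
  have D: "D > 0" using assms by simp
  have "r j ^ a = r a ^ j" for a j by (simp add: r_def Complex.DeMoivre mult_ac)
  hence t: "r j ^ a * cnj (r j ^ b) = c ^ j" for j
    by (simp add: c_def power_mult_distrib)
  have pw: "r k ^ D = 1" for k
    using D by (simp add: r_def Complex.DeMoivre)
  have cD: "c ^ D = 1"
    unfolding c_def power_mult_distrib complex_cnj_power[symmetric] pw by simp
  have "(\<Sum>j<D. c ^ j) = (if a = b then of_nat D else 0)"
  proof (cases "a = b")
    case True
    hence "c = 1" by (simp add: c_def r_def cis_cnj cis_mult)
    thus ?thesis using True by simp
  next
    case False
    have "inj_on r {..<D}"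
      using Complex.bij_betw_roots_unity[OF D] by (simp add: bij_betw_def r_def[abs_def])
    hence "r a \<noteq> r b" using assms False by (auto simp: inj_on_def)
    have "c \<noteq> 1"
    proof
      assume "c = 1"
      hence "r b = r b * (r a * cnj (r b))" by (simp add: c_def)
      also have "... = r a * (r b * cnj (r b))" by simp
      also have "r b * cnj (r b) = 1" by (simp add: r_def cis_cnj cis_mult)
      finally show False using \<open>r a \<noteq> r b\<close> by simp
    qed
    thus ?thesis using False cD by (simp add: sum_gp_strict)
  qed
  thus ?thesis by (simp only: t[symmetric]) (simp add: r_def)
qed

text \<open>The sum over the grid of roots of unity factorises over the variables, and each factor
  is \<open>sum_cis_roots\<close>.\<close>

lemma mcoeff_mon:
  assumes "finite X" and "m \<in> X \<rightarrow>\<^sub>E {..<D}" and "k \<in> X \<rightarrow>\<^sub>E {..<D}"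
  shows "mcoeff X D m (mon X k) = (if m = k then 1 else 0)"
proof -
  have "(\<Sum>w\<in>X \<rightarrow>\<^sub>E {..<D}. mon X k (roots_pt D w) * cnj (mon X m (roots_pt D w)))
     = (\<Sum>w\<in>X \<rightarrow>\<^sub>E {..<D}. \<Prod>x\<in>X. cis (2 * pi * real (w x) / real D) ^ k x *
            cnj (cis (2 * pi * real (w x) / real D) ^ m x))"
    by (simp add: mon_def roots_pt_def prod.distrib)
  also have "... = (\<Prod>x\<in>X. \<Sum>j<D. cis (2 * pi * real j / real D) ^ k x *
            cnj (cis (2 * pi * real j / real D) ^ m x))"
    using assms(1) by (subst prod_sum_PiE) auto
  also have "... = (\<Prod>x\<in>X. if k x = m x then of_nat D else 0)"
    using assms by (intro prod.cong refl sum_cis_roots) (auto simp: PiE_iff)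
  also have "... = (if m = k then of_nat D ^ card X else 0)"
  proof (cases "m = k")
    case False
    then obtain x where "m x \<noteq> k x" by auto
    moreover from this have "x \<in> X" using assms(2,3) by (metis PiE_arb)
    ultimately show ?thesis using assms(1) False by (auto intro!: prod_zero bexI[of _ x])
  qed auto
  finally have e: "(\<Sum>w\<in>X \<rightarrow>\<^sub>E {..<D}. mon X k (roots_pt D w) * cnj (mon X m (roots_pt D w)))
     = (if m = k then of_nat D ^ card X else 0)" .
  \<comment> \<open>Licence to divide by \<open>D ^ card X\<close>: for empty X the divisor is 1
    whatever D is.\<close>
  have "D > 0 \<or> X = {}"
    using assms(2) by (cases "X = {}") (auto simp: PiE_iff)
  thus ?thesis unfolding mcoeff_def e by auto
qed

text \<open>Quantifying over all D beyond a bound lets the induction bring two summands to a common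
  box of exponents.\<close>

lemma polyfun_expansion_ex:
  assumes "finite X" "polyfun X p"
  shows "\<exists>D0. \<forall>D\<ge>D0. \<exists>c. \<forall>v. p v = (\<Sum>m\<in>X \<rightarrow>\<^sub>E {..<D}. c m * mon X m v)"
  using assms(2)
proof (induction rule: polyfun.induct)
  case (polyfun_const c)
  have "c = (\<Sum>m\<in>X \<rightarrow>\<^sub>E {..<D}. (if m = (\<lambda>x\<in>X. 0) then c else 0) * mon X m v)" if "D \<ge> 1" for D v
    using that assms(1) by (subst sum.mono_neutral_right[of _ "{\<lambda>x\<in>X. 0}"])
      (auto simp: mon_def finite_PiE)
  thus ?case by (intro exI[of _ 1] allI impI exI[of _ "\<lambda>m. if m = (\<lambda>x\<in>X. 0) then c else 0"])
next
  case (polyfun_var y)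
  let ?m = "\<lambda>x\<in>X. if x = y then 1 else (0::nat)"
  have "mon X ?m v = v y" for v
  proof -
    have "mon X ?m v = (\<Prod>x\<in>X. if x = y then v x else 1)"
      unfolding mon_def by (intro prod.cong) auto
    thus ?thesis using assms(1) polyfun_var by simp
  qed
  hence "v y = (\<Sum>m\<in>X \<rightarrow>\<^sub>E {..<D}. (if m = ?m then 1 else 0) * mon X m v)" if "D \<ge> 2" for D v
    using that assms(1) by (subst sum.mono_neutral_right[of _ "{?m}"])
      (auto simp: finite_PiE)
  thus ?case by (intro exI[of _ 2] allI impI exI[of _ "\<lambda>m. if m = ?m then 1 else 0"])
next
  case (polyfun_add p q)
  then obtain D1 D2 where
    1: "!!D. D\<ge>D1 ==> \<exists>c. \<forall>v. p v = (\<Sum>m\<in>X \<rightarrow>\<^sub>E {..<D}. c m * mon X m v)" and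
    2: "!!D. D\<ge>D2 ==> \<exists>c. \<forall>v. q v = (\<Sum>m\<in>X \<rightarrow>\<^sub>E {..<D}. c m * mon X m v)" by blast
  show ?case
  proof (intro exI[of _ "max D1 D2"] allI impI)
    fix D assume "max D1 D2 \<le> D"
    then obtain c d where "\<forall>v. p v = (\<Sum>m\<in>X \<rightarrow>\<^sub>E {..<D}. c m * mon X m v)"
        "\<forall>v. q v = (\<Sum>m\<in>X \<rightarrow>\<^sub>E {..<D}. d m * mon X m v)" using 1 2 by fastforce
    hence "\<forall>v. p v + q v = (\<Sum>m\<in>X \<rightarrow>\<^sub>E {..<D}. (c m + d m) * mon X m v)"
      by (simp add: algebra_simps sum.distrib)
    thus "\<exists>c. \<forall>v. p v + q v = (\<Sum>m\<in>X \<rightarrow>\<^sub>E {..<D}. c m * mon X m v)"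
      by (intro exI[of _ "\<lambda>m. c m + d m"])
  qed
next
  case (polyfun_mult p q)
  then obtain D1 D2 where
    1: "!!D. D\<ge>D1 ==> \<exists>c. \<forall>v. p v = (\<Sum>m\<in>X \<rightarrow>\<^sub>E {..<D}. c m * mon X m v)" and
    2: "!!D. D\<ge>D2 ==> \<exists>c. \<forall>v. q v = (\<Sum>m\<in>X \<rightarrow>\<^sub>E {..<D}. c m * mon X m v)" by blast
  obtain c d where c: "!!v. p v = (\<Sum>m\<in>X \<rightarrow>\<^sub>E {..<D1}. c m * mon X m v)" and
    d: "!!v. q v = (\<Sum>m\<in>X \<rightarrow>\<^sub>E {..<D2}. d m * mon X m v)" using 1[of D1] 2[of D2] by auto
  let ?a = "\<lambda>m k. \<lambda>x\<in>X. m x + (k x :: nat)"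
  have am: "mon X m v * mon X k v = mon X (?a m k) v" for m k v
    by (simp add: mon_def prod.distrib power_add)
  show ?case
  proof (intro exI[of _ "D1 + D2"] allI impI)
    fix D assume D: "D1 + D2 \<le> D"
    let ?P = "(X \<rightarrow>\<^sub>E {..<D1}) \<times> (X \<rightarrow>\<^sub>E {..<D2})"
    have mem: "?a m k \<in> X \<rightarrow>\<^sub>E {..<D}" if "(m, k) \<in> ?P" for m k
      using that D by (force simp: PiE_iff intro: add_strict_mono dest: bspec)
    show "\<exists>e. \<forall>v. p v * q v = (\<Sum>m\<in>X \<rightarrow>\<^sub>E {..<D}. e m * mon X m v)"
    proof (intro exI allI)
      fix v
      have "p v * q v = (\<Sum>(m,k)\<in>?P. c m * d k * mon X (?a m k) v)"
        unfolding c d sum_product sum.cartesian_product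
        by (intro sum.cong refl) (auto simp: am[symmetric])
      also have "... = (\<Sum>e\<in>X \<rightarrow>\<^sub>E {..<D}. \<Sum>(m,k)\<in>{z\<in>?P. ?a (fst z) (snd z) = e}. c m * d k * mon X (?a m k) v)"
        using mem assms(1) by (subst sum.group[symmetric, of ?P "X \<rightarrow>\<^sub>E {..<D}" "\<lambda>z. ?a (fst z) (snd z)"])
           (simp_all add: finite_PiE image_subset_iff mem split_beta del: restrict_PiE_iff)
      also have "... = (\<Sum>e\<in>X \<rightarrow>\<^sub>E {..<D}. (\<Sum>(m,k)\<in>{z\<in>?P. ?a (fst z) (snd z) = e}. c m * d k) * mon X e v)"
        by (intro sum.cong refl) (auto simp: sum_distrib_right intro!: sum.cong)
      finally show "p v * q v = ..." .
    qed
  qed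
qed

lemma polyfun_expansion:
  assumes "finite X" "polyfun X p"
  shows "\<exists>D\<ge>D0. \<exists>c. \<forall>v. p v = (\<Sum>m\<in>X \<rightarrow>\<^sub>E {..<D}. c m * mon X m v)"
  using polyfun_expansion_ex[OF assms] by (metis max.cobounded1 max.cobounded2)

text \<open>Vanishing at points of modulus one suffices because \<open>mcoeff\<close> samples only
  roots of unity. This is the form needed for characters of tori.\<close>

lemma mon_independent:
  assumes "finite X" "E \<subseteq> X \<rightarrow>\<^sub>E (UNIV::nat set)" "finite E" "m \<in> E"
    and "!!v. (!!x. cmod (v x) = 1) ==> (\<Sum>k\<in>E. c k * mon X k v) = 0"
  shows "c m = 0"
proof -
  \<comment> \<open>A crude strict bound for every exponent that occurs in E.\<close>
  define D where "D = Suc (\<Sum>k\<in>E. \<Sum>x\<in>X. k x)"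
  have "k x < D" if "k \<in> E" "x \<in> X" for k x
  proof -
    have "k x \<le> (\<Sum>x\<in>X. k x)" using that assms(1) by (intro member_le_sum) auto
    also have "... \<le> (\<Sum>k\<in>E. \<Sum>x\<in>X. k x)" using that assms(3) by (intro member_le_sum[where f="\<lambda>k. \<Sum>x\<in>X. k x"]) auto
    finally show ?thesis by (simp add: D_def)
  qed
  hence sub: "E \<subseteq> X \<rightarrow>\<^sub>E {..<D}" using assms(2) by (auto simp: PiE_iff subset_iff)
  have "0 = mcoeff X D m (\<lambda>v. \<Sum>k\<in>E. c k * mon X k v)"
    by (simp add: assms(5) mcoeff_def roots_pt_def)
  also have "... = (\<Sum>k\<in>E. c k * mcoeff X D m (mon X k))" by (rule mcoeff_sum)
  also have "... = (\<Sum>k\<in>E. if k = m then c k else 0)"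
    using sub assms(1,4) by (intro sum.cong refl) (auto simp: mcoeff_mon subset_iff)
  also have "... = c m" using assms(3,4) by simp
  finally show ?thesis by simp
qed

text \<open>A grading assigns to each label \<open>c\<close> a set \<open>W c\<close> of variables of weight one.\<close>

definition exps :: "'x set => 'c set => ('c => 'x set) => ('c => nat) => ('x => nat) set" where
  "exps X C W d = {m \<in> X \<rightarrow>\<^sub>E UNIV. \<forall>c\<in>C. (\<Sum>x\<in>W c. m x) = d c}"

text \<open>The single scalar 2 detects the degree, since its powers are pairwise distinct.\<close>

definition homog :: "'c set => ('c => 'x set) => ('c => nat) => (('x => complex) => complex) => bool" where
  "homog C W d p \<longleftrightarrow> (\<forall>c\<in>C. \<forall>v. p (\<lambda>x. if x \<in> W c then 2 * v x else v x) = 2 ^ d c * p v)"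

text \<open>Weight sets of different labels may overlap: an entry of the meson matrix has a row
  weight and a column weight. That every variable has some weight bounds all exponents by the
  degrees.\<close>

locale grading =
  fixes X :: "'x set" and C :: "'c set" and W :: "'c => 'x set"
  assumes finite_vars: "finite X" and finite_labels: "finite C"
    and weights_sub: "!!c. c \<in> C ==> W c \<subseteq> X" and weights_cover: "X \<subseteq> (\<Union>c\<in>C. W c)"
begin

definition bnd :: "('c => nat) => nat" where "bnd d = Suc (\<Sum>c\<in>C. d c)"

lemma exps_sub: "exps X C W d \<subseteq> X \<rightarrow>\<^sub>E {..<bnd d}"
proof -
  have "m x < bnd d" if m: "m \<in> exps X C W d" "x \<in> X" for m x
  proof -
    obtain c where c: "c \<in> C" "x \<in> W c" using m(2) weights_cover by blast
    have "finite (W c)" using c weights_sub finite_vars finite_subset by blast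
    hence "m x \<le> (\<Sum>x\<in>W c. m x)" using c by (intro member_le_sum) auto
    also have "... = d c" using m c by (auto simp: exps_def)
    also have "... \<le> (\<Sum>c\<in>C. d c)" using c finite_labels by (intro member_le_sum) auto
    finally show ?thesis by (simp add: bnd_def)
  qed
  thus ?thesis by (auto simp: PiE_iff) (auto simp: exps_def PiE_iff extensional_def)
qed

lemma finite_exps: "finite (exps X C W d)"
  by (rule finite_subset[OF exps_sub]) (simp add: finite_PiE finite_vars)

lemma mcoeff_mon_exps:
  assumes "m \<in> exps X C W d" "k \<in> exps X C W d"
  shows "mcoeff X (bnd d) m (mon X k) = (if m = k then 1 else 0)"
  using assms exps_sub finite_vars by (intro mcoeff_mon) auto

lemma mon_scale:
  assumes "c \<in> C"
  shows "mon X m (\<lambda>x. if x \<in> W c then s * v x else v x) = s ^ (\<Sum>x\<in>W c. m x) * mon X m v"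
proof -
  have "mon X m (\<lambda>x. if x \<in> W c then s * v x else v x)
    = (\<Prod>x\<in>X. (if x \<in> W c then s ^ m x else 1) * v x ^ m x)"
    unfolding mon_def by (intro prod.cong) (auto simp: power_mult_distrib)
  also have "... = (\<Prod>x\<in>X. if x \<in> W c then s ^ m x else 1) * mon X m v"
    by (simp add: prod.distrib mon_def)
  also have "(\<Prod>x\<in>X. if x \<in> W c then s ^ m x else 1) = (\<Prod>x\<in>W c. s ^ m x)"
    using weights_sub[OF assms] finite_vars
    by (simp add: prod.If_cases Int_absorb1)
  finally show ?thesis by (simp add: power_sum)
qed

lemma homog_mon: "m \<in> exps X C W d ==> homog C W d (mon X m)"
  by (auto simp: homog_def mon_scale exps_def)

lemma homog_expansion:
  assumes p: "polyfun X p" and h: "homog C W d p"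
  shows "p v = (\<Sum>m\<in>exps X C W d. mcoeff X (bnd d) m p * mon X m v)"
proof -
  obtain D c where D: "!!v. p v = (\<Sum>m\<in>X \<rightarrow>\<^sub>E {..<D}. c m * mon X m v)" "bnd d \<le> D"
    using polyfun_expansion[OF finite_vars p, of "bnd d"] by blast
  let ?E = "X \<rightarrow>\<^sub>E {..<D}" and ?S = "exps X C W d"
  have sub: "?S \<subseteq> ?E" using exps_sub[of d] by (rule subset_trans) (use D(2) in \<open>intro PiE_mono; auto\<close>)
  \<comment> \<open>Homogeneity says that each coefficient times (2 to its degree minus 2 to the
    prescribed degree) vanishes, by independence of monomials.\<close>
  have z: "c m = 0" if m: "m \<in> ?E - ?S" for m
  proof -
    obtain b where b: "b \<in> C" "(\<Sum>x\<in>W b. m x) \<noteq> d b" using m by (auto simp: exps_def PiE_iff)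
    have "(\<Sum>k\<in>?E. (c k * (2 ^ (\<Sum>x\<in>W b. k x) - 2 ^ d b)) * mon X k v) = 0" for v
    proof -
      have "p (\<lambda>x. if x \<in> W b then 2 * v x else v x) = 2 ^ d b * p v"
        using h b by (auto simp: homog_def)
      thus ?thesis unfolding D(1) mon_scale[OF b(1)]
        by (simp add: algebra_simps sum_subtractf sum_distrib_left)
    qed
    hence "c m * (2 ^ (\<Sum>x\<in>W b. m x) - 2 ^ d b) = 0"
      using m finite_vars
      by (intro mon_independent[of X ?E m "\<lambda>k. c k * (2 ^ (\<Sum>x\<in>W b. k x) - 2 ^ d b)"]) (auto simp: finite_PiE PiE_iff)
    moreover have "(2::complex) ^ (\<Sum>x\<in>W b. m x) \<noteq> 2 ^ d b"
      using b(2) by (metis numeral_power_eq_of_nat_cancel_iff of_nat_eq_iff of_nat_numeral of_nat_power one_less_numeral_iff power_inject_exp semiring_norm(76))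
    ultimately show ?thesis by simp
  qed
  have e: "p = (\<lambda>v. \<Sum>m\<in>?S. c m * mon X m v)"
    using sub z finite_vars unfolding D(1)[abs_def]
    by (intro ext sum.mono_neutral_right) (auto simp: finite_PiE)
  have "mcoeff X (bnd d) m p = c m" if "m \<in> ?S" for m
  proof -
    have "mcoeff X (bnd d) m p = (\<Sum>k\<in>?S. c k * mcoeff X (bnd d) m (mon X k))"
      unfolding e by (rule mcoeff_sum)
    also have "... = (\<Sum>k\<in>?S. if k = m then c k else 0)"
      using that by (intro sum.cong refl) (auto simp: mcoeff_mon_exps)
    finally show ?thesis using that finite_exps by simp
  qed
  thus ?thesis by (subst e) simp
qed

text \<open>The trace of the substitution operator p \<mapsto> p o L on the polynomials of
  multidegree d, taken in the basis of monomials.\<close>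

definition op_trace :: "('c => nat) => (('x => complex) => 'x => complex) => complex" where
  "op_trace d L = (\<Sum>m\<in>exps X C W d. mcoeff X (bnd d) m (\<lambda>v. mon X m (L v)))"

definition graded_map :: "(('x => complex) => 'x => complex) => bool" where
  "graded_map L \<longleftrightarrow> (\<forall>x\<in>X. polyfun X (\<lambda>v. L v x)) \<and>
     (\<forall>c\<in>C. \<forall>v. \<forall>x\<in>X. L (\<lambda>x. if x \<in> W c then 2 * v x else v x) x = (if x \<in> W c then 2 * L v x else L v x))"

lemma graded_expansion:
  assumes L: "graded_map L" and p: "polyfun X p" "homog C W d p"
  shows "p (L v) = (\<Sum>m\<in>exps X C W d. mcoeff X (bnd d) m (\<lambda>v. p (L v)) * mon X m v)"
proof (rule homog_expansion[of "\<lambda>v. p (L v)"])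
  show "polyfun X (\<lambda>v. p (L v))" using L by (intro polyfun_compose[OF p(1)]) (auto simp: graded_map_def)
  show "homog C W d (\<lambda>v. p (L v))"
    unfolding homog_def
  proof (intro ballI allI)
    fix c v assume c: "c \<in> C"
    have "p (L (\<lambda>x. if x \<in> W c then 2 * v x else v x)) = p (\<lambda>x. if x \<in> W c then 2 * L v x else L v x)"
      using L c by (intro polyfun_cong_vars[OF p(1)]) (auto simp: graded_map_def)
    also have "... = 2 ^ d c * p (L v)" using p(2) c by (auto simp: homog_def)
    finally show "p (L (\<lambda>x. if x \<in> W c then 2 * v x else v x)) = 2 ^ d c * p (L v)" .
  qed
qed

text \<open>Cyclicity of the trace: the coefficient matrix of a composite substitution is the
  product of the two coefficient matrices.\<close>

lemma op_trace_commute: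
  assumes "graded_map L" "graded_map M"
  shows "op_trace d (\<lambda>v. L (M v)) = op_trace d (\<lambda>v. M (L v))"
proof -
  let ?E = "exps X C W d"
  let ?S = "\<lambda>L m k. mcoeff X (bnd d) k (\<lambda>v. mon X m (L v))"
  have *: "?S (\<lambda>v. L (M v)) m m = (\<Sum>k\<in>?E. ?S L m k * ?S M k m)"
    if "graded_map L" "m \<in> ?E" for L M :: "('x => complex) => 'x => complex" and m
  proof -
    have "mon X m (L (M v)) = (\<Sum>k\<in>?E. ?S L m k * mon X k (M v))" for v
      using that by (intro graded_expansion polyfun_mon homog_mon)
    hence "?S (\<lambda>v. L (M v)) m m = mcoeff X (bnd d) m (\<lambda>v. \<Sum>k\<in>?E. ?S L m k * mon X k (M v))"
      by simp
    thus ?thesis by (simp add: mcoeff_sum)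
  qed
  have "op_trace d (\<lambda>v. L (M v)) = (\<Sum>m\<in>?E. \<Sum>k\<in>?E. ?S L m k * ?S M k m)"
    unfolding op_trace_def using assms by (intro sum.cong refl *)
  also have "... = (\<Sum>k\<in>?E. \<Sum>m\<in>?E. ?S M k m * ?S L m k)"
    by (subst sum.swap) (simp add: mult.commute)
  also have "... = op_trace d (\<lambda>v. M (L v))"
    unfolding op_trace_def using assms by (intro sum.cong refl *[symmetric])
  finally show ?thesis .
qed

lemma op_trace_diag:
  assumes "!!v x. x \<in> X ==> L v x = c x * v x"
  shows "op_trace d L = (\<Sum>m\<in>exps X C W d. mon X m c)"
proof -
  have e: "mon X m (L v) = (\<Sum>k\<in>{m}. mon X m c * mon X k v)" for m v
  proof -
    have "mon X m (L v) = (\<Prod>x\<in>X. c x ^ m x * v x ^ m x)"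
      unfolding mon_def by (intro prod.cong refl) (simp add: assms power_mult_distrib)
    thus ?thesis by (simp add: mon_def prod.distrib)
  qed
  have "mcoeff X (bnd d) m (\<lambda>v. mon X m (L v)) = mon X m c" if "m \<in> exps X C W d" for m
    unfolding e mcoeff_sum using that by (simp add: mcoeff_mon_exps)
  thus ?thesis by (simp add: op_trace_def)
qed

end

section \<open>Unitary matrices\<close>

abbreviation SU_grp :: "nat => complex mat set" where "SU_grp n \<equiv> carrier (special_unitary_group n)"
abbreviation U_grp :: "nat => complex mat set" where "U_grp n \<equiv> carrier (unitary_group n)"

lemma mat_mult_index:
  assumes "A \<in> carrier_mat nr n" "B \<in> carrier_mat n nc" "i < nr" "j < nc"
  shows "(A * B) $$ (i,j) = (\<Sum>k<n. A $$ (i,k) * B $$ (k,j))"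
  using assms by (auto simp: scalar_prod_def atLeast0LessThan intro!: sum.cong)

lemma square_mult_carrier [simp]:
  "A \<in> carrier_mat n n ==> B \<in> carrier_mat n n ==> A * B \<in> carrier_mat n n"
  by (rule mult_carrier_mat)

lemma square_mult_one [simp]:
  fixes A :: "'a :: semiring_1 mat"
  assumes "A \<in> carrier_mat n n"
  shows "A * 1\<^sub>m n = A" "1\<^sub>m n * A = A"
  using assms by auto

lemma mat_adjoint_dim [simp]: "dim_row (mat_adjoint A) = dim_col A" "dim_col (mat_adjoint A) = dim_row A"
  by (auto simp: mat_adjoint_def)

lemma mat_adjoint_index_dim [simp]:
  fixes A :: "complex mat"
  assumes "i < dim_col A" "j < dim_row A"
  shows "mat_adjoint A $$ (i,j) = cnj (A $$ (j,i))"
  using assms by (auto simp: mat_adjoint_def mat_of_rows_def)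

lemma mat_adjoint_carrier [simp]: "A \<in> carrier_mat nr nc ==> mat_adjoint A \<in> carrier_mat nc nr"
  by (auto simp: mat_adjoint_def)

lemma mat_adjoint_index:
  assumes "A \<in> carrier_mat nr nc" "i < nc" "j < nr"
  shows "mat_adjoint A $$ (i,j) = conjugate (A $$ (j,i))"
  using assms by (auto simp: mat_adjoint_def mat_of_rows_def)

lemma mat_adjoint_index_cnj:
  assumes "A \<in> carrier_mat nr nc" "i < nc" "j < nr"
  shows "mat_adjoint A $$ (i,j) = cnj (A $$ (j,i))"
  using mat_adjoint_index[OF assms] by simp

lemma mat_adjoint_adjoint:
  fixes A :: "complex mat"
  assumes "A \<in> carrier_mat nr nc" shows "mat_adjoint (mat_adjoint A) = A"
proof (rule eq_matI)
  have A': "mat_adjoint A \<in> carrier_mat nc nr" using assms by simp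
  fix i j assume "i < dim_row A" "j < dim_col A"
  thus "mat_adjoint (mat_adjoint A) $$ (i,j) = A $$ (i,j)"
    using assms by (simp add: mat_adjoint_index_cnj[OF A'] mat_adjoint_index_cnj[OF assms])
qed (use assms mat_adjoint_carrier[OF mat_adjoint_carrier[OF assms]] in auto)

lemma mat_adjoint_mult:
  fixes A B :: "complex mat"
  assumes A: "A \<in> carrier_mat nr n" and B: "B \<in> carrier_mat n nc"
  shows "mat_adjoint (A * B) = mat_adjoint B * mat_adjoint A"
proof (rule eq_matI)
  have AB: "A * B \<in> carrier_mat nr nc" using assms by simp
  have C: "mat_adjoint B * mat_adjoint A \<in> carrier_mat nc nr"
    using assms by (intro mult_carrier_mat mat_adjoint_carrier)
  show "dim_row (mat_adjoint (A * B)) = dim_row (mat_adjoint B * mat_adjoint A)"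
    "dim_col (mat_adjoint (A * B)) = dim_col (mat_adjoint B * mat_adjoint A)"
    using C mat_adjoint_carrier[OF AB] by auto
  fix i j assume "i < dim_row (mat_adjoint B * mat_adjoint A)" "j < dim_col (mat_adjoint B * mat_adjoint A)"
  hence ij: "i < nc" "j < nr" using C by auto
  show "mat_adjoint (A * B) $$ (i,j) = (mat_adjoint B * mat_adjoint A) $$ (i,j)"
    unfolding mat_adjoint_index_cnj[OF AB ij] mat_mult_index[OF A B ij(2,1)]
      mat_mult_index[OF mat_adjoint_carrier[OF B] mat_adjoint_carrier[OF A] ij]
    using ij by (auto simp: mat_adjoint_index_cnj[OF A] mat_adjoint_index_cnj[OF B] mult.commute intro!: sum.cong)
qed

lemma det_mat_adjoint:
  fixes A :: "complex mat"
  assumes A: "A \<in> carrier_mat n n"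
  shows "det (mat_adjoint A) = cnj (det A)"
proof -
  have "mat_adjoint A = transpose_mat (map_mat cnj A)"
    using A by (intro eq_matI) (auto simp: mat_adjoint_index_cnj[OF A] mat_adjoint_carrier[OF A, THEN carrier_matD(1)]
        mat_adjoint_carrier[OF A, THEN carrier_matD(2)])
  hence "det (mat_adjoint A) = det (map_mat cnj A)" using A by (simp add: det_transpose[of _ n])
  also have "... = cnj (det A)"
  proof -
    have *: "cnj (signof p) = signof p" for p by (simp add: sign_def)
    have "map_mat cnj A \<in> carrier_mat n n" using A by simp
    from det_def'[OF this] show ?thesis unfolding det_def'[OF A]
      using A permutes_in_image by (auto simp: * intro!: sum.cong prod.cong)
  qed
  finally show ?thesis .
qed

lemma Ugrp_iff: "A \<in> U_grp n \<longleftrightarrow> A \<in> carrier_mat n n \<and> mat_adjoint A * A = 1\<^sub>m n"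
  by (simp add: unitary_group_def)

lemma SU_iff: "A \<in> SU_grp n \<longleftrightarrow> A \<in> U_grp n \<and> det A = 1"
  by (simp add: special_unitary_group_def)

lemma Ugrp_carrier [simp]: "A \<in> U_grp n ==> A \<in> carrier_mat n n"
  by (simp add: Ugrp_iff)

lemma SU_Ugrp: "A \<in> SU_grp n ==> A \<in> U_grp n"
  by (simp add: SU_iff)

lemma SU_carrier [simp]: "A \<in> SU_grp n ==> A \<in> carrier_mat n n"
  by (simp add: SU_iff)

lemma Ugrp_adjoint_left: "A \<in> U_grp n ==> mat_adjoint A * A = 1\<^sub>m n"
  by (simp add: Ugrp_iff)

lemma Ugrp_adjoint_right: "A \<in> U_grp n ==> A * mat_adjoint A = 1\<^sub>m n"
  by (rule mat_mult_left_right_inverse[of "mat_adjoint A" n A]) (auto simp: Ugrp_iff)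

lemma Ugrp_one: "1\<^sub>m n \<in> U_grp n"
proof -
  have "mat_adjoint (1\<^sub>m n :: complex mat) = 1\<^sub>m n"
    using mat_adjoint_carrier[OF one_carrier_mat[of n, where 'a=complex]]
    by (intro eq_matI) (auto simp: mat_adjoint_index_cnj[OF one_carrier_mat])
  thus ?thesis by (simp add: Ugrp_iff)
qed

lemma Ugrp_mult:
  assumes "A \<in> U_grp n" "B \<in> U_grp n" shows "A * B \<in> U_grp n"
proof -
  have c: "A \<in> carrier_mat n n" "B \<in> carrier_mat n n" "mat_adjoint A \<in> carrier_mat n n" "mat_adjoint B \<in> carrier_mat n n"
    using assms by auto
  have "mat_adjoint B * mat_adjoint A * (A * B) = mat_adjoint B * ((mat_adjoint A * A) * B)"
    using c by (simp add: assoc_mult_mat[of _ n n _ n _ n])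
  also have "... = 1\<^sub>m n" using assms c by (simp add: Ugrp_adjoint_left)
  finally show ?thesis using c by (simp add: Ugrp_iff mat_adjoint_mult[of _ n n _ n])
qed

lemma Ugrp_adjoint: "A \<in> U_grp n ==> mat_adjoint A \<in> U_grp n"
  using Ugrp_adjoint_right[of A n] by (simp add: Ugrp_iff mat_adjoint_adjoint[of _ n n])

lemma Ugrp_det: assumes "A \<in> U_grp n" shows "cmod (det A) = 1"
proof -
  have A: "A \<in> carrier_mat n n" using assms by simp
  have "det (mat_adjoint A * A) = cnj (det A) * det A"
    using A by (simp add: det_mult[of _ n] det_mat_adjoint)
  hence "cnj (det A) * det A = 1" using assms by (simp add: Ugrp_adjoint_left)
  hence "cmod (cnj (det A) * det A) = 1" by simp
  hence "cmod (det A) ^ 2 = 1" by (simp add: norm_mult power2_eq_square)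
  thus ?thesis by (metis norm_ge_zero power2_eq_1_iff abs_of_nonneg abs_1 abs_minus)
qed

lemma SU_one: "1\<^sub>m n \<in> SU_grp n" by (simp add: SU_iff Ugrp_one)

lemma SU_mult: "A \<in> SU_grp n ==> B \<in> SU_grp n ==> A * B \<in> SU_grp n"
  by (simp add: SU_iff Ugrp_mult det_mult[of _ n])

lemma SU_adjoint: "A \<in> SU_grp n ==> mat_adjoint A \<in> SU_grp n"
  by (simp add: SU_iff Ugrp_adjoint det_mat_adjoint[of _ n])

lemma mat_adjoint_diag: "mat_adjoint (mat_diag n f) = mat_diag n (\<lambda>i. cnj (f i))"
  using mat_adjoint_carrier[OF mat_diag_dim[of n f]]
  by (intro eq_matI) (auto simp: mat_adjoint_index_cnj[OF mat_diag_dim] mat_diag_def)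

lemma det_mat_diag: "det (mat_diag n f) = (\<Prod>i<n. f i)"
proof -
  have "det (mat_diag n f) = prod_list (diag_mat (mat_diag n f))"
    by (rule det_upper_triangular[of _ n]) (auto simp: upper_triangular_def mat_diag_def)
  also have "diag_mat (mat_diag n f) = map f [0..<n]"
    by (auto simp: diag_mat_def mat_diag_def)
  also have "prod_list (map f [0..<n]) = prod f (set [0..<n])"
    by (rule prod.distinct_set_conv_list[symmetric]) simp
  finally show ?thesis by (simp add: atLeast0LessThan)
qed

lemma mat_diag_cong: "(!!i. i < n ==> f i = g i) ==> mat_diag n f = mat_diag n g"
  by (auto simp: mat_diag_def intro!: eq_matI)

lemma mat_diag_Ugrp: assumes "!!i. i < n ==> cmod (f i) = 1" shows "mat_diag n f \<in> U_grp n"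
proof -
  have "cnj (f i) * f i = 1" if "i < n" for i
    using assms[OF that] by (metis complex_norm_square mult.commute of_real_1 power_one)
  hence "mat_diag n (\<lambda>i. cnj (f i) * f i) = mat_diag n (\<lambda>i. 1)" by (intro mat_diag_cong)
  thus ?thesis by (simp add: Ugrp_iff mat_adjoint_diag)
qed

subsection \<open>Gram--Schmidt orthonormalisation\<close>

text \<open>Gram--Schmidt as an explicit recursion on the column, since the result must later be
  shown equivariant and measurable in B.\<close>

fun gs :: "nat => complex mat => nat => nat => complex" where
  "gs n B k = (let u = (\<lambda>i. B $$ (i,k) - (\<Sum>l<k. (\<Sum>j<n. cnj (gs n B l j) * B $$ (j,k)) * gs n B l i))
     in (\<lambda>i. u i / complex_of_real (sqrt (\<Sum>j<n. (cmod (u j))\<^sup>2))))"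

declare gs.simps [simp del]

definition gs_res :: "nat => complex mat => nat => nat => complex" where
  "gs_res n B k i = B $$ (i,k) - (\<Sum>l<k. (\<Sum>j<n. cnj (gs n B l j) * B $$ (j,k)) * gs n B l i)"

definition gs_norm :: "nat => complex mat => nat => real" where
  "gs_norm n B k = sqrt (\<Sum>j<n. (cmod (gs_res n B k j))\<^sup>2)"

lemma gs_eq: "gs n B k i = gs_res n B k i / complex_of_real (gs_norm n B k)"
  by (subst gs.simps) (simp add: gs_res_def gs_norm_def Let_def)

definition gs_mat :: "nat => complex mat => complex mat" where
  "gs_mat n B = Matrix.mat n n (\<lambda>(i,k). gs n B k i)"

lemma gs_mat_carrier [simp]: "gs_mat n B \<in> carrier_mat n n"
  by (simp add: gs_mat_def)

lemma gs_mat_dim [simp]: "dim_row (gs_mat n B) = n" "dim_col (gs_mat n B) = n"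
  by (simp_all add: gs_mat_def)

text \<open>The three claims need a joint induction: the residual is nonzero because it is a
  combination of columns of B in which column k has coefficient 1, and this uses the expansions of
  the earlier vectors.\<close>

lemma gs_properties:
  assumes B: "B \<in> carrier_mat n n" and det: "det B \<noteq> 0" and "k < n"
  shows "gs_norm n B k > 0 \<and>
    (\<forall>l\<le>k. (\<Sum>j<n. cnj (gs n B l j) * gs n B k j) = (if l = k then 1 else 0)) \<and>
    (\<exists>c. \<forall>i<n. gs n B k i = (\<Sum>m\<le>k. c m * B $$ (i,m)))"
  using \<open>k < n\<close>
proof (induction k rule: less_induct)
  case (less k)
  let ?q = "gs n B" and ?u = "gs_res n B k" and ?r = "gs_norm n B k"
  have pos: "gs_norm n B l > 0" and
       on: "l' \<le> l ==> (\<Sum>j<n. cnj (?q l' j) * ?q l j) = (if l' = l then 1 else 0)" and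
       ex: "\<exists>c. \<forall>i<n. ?q l i = (\<Sum>m\<le>l. c m * B $$ (i,m))" if "l < k" for l l'
    using less that by auto
  have on': "(\<Sum>j<n. cnj (?q l' j) * ?q l j) = (if l' = l then 1 else 0)" if "l < k" "l' < k" for l l'
  proof (cases "l' \<le> l")
    case False
    have "(\<Sum>j<n. cnj (?q l' j) * ?q l j) = cnj (\<Sum>j<n. cnj (?q l j) * ?q l' j)"
      by (simp add: mult.commute)
    thus ?thesis using on[of l' l] False that by auto
  qed (use on that in auto)
  obtain c where c: "!!l i. l < k ==> i < n ==> ?q l i = (\<Sum>m\<le>l. c l m * B $$ (i,m))"
    using ex by metis
  define b where "b l = (\<Sum>j<n. cnj (?q l j) * B $$ (j,k))" for l
  \<comment> \<open>Coefficients of the residual in the columns of B, read off after exchanging the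
    order of the double sum.\<close>
  define t where "t m = (if m = k then 1 else - (\<Sum>l\<in>{m..<k}. b l * c l m))" for m
  have u: "?u i = (\<Sum>m\<le>k. t m * B $$ (i,m))" if "i < n" for i
  proof -
    have "(\<Sum>l<k. b l * ?q l i) = (\<Sum>l<k. \<Sum>m\<le>l. b l * c l m * B $$ (i,m))"
      using that by (simp add: c sum_distrib_left mult.assoc)
    also have "... = (\<Sum>m<k. \<Sum>l\<in>{m..<k}. b l * c l m * B $$ (i,m))"
      by (subst sum.Sigma, simp, simp, subst sum.Sigma, simp, simp)
        (rule sum.reindex_bij_witness[of _ "\<lambda>(a,b). (b,a)" "\<lambda>(a,b). (b,a)"], auto)
    finally have e: "(\<Sum>l<k. b l * ?q l i) = (\<Sum>m<k. (\<Sum>l\<in>{m..<k}. b l * c l m) * B $$ (i,m))"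
      by (simp add: sum_distrib_right)
    have "?u i = B $$ (i,k) - (\<Sum>l<k. b l * ?q l i)"
      by (simp add: gs_res_def b_def)
    also have "... = (\<Sum>m\<le>k. t m * B $$ (i,m))"
      unfolding e by (simp add: lessThan_Suc_atMost[symmetric] t_def sum_negf)
    finally show ?thesis .
  qed
  have "\<exists>i<n. ?u i \<noteq> 0"
  proof (rule ccontr)
    assume "\<not> ?thesis"
    hence z: "(\<Sum>m\<le>k. t m * B $$ (i,m)) = 0" if "i < n" for i using u[OF that] that by auto
    \<comment> \<open>If the residual vanished, its coefficients would form a kernel vector of B
      with entry 1 at k.\<close>
    define v where "v = Matrix.vec n (\<lambda>m. if m \<le> k then t m else 0)"
    have "B *\<^sub>v v = 0\<^sub>v n"
    proof (rule eq_vecI)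
      fix i assume i: "i < dim_vec (0\<^sub>v n)"
      hence "vec_index (B *\<^sub>v v) i = (\<Sum>m<n. B $$ (i,m) * (if m \<le> k then t m else 0))"
        using B by (auto simp: scalar_prod_def v_def atLeast0LessThan intro!: sum.cong)
      also have "... = (\<Sum>m\<le>k. t m * B $$ (i,m))"
        using less.prems by (intro sum.mono_neutral_cong_right) auto
      finally show "vec_index (B *\<^sub>v v) i = vec_index (0\<^sub>v n) i" using z i by simp
    qed (use B in auto)
    moreover have "v \<noteq> 0\<^sub>v n"
    proof
      assume "v = 0\<^sub>v n"
      hence "vec_index v k = 0" using less.prems by simp
      thus False using less.prems by (simp add: v_def t_def)
    qed
    moreover have "v \<in> carrier_vec n" by (simp add: v_def)
    ultimately show False using det_0_iff_vec_prod_zero_field[OF B] det by blast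
  qed
  hence "(\<Sum>j<n. (cmod (?u j))\<^sup>2) > 0" by (auto intro!: sum_pos2)
  hence r: "?r > 0" by (simp add: gs_norm_def)
  have orth: "(\<Sum>j<n. cnj (?q l j) * ?u j) = 0" if "l < k" for l
  proof -
    have "(\<Sum>j<n. cnj (?q l j) * ?u j) = b l - (\<Sum>j<n. \<Sum>l'<k. b l' * (cnj (?q l j) * ?q l' j))"
      by (simp add: gs_res_def b_def algebra_simps sum_subtractf sum_distrib_left)
    also have "(\<Sum>j<n. \<Sum>l'<k. b l' * (cnj (?q l j) * ?q l' j)) = (\<Sum>l'<k. b l' * (\<Sum>j<n. cnj (?q l j) * ?q l' j))"
      by (subst sum.swap) (simp add: sum_distrib_left)
    also have "... = (\<Sum>l'<k. if l' = l then b l' else 0)"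
      using that by (intro sum.cong refl) (auto simp: on')
    also have "... = b l" using that by simp
    finally show ?thesis by simp
  qed
  have "(\<Sum>j<n. cnj (?q l j) * ?q k j) = (if l = k then 1 else 0)" if "l \<le> k" for l
  proof (cases "l = k")
    case True
    have "(\<Sum>j<n. cnj (?q k j) * ?q k j) = (\<Sum>j<n. complex_of_real ((cmod (?u j))\<^sup>2)) / complex_of_real (?r\<^sup>2)"
      unfolding sum_divide_distrib
      by (intro sum.cong refl, simp only: complex_norm_square gs_eq) (simp add: power2_eq_square mult.commute)
    also have "(\<Sum>j<n. complex_of_real ((cmod (?u j))\<^sup>2)) = complex_of_real (?r\<^sup>2)"
      unfolding gs_norm_def by (simp add: sum_nonneg)
    finally show ?thesis using r True by simp
  next
    case False
    have "(\<Sum>j<n. cnj (?q l j) * ?q k j) = (\<Sum>j<n. cnj (?q l j) * ?u j) / ?r"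
      by (subst (2) gs_eq) (simp add: sum_divide_distrib)
    thus ?thesis using orth False that by simp
  qed
  moreover have "\<exists>c. \<forall>i<n. ?q k i = (\<Sum>m\<le>k. c m * B $$ (i,m))"
    by (intro exI[of _ "\<lambda>m. t m / ?r"]) (auto simp: gs_eq u sum_divide_distrib)
  ultimately show ?case using r by blast
qed

lemma gs_mat_Ugrp:
  assumes B: "B \<in> carrier_mat n n" and det: "det B \<noteq> 0"
  shows "gs_mat n B \<in> U_grp n"
proof -
  have *: "(\<Sum>j<n. cnj (gs n B l j) * gs n B k j) = (if l = k then 1 else 0)" if "l < n" "k < n" for l k
  proof (cases "l \<le> k")
    case False
    have "(\<Sum>j<n. cnj (gs n B l j) * gs n B k j) = cnj (\<Sum>j<n. cnj (gs n B k j) * gs n B l j)"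
      by (simp add: mult.commute)
    thus ?thesis using gs_properties[OF B det, of l] False that by auto
  qed (use gs_properties[OF B det, of k] that in auto)
  have "mat_adjoint (gs_mat n B) * gs_mat n B = 1\<^sub>m n"
  proof (rule eq_matI)
    fix i j assume "i < dim_row (1\<^sub>m n :: complex mat)" "j < dim_col (1\<^sub>m n :: complex mat)"
    hence ij: "i < n" "j < n" by auto
    show "(mat_adjoint (gs_mat n B) * gs_mat n B) $$ (i,j) = 1\<^sub>m n $$ (i,j)"
      unfolding mat_mult_index[OF mat_adjoint_carrier[OF gs_mat_carrier] gs_mat_carrier ij]
      using ij *[of i j] by (simp add: mat_adjoint_index_cnj[OF gs_mat_carrier] gs_mat_def)
  qed (use mult_carrier_mat[OF mat_adjoint_carrier[OF gs_mat_carrier] gs_mat_carrier] in auto)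
  thus ?thesis by (simp add: Ugrp_iff)
qed

text \<open>A unitary h preserves every inner product, so the coefficients and norms in the
  recursion do not change and only the vectors are moved.\<close>

lemma gs_equivariant:
  assumes h: "h \<in> U_grp n" and B: "B \<in> carrier_mat n n" and "k < n"
  shows "i < n ==> gs n (h * B) k i = (\<Sum>j<n. h $$ (i,j) * gs n B k j)"
  using \<open>k < n\<close>
proof (induction k arbitrary: i rule: less_induct)
  case (less k)
  have hc: "h \<in> carrier_mat n n" using h by simp
  have iso: "(\<Sum>j<n. cnj (\<Sum>a<n. h $$ (j,a) * v a) * (\<Sum>b<n. h $$ (j,b) * w b)) = (\<Sum>a<n. cnj (v a) * w a)"
    for v w :: "nat => complex"
  proof -
    have hh: "(\<Sum>j<n. cnj (h $$ (j,a)) * h $$ (j,b)) = (if a = b then 1 else 0)" if "a < n" "b < n" for a b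
    proof -
      have "(mat_adjoint h * h) $$ (a,b) = (1\<^sub>m n) $$ (a,b)" using h by (simp add: Ugrp_adjoint_left)
      thus ?thesis
        using that hc by (simp add: mat_mult_index[OF mat_adjoint_carrier[OF hc] hc] del: index_mult_mat)
    qed
    have "(\<Sum>j<n. cnj (\<Sum>a<n. h $$ (j,a) * v a) * (\<Sum>b<n. h $$ (j,b) * w b))
      = (\<Sum>j<n. \<Sum>a<n. \<Sum>b<n. cnj (v a) * w b * (cnj (h $$ (j,a)) * h $$ (j,b)))"
      by (simp add: sum_product mult_ac) (rule sum.cong[OF refl], rule sum.swap)
    also have "... = (\<Sum>a<n. \<Sum>b<n. \<Sum>j<n. cnj (v a) * w b * (cnj (h $$ (j,a)) * h $$ (j,b)))"
      by (subst sum.swap) (intro sum.cong refl sum.swap)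
    also have "... = (\<Sum>a<n. \<Sum>b<n. cnj (v a) * w b * (if a = b then 1 else 0))"
      unfolding sum_distrib_left[symmetric] by (intro sum.cong refl) (simp add: hh)
    also have "... = (\<Sum>a<n. cnj (v a) * w a)"
      by (intro sum.cong refl) (simp add: if_distrib cong: if_cong)
    finally show ?thesis .
  qed
  have hB: "(h * B) $$ (i,k) = (\<Sum>j<n. h $$ (i,j) * B $$ (j,k))" if "i < n" for i
    using mat_mult_index[OF hc B that less.prems(2)] .
  have in_: "(\<Sum>j<n. cnj (gs n (h * B) l j) * (h * B) $$ (j,k)) = (\<Sum>j<n. cnj (gs n B l j) * B $$ (j,k))" if "l < k" for l
  proof -
    have "(\<Sum>j<n. cnj (gs n (h * B) l j) * (h * B) $$ (j,k))
       = (\<Sum>j<n. cnj (\<Sum>a<n. h $$ (j,a) * gs n B l a) * (\<Sum>b<n. h $$ (j,b) * B $$ (b,k)))"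
      using less that by (intro sum.cong refl) (simp add: hB)
    thus ?thesis by (simp only: iso)
  qed
  have res: "gs_res n (h * B) k i = (\<Sum>j<n. h $$ (i,j) * gs_res n B k j)" if i: "i < n" for i
  proof -
    define b where "b l = (\<Sum>j<n. cnj (gs n B l j) * B $$ (j,k))" for l
    have "gs_res n (h * B) k i = (h * B) $$ (i,k) - (\<Sum>l<k. b l * gs n (h * B) l i)"
      by (simp add: gs_res_def in_ b_def)
    also have "(\<Sum>l<k. b l * gs n (h * B) l i) = (\<Sum>l<k. \<Sum>j<n. h $$ (i,j) * (b l * gs n B l j))"
      using less i by (intro sum.cong refl) (simp add: sum_distrib_left mult_ac)
    also have "... = (\<Sum>j<n. h $$ (i,j) * (\<Sum>l<k. b l * gs n B l j))"
      by (subst sum.swap) (simp add: sum_distrib_left)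
    finally show ?thesis
      unfolding hB[OF i] by (simp add: gs_res_def b_def[symmetric] right_diff_distrib sum_subtractf)
  qed
  have "complex_of_real ((gs_norm n (h * B) k)\<^sup>2) = complex_of_real ((gs_norm n B k)\<^sup>2)"
  proof -
    have *: "complex_of_real ((gs_norm n B k)\<^sup>2) = (\<Sum>j<n. cnj (gs_res n B k j) * gs_res n B k j)" for B
      by (simp add: gs_norm_def sum_nonneg complex_norm_square mult.commute del: of_real_power)
    have "complex_of_real ((gs_norm n (h * B) k)\<^sup>2) =
       (\<Sum>j<n. cnj (\<Sum>a<n. h $$ (j,a) * gs_res n B k a) * (\<Sum>b<n. h $$ (j,b) * gs_res n B k b))"
      unfolding * by (intro sum.cong refl) (simp add: res)
    thus ?thesis unfolding iso * .
  qed
  hence "gs_norm n (h * B) k = gs_norm n B k"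
    by (simp only: of_real_eq_iff) (simp add: gs_norm_def sum_nonneg)
  thus ?case using less.prems by (simp add: gs_eq res sum_divide_distrib)
qed

lemma gs_mat_equivariant:
  assumes h: "h \<in> U_grp n" and B: "B \<in> carrier_mat n n"
  shows "gs_mat n (h * B) = h * gs_mat n B"
proof (rule eq_matI)
  have hc: "h \<in> carrier_mat n n" using h by simp
  fix i j assume "i < dim_row (h * gs_mat n B)" "j < dim_col (h * gs_mat n B)"
  hence ij: "i < n" "j < n" using hc by (auto simp: gs_mat_def)
  show "gs_mat n (h * B) $$ (i,j) = (h * gs_mat n B) $$ (i,j)"
    unfolding mat_mult_index[OF hc gs_mat_carrier ij]
    using ij gs_equivariant[OF h B] by (simp add: gs_mat_def)
qed (use h in \<open>auto simp: gs_mat_def dest: Ugrp_carrier\<close>)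

lemma QR_decomposition:
  assumes B: "B \<in> carrier_mat n n" and det: "det B \<noteq> 0"
  obtains V R where "V \<in> U_grp n" "R \<in> carrier_mat n n" "upper_triangular R" "B = V * R"
proof -
  let ?V = "gs_mat n B"
  have V: "?V \<in> U_grp n" using gs_mat_Ugrp[OF assms] .
  have Vc: "?V \<in> carrier_mat n n" by simp
  define R where "R = mat_adjoint ?V * B"
  have R: "R \<in> carrier_mat n n" using B by (simp add: R_def)
  have "?V * R = (?V * mat_adjoint ?V) * B"
    unfolding R_def using B mat_adjoint_carrier[OF Vc] by (simp add: assoc_mult_mat[of _ n n _ n _ n])
  hence "B = ?V * R" using Ugrp_adjoint_right[OF V] B by simp
  moreover have "upper_triangular R"
  proof
    fix i j assume ij: "j < i" "i < dim_row R"
    hence ij': "i < n" "j < n" using R by auto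
    have Bj: "B $$ (a,j) = (\<Sum>l<j. (\<Sum>b<n. cnj (gs n B l b) * B $$ (b,j)) * gs n B l a) + gs_norm n B j * gs n B j a" for a
      using gs_properties[OF assms ij'(2)] by (simp add: gs_eq[of n B j] gs_res_def)
    have "R $$ (i,j) = (\<Sum>a<n. cnj (gs n B i a) * B $$ (a,j))"
      unfolding R_def mat_mult_index[OF mat_adjoint_carrier[OF Vc] B ij']
      using ij' by (simp add: mat_adjoint_index_cnj[OF Vc] gs_mat_def)
    also have "... = (\<Sum>a<n. \<Sum>l<j. (\<Sum>b<n. cnj (gs n B l b) * B $$ (b,j)) * (cnj (gs n B i a) * gs n B l a))
         + gs_norm n B j * (\<Sum>a<n. cnj (gs n B i a) * gs n B j a)"
      by (subst Bj) (simp add: algebra_simps sum.distrib sum_distrib_left)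
    also have "(\<Sum>a<n. \<Sum>l<j. (\<Sum>b<n. cnj (gs n B l b) * B $$ (b,j)) * (cnj (gs n B i a) * gs n B l a))
       = (\<Sum>l<j. (\<Sum>b<n. cnj (gs n B l b) * B $$ (b,j)) * (\<Sum>a<n. cnj (gs n B i a) * gs n B l a))"
      by (subst sum.swap) (simp add: sum_distrib_left)
    also have z: "(\<Sum>a<n. cnj (gs n B i a) * gs n B l a) = 0" if "l < i" for l
    proof -
      have "(\<Sum>a<n. cnj (gs n B i a) * gs n B l a) = cnj (\<Sum>a<n. cnj (gs n B l a) * gs n B i a)"
        by (simp add: mult.commute)
      thus ?thesis using gs_properties[OF assms ij'(1)] that by auto
    qed
    finally show "R $$ (i,j) = 0" using ij by (simp add: z)
  qed
  ultimately show ?thesis using that V R by blast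
qed

subsection \<open>Diagonalisation of normal matrices\<close>

text \<open>Schur's theorem gives A = P B Q with B triangular but P merely invertible. The unitary
  factor V of P = V R also works, since T = V* A V satisfies T R = R B with R triangular and
  invertible.\<close>

lemma unitary_triangularisation:
  fixes A :: "complex mat"
  assumes A: "A \<in> carrier_mat n n"
  obtains V where "V \<in> U_grp n" "upper_triangular (mat_adjoint V * A * V)"
proof -
  obtain es where es: "char_poly A = (\<Prod>a\<leftarrow>es. [:- a, 1:])"
    using char_poly_factorized[OF A] by auto
  obtain B P Q where sd: "schur_decomposition A es = (B,P,Q)" by (metis prod_cases3)
  from schur_decomposition[OF A es sd]
  have sim: "similar_mat_wit A B P Q" and ut: "upper_triangular B" by auto
  have P: "P \<in> carrier_mat n n" and Q: "Q \<in> carrier_mat n n" and B: "B \<in> carrier_mat n n"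
    and PQ: "P * Q = 1\<^sub>m n" "Q * P = 1\<^sub>m n" and AP: "A = P * B * Q"
    using similar_mat_witD2[OF A sim] by auto
  have "det P * det Q = 1" using det_mult[OF P Q] PQ by simp
  hence "det P \<noteq> 0" by auto
  from QR_decomposition[OF P this] obtain V R where VR: "V \<in> U_grp n" "R \<in> carrier_mat n n" "upper_triangular R" "P = V * R"
    by blast
  have V: "V \<in> carrier_mat n n" "mat_adjoint V \<in> carrier_mat n n" using VR by auto
  have "det P = det V * det R" using V VR by (simp add: det_mult[of _ n])
  hence dR: "det R \<noteq> 0" using \<open>det P \<noteq> 0\<close> by auto
  have Rd: "R $$ (j,j) \<noteq> 0" if "j < n" for j
    using dR det_upper_triangular[OF VR(3,2)] VR(2) that by (auto simp: diag_mat_def prod_list_zero_iff)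
  define T where "T = mat_adjoint V * A * V"
  have T: "T \<in> carrier_mat n n" using V A by (auto simp: T_def)
  have "T * R = mat_adjoint V * (A * (V * R))"
    unfolding T_def using V A VR(2) by (simp add: assoc_mult_mat[of _ n n _ n _ n])
  also have "A * (V * R) = V * (R * B)"
  proof -
    have "A * P = P * (B * (Q * P))" unfolding AP using P B Q by (simp add: assoc_mult_mat[of _ n n _ n _ n])
    also have "... = P * B" using PQ B by simp
    finally show ?thesis unfolding VR(4) using V VR(2) B by (simp add: assoc_mult_mat[of _ n n _ n _ n])
  qed
  also have "mat_adjoint V * (V * (R * B)) = (mat_adjoint V * V) * (R * B)"
    using V VR(2) B by (simp add: assoc_mult_mat[of _ n n _ n _ n])
  also have "... = R * B" using Ugrp_adjoint_left[OF VR(1)] VR(2) B by simp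
  finally have TR: "T * R = R * B" .
  have RB: "(R * B) $$ (i,j) = 0" if "j < i" "i < n" for i j
  proof -
    have "(R * B) $$ (i,j) = (\<Sum>k<n. R $$ (i,k) * B $$ (k,j))" using that VR(2) B by (intro mat_mult_index[of _ n n _ n]) auto
    also have "... = 0" using that VR ut B
      by (intro sum.neutral ballI) (metis carrier_matD(1) lessThan_iff linorder_not_less mult_eq_0_iff order_le_less_trans upper_triangularD)
    finally show ?thesis .
  qed
  \<comment> \<open>Induction on the column: below the diagonal the equation T R = R B leaves the
    single term T(i,j) R(j,j).\<close>
  have "T $$ (i,j) = 0" if "j < i" "i < n" for i j
    using that
  proof (induction j rule: less_induct)
    case (less j)
    have "0 = (T * R) $$ (i,j)" using RB less TR by simp
    also have "... = (\<Sum>k<n. T $$ (i,k) * R $$ (k,j))" using less T VR(2) by (intro mat_mult_index[of _ n n _ n]) auto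
    also have "... = (\<Sum>k<n. if k = j then T $$ (i,j) * R $$ (j,j) else 0)"
    proof (intro sum.cong refl)
      fix k assume k: "k \<in> {..<n}"
      show "T $$ (i,k) * R $$ (k,j) = (if k = j then T $$ (i,j) * R $$ (j,j) else 0)"
        using less.IH[of k] less.prems k upper_triangularD[OF VR(3), of j k] VR(2)
        by (cases k j rule: linorder_cases) auto
    qed
    also have "... = T $$ (i,j) * R $$ (j,j)" using less.prems by simp
    finally show ?case using Rd[of j] less.prems by auto
  qed
  hence "upper_triangular T" using T by auto
  thus ?thesis using that VR(1) by (simp add: T_def)
qed

text \<open>Normality equates the norms of row i and column i. By induction on i only the diagonal
  entry of the column survives, so the rest of the row vanishes.\<close>

lemma normal_upper_triangular_diagonal:
  fixes T :: "complex mat"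
  assumes T: "T \<in> carrier_mat n n" and ut: "upper_triangular T"
    and normal: "mat_adjoint T * T = T * mat_adjoint T"
  shows "T = mat_diag n (\<lambda>i. T $$ (i,i))"
proof -
  have T': "mat_adjoint T \<in> carrier_mat n n" using T by simp
  have "k < n ==> k \<noteq> i ==> T $$ (i,k) = 0" if "i < n" for i k
    using that
  proof (induction i arbitrary: k rule: less_induct)
    case (less i)
    have sq: "cnj z * z = complex_of_real ((cmod z)\<^sup>2)" "z * cnj z = complex_of_real ((cmod z)\<^sup>2)" for z
      by (simp_all add: complex_norm_square mult.commute del: of_real_power)
    have "(mat_adjoint T * T) $$ (i,i) = complex_of_real (\<Sum>l<n. (cmod (T $$ (l,i)))\<^sup>2)"
      using less.prems by (simp add: mat_mult_index[OF T' T] mat_adjoint_index_cnj[OF T] sq del: of_real_power)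
    moreover have "(T * mat_adjoint T) $$ (i,i) = complex_of_real (\<Sum>l<n. (cmod (T $$ (i,l)))\<^sup>2)"
      using less.prems by (simp add: mat_mult_index[OF T T'] mat_adjoint_index_cnj[OF T] sq del: of_real_power)
    ultimately have e: "(\<Sum>l<n. (cmod (T $$ (l,i)))\<^sup>2) = (\<Sum>l<n. (cmod (T $$ (i,l)))\<^sup>2)"
      using normal by (simp only: of_real_eq_iff)
    have "(\<Sum>l<n. (cmod (T $$ (l,i)))\<^sup>2) = (\<Sum>l<n. if l = i then (cmod (T $$ (i,i)))\<^sup>2 else 0)"
    proof (intro sum.cong refl)
      fix l assume "l \<in> {..<n}"
      thus "(cmod (T $$ (l,i)))\<^sup>2 = (if l = i then (cmod (T $$ (i,i)))\<^sup>2 else 0)"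
        using less upper_triangularD[OF ut, of i l] T by (cases l i rule: linorder_cases) auto
    qed
    hence "(\<Sum>l<n. (cmod (T $$ (i,l)))\<^sup>2) = (cmod (T $$ (i,i)))\<^sup>2" using e less.prems by simp
    hence "(\<Sum>l\<in>{..<n}-{i}. (cmod (T $$ (i,l)))\<^sup>2) = 0" using less.prems by (simp add: sum_diff1)
    thus ?case using less.prems by (subst (asm) sum_nonneg_eq_0_iff) auto
  qed
  thus ?thesis using T by (intro eq_matI) (auto simp: mat_diag_def)
qed

lemma normal_diagonalisation:
  fixes A :: "complex mat"
  assumes A: "A \<in> carrier_mat n n" and normal: "mat_adjoint A * A = A * mat_adjoint A"
  obtains V f where "V \<in> SU_grp n" "A = V * mat_diag n f * mat_adjoint V"
proof -
  obtain V where V: "V \<in> U_grp n" and ut: "upper_triangular (mat_adjoint V * A * V)"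
    using unitary_triangularisation[OF A] by blast
  note assoc = assoc_mult_mat[of _ n n _ n _ n]
  have c: "V \<in> carrier_mat n n" "mat_adjoint V \<in> carrier_mat n n" "mat_adjoint A \<in> carrier_mat n n"
    using V A by auto
  define T where "T = mat_adjoint V * A * V"
  have T: "T \<in> carrier_mat n n" using c A by (auto simp: T_def)
  have VV: "V * (mat_adjoint V * X) = X" "mat_adjoint V * (V * X) = X" if "X \<in> carrier_mat n n" for X
    using that c Ugrp_adjoint_left[OF V] Ugrp_adjoint_right[OF V] by (simp_all flip: assoc)
  have T': "mat_adjoint T = mat_adjoint V * mat_adjoint A * V"
    unfolding T_def using c A by (simp add: mat_adjoint_mult[of _ n n _ n] mat_adjoint_adjoint[of _ n n] assoc)
  have "mat_adjoint T * T = mat_adjoint V * ((mat_adjoint A * A) * V)"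
    unfolding T' unfolding T_def using c A by (simp add: assoc VV)
  also have "... = T * mat_adjoint T"
    unfolding T' normal unfolding T_def using c A by (simp add: assoc VV)
  finally have n: "T = mat_diag n (\<lambda>i. T $$ (i,i))"
    using normal_upper_triangular_diagonal[OF T] ut by (simp add: T_def)
  define f where "f = (\<lambda>i. T $$ (i,i))"
  have Tf: "T = mat_diag n f" using n by (simp add: f_def)
  have AT: "A = V * T * mat_adjoint V"
    unfolding T_def using c A Ugrp_adjoint_right[OF V] by (simp add: assoc VV)
  \<comment> \<open>A diagonal phase brings V to determinant one; it commutes with the diagonal
    matrix and therefore does not affect the conjugation.\<close>
  define D where "D = mat_diag n (\<lambda>i. if i = 0 then cnj (det V) else (1::complex))"
  have Dc: "D \<in> carrier_mat n n" by (simp add: D_def)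
  have D: "D \<in> U_grp n" unfolding D_def using Ugrp_det[OF V] by (intro mat_diag_Ugrp) auto
  have D': "mat_adjoint D \<in> carrier_mat n n" using Dc by simp
  have "det (V * D) = 1"
  proof (cases "n = 0")
    case False
    have "det D = cnj (det V)"
      using False unfolding D_def det_mat_diag by (simp add: prod.If_cases lessThan_def)
    thus ?thesis using Ugrp_det[OF V] c Dc
      by (simp add: det_mult complex_norm_square[symmetric])
  qed (use c Dc in \<open>simp add: det_mult\<close>)
  hence VD: "V * D \<in> SU_grp n" using Ugrp_mult[OF V D] by (simp add: SU_iff)
  have comm: "D * mat_diag n f = mat_diag n f * D"
    unfolding D_def by (simp add: mult.commute)
  have "V * D * mat_diag n f * mat_adjoint (V * D) = V * (D * mat_diag n f * (mat_adjoint D * mat_adjoint V))"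
    using c Dc D' by (simp add: mat_adjoint_mult[OF c(1) Dc] assoc)
  also have "... = V * (mat_diag n f * (D * mat_adjoint D) * mat_adjoint V)"
    unfolding comm using c Dc D' by (simp add: assoc)
  also have "... = A" using Ugrp_adjoint_right[OF D] AT c by (simp add: Tf assoc)
  finally show ?thesis using that VD by metis
qed

lemma Ugrp_diagonalisation:
  assumes A: "A \<in> U_grp n"
  obtains V f where "V \<in> SU_grp n" "A = V * mat_diag n f * mat_adjoint V" "!!i. i < n ==> cmod (f i) = 1"
proof -
  have Ac: "A \<in> carrier_mat n n" using A by simp
  obtain V f where V: "V \<in> SU_grp n" and AV: "A = V * mat_diag n f * mat_adjoint V"
    using normal_diagonalisation[OF Ac] Ugrp_adjoint_left[OF A] Ugrp_adjoint_right[OF A] by metis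
  note assoc = assoc_mult_mat[of _ n n _ n _ n]
  have c: "V \<in> carrier_mat n n" "mat_adjoint V \<in> carrier_mat n n" using V by auto
  have VV: "mat_adjoint V * V = 1\<^sub>m n" using Ugrp_adjoint_left[OF SU_Ugrp[OF V]] .
  have "mat_adjoint V * A * V = (mat_adjoint V * V) * mat_diag n f * (mat_adjoint V * V)"
    unfolding AV using c by (simp add: assoc)
  hence "mat_diag n f = mat_adjoint V * A * V" by (simp add: VV)
  hence U: "mat_diag n f \<in> U_grp n" using V A by (simp add: Ugrp_mult Ugrp_adjoint SU_Ugrp)
  have "cmod (f i) = 1" if i: "i < n" for i
  proof -
    have "mat_diag n (\<lambda>i. cnj (f i) * f i) = 1\<^sub>m n"
      using Ugrp_adjoint_left[OF U] by (simp add: mat_adjoint_diag)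
    hence "mat_diag n (\<lambda>i. cnj (f i) * f i) $$ (i,i) = 1\<^sub>m n $$ (i,i)" by simp
    hence "cnj (f i) * f i = 1" using i by (simp add: mat_diag_def)
    hence "complex_of_real ((cmod (f i))\<^sup>2) = 1" by (metis complex_norm_square mult.commute)
    hence "(cmod (f i))\<^sup>2 = 1" by (simp only: of_real_eq_1_iff)
    thus ?thesis by (simp add: power2_eq_1_iff) (smt (verit) norm_ge_zero)
  qed
  thus ?thesis using that V AV by blast
qed

text \<open>If V diagonalises g* g, the columns of g V are orthogonal; the s i are their lengths,
  and rescaling the columns leaves a special unitary matrix.\<close>

lemma SL_polar:
  fixes g :: "complex mat"
  assumes g: "g \<in> carrier_mat n n" and det: "det g = 1"
  obtains u s V where "u \<in> SU_grp n" "V \<in> SU_grp n" "!!i. i < n ==> (s i :: real) > 0" "(\<Prod>i<n. s i) = 1"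
    "g = u * mat_diag n (\<lambda>i. complex_of_real (s i)) * V"
proof -
  note assoc = assoc_mult_mat[of _ n n _ n _ n]
  have g': "mat_adjoint g \<in> carrier_mat n n" using g by simp
  define H where "H = mat_adjoint g * g"
  have H: "H \<in> carrier_mat n n" using g g' by (simp add: H_def)
  have Hh: "mat_adjoint H = H" unfolding H_def using g g' by (simp add: mat_adjoint_mult[of _ n n _ n] mat_adjoint_adjoint[of _ n n])
  obtain V f where V: "V \<in> SU_grp n" and HV: "H = V * mat_diag n f * mat_adjoint V"
    using normal_diagonalisation[OF H] Hh by metis
  have c: "V \<in> carrier_mat n n" "mat_adjoint V \<in> carrier_mat n n" using V by auto
  have VV: "mat_adjoint V * V = 1\<^sub>m n" "V * mat_adjoint V = 1\<^sub>m n"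
    using Ugrp_adjoint_left[OF SU_Ugrp[OF V]] Ugrp_adjoint_right[OF SU_Ugrp[OF V]] .
  define W where "W = g * V"
  have W: "W \<in> carrier_mat n n" "mat_adjoint W \<in> carrier_mat n n" using g c by (auto simp: W_def)
  have WW: "mat_adjoint W * W = mat_diag n f"
  proof -
    have "mat_adjoint W * W = mat_adjoint V * H * V"
      unfolding W_def H_def using g g' c by (simp add: mat_adjoint_mult[of _ n n _ n] assoc)
    also have "... = (mat_adjoint V * V) * mat_diag n f * (mat_adjoint V * V)"
      unfolding HV using c by (simp add: assoc)
    finally show ?thesis by (simp add: VV)
  qed
  have dW: "det W = 1" using g c det V by (simp add: W_def det_mult SU_iff)
  define s where "s i = sqrt (\<Sum>k<n. (cmod (W $$ (k,i)))\<^sup>2)" for i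
  have fs: "f i = complex_of_real ((s i)\<^sup>2)" if "i < n" for i
  proof -
    have "mat_diag n f $$ (i,i) = (\<Sum>k<n. cnj (W $$ (k,i)) * W $$ (k,i))"
      unfolding WW[symmetric] using that by (simp add: mat_mult_index[OF W(2,1)] mat_adjoint_index_cnj[OF W(1)])
    thus ?thesis using that
      by (simp add: mat_diag_def s_def sum_nonneg complex_norm_square mult.commute del: of_real_power)
  qed
  have "det (mat_diag n f) = 1" unfolding WW[symmetric] using W dW by (simp add: det_mult[of _ n] det_mat_adjoint[of _ n])
  hence "(\<Prod>i<n. complex_of_real ((s i)\<^sup>2)) = 1" by (simp add: det_mat_diag fs del: of_real_power)
  hence "complex_of_real ((\<Prod>i<n. s i)\<^sup>2) = 1" by (simp add: prod_power_distrib)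
  hence p2: "(\<Prod>i<n. s i)\<^sup>2 = 1" by (simp only: of_real_eq_1_iff)
  have s0: "s i \<ge> 0" for i by (simp add: s_def sum_nonneg)
  hence p: "(\<Prod>i<n. s i) = 1" using p2 by (simp add: power2_eq_1_iff) (smt (verit) prod_nonneg)
  have pos: "s i > 0" if "i < n" for i
    using s0[of i] p that by (metis finite_lessThan lessThan_iff less_eq_real_def prod_zero_iff zero_neq_one)
  define S where "S = mat_diag n (\<lambda>i. complex_of_real (s i))"
  define S' where "S' = mat_diag n (\<lambda>i. complex_of_real (1 / s i))"
  have S: "S \<in> carrier_mat n n" "S' \<in> carrier_mat n n" by (auto simp: S_def S'_def)
  have SS: "S' * S = 1\<^sub>m n"
  proof -
    have "S' * S = mat_diag n (\<lambda>i. 1)" unfolding S_def S'_def mat_diag_diag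
      using pos by (intro mat_diag_cong) (metis less_irrefl mult.commute nonzero_mult_div_cancel_left of_real_mult of_real_1 times_divide_eq_right mult.right_neutral)
    thus ?thesis by simp
  qed
  define u where "u = W * S'"
  have u: "u \<in> carrier_mat n n" using W S by (simp add: u_def)
  have Sa: "mat_adjoint S' = S'" by (simp add: S'_def mat_adjoint_diag)
  have "mat_adjoint u * u = S' * (mat_adjoint W * W) * S'"
    unfolding u_def using W S by (simp add: mat_adjoint_mult[of _ n n _ n] Sa assoc)
  also have "... = mat_diag n (\<lambda>i. 1)"
    unfolding WW S'_def mat_diag_diag using pos
    by (intro mat_diag_cong) (simp add: fs power2_eq_square less_imp_neq[symmetric])
  finally have uU: "u \<in> U_grp n" using u by (simp add: Ugrp_iff)
  have "det u = 1"
  proof -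
    have "det S' * det S = 1" using SS S det_mult[OF S(2,1)] by simp
    moreover have "det S = 1" unfolding S_def det_mat_diag using p by (metis of_real_prod of_real_1)
    ultimately have "det S' = 1" by simp
    thus ?thesis using dW W S by (simp add: u_def det_mult)
  qed
  hence "u \<in> SU_grp n" using uU by (simp add: SU_iff)
  moreover have "g = u * S * mat_adjoint V"
  proof -
    have "u * S * mat_adjoint V = g * ((V * (S' * S)) * mat_adjoint V)"
      unfolding u_def W_def using g c S by (simp add: assoc)
    also have "... = g" using SS VV c g by simp
    finally show ?thesis by simp
  qed
  ultimately show ?thesis using that[of u "mat_adjoint V" s] V pos p by (simp add: SU_adjoint S_def)
qed

section \<open>Invariants of vectors and covectors\<close>

lemma polyfun_line:
  assumes "polyfun X p"
  shows "\<exists>P. \<forall>s. p (\<lambda>x. a x + s * b x) = poly P s"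
  using assms
proof (induction rule: polyfun.induct)
  case (polyfun_const c)
  show ?case by (intro exI[of _ "[:c:]"]) simp
next
  case (polyfun_var x)
  show ?case by (intro exI[of _ "[:a x, b x:]"]) simp
next
  case (polyfun_add p q)
  then obtain P Q where "\<forall>s. p (\<lambda>x. a x + s * b x) = poly P s" "\<forall>s. q (\<lambda>x. a x + s * b x) = poly Q s" by blast
  thus ?case by (intro exI[of _ "P + Q"]) simp
next
  case (polyfun_mult p q)
  then obtain P Q where "\<forall>s. p (\<lambda>x. a x + s * b x) = poly P s" "\<forall>s. q (\<lambda>x. a x + s * b x) = poly Q s" by blast
  thus ?case by (intro exI[of _ "P * Q"]) simp
qed

text \<open>On the line through v and v1 both functions become polynomials in one variable, where a
  product vanishes only if a factor does. Serves to extend identities from generic points to all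
  points.\<close>

lemma polyfun_no_zero_divisors:
  assumes "polyfun X p" "polyfun X q" "!!v. p v = 0 \<or> q v = 0" "p v1 \<noteq> 0"
  shows "q v = 0"
proof -
  let ?l = "\<lambda>s x. v x + s * (v1 x - v x)"
  obtain P Q where P: "!!s. p (?l s) = poly P s" and Q: "!!s. q (?l s) = poly Q s"
    using polyfun_line[OF assms(1), of v "\<lambda>x. v1 x - v x"] polyfun_line[OF assms(2), of v "\<lambda>x. v1 x - v x"]
    by blast
  have "poly (P * Q) s = 0" for s using assms(3)[of "?l s"] by (auto simp: P Q)
  hence "P * Q = 0" using poly_all_0_iff_0 by blast
  moreover have "poly P 1 \<noteq> 0" using assms(4) by (simp flip: P)
  hence "P \<noteq> 0" by auto
  ultimately have "Q = 0" by simp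
  thus ?thesis using Q[of 0] by simp
qed

lemma polyfun_holomorphic:
  assumes "polyfun X p" and "!!x. x \<in> X ==> (\<lambda>s. w s x) holomorphic_on S"
  shows "(\<lambda>s. p (w s)) holomorphic_on S"
  using assms by (induction rule: polyfun.induct) (auto intro!: holomorphic_intros)

lemma polyfun_det:
  assumes "!!i j. i < N ==> j < N ==> polyfun X (\<lambda>v. f v i j)"
  shows "polyfun X (\<lambda>v. det (Matrix.mat N N (\<lambda>(i,j). f v i j)))"
proof -
  have "det (Matrix.mat N N (\<lambda>(i,j). f v i j)) = (\<Sum>p | p permutes {0..<N}. signof p * (\<Prod>i = 0..<N. f v i (p i)))" for v
    by (subst det_def'[of _ N]) (auto intro!: sum.cong prod.cong dest: permutes_in_image)
  thus ?thesis
    by (auto intro!: polyfun_sum polyfun_mult polyfun_const polyfun_prod assms dest: permutes_in_image)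
qed

type_synonym qvar = "(nat \<times> nat) + (nat \<times> nat)"

text \<open>\<open>Inl (i, j)\<close> stands for the entry \<open>(i, j)\<close> of an \<open>n \<times> N\<close> matrix \<open>Q\<close> of quarks and
  \<open>Inr (j, i)\<close> for the entry \<open>(j, i)\<close> of an \<open>N \<times> n\<close> matrix \<open>Q'\<close> of antiquarks; the group acts by
  \<open>Q \<mapsto> h Q\<close> and \<open>Q' \<mapsto> Q' h\<^sup>-\<^sup>1\<close>.\<close>

definition qvars :: "nat => nat => qvar set" where
  "qvars n N = Inl ` ({..<n} \<times> {..<N}) \<union> Inr ` ({..<N} \<times> {..<n})"

text \<open>The matrix on the antiquarks is a separate argument: it is the adjoint for unitary h and
  an inverse in the steps to SL(n) and GL(n).\<close>

definition act :: "nat => complex mat => complex mat => (qvar => complex) => qvar => complex" where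
  "act n h h' v x = (case x of Inl (i,j) => \<Sum>k<n. h $$ (i,k) * v (Inl (k,j))
     | Inr (j,i) => \<Sum>k<n. v (Inr (j,k)) * h' $$ (k,i))"

definition meson :: "nat => (qvar => complex) => nat \<times> nat => complex" where
  "meson n v = (\<lambda>(i,j). \<Sum>k<n. v (Inr (i,k)) * v (Inl (k,j)))"

text \<open>A section of \<open>meson\<close> for N \<le> n: the quarks are M over zeros and the
  antiquarks are the identity next to zeros.\<close>

definition canon :: "nat => (nat \<times> nat => complex) => qvar => complex" where
  "canon N M x = (case x of Inl (i,j) => if i < N then M (i,j) else 0
     | Inr (j,i) => if i = j then 1 else 0)"

definition mvars :: "nat => (nat \<times> nat) set" where "mvars N = {..<N} \<times> {..<N}"

lemma finite_qvars [simp]: "finite (qvars n N)" by (simp add: qvars_def)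
lemma finite_mvars [simp]: "finite (mvars n)" by (simp add: mvars_def)

lemma qvars_cases:
  assumes "x \<in> qvars n N"
  obtains i j where "x = Inl (i,j)" "i < n" "j < N" | i j where "x = Inr (j,i)" "i < n" "j < N"
  using assms by (auto simp: qvars_def)

lemma qvars_simps [simp]: "Inl (i,j) \<in> qvars n N \<longleftrightarrow> i < n \<and> j < N" "Inr (j,i) \<in> qvars n N \<longleftrightarrow> j < N \<and> i < n"
  by (auto simp: qvars_def)

lemma act_act:
  assumes "h \<in> carrier_mat n n" "h' \<in> carrier_mat n n" "k \<in> carrier_mat n n" "k' \<in> carrier_mat n n"
    and "x \<in> qvars n N"
  shows "act n h h' (act n k k' v) x = act n (h * k) (k' * h') v x"
  using assms(5)
proof (cases rule: qvars_cases)
  case (1 i j)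
  have "(\<Sum>a<n. h $$ (i,a) * (\<Sum>b<n. k $$ (a,b) * v (Inl (b,j)))) = (\<Sum>b<n. (h * k) $$ (i,b) * v (Inl (b,j)))"
    using 1 assms
    by (simp add: mat_mult_index[of _ n n _ n] sum_distrib_left sum_distrib_right mult.assoc del: index_mult_mat)
       (rule sum.swap)
  thus ?thesis using 1 by (simp add: act_def)
next
  case (2 i j)
  have "(\<Sum>a<n. (\<Sum>b<n. v (Inr (j,b)) * k' $$ (b,a)) * h' $$ (a,i)) = (\<Sum>b<n. v (Inr (j,b)) * (k' * h') $$ (b,i))"
    using 2 assms
    by (simp add: mat_mult_index[of _ n n _ n] sum_distrib_left sum_distrib_right mult.assoc del: index_mult_mat)
       (rule sum.swap)
  thus ?thesis using 2 by (simp add: act_def)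
qed

lemma act_diag:
  "x \<in> qvars n N ==> act n (mat_diag n f) (mat_diag n f') v x =
    (case x of Inl (i,j) => f i | Inr (j,i) => f' i) * v x"
  by (erule qvars_cases) (auto simp: act_def mat_diag_def if_distrib if_distribR mult.commute cong: if_cong)

lemma meson_act:
  assumes "h \<in> carrier_mat n n" "h' \<in> carrier_mat n n" "h' * h = 1\<^sub>m n" "x \<in> mvars N"
  shows "meson n (act n h h' v) x = meson n v x"
proof -
  obtain i j where x: "x = (i,j)" by (cases x)
  have "meson n (act n h h' v) x = (\<Sum>k<n. (\<Sum>a<n. v (Inr (i,a)) * h' $$ (a,k)) * (\<Sum>b<n. h $$ (k,b) * v (Inl (b,j))))"
    by (simp add: x meson_def act_def)
  also have "... = (\<Sum>k<n. \<Sum>a<n. \<Sum>b<n. v (Inr (i,a)) * v (Inl (b,j)) * (h' $$ (a,k) * h $$ (k,b)))"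
    unfolding sum_product by (intro sum.cong refl) (simp only: mult_ac)
  also have "... = (\<Sum>a<n. \<Sum>b<n. \<Sum>k<n. v (Inr (i,a)) * v (Inl (b,j)) * (h' $$ (a,k) * h $$ (k,b)))"
    by (subst sum.swap) (intro sum.cong refl sum.swap)
  also have "... = (\<Sum>a<n. \<Sum>b<n. v (Inr (i,a)) * v (Inl (b,j)) * (if a = b then 1 else 0))"
  proof (intro sum.cong refl)
    fix a b assume "a \<in> {..<n}" "b \<in> {..<n}"
    hence "(\<Sum>k<n. h' $$ (a,k) * h $$ (k,b)) = (h' * h) $$ (a,b)"
      using mat_mult_index[OF assms(2,1)] by simp
    also have "... = (if a = b then 1 else 0)" using \<open>a \<in> _\<close> \<open>b \<in> _\<close> unfolding assms(3) by simp
    finally show "(\<Sum>k<n. v (Inr (i,a)) * v (Inl (b,j)) * (h' $$ (a,k) * h $$ (k,b)))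
        = v (Inr (i,a)) * v (Inl (b,j)) * (if a = b then 1 else 0)"
      by (simp only: sum_distrib_left[symmetric])
  qed
  also have "... = meson n v x"
    unfolding x meson_def prod.case by (intro sum.cong refl) (simp add: if_distrib cong: if_cong)
  finally show ?thesis .
qed

lemma meson_canon:
  assumes "N \<le> n" "x \<in> mvars N" shows "meson n (canon N M) x = M x"
proof -
  obtain i j where x: "x = (i,j)" "i < N" "j < N" using assms by (auto simp: mvars_def)
  have "meson n (canon N M) x = (\<Sum>k<n. if k = i then M (i,j) else 0)"
    unfolding x meson_def prod.case using x by (intro sum.cong refl) (simp add: canon_def)
  thus ?thesis using x assms by simp
qed

definition SU_invariant :: "nat => ((qvar => complex) => complex) => bool" where
  "SU_invariant n p \<longleftrightarrow> (\<forall>h\<in>SU_grp n. \<forall>v. p (act n h (mat_adjoint h) v) = p v)"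

text \<open>Invariance under scalar matrices, the condition that excludes determinants of the quarks
  when N = n.\<close>

definition balanced :: "((qvar => complex) => complex) => bool" where
  "balanced p \<longleftrightarrow> (\<forall>c v. c \<noteq> 0 --> p (\<lambda>x. (case x of Inl _ => c | Inr _ => inverse c) * v x) = p v)"

text \<open>The unitary trick. The powers of diag(s) with complex exponent z act holomorphically in
  z and lie in SU(n) for imaginary z. Invariance therefore continues from the imaginary axis to z =
  1.\<close>

lemma SU_invariant_positive_diag:
  assumes p: "polyfun (qvars n N) p" and inv: "SU_invariant n p"
    and s: "!!i. i < n ==> (s i :: real) > 0" "(\<Prod>i<n. s i) = 1"
  shows "p (\<lambda>x. (case x of Inl (i,j) => complex_of_real (s i) | Inr (j,i) => complex_of_real (1 / s i)) * v x) = p v"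
proof -
  define e where "e z i = exp (z * complex_of_real (ln (s i)))" for z i
  define w where "w z x = (case x of Inl (i,j) => e z i | Inr (j,i) => e (-z) i) * v x" for z and x :: qvar
  define f where "f z = p (w z) - p v" for z
  have hol: "f holomorphic_on UNIV"
    unfolding f_def
  proof (intro holomorphic_intros polyfun_holomorphic[OF p])
    fix x :: qvar
    show "(\<lambda>s. w s x) holomorphic_on UNIV"
      unfolding w_def e_def by (cases x) (auto intro!: holomorphic_intros split: prod.splits)
  qed
  have imag: "f (\<i> * complex_of_real \<theta>) = 0" for \<theta>
  proof -
    define h where "h = mat_diag n (e (\<i> * complex_of_real \<theta>))"
    have cn: "cnj (e (\<i> * complex_of_real \<theta>) i) = e (- (\<i> * complex_of_real \<theta>)) i" for i
      by (simp add: e_def exp_cnj)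
    have "(\<Sum>i<n. ln (s i)) = ln (\<Prod>i<n. s i)" using s(1) by (intro ln_prod[symmetric] finite_lessThan) (metis lessThan_iff less_irrefl)
    hence ls: "(\<Sum>i<n. ln (s i)) = 0" using s(2) by simp
    have "det h = exp (\<i> * complex_of_real \<theta> * complex_of_real (\<Sum>i<n. ln (s i)))"
      unfolding h_def det_mat_diag e_def by (simp add: exp_sum sum_distrib_left)
    hence "det h = 1" unfolding ls by simp
    moreover have "h \<in> U_grp n" unfolding h_def e_def by (intro mat_diag_Ugrp) (simp add: norm_exp_eq_Re)
    ultimately have "h \<in> SU_grp n" by (simp add: SU_iff)
    hence "p (act n h (mat_adjoint h) v) = p v" using inv by (auto simp: SU_invariant_def)
    moreover have "p (act n h (mat_adjoint h) v) = p (w (\<i> * complex_of_real \<theta>))"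
      unfolding h_def mat_adjoint_diag
      by (intro polyfun_cong_vars[OF p]) (auto simp: act_diag w_def cn split: sum.split)
    ultimately show ?thesis by (simp add: f_def)
  qed
  have lim: "(0::complex) islimpt range (\<lambda>\<theta>. \<i> * complex_of_real \<theta>)"
    unfolding islimpt_approachable
  proof (intro allI impI)
    fix e :: real assume "e > 0"
    thus "\<exists>x'\<in>range (\<lambda>\<theta>. \<i> * complex_of_real \<theta>). x' \<noteq> 0 \<and> dist x' 0 < e"
      by (intro bexI[of _ "\<i> * complex_of_real (e/2)"] rangeI) (simp add: norm_mult)
  qed
  have "f 1 = 0"
    by (rule analytic_continuation[OF hol _ _ _ _ lim]) (auto simp: imag)
  hence "p (w 1) = p v" by (simp add: f_def)
  moreover have "p (w 1) = p (\<lambda>x. (case x of Inl (i,j) => complex_of_real (s i) | Inr (j,i) => complex_of_real (1 / s i)) * v x)"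
  proof (rule polyfun_cong_vars[OF p])
    fix x assume "x \<in> qvars n N"
    thus "w 1 x = (case x of Inl (i,j) => complex_of_real (s i) | Inr (j,i) => complex_of_real (1 / s i)) * v x"
    proof (cases rule: qvars_cases)
      case (1 i j) thus ?thesis using s(1)[of i] by (simp add: w_def e_def exp_of_real)
    next
      case (2 i j)
      have "exp (- complex_of_real (ln (s i))) = complex_of_real (exp (- ln (s i)))"
        by (simp add: exp_of_real[symmetric])
      also have "exp (- ln (s i)) = 1 / s i" using s(1)[OF 2(2)] by (simp add: exp_minus inverse_eq_divide)
      finally show ?thesis using 2 by (simp add: w_def e_def)
    qed
  qed
  ultimately show ?thesis by simp
qed

lemma SU_invariant_imp_SL_invariant:
  assumes p: "polyfun (qvars n N) p" and inv: "SU_invariant n p"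
    and g: "g \<in> carrier_mat n n" "g' \<in> carrier_mat n n" "g' * g = 1\<^sub>m n" "det g = 1"
  shows "p (act n g g' v) = p v"
proof -
  note assoc = assoc_mult_mat[of _ n n _ n _ n]
  obtain u s V where usV: "u \<in> SU_grp n" "V \<in> SU_grp n" "!!i. i < n ==> (s i :: real) > 0" "(\<Prod>i<n. s i) = 1"
    and gu: "g = u * mat_diag n (\<lambda>i. complex_of_real (s i)) * V"
    using SL_polar[OF g(1,4)] by metis
  define S where "S = mat_diag n (\<lambda>i. complex_of_real (s i))"
  define S' where "S' = mat_diag n (\<lambda>i. complex_of_real (1 / s i))"
  have c: "u \<in> carrier_mat n n" "mat_adjoint u \<in> carrier_mat n n" "V \<in> carrier_mat n n"
    "mat_adjoint V \<in> carrier_mat n n" "S \<in> carrier_mat n n" "S' \<in> carrier_mat n n"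
    using usV by (auto simp: S_def S'_def)
  have SS: "S * S' = 1\<^sub>m n"
  proof -
    have "complex_of_real (s i) * complex_of_real (1 / s i) = 1" if "i < n" for i
      using usV(3)[OF that] by simp
    hence "S * S' = mat_diag n (\<lambda>i. 1)" unfolding S_def S'_def mat_diag_diag by (intro mat_diag_cong)
    thus ?thesis by simp
  qed
  have "g * (mat_adjoint V * S' * mat_adjoint u) = u * (S * ((V * mat_adjoint V) * S')) * mat_adjoint u"
    unfolding gu S_def[symmetric] using c by (simp add: assoc)
  also have "... = 1\<^sub>m n"
    using c SS Ugrp_adjoint_right[OF SU_Ugrp[OF usV(1)]] Ugrp_adjoint_right[OF SU_Ugrp[OF usV(2)]] by simp
  finally have gi: "g * (mat_adjoint V * S' * mat_adjoint u) = 1\<^sub>m n" .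
  have "g' = g' * (g * (mat_adjoint V * S' * mat_adjoint u))" using gi g by simp
  also have "... = (g' * g) * (mat_adjoint V * S' * mat_adjoint u)" using g(1,2) c by (simp add: assoc)
  also have "... = mat_adjoint V * S' * mat_adjoint u" using g c by simp
  finally have g'V: "g' = mat_adjoint V * S' * mat_adjoint u" .
  have "p (act n g g' v) = p (act n u (mat_adjoint u) (act n (S * V) (mat_adjoint V * S') v))"
    unfolding gu g'V S_def[symmetric] using c
    by (intro polyfun_cong_vars[OF p]) (simp add: act_act assoc)
  also have "... = p (act n (S * V) (mat_adjoint V * S') v)"
    using inv usV by (auto simp: SU_invariant_def)
  also have "... = p (\<lambda>x. (case x of Inl (i,j) => complex_of_real (s i) | Inr (j,i) => complex_of_real (1 / s i)) * act n V (mat_adjoint V) v x)"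
  proof (rule polyfun_cong_vars[OF p])
    fix x assume x: "x \<in> qvars n N"
    have "act n (S * V) (mat_adjoint V * S') v x = act n S S' (act n V (mat_adjoint V) v) x"
      using c x by (simp add: act_act)
    thus "act n (S * V) (mat_adjoint V * S') v x = (case x of Inl (i,j) => complex_of_real (s i) | Inr (j,i) => complex_of_real (1 / s i)) * act n V (mat_adjoint V) v x"
      unfolding S_def S'_def act_diag[OF x] .
  qed
  also have "... = p (act n V (mat_adjoint V) v)"
    by (rule SU_invariant_positive_diag[OF p inv usV(3,4)])
  also have "... = p v" using inv usV by (auto simp: SU_invariant_def)
  finally show ?thesis .
qed

lemma balanced_SU_invariant_imp_GL_invariant:
  assumes p: "polyfun (qvars n N) p" and inv: "SU_invariant n p" and bal: "balanced p" and n: "n > 0"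
    and g: "g \<in> carrier_mat n n" "g' \<in> carrier_mat n n" "g' * g = 1\<^sub>m n"
  shows "p (act n g g' v) = p v"
proof -
  have "det g' * det g = 1" using det_mult[OF g(2,1)] g(3) by simp
  hence dg: "det g \<noteq> 0" by auto
  \<comment> \<open>An n-th root of det g, so that g / c has determinant one; the scalar c is
    absorbed by \<open>balanced\<close>.\<close>
  define c where "c = exp (Ln (det g) / of_nat n)"
  have c0: "c \<noteq> 0" by (simp add: c_def)
  have cn: "c ^ n = det g" using n dg by (simp add: c_def exp_of_nat_mult[symmetric])
  define k where "k = inverse c \<cdot>\<^sub>m g"
  define k' where "k' = c \<cdot>\<^sub>m g'"
  have kc: "k \<in> carrier_mat n n" "k' \<in> carrier_mat n n" using g by (auto simp: k_def k'_def)
  have "det k = 1" using g c0 cn n by (simp add: k_def power_inverse dg)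
  moreover have "k' * k = 1\<^sub>m n"
  proof -
    have "k' * k = c \<cdot>\<^sub>m (inverse c \<cdot>\<^sub>m (g' * g))"
      unfolding k_def k'_def using g(1,2) by (intro eq_matI) auto
    thus ?thesis using g(3) c0 by (intro eq_matI) auto
  qed
  ultimately have "p (act n k k' v) = p v" using SU_invariant_imp_SL_invariant[OF p inv] kc by blast
  moreover have "p (act n g g' v) = p (\<lambda>x. (case x of Inl _ => c | Inr _ => inverse c) * act n k k' v x)"
  proof (rule polyfun_cong_vars[OF p])
    fix x assume "x \<in> qvars n N"
    thus "act n g g' v x = (case x of Inl _ => c | Inr _ => inverse c) * act n k k' v x"
      using g c0 by (cases rule: qvars_cases) (auto simp: act_def k_def k'_def sum_distrib_left intro!: sum.cong)
  qed
  ultimately show ?thesis using bal c0 by (simp add: balanced_def)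
qed

text \<open>The first fundamental theorem in the stable range. For generic \<open>Q\<close>, \<open>Q'\<close> there is a \<open>g\<close> with
  \<open>g Q = (Q' Q, 0)\<^sup>T\<close> and \<open>Q' g\<^sup>-\<^sup>1 = (1, 0)\<close>: take \<open>g = L K\<^sup>-\<^sup>1\<close>, where the first \<open>N\<close> columns of \<open>K\<close>
  and \<open>L\<close> are \<open>Q\<close> and \<open>(Q' Q, 0)\<^sup>T\<close>. If \<open>N < n\<close>, one free entry of \<open>L\<close> adjusts the determinant.\<close>

lemma invariant_function_of_mesons:
  assumes p: "polyfun (qvars n N) p" and inv: "SU_invariant n p"
    and rng: "N < n \<or> N = n \<and> n > 0 \<and> balanced p"
  shows "p v = p (canon N (meson n v))"
proof -
  define Q1 where "Q1 v = Matrix.mat N N (\<lambda>(i,j). v (Inl (i,j)))" for v :: "qvar => complex"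
  define M where "M v = Matrix.mat N N (\<lambda>(i,j). meson n v (i,j))" for v
  let ?D = "\<lambda>v. det (Q1 v) * det (M v)"
  let ?E = "\<lambda>v. p v - p (canon N (meson n v))"
  have Nn: "N \<le> n" using rng by auto
  have pm: "polyfun (qvars n N) (\<lambda>v. meson n v (i,j))" if "i < N" "j < N" for i j
    using that by (auto simp: meson_def intro!: polyfun_sum polyfun_mult polyfun_var)
  have pD: "polyfun (qvars n N) ?D"
    unfolding Q1_def M_def using Nn by (intro polyfun_mult polyfun_det pm polyfun_var) auto
  have pc: "polyfun (qvars n N) (\<lambda>v. canon N (meson n v) x)" if x: "x \<in> qvars n N" for x
    using x
  proof (cases rule: qvars_cases)
    case (1 i j)
    thus ?thesis using pm by (cases "i < N") (auto simp: canon_def intro: polyfun_const)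
  next
    case (2 i j)
    thus ?thesis by (auto simp: canon_def intro: polyfun_const)
  qed
  have "polyfun (qvars n N) (\<lambda>v. p v + (-1) * p (canon N (meson n v)))"
    by (intro polyfun_add polyfun_mult polyfun_const p polyfun_compose[OF p] pc)
  hence pE: "polyfun (qvars n N) ?E" by simp
  have "?E v = 0" if D: "?D v \<noteq> 0" for v
  proof -
    have dQ: "det (Q1 v) \<noteq> 0" and dM: "det (M v) \<noteq> 0" using D by auto
    \<comment> \<open>The free diagonal entry of L, chosen to give det L = det K. For N = n there is
      no such entry.\<close>
    define c where "c = (if N < n then det (Q1 v) / det (M v) else 1)"
    have c0: "c \<noteq> 0" using dQ dM by (simp add: c_def)
    define K where "K = Matrix.mat n n (\<lambda>(i,j). if j < N then v (Inl (i,j)) else if i = j then 1 else 0)"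
    \<comment> \<open>Beyond column N the upper rows of L are forced by the antiquarks: Q' K must be
      the first N rows of L.\<close>
    define L where "L = Matrix.mat n n (\<lambda>(i,j). if i < N then (if j < N then meson n v (i,j) else v (Inr (i,j)))
       else if i = j then (if i = N then c else 1) else 0)"
    have KL: "K \<in> carrier_mat n n" "L \<in> carrier_mat n n" by (auto simp: K_def L_def)
    let ?m = "n - N"
    have "K = four_block_mat (Q1 v) (0\<^sub>m N ?m) (Matrix.mat ?m N (\<lambda>(i,j). v (Inl (i + N, j)))) (1\<^sub>m ?m)"
      unfolding K_def Q1_def using Nn by (intro eq_matI) auto
    hence dK: "det K = det (Q1 v)"
      by (subst (asm) Q1_def) (simp add: det_four_block_mat_upper_right_zero[where n=N and m="?m"] Q1_def)
    have "L = four_block_mat (M v) (Matrix.mat N ?m (\<lambda>(i,j). v (Inr (i, j + N)))) (0\<^sub>m ?m N) (mat_diag ?m (\<lambda>i. if i = 0 then c else 1))"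
      unfolding L_def M_def mat_diag_def using Nn by (intro eq_matI) auto
    hence "det L = det (M v) * det (mat_diag ?m (\<lambda>i. if i = 0 then c else 1))"
      by (simp add: det_four_block_mat_lower_left_zero[where n=N and m="?m"] M_def)
    also have "det (mat_diag ?m (\<lambda>i. if i = 0 then c else 1)) = c"
      unfolding det_mat_diag by (cases "N < n") (auto simp: prod.If_cases c_def lessThan_def)
    finally have dL: "det L = det (M v) * c" .
    obtain Ki where Ki: "Ki \<in> carrier_mat n n" "K * Ki = 1\<^sub>m n" "Ki * K = 1\<^sub>m n"
      using det_non_zero_imp_unit[OF KL(1), of undefined] dQ dK unfolding Units_def by (auto simp: ring_mat_def)
    obtain Li where Li: "Li \<in> carrier_mat n n" "L * Li = 1\<^sub>m n" "Li * L = 1\<^sub>m n"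
      using det_non_zero_imp_unit[OF KL(2), of undefined] dM dL c0 unfolding Units_def by (auto simp: ring_mat_def)
    note assoc = assoc_mult_mat[of _ n n _ n _ n]
    define g where "g = L * Ki"
    define g' where "g' = K * Li"
    have g: "g \<in> carrier_mat n n" "g' \<in> carrier_mat n n" using KL Ki Li by (auto simp: g_def g'_def)
    have "g' * g = K * ((Li * L) * Ki)" unfolding g_def g'_def using KL Ki(1) Li(1) by (simp add: assoc)
    hence g'g: "g' * g = 1\<^sub>m n" using KL Ki Li by simp
    have gK: "g * K = L" unfolding g_def using KL Ki by (simp add: assoc)
    have g'L: "g' * L = K" unfolding g'_def using KL Li by (simp add: assoc)
    have pinv: "p (act n g g' v) = p v"
    proof (cases "N < n")
      case True
      have "det K * det Ki = 1" using det_mult[OF KL(1) Ki(1)] Ki by simp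
      moreover have "det g = det L * det Ki" unfolding g_def using KL Ki by (simp add: det_mult[of _ n])
      ultimately have "det g = 1" using dL dK dM True by (simp add: c_def)
      thus ?thesis using SU_invariant_imp_SL_invariant[OF p inv g g'g] by blast
    next
      case False
      thus ?thesis using balanced_SU_invariant_imp_GL_invariant[OF p inv _ _ g g'g] rng by auto
    qed
    have gQ: "(\<Sum>k<n. g $$ (i,k) * v (Inl (k,j))) = (if i < N then meson n v (i,j) else 0)" if "i < n" "j < N" for i j
    proof -
      have "(\<Sum>k<n. g $$ (i,k) * v (Inl (k,j))) = (g * K) $$ (i,j)"
        using that Nn by (subst mat_mult_index[OF g(1) KL(1)]) (auto simp: K_def)
      also have "... = (if i < N then meson n v (i,j) else 0)" unfolding gK using that Nn by (auto simp: L_def)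
      finally show ?thesis .
    qed
    have gr: "(\<Sum>k<n. v (Inr (j,k)) * g' $$ (k,i)) = (if i = j then 1 else 0)" if ij: "i < n" "j < N" for i j
    proof -
      \<comment> \<open>The row \<open>Q'\<^sub>j\<close> satisfies \<open>Q'\<^sub>j K = L\<^sub>j\<close>.\<close>
      define R where "R = Matrix.mat 1 n (\<lambda>(_,k). v (Inr (j,k)))"
      have R: "R \<in> carrier_mat 1 n" by (simp add: R_def)
      define e where "e = Matrix.mat 1 n (\<lambda>(_,k). if k = j then 1 else (0::complex))"
      have e: "e \<in> carrier_mat 1 n" by (simp add: e_def)
      have "R * K = e * L"
      proof (rule eq_matI)
        fix a b assume "a < dim_row (e * L)" "b < dim_col (e * L)"
        hence ab: "a = 0" "b < n" using e KL by auto
        have "(R * K) $$ (a,b) = (\<Sum>k<n. v (Inr (j,k)) * K $$ (k,b))"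
          using ab by (subst mat_mult_index[OF R KL(1)]) (auto simp: R_def)
        also have "... = L $$ (j,b)"
        proof (cases "b < N")
          case True
          thus ?thesis using ab ij Nn by (auto simp: K_def L_def meson_def)
        next
          case False
          have "(\<Sum>k<n. v (Inr (j,k)) * K $$ (k,b)) = (\<Sum>k<n. if k = b then v (Inr (j,b)) else 0)"
            using ab False by (intro sum.cong refl) (simp add: K_def)
          thus ?thesis using ab ij Nn False by (simp add: L_def)
        qed
        also have "... = (e * L) $$ (a,b)"
        proof -
          have "(e * L) $$ (a,b) = (\<Sum>k<n. e $$ (a,k) * L $$ (k,b))"
            using ab by (subst mat_mult_index[OF e KL(2)]) auto
          also have "... = (\<Sum>k<n. if k = j then L $$ (j,b) else 0)"
            using ab by (intro sum.cong refl) (simp add: e_def)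
          finally show ?thesis using ij Nn by simp
        qed
        finally show "(R * K) $$ (a,b) = (e * L) $$ (a,b)" .
      qed (use R e KL in auto)
      hence "R * g' = (e * L) * Li"
        unfolding g'_def using R KL Li by (simp flip: assoc_mult_mat[of _ 1 n _ n _ n])
      also have "... = e" using e KL Li by (simp add: assoc_mult_mat[of _ 1 n _ n _ n])
      finally have "(R * g') $$ (0,i) = e $$ (0,i)" by simp
      moreover have "(R * g') $$ (0,i) = (\<Sum>k<n. v (Inr (j,k)) * g' $$ (k,i))"
        using ij by (subst mat_mult_index[OF R g(2)]) (auto simp: R_def)
      ultimately show ?thesis using ij by (simp add: e_def)
    qed
    have "p (act n g g' v) = p (canon N (meson n v))"
    proof (rule polyfun_cong_vars[OF p])
      fix x assume "x \<in> qvars n N"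
      thus "act n g g' v x = canon N (meson n v) x"
        by (cases rule: qvars_cases) (simp_all add: act_def canon_def gQ gr)
    qed
    thus ?thesis using pinv by simp
  qed
  hence dom: "?D v = 0 \<or> ?E v = 0" for v by blast
  \<comment> \<open>At this point both determinants are 1, so the factor cutting out the generic set
    is not identically zero.\<close>
  define v1 where "v1 = canon N (\<lambda>(i,j). if i = j then 1 else 0)"
  have "Q1 v1 = 1\<^sub>m N" "M v1 = 1\<^sub>m N"
    unfolding Q1_def M_def v1_def using Nn
    by (intro eq_matI; simp add: canon_def meson_canon mvars_def)+
  hence "?D v1 \<noteq> 0" by simp
  hence "?E v = 0" by (rule polyfun_no_zero_divisors[OF pD pE dom])
  thus ?thesis by simp
qed

section \<open>Complete homogeneous symmetric functions\<close>

definition hsum :: "'x set => nat => ('x => complex) => complex" where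
  "hsum Y r c = (\<Sum>m\<in>{m \<in> Y \<rightarrow>\<^sub>E UNIV. (\<Sum>y\<in>Y. m y) = r}. \<Prod>y\<in>Y. c y ^ m y)"

lemma finite_hsum_index:
  assumes "finite Y" shows "finite {m \<in> Y \<rightarrow>\<^sub>E (UNIV :: nat set). (\<Sum>y\<in>Y. m y) = r}"
proof (rule finite_subset)
  show "{m \<in> Y \<rightarrow>\<^sub>E (UNIV :: nat set). (\<Sum>y\<in>Y. m y) = r} \<subseteq> Y \<rightarrow>\<^sub>E {..r}"
    using assms by (auto simp: PiE_iff extensional_def intro!: member_le_sum)
qed (simp add: finite_PiE assms)

lemma hsum_empty: "hsum {} r c = (if r = 0 then 1 else 0)"
  by (auto simp: hsum_def)

lemma hsum_insert:
  assumes Y: "finite Y" "y \<notin> Y"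
  shows "hsum (insert y Y) r c = (\<Sum>s\<le>r. c y ^ s * hsum Y (r - s) c)"
proof -
  let ?A = "\<lambda>Y r. {m \<in> Y \<rightarrow>\<^sub>E (UNIV :: nat set). (\<Sum>y\<in>Y. m y) = r}"
  have "(\<Sum>s\<le>r. c y ^ s * hsum Y (r - s) c) = (\<Sum>(s,m)\<in>Sigma {..r} (\<lambda>s. ?A Y (r - s)). c y ^ s * (\<Prod>y\<in>Y. c y ^ m y))"
    using finite_hsum_index[OF Y(1)] by (simp add: hsum_def sum_distrib_left sum.Sigma)
  also have "... = (\<Sum>m\<in>?A (insert y Y) r. \<Prod>y\<in>insert y Y. c y ^ m y)"
  proof (rule sum.reindex_bij_witness[where j = "\<lambda>(s,m). m(y := s)" and i = "\<lambda>m. (m y, m(y := undefined))"], goal_cases)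
    case (1 a) thus ?case using Y by (auto simp: PiE_iff extensional_def)
  next
    case (2 a)
    obtain s m where a: "a = (s, m)" by (cases a)
    have "(\<Sum>x\<in>Y. (m(y := s)) x) = (\<Sum>x\<in>Y. m x)" using Y by (intro sum.cong) auto
    thus ?case using 2 Y by (auto simp: a PiE_iff extensional_def)
  next
    case (3 m) thus ?case by (auto simp: PiE_iff)
  next
    case (4 m)
    have "(\<Sum>x\<in>Y. (m(y := undefined)) x) = (\<Sum>x\<in>Y. m x)" using Y by (intro sum.cong) auto
    thus ?case using 4 Y by (auto simp: PiE_iff extensional_def)
  next
    case (5 a)
    obtain s m where a: "a = (s, m)" by (cases a)
    have "(\<Prod>x\<in>Y. c x ^ (m(y := s)) x) = (\<Prod>x\<in>Y. c x ^ m x)" using Y by (intro prod.cong) auto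
    thus ?case using Y by (simp add: a)
  qed
  finally show ?thesis by (simp add: hsum_def)
qed

lemma hsum_image:
  assumes "finite Y" "inj_on f Y"
  shows "hsum (f ` Y) r c = hsum Y r (\<lambda>y. c (f y))"
  using assms
proof (induction Y arbitrary: r rule: finite_induct)
  case (insert y Y)
  thus ?case by (simp add: hsum_insert)
qed (simp add: hsum_empty)

lemma hsum_cong: "(!!y. y \<in> Y ==> c y = c' y) ==> hsum Y r c = hsum Y r c'"
  by (simp add: hsum_def)

lemma hsum_scale: "hsum Y r (\<lambda>y. s * c y) = s ^ r * hsum Y r c"
  unfolding hsum_def sum_distrib_left
  by (intro sum.cong refl) (auto simp: power_mult_distrib prod.distrib power_sum[symmetric])

lemma hsum_cnj: "hsum Y r (\<lambda>y. cnj (c y)) = cnj (hsum Y r c)"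
  by (simp add: hsum_def)

lemma hsum_0 [simp]: "finite Y ==> hsum Y 0 c = 1"
  by (induction rule: finite_induct) (auto simp: hsum_empty hsum_insert)

lemma hsum_1: "finite Y ==> hsum Y (Suc 0) c = (\<Sum>y\<in>Y. c y)"
  by (induction rule: finite_induct) (auto simp: hsum_empty hsum_insert add.commute)

lemma geometric_fps:
  "(1 - fps_const (c::complex) * fps_X) * Abs_fps (\<lambda>n. c ^ n) = 1"
proof (rule fps_ext)
  fix n
  show "fps_nth ((1 - fps_const c * fps_X) * Abs_fps (\<lambda>n. c ^ n)) n = fps_nth 1 n"
    by (cases n) (simp_all add: left_diff_distrib mult.assoc)
qed

lemma hsum_fps: "finite Y ==> (\<Prod>y\<in>Y. Abs_fps (\<lambda>n. c y ^ n)) = Abs_fps (\<lambda>r. hsum Y r c)"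
proof (induction Y rule: finite_induct)
  case empty
  show ?case by (auto simp: fps_eq_iff hsum_empty)
next
  case (insert y Y)
  thus ?case by (auto simp: fps_eq_iff fps_mult_nth hsum_insert atLeast0AtMost)
qed

lemma norm_hsum_le: "cmod (hsum Y r c) \<le> Re (hsum Y r (\<lambda>y. complex_of_real (cmod (c y))))"
  unfolding hsum_def by (rule order_trans[OF norm_sum]) (simp add: prod_norm[symmetric] norm_power flip: of_real_power of_real_prod of_real_sum)

lemma hsum_of_real: "hsum Y r (\<lambda>y. complex_of_real (c y)) = complex_of_real (Re (hsum Y r (\<lambda>y. complex_of_real (c y))))"
  unfolding hsum_def by (simp flip: of_real_power of_real_prod of_real_sum)

text \<open>Induction by Cauchy products. The absolute convergence they need is the induction
  hypothesis at the moduli of the parameters, hence the generalisation over c and \<beta>.\<close>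

lemma hsum_sums_aux:
  assumes "finite Y" "!!y. y \<in> Y ==> cmod (\<beta> * c y) < 1"
  shows "(\<lambda>r. hsum Y r c * \<beta> ^ r) sums (\<Prod>y\<in>Y. 1 / (1 - \<beta> * c y))"
  using assms
proof (induction Y arbitrary: c \<beta> rule: finite_induct)
  case empty
  show ?case using sums_If_finite_set[of "{0}" "\<lambda>r. 1::complex"]
    by (simp add: hsum_empty if_distrib if_distribR cong: if_cong)
next
  case (insert y Y)
  let ?a = "\<lambda>k. (\<beta> * c y) ^ k" and ?b = "\<lambda>k. hsum Y k c * \<beta> ^ k"
  have sb: "?b sums (\<Prod>y\<in>Y. 1 / (1 - \<beta> * c y))" using insert by simp
  have nb: "summable (\<lambda>k. norm (?b k))"
  proof (rule summable_comparison_test')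
    let ?c = "\<lambda>y. complex_of_real (cmod (c y))"
    have "(\<lambda>r. hsum Y r ?c * complex_of_real (cmod \<beta>) ^ r) sums (\<Prod>y\<in>Y. 1 / (1 - complex_of_real (cmod \<beta>) * ?c y))"
      using insert.prems by (intro insert.IH) (auto simp: norm_mult)
    hence "summable (\<lambda>r. Re (hsum Y r ?c * complex_of_real (cmod \<beta>) ^ r))"
      by (intro summable_Re sums_summable)
    thus "summable (\<lambda>r. Re (hsum Y r ?c) * cmod \<beta> ^ r)" by (simp flip: of_real_power)
    fix r show "norm (norm (?b r)) \<le> Re (hsum Y r ?c) * cmod \<beta> ^ r"
      by (simp add: norm_mult norm_power mult_right_mono norm_hsum_le)
  qed
  have na: "summable (\<lambda>k. norm (?a k))"
    using insert.prems[of y] by (simp add: norm_power summable_geometric)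
  have sa: "(\<Sum>k. ?a k) = 1 / (1 - \<beta> * c y)"
    using insert.prems[of y] by (intro suminf_geometric) auto
  have "(\<lambda>k. \<Sum>i\<le>k. ?a i * ?b (k - i)) sums ((\<Sum>k. ?a k) * (\<Sum>k. ?b k))"
    by (rule Cauchy_product_sums[OF na nb])
  moreover have "(\<Sum>i\<le>k. ?a i * ?b (k - i)) = hsum (insert y Y) k c * \<beta> ^ k" for k
    unfolding hsum_insert[OF insert.hyps(1,2)] sum_distrib_right
  proof (intro sum.cong refl)
    fix i assume "i \<in> {..k}"
    hence "\<beta> ^ k = \<beta> ^ i * \<beta> ^ (k - i)" by (simp flip: power_add)
    thus "?a i * ?b (k - i) = c y ^ i * hsum Y (k - i) c * \<beta> ^ k" by (simp add: power_mult_distrib)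
  qed
  ultimately show ?case using insert.hyps sums_unique[OF sb] by (simp add: sa)
qed

lemma hsum_sums:
  assumes "finite Y" "!!y. y \<in> Y ==> cmod (\<beta> * c y) < 1"
  shows "summable (\<lambda>r. cmod (hsum Y r c * \<beta> ^ r))"
    and "(\<lambda>r. hsum Y r c * \<beta> ^ r) sums (\<Prod>y\<in>Y. 1 / (1 - \<beta> * c y))"
proof -
  show "(\<lambda>r. hsum Y r c * \<beta> ^ r) sums (\<Prod>y\<in>Y. 1 / (1 - \<beta> * c y))" using hsum_sums_aux[OF assms] .
  let ?c = "\<lambda>y. complex_of_real (cmod (c y))"
  have "(\<lambda>r. hsum Y r ?c * complex_of_real (cmod \<beta>) ^ r) sums (\<Prod>y\<in>Y. 1 / (1 - complex_of_real (cmod \<beta>) * ?c y))"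
    using assms by (intro hsum_sums_aux) (auto simp: norm_mult)
  hence "summable (\<lambda>r. Re (hsum Y r ?c * complex_of_real (cmod \<beta>) ^ r))"
    by (intro summable_Re sums_summable)
  hence "summable (\<lambda>r. Re (hsum Y r ?c) * cmod \<beta> ^ r)" by (simp flip: of_real_power)
  thus "summable (\<lambda>r. cmod (hsum Y r c * \<beta> ^ r))"
    by (rule summable_comparison_test'[of _ 0])
      (simp add: norm_mult norm_power mult_right_mono norm_hsum_le)
qed

text \<open>When every variable carries exactly one label, exponents of multidegree d are
  independent choices for each label.\<close>

lemma sum_exps_eq_prod_hsum:
  assumes X: "finite X" and C: "finite C" and lab: "!!x. x \<in> X ==> lab x \<in> C"
    and W: "!!l. l \<in> C ==> W l = {x\<in>X. lab x = l}"
  shows "(\<Sum>m\<in>exps X C W d. mon X m c) = (\<Prod>l\<in>C. hsum (W l) (d l) c)"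
proof -
  let ?B = "\<lambda>l. {m \<in> W l \<rightarrow>\<^sub>E (UNIV :: nat set). (\<Sum>y\<in>W l. m y) = d l}"
  have fW: "finite (W l)" if "l \<in> C" for l using W[OF that] X by simp
  have "(\<Prod>l\<in>C. hsum (W l) (d l) c) = (\<Sum>g\<in>PiE C ?B. \<Prod>l\<in>C. \<Prod>y\<in>W l. c y ^ g l y)"
    unfolding hsum_def using C fW finite_hsum_index by (intro prod_sum_PiE) auto
  also have "... = (\<Sum>m\<in>exps X C W d. mon X m c)"
  proof (rule sum.reindex_bij_witness[where j = "\<lambda>g. \<lambda>x\<in>X. g (lab x) x" and i = "\<lambda>m. \<lambda>l\<in>C. restrict m (W l)"], goal_cases)
    case (1 g)
    show ?case
    proof (rule PiE_ext)
      show "(\<lambda>l\<in>C. restrict (\<lambda>x\<in>X. g (lab x) x) (W l)) \<in> PiE C (\<lambda>l. W l \<rightarrow>\<^sub>E UNIV)"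
        by auto
      show "g \<in> PiE C (\<lambda>l. W l \<rightarrow>\<^sub>E UNIV)" using 1 by (auto simp: PiE_iff)
      fix l assume l: "l \<in> C"
      hence "g l \<in> extensional (W l)" using 1 by (auto simp: PiE_iff)
      thus "(\<lambda>l\<in>C. restrict (\<lambda>x\<in>X. g (lab x) x) (W l)) l = g l"
        using l W[OF l] by (auto simp: extensional_def fun_eq_iff)
    qed
  next
    case (2 g)
    have "(\<Sum>x\<in>W l. (\<lambda>x\<in>X. g (lab x) x) x) = d l" if l: "l \<in> C" for l
    proof -
      have "(\<Sum>x\<in>W l. (\<lambda>x\<in>X. g (lab x) x) x) = (\<Sum>x\<in>W l. g l x)" using W[OF l] by (intro sum.cong) auto
      thus ?thesis using 2 l by (auto simp: PiE_iff)
    qed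
    thus ?case by (auto simp: exps_def)
  next
    case (3 m)
    show ?case
    proof
      fix x show "(\<lambda>x\<in>X. (\<lambda>l\<in>C. restrict m (W l)) (lab x) x) x = m x"
        using 3 lab W by (cases "x \<in> X") (auto simp: exps_def PiE_iff extensional_def)
    qed
  next
    case (4 m)
    thus ?case by (auto simp: exps_def)
  next
    case (5 g)
    have "mon X (\<lambda>x\<in>X. g (lab x) x) c = (\<Prod>x\<in>X. c x ^ g (lab x) x)"
      unfolding mon_def by (intro prod.cong) auto
    also have "... = (\<Prod>l\<in>C. \<Prod>x\<in>{x\<in>X. lab x = l}. c x ^ g (lab x) x)"
      using X C lab by (intro prod.group[symmetric]) (auto simp: image_subset_iff)
    also have "... = (\<Prod>l\<in>C. \<Prod>y\<in>W l. c y ^ g l y)"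
      by (intro prod.cong refl) (auto simp: W)
    finally show ?case by simp
  qed
  finally show ?thesis by simp
qed

section \<open>Means over groups between \<open>SU(n)\<close> and \<open>U(n)\<close>\<close>

text \<open>Boundedness rather than integrability, because the class must be closed under
  products.\<close>

definition bdd_measurable :: "'a measure => ('a => complex) => bool" where
  "bdd_measurable M f \<longleftrightarrow> f \<in> borel_measurable M \<and> (\<exists>B. \<forall>g\<in>space M. cmod (f g) \<le> B)"

lemma bmf_const: "bdd_measurable M (\<lambda>g. c)" by (auto simp: bdd_measurable_def)

lemma bmf_add:
  assumes "bdd_measurable M f" "bdd_measurable M h" shows "bdd_measurable M (\<lambda>g. f g + h g)"
proof -
  obtain B B' where B: "!!g. g\<in>space M ==> cmod (f g) \<le> B" "!!g. g\<in>space M ==> cmod (h g) \<le> B'"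
    using assms by (auto simp: bdd_measurable_def)
  have "cmod (f g + h g) \<le> B + B'" if "g \<in> space M" for g
    using B[OF that] by (rule norm_triangle_mono)
  thus ?thesis using assms by (auto simp: bdd_measurable_def)
qed

lemma bmf_mult:
  assumes "bdd_measurable M f" "bdd_measurable M h" shows "bdd_measurable M (\<lambda>g. f g * h g)"
proof -
  obtain B B' where B: "!!g. g\<in>space M ==> cmod (f g) \<le> B" "!!g. g\<in>space M ==> cmod (h g) \<le> B'"
    using assms by (auto simp: bdd_measurable_def)
  have "cmod (f g * h g) \<le> B * B'" if "g \<in> space M" for g
    unfolding norm_mult using B[OF that] by (intro mult_mono) (auto intro: order_trans[OF norm_ge_zero])
  thus ?thesis using assms by (auto simp: bdd_measurable_def)
qed

lemma bmf_sum: "(!!i. i \<in> I ==> bdd_measurable M (f i)) ==> bdd_measurable M (\<lambda>g. \<Sum>i\<in>I. f i g)"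
  by (induction I rule: infinite_finite_induct) (simp_all add: bmf_const bmf_add)

lemma bmf_cnj: "bdd_measurable M f ==> bdd_measurable M (\<lambda>g. cnj (f g))"
  unfolding bdd_measurable_def using measurable_compose[OF _ borel_measurable_continuous_onI[OF continuous_on_cnj[OF continuous_on_id]], of f M]
  by auto

lemma bmf_cong: "(!!g. g \<in> space M ==> f g = f' g) ==> bdd_measurable M f \<longleftrightarrow> bdd_measurable M f'"
  by (auto simp: bdd_measurable_def cong: measurable_cong)


lemma (in finite_measure) bmf_integrable: "bdd_measurable M f ==> integrable M f"
  unfolding bdd_measurable_def by (auto intro: integrable_const_bound)

text \<open>Covers the Haar measures of SU(n) and U(n) at once. Translations by SU(n) alone
  determine every integral of \<open>integral_op_trace\<close>.\<close>

locale unitary_mean = prob_space \<mu> for \<mu> :: "complex mat measure" +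
  fixes n :: nat
  assumes space_sub: "space \<mu> \<subseteq> U_grp n"
    and entry_measurable: "!!i j. i < n ==> j < n ==> (\<lambda>g. g $$ (i,j)) \<in> borel_measurable \<mu>"
    and translate_measurable: "!!h. h \<in> SU_grp n ==> (\<lambda>g. h * g) \<in> measurable \<mu> \<mu>"
    and translate_distr: "!!h. h \<in> SU_grp n ==> distr \<mu> \<mu> (\<lambda>g. h * g) = \<mu>"
begin

abbreviation bmf :: "(complex mat => complex) => bool" where "bmf \<equiv> bdd_measurable \<mu>"

lemma entry_bound:
  assumes "g \<in> space \<mu>" "i < n" "j < n" shows "cmod (g $$ (i,j)) \<le> 1"
proof -
  have g: "g \<in> U_grp n" "g \<in> carrier_mat n n" using assms space_sub by auto
  have "(mat_adjoint g * g) $$ (j,j) = 1" using assms Ugrp_adjoint_left[OF g(1)] by simp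
  hence "(\<Sum>k<n. complex_of_real ((cmod (g $$ (k,j)))\<^sup>2)) = 1"
    using assms g(2) by (subst (asm) mat_mult_index[OF mat_adjoint_carrier[OF g(2)] g(2)])
      (auto simp: complex_norm_square mult.commute simp del: of_real_power)
  hence "complex_of_real (\<Sum>k<n. (cmod (g $$ (k,j)))\<^sup>2) = 1" by (simp del: of_real_power)
  hence "(\<Sum>k<n. (cmod (g $$ (k,j)))\<^sup>2) = 1" by (simp only: of_real_eq_1_iff)
  moreover have "(cmod (g $$ (i,j)))\<^sup>2 \<le> (\<Sum>k<n. (cmod (g $$ (k,j)))\<^sup>2)"
    using assms by (intro member_le_sum) auto
  ultimately have "(cmod (g $$ (i,j)))\<^sup>2 \<le> 1\<^sup>2" by simp
  thus ?thesis by (rule power2_le_imp_le) simp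
qed

lemma bmf_entry: "i < n ==> j < n ==> bmf (\<lambda>g. g $$ (i,j))"
  unfolding bdd_measurable_def using entry_measurable entry_bound by (intro conjI exI[of _ 1]) auto

lemma bmf_adjoint_entry:
  assumes "i < n" "j < n" shows "bmf (\<lambda>g. mat_adjoint g $$ (i,j))"
proof -
  have "mat_adjoint g $$ (i,j) = cnj (g $$ (j,i))" if "g \<in> space \<mu>" for g
    using that assms space_sub by (intro mat_adjoint_index_cnj[of _ n n]) auto
  thus ?thesis using bmf_cnj[OF bmf_entry[OF assms(2,1)]] by (simp cong: bmf_cong)
qed

lemma bmf_polyfun:
  assumes "polyfun X p" "!!x. x \<in> X ==> bmf (\<lambda>g. w g x)"
  shows "bmf (\<lambda>g. p (w g))"
  using assms by (induction rule: polyfun.induct) (simp_all add: bmf_const bmf_add bmf_mult)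

lemma bmf_act: 
  assumes "polyfun (qvars n N) p" shows "bmf (\<lambda>g. p (act n (mat_adjoint g) g v))"
proof (rule bmf_polyfun[OF assms])
  fix x assume "x \<in> qvars n N"
  thus "bmf (\<lambda>g. act n (mat_adjoint g) g v x)"
    by (cases rule: qvars_cases) (auto simp: act_def intro!: bmf_sum bmf_mult bmf_const bmf_entry bmf_adjoint_entry)
qed

lemma translate_space: "h \<in> SU_grp n ==> g \<in> space \<mu> ==> h * g \<in> space \<mu>"
  using translate_measurable by (auto dest: measurable_space)

lemma integral_translate:
  fixes f :: "complex mat => complex"
  assumes "h \<in> SU_grp n" "f \<in> borel_measurable \<mu>"
  shows "(LINT g|\<mu>. f (h * g)) = (LINT g|\<mu>. f g)"
proof -
  have "(LINT g|\<mu>. f g) = (LINT g|distr \<mu> \<mu> (\<lambda>g. h * g). f g)" using translate_distr[OF assms(1)] by simp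
  also have "... = (LINT g|\<mu>. f (h * g))"
    by (rule integral_distr[OF translate_measurable[OF assms(1)] assms(2)])
  finally show ?thesis by simp
qed

end

section \<open>Gradings of quark and meson polynomials, and the trace of a group element\<close>

definition qlabels :: "nat => (nat + nat) set" where "qlabels N = Inl ` {..<N} \<union> Inr ` {..<N}"

definition qlab :: "qvar => nat + nat" where
  "qlab x = (case x of Inl (i,j) => Inl j | Inr (j,i) => Inr j)"

definition qweights :: "nat => nat => nat + nat => qvar set" where
  "qweights n N l = {x \<in> qvars n N. qlab x = l}"

definition mweights :: "nat => nat + nat => (nat \<times> nat) set" where
  "mweights N l = {(i,j) \<in> mvars N. case l of Inl j' => j = j' | Inr i' => i = i'}"

text \<open>Contingency tables: N x N matrices of natural numbers with column sums a and row sums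
  b.\<close>

definition ctab :: "nat => (nat => nat) => (nat => nat) => (nat \<times> nat => nat) set" where
  "ctab N a b = exps (mvars N) (qlabels N) (mweights N) (case_sum a b)"

interpretation q: grading "qvars n N" "qlabels N" "qweights n N" for n N
  by unfold_locales (auto simp: qlabels_def qweights_def qlab_def qvars_def)

interpretation m: grading "mvars N" "qlabels N" "mweights N" for N
  by unfold_locales (auto simp: qlabels_def mweights_def mvars_def)

lemma graded_act: "q.graded_map n N (act n h h')"
  unfolding q.graded_map_def
proof (intro conjI ballI allI)
  fix x assume "x \<in> qvars n N"
  thus "polyfun (qvars n N) (\<lambda>v. act n h h' v x)"
    by (cases rule: qvars_cases) (auto simp: act_def intro!: polyfun_sum polyfun_mult polyfun_const polyfun_var)
next
  fix c v x assume "c \<in> qlabels N" "x \<in> qvars n N"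
  from this(2) show "act n h h' (\<lambda>x. if x \<in> qweights n N c then 2 * v x else v x) x =
    (if x \<in> qweights n N c then 2 * act n h h' v x else act n h h' v x)"
    by (cases rule: qvars_cases) (auto simp: act_def qweights_def qlab_def sum_distrib_left intro!: sum.cong)
qed

lemma op_trace_cong:
  assumes "!!v x. x \<in> qvars n N ==> L v x = L' v x"
  shows "q.op_trace n N d L = q.op_trace n N d L'"
  unfolding q.op_trace_def using assms by (simp cong: mon_cong)

text \<open>The trace is invariant under conjugation, so g may be replaced by its eigenvalues.
  Monomials are then eigenvectors, and their eigenvalues sum to one complete homogeneous function
  for each flavour.\<close>

lemma op_trace_act:
  assumes V: "V \<in> SU_grp n" and g: "g = V * mat_diag n z * mat_adjoint V"
  shows "q.op_trace n N (case_sum a b) (act n (mat_adjoint g) g) =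
    (\<Prod>j<N. hsum {..<n} (a j) (\<lambda>i. cnj (z i))) * (\<Prod>j<N. hsum {..<n} (b j) z)"
proof -
  note assoc = assoc_mult_mat[of _ n n _ n _ n]
  define D where "D = mat_diag n z"
  define D' where "D' = mat_diag n (\<lambda>i. cnj (z i))"
  have c: "V \<in> carrier_mat n n" "mat_adjoint V \<in> carrier_mat n n" "D \<in> carrier_mat n n" "D' \<in> carrier_mat n n"
    using V by (auto simp: D_def D'_def)
  have VV: "mat_adjoint V * V = 1\<^sub>m n" using Ugrp_adjoint_left[OF SU_Ugrp[OF V]] .
  have ag: "mat_adjoint g = V * (D' * mat_adjoint V)"
    unfolding g using c by (simp add: mat_adjoint_mult[of _ n n _ n] mat_adjoint_adjoint[of _ n n] assoc mat_adjoint_diag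
        D_def D'_def)
  have gD: "g = (V * D) * mat_adjoint V" by (simp add: g D_def)
  let ?d = "case_sum a b"
  let ?L = "act n V (mat_adjoint V)" and ?M = "act n (D' * mat_adjoint V) (V * D)"
  have "q.op_trace n N ?d (act n (mat_adjoint g) g) = q.op_trace n N ?d (\<lambda>v. ?L (?M v))"
    unfolding ag unfolding gD using c by (intro op_trace_cong) (simp add: act_act)
  also have "... = q.op_trace n N ?d (\<lambda>v. ?M (?L v))"
    by (intro q.op_trace_commute graded_act)
  also have "... = q.op_trace n N ?d (act n D' D)"
  proof (rule op_trace_cong)
    fix v x assume x: "x \<in> qvars n N"
    have e: "D' * mat_adjoint V * V = D'" "mat_adjoint V * (V * D) = D"
      using c VV by (simp_all add: assoc) (simp flip: assoc)
    have "?M (?L v) x = act n (D' * mat_adjoint V * V) (mat_adjoint V * (V * D)) v x"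
      using c x by (intro act_act) auto
    thus "?M (?L v) x = act n D' D v x" by (simp only: e)
  qed
  also have "... = (\<Sum>m\<in>exps (qvars n N) (qlabels N) (qweights n N) ?d.
       mon (qvars n N) m (case_sum (\<lambda>(i,j). cnj (z i)) (\<lambda>(j,i). z i)))"
    unfolding D_def D'_def by (intro q.op_trace_diag) (auto simp: act_diag split: sum.splits)
  also have "... = (\<Prod>l\<in>qlabels N. hsum (qweights n N l) (?d l) (case_sum (\<lambda>(i,j). cnj (z i)) (\<lambda>(j,i). z i)))"
    by (rule sum_exps_eq_prod_hsum[where lab = qlab])
      (auto simp: qweights_def qlabels_def qlab_def qvars_def)
  also have "... = (\<Prod>j<N. hsum (qweights n N (Inl j)) (a j) (case_sum (\<lambda>(i,j). cnj (z i)) (\<lambda>(j,i). z i)))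
     * (\<Prod>j<N. hsum (qweights n N (Inr j)) (b j) (case_sum (\<lambda>(i,j). cnj (z i)) (\<lambda>(j,i). z i)))"
    unfolding qlabels_def by (subst prod.union_disjoint) (auto simp: prod.reindex)
  also have "... = (\<Prod>j<N. hsum {..<n} (a j) (\<lambda>i. cnj (z i))) * (\<Prod>j<N. hsum {..<n} (b j) z)"
  proof (intro arg_cong2[where f="(*)"] prod.cong refl)
    fix j assume j: "j \<in> {..<N}"
    have "qweights n N (Inl j) = (\<lambda>i. Inl (i,j)) ` {..<n}"
      using j by (auto simp: qweights_def qlab_def qvars_def)
    thus "hsum (qweights n N (Inl j)) (a j) (case_sum (\<lambda>(i,j). cnj (z i)) (\<lambda>(j,i). z i)) = hsum {..<n} (a j) (\<lambda>i. cnj (z i))"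
      by (simp add: hsum_image inj_on_def)
    have "qweights n N (Inr j) = (\<lambda>i. Inr (j,i)) ` {..<n}"
      using j by (auto simp: qweights_def qlab_def qvars_def)
    thus "hsum (qweights n N (Inr j)) (b j) (case_sum (\<lambda>(i,j). cnj (z i)) (\<lambda>(j,i). z i)) = hsum {..<n} (b j) z"
      by (simp add: hsum_image inj_on_def)
  qed
  finally show ?thesis .
qed

context unitary_mean
begin

text \<open>The inverse of g acts on the quarks, so that left translation of the measure makes the
  average invariant.\<close>

definition avg :: "((qvar => complex) => complex) => (qvar => complex) => complex" where
  "avg p v = (LINT g|\<mu>. p (act n (mat_adjoint g) g v))"

lemma avg_sum:
  assumes "!!m. m \<in> E ==> polyfun (qvars n N) (p m)"
  shows "avg (\<lambda>v. \<Sum>m\<in>E. c m * p m v) v = (\<Sum>m\<in>E. c m * avg (p m) v)"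
  unfolding avg_def using assms
  by (subst Bochner_Integration.integral_sum)
    (auto intro!: bmf_integrable bmf_act polyfun_mult polyfun_const)

lemma SU_invariant_avg:
  assumes p: "polyfun (qvars n N) p" shows "SU_invariant n (avg p)"
  unfolding SU_invariant_def
proof (intro ballI allI)
  fix h v assume h: "h \<in> SU_grp n"
  have hc: "h \<in> carrier_mat n n" "mat_adjoint h \<in> carrier_mat n n" using h by auto
  have "avg p (act n h (mat_adjoint h) v) = (LINT g|\<mu>. p (act n (mat_adjoint (mat_adjoint h * g)) (mat_adjoint h * g) v))"
    unfolding avg_def
  proof (intro Bochner_Integration.integral_cong refl)
    fix g assume "g \<in> space \<mu>"
    hence g: "g \<in> carrier_mat n n" "mat_adjoint g \<in> carrier_mat n n" using space_sub by auto
    have "mat_adjoint (mat_adjoint h * g) = mat_adjoint g * h"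
      using g hc by (simp add: mat_adjoint_mult[of _ n n _ n] mat_adjoint_adjoint[of _ n n])
    thus "p (act n (mat_adjoint g) g (act n h (mat_adjoint h) v)) = p (act n (mat_adjoint (mat_adjoint h * g)) (mat_adjoint h * g) v)"
      using g hc by (intro polyfun_cong_vars[OF p]) (simp add: act_act)
  qed
  also have "... = avg p v"
    unfolding avg_def using bmf_act[OF p] by (intro integral_translate SU_adjoint h) (auto simp: bdd_measurable_def)
  finally show "avg p (act n h (mat_adjoint h) v) = avg p v" .
qed

text \<open>The integrand is the trace of \<open>g\<close> on the polynomials of multidegree \<open>(a, b)\<close>, so the integral is
  the trace of the averaging projection onto the invariants, for which the monomials in the mesons
  of that multidegree form a basis.\<close>

theorem integral_op_trace:
  assumes rng: "N < n \<or> N = n \<and> n > 0 \<and> (\<Sum>j<N. a j) = (\<Sum>j<N. b j)"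
  shows "(LINT g|\<mu>. q.op_trace n N (case_sum a b) (act n (mat_adjoint g) g)) = of_nat (card (ctab N a b))"
proof -
  let ?X = "qvars n N" and ?d = "case_sum a b"
  let ?E = "exps ?X (qlabels N) (qweights n N) ?d" and ?E' = "ctab N a b"
  let ?cf = "mcoeff ?X (q.bnd N ?d)" and ?cf' = "mcoeff (mvars N) (q.bnd N ?d)"
  have Nn: "N \<le> n" using rng by auto
  define P where "P m = avg (mon ?X m)" for m
  have Pexp: "P m v = (\<Sum>k\<in>?E. (LINT g|\<mu>. ?cf k (\<lambda>v. mon ?X m (act n (mat_adjoint g) g v))) * mon ?X k v)"
    if m: "m \<in> ?E" for m v
  proof -
    have bm: "bmf (\<lambda>g. ?cf k (\<lambda>v. mon ?X m (act n (mat_adjoint g) g v)))" for k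
      unfolding mcoeff_def divide_inverse
      by (intro bmf_mult bmf_const bmf_sum bmf_act[OF polyfun_mon])
    have "P m v = (LINT g|\<mu>. (\<Sum>k\<in>?E. ?cf k (\<lambda>v. mon ?X m (act n (mat_adjoint g) g v)) * mon ?X k v))"
      unfolding P_def avg_def using m
      by (subst q.graded_expansion[OF graded_act polyfun_mon q.homog_mon]) auto
    also have "... = (\<Sum>k\<in>?E. (LINT g|\<mu>. ?cf k (\<lambda>v. mon ?X m (act n (mat_adjoint g) g v)) * mon ?X k v))"
      by (intro Bochner_Integration.integral_sum bmf_integrable bmf_mult bmf_const bm)
    also have "... = (\<Sum>k\<in>?E. (LINT g|\<mu>. ?cf k (\<lambda>v. mon ?X m (act n (mat_adjoint g) g v))) * mon ?X k v)"
      by (simp only: integral_mult_left_zero)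
    finally show ?thesis .
  qed
  have Ppoly: "polyfun ?X (P m)" if "m \<in> ?E" for m
    unfolding Pexp[OF that, abs_def] by (intro polyfun_sum polyfun_mult polyfun_const polyfun_mon)
  have Phom: "homog (qlabels N) (qweights n N) ?d (P m)" if "m \<in> ?E" for m
  proof -
    have "mon ?X k (\<lambda>x. if x \<in> qweights n N c then 2 * v x else v x) = 2 ^ ?d c * mon ?X k v"
      if "k \<in> ?E" "c \<in> qlabels N" for k c v
      using q.homog_mon[OF that(1)] that(2) by (auto simp: homog_def)
    thus ?thesis
      unfolding homog_def Pexp[OF that] by (auto simp: sum_distrib_left intro!: sum.cong)
  qed
  \<comment> \<open>On multidegree (a, b) the scalar c acts by its power with exponent the total of
    a minus the total of b.\<close>
  have Pbal: "balanced (P m)" if m: "m \<in> ?E" and eq: "(\<Sum>j<N. a j) = (\<Sum>j<N. b j)" for m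
  proof -
    have "mon ?X k (\<lambda>x. (case x of Inl _ => c | Inr _ => inverse c) * v x) = mon ?X k v"
      if k: "k \<in> ?E" and c: "c \<noteq> 0" for k c v
    proof -
      let ?s = "\<lambda>x::qvar. case x of Inl _ => c | Inr _ => inverse c"
      have "mon ?X k (\<lambda>x. ?s x * v x) = (\<Prod>x\<in>?X. ?s x ^ k x) * mon ?X k v"
        by (simp add: mon_def power_mult_distrib prod.distrib)
      also have "(\<Prod>x\<in>?X. ?s x ^ k x) = (\<Prod>l\<in>qlabels N. \<Prod>x\<in>{x\<in>?X. qlab x = l}. ?s x ^ k x)"
        by (intro prod.group[symmetric]) (auto simp: qlabels_def qlab_def qvars_def)
      also have "... = (\<Prod>l\<in>qlabels N. (case l of Inl _ => c | Inr _ => inverse c) ^ ?d l)"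
      proof (intro prod.cong refl)
        fix l assume l: "l \<in> qlabels N"
        have "(\<Prod>x\<in>{x\<in>?X. qlab x = l}. ?s x ^ k x) = (\<Prod>x\<in>qweights n N l. (case l of Inl _ => c | Inr _ => inverse c) ^ k x)"
          by (intro prod.cong) (auto simp: qweights_def qlab_def split: sum.splits)
        also have "... = (case l of Inl _ => c | Inr _ => inverse c) ^ (\<Sum>x\<in>qweights n N l. k x)"
          by (simp add: power_sum)
        also have "(\<Sum>x\<in>qweights n N l. k x) = ?d l" using k l by (auto simp: exps_def)
        finally show "(\<Prod>x\<in>{x\<in>?X. qlab x = l}. ?s x ^ k x) = (case l of Inl _ => c | Inr _ => inverse c) ^ ?d l" .
      qed
      also have "... = c ^ (\<Sum>j<N. a j) * inverse c ^ (\<Sum>j<N. b j)"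
        unfolding qlabels_def by (subst prod.union_disjoint) (auto simp: prod.reindex power_sum)
      also have "... = 1" using eq c by (simp flip: power_mult_distrib)
      finally show ?thesis by simp
    qed
    thus ?thesis unfolding balanced_def Pexp[OF m] by (auto intro!: sum.cong)
  qed
  \<comment> \<open>The averaged monomial as a polynomial in the mesons, obtained by evaluating it
    on the section \<open>canon\<close>.\<close>
  define F where "F m M = P m (canon N M)" for m M
  have PF: "P m v = F m (meson n v)" if "m \<in> ?E" for m v
    unfolding F_def
    by (rule invariant_function_of_mesons[OF Ppoly[OF that]])
      (use rng Pbal[OF that] SU_invariant_avg[OF polyfun_mon] in \<open>auto simp: P_def\<close>)
  have Fpoly: "polyfun (mvars N) (F m)" if "m \<in> ?E" for m
    unfolding F_def[abs_def]
  proof (rule polyfun_compose[OF Ppoly[OF that]])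
    fix x assume "x \<in> ?X"
    thus "polyfun (mvars N) (\<lambda>v. canon N v x)"
    proof (cases rule: qvars_cases)
      case (1 i j)
      thus ?thesis by (cases "i < N") (auto simp: canon_def mvars_def intro!: polyfun_const polyfun_var)
    qed (simp add: canon_def polyfun_const)
  qed
  \<comment> \<open>Scaling a column of M amounts to scaling a quark of the canonical point, scaling
    a row to scaling an antiquark.\<close>
  have Fhom: "homog (qlabels N) (mweights N) ?d (F m)" if m: "m \<in> ?E" for m
    unfolding homog_def
  proof (intro ballI allI)
    fix l M assume l: "l \<in> qlabels N"
    let ?v = "\<lambda>x. if x \<in> qweights n N l then 2 * canon N M x else canon N M x"
    have "F m (\<lambda>x. if x \<in> mweights N l then 2 * M x else M x) = F m (meson n ?v)"
    proof (rule polyfun_cong_vars[OF Fpoly[OF m]])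
      fix x assume x: "x \<in> mvars N"
      obtain i j where ij: "x = (i,j)" "i < N" "j < N" using x by (auto simp: mvars_def)
      have "meson n ?v x = (\<Sum>k<n. if k = i then (if x \<in> mweights N l then 2 * M x else M x) else 0)"
        unfolding ij meson_def prod.case
        using ij Nn by (intro sum.cong refl)
          (cases l; auto simp: canon_def qweights_def qlab_def mweights_def mvars_def)
      thus "(if x \<in> mweights N l then 2 * M x else M x) = meson n ?v x"
        using ij Nn by simp
    qed
    also have "... = P m ?v" using PF[OF m] by simp
    also have "... = 2 ^ ?d l * P m (canon N M)" using Phom[OF m] l by (auto simp: homog_def)
    finally show "F m (\<lambda>x. if x \<in> mweights N l then 2 * M x else M x) = 2 ^ ?d l * F m M"
      by (simp add: F_def)
  qed
  define e where "e k v = mon (mvars N) k (meson n v)" for k v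
  have Pe: "P m v = (\<Sum>k\<in>?E'. ?cf' k (F m) * e k v)" if "m \<in> ?E" for m v
    unfolding PF[OF that] e_def ctab_def by (rule m.homog_expansion[OF Fpoly[OF that] Fhom[OF that]])
  have epoly: "polyfun ?X (e k)" for k
    unfolding e_def[abs_def] meson_def
    by (rule polyfun_compose[OF polyfun_mon]) (auto simp: mvars_def intro!: polyfun_sum polyfun_mult polyfun_var)
  have ehom: "homog (qlabels N) (qweights n N) ?d (e k)" if k: "k \<in> ?E'" for k
    unfolding homog_def
  proof (intro ballI allI)
    fix l v assume l: "l \<in> qlabels N"
    have "e k (\<lambda>x. if x \<in> qweights n N l then 2 * v x else v x) =
      mon (mvars N) k (\<lambda>x. if x \<in> mweights N l then 2 * meson n v x else meson n v x)"
      unfolding e_def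
    proof (rule mon_cong)
      fix x assume "x \<in> mvars N"
      thus "meson n (\<lambda>x. if x \<in> qweights n N l then 2 * v x else v x) x =
         (if x \<in> mweights N l then 2 * meson n v x else meson n v x)"
        by (cases l; cases x) (auto simp: meson_def mweights_def mvars_def qweights_def qlab_def sum_distrib_left intro!: sum.cong)
    qed
    also have "... = 2 ^ ?d l * e k v"
      using m.homog_mon[of k N ?d] k l by (auto simp: e_def homog_def ctab_def)
    finally show "e k (\<lambda>x. if x \<in> qweights n N l then 2 * v x else v x) = 2 ^ ?d l * e k v" .
  qed
  \<comment> \<open>Averaging fixes \<open>e k\<close>. On the section \<open>canon\<close> the
    mesons are free coordinates, so comparing coefficients there shows that \<open>e k\<close>
    occurs in its own average with coefficient 1.\<close>
  have dual: "(\<Sum>m\<in>?E. ?cf m (e k) * ?cf' k (F m)) = 1" if k: "k \<in> ?E'" for k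
  proof -
    have "(\<Sum>m\<in>?E. ?cf m (e k) * F m M) = mon (mvars N) k M" for M
    proof -
      have "(\<Sum>m\<in>?E. ?cf m (e k) * F m M) = avg (\<lambda>v. \<Sum>m\<in>?E. ?cf m (e k) * mon ?X m v) (canon N M)"
        unfolding F_def P_def by (intro avg_sum[where N = N, symmetric] polyfun_mon)
      also have "(\<lambda>v. \<Sum>m\<in>?E. ?cf m (e k) * mon ?X m v) = e k"
        by (intro ext q.homog_expansion[symmetric] epoly ehom k)
      also have "avg (e k) (canon N M) = (LINT g|\<mu>. mon (mvars N) k M)"
        unfolding avg_def
      proof (intro Bochner_Integration.integral_cong refl)
        fix g assume "g \<in> space \<mu>"
        hence g: "g \<in> U_grp n" "g \<in> carrier_mat n n" "mat_adjoint g \<in> carrier_mat n n" using space_sub by auto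
        show "e k (act n (mat_adjoint g) g (canon N M)) = mon (mvars N) k M"
          unfolding e_def using g Nn Ugrp_adjoint_right[OF g(1)]
          by (intro mon_cong) (simp add: meson_act meson_canon)
      qed
      finally show ?thesis by (simp add: prob_space)
    qed
    hence "?cf' k (\<lambda>M. \<Sum>m\<in>?E. ?cf m (e k) * F m M) = ?cf' k (mon (mvars N) k)" by simp
    also have "... = 1" using k m.mcoeff_mon_exps[of k N ?d k] by (simp add: ctab_def)
    finally show ?thesis by (simp add: mcoeff_sum)
  qed
  have "(LINT g|\<mu>. q.op_trace n N ?d (act n (mat_adjoint g) g)) = (\<Sum>m\<in>?E. ?cf m (P m))"
  proof -
    let ?r = "\<lambda>w. roots_pt (q.bnd N ?d) w" and ?Z = "?X \<rightarrow>\<^sub>E {..<q.bnd N ?d}"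
    let ?c = "inverse (of_nat (q.bnd N ?d) ^ card ?X) :: complex"
    have "(LINT g|\<mu>. q.op_trace n N ?d (act n (mat_adjoint g) g)) =
      (LINT g|\<mu>. (\<Sum>m\<in>?E. \<Sum>w\<in>?Z. mon ?X m (act n (mat_adjoint g) g (?r w)) * (cnj (mon ?X m (?r w)) * ?c)))"
      by (simp add: q.op_trace_def mcoeff_def sum_divide_distrib divide_inverse mult.assoc sum_distrib_right)
    also have "... = (\<Sum>m\<in>?E. LINT g|\<mu>. (\<Sum>w\<in>?Z. mon ?X m (act n (mat_adjoint g) g (?r w)) * (cnj (mon ?X m (?r w)) * ?c)))"
      by (intro Bochner_Integration.integral_sum bmf_integrable bmf_sum bmf_mult bmf_const bmf_act[OF polyfun_mon])
    also have "... = (\<Sum>m\<in>?E. \<Sum>w\<in>?Z. LINT g|\<mu>. mon ?X m (act n (mat_adjoint g) g (?r w)) * (cnj (mon ?X m (?r w)) * ?c))"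
      by (intro sum.cong refl Bochner_Integration.integral_sum bmf_integrable bmf_sum bmf_mult bmf_const bmf_act[OF polyfun_mon])
    also have "... = (\<Sum>m\<in>?E. \<Sum>w\<in>?Z. P m (?r w) * (cnj (mon ?X m (?r w)) * ?c))"
      unfolding P_def avg_def
      by (simp only: integral_mult_left_zero)
    also have "... = (\<Sum>m\<in>?E. ?cf m (P m))"
      by (simp add: mcoeff_def sum_divide_distrib divide_inverse mult.assoc sum_distrib_right)
    finally show ?thesis .
  qed
  \<comment> \<open>The projection factors through the span of the \<open>e k\<close>; exchanging
    the two sums computes its trace there.\<close>
  also have "... = (\<Sum>m\<in>?E. \<Sum>k\<in>?E'. ?cf' k (F m) * ?cf m (e k))"
  proof (intro sum.cong refl)
    fix m assume "m \<in> ?E"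
    thus "?cf m (P m) = (\<Sum>k\<in>?E'. ?cf' k (F m) * ?cf m (e k))"
      unfolding Pe[OF \<open>m \<in> ?E\<close>, abs_def] by (rule_tac mcoeff_sum)
  qed
  also have "... = (\<Sum>k\<in>?E'. \<Sum>m\<in>?E. ?cf m (e k) * ?cf' k (F m))"
    by (subst sum.swap) (simp add: mult.commute)
  also have "... = of_nat (card ?E')" by (simp add: dual)
  finally show ?thesis .
qed

end

section \<open>Haar measures\<close>

lemma continuous_map_mat_entry:
  assumes "i < n" "j < n"
  shows "continuous_map (mat_topology n) euclidean (\<lambda>A. A $$ (i,j))"
proof -
  have "continuous_map (product_topology (\<lambda>_. euclidean) ({..<n} \<times> {..<n})) euclidean (\<lambda>f. f (i,j) :: complex)"
    using assms by (intro continuous_map_product_projection) auto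
  from continuous_map_pullback[OF this, of "carrier_mat n n" "\<lambda>A. \<lambda>ij\<in>{..<n} \<times> {..<n}. A $$ ij"]
  have "continuous_map (mat_topology n) euclidean ((\<lambda>f. f (i,j)) \<circ> (\<lambda>A. \<lambda>ij\<in>{..<n} \<times> {..<n}. A $$ ij))"
    by (simp add: mat_topology_def)
  also have "((\<lambda>f. f (i,j)) \<circ> (\<lambda>A. \<lambda>ij\<in>{..<n} \<times> {..<n}. A $$ ij)) = (\<lambda>A :: complex mat. A $$ (i,j))"
    using assms by auto
  finally show ?thesis .
qed

lemma continuous_map_mult:
  fixes f g :: "'a => 'b :: real_normed_algebra"
  shows "continuous_map X euclidean f ==> continuous_map X euclidean g ==> continuous_map X euclidean (\<lambda>x. f x * g x)"
  by (simp add: continuous_map_atin tendsto_mult)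

lemma topspace_mat_topology [simp]: "topspace (mat_topology n) = carrier_mat n n"
  unfolding mat_topology_def topspace_pullback_topology by (auto simp: topspace_product_topology)

lemma topspace_group_topology: "carrier G \<subseteq> carrier_mat n n ==> topspace (group_topology n G) = carrier G"
  by (auto simp: group_topology_def)

lemma continuous_map_into_mat_topology:
  assumes "!!x. x \<in> topspace T ==> f x \<in> carrier_mat n n"
    and "!!i j. i < n ==> j < n ==> continuous_map T euclidean (\<lambda>x. f x $$ (i,j))"
  shows "continuous_map T (mat_topology n) f"
  unfolding mat_topology_def
proof (rule continuous_map_pullback')
  show "topspace T \<subseteq> f -` carrier_mat n n" using assms by auto
  show "continuous_map T (product_topology (\<lambda>_. euclidean) ({..<n} \<times> {..<n})) ((\<lambda>A. \<lambda>ij\<in>{..<n} \<times> {..<n}. A $$ ij) \<circ> f)"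
    unfolding continuous_map_componentwise using assms(2) by auto
qed

lemma continuous_map_into_group_topology:
  assumes "carrier G \<subseteq> carrier_mat n n" "!!x. x \<in> topspace T ==> f x \<in> carrier G"
    and "!!i j. i < n ==> j < n ==> continuous_map T euclidean (\<lambda>x. f x $$ (i,j))"
  shows "continuous_map T (group_topology n G) f"
  unfolding group_topology_def
  using assms by (intro continuous_map_into_subtopology continuous_map_into_mat_topology) auto

lemma continuous_map_group_entry:
  assumes "i < n" "j < n"
  shows "continuous_map (group_topology n G) euclidean (\<lambda>A. A $$ (i,j))"
  unfolding group_topology_def
  by (rule continuous_map_from_subtopology[OF continuous_map_mat_entry[OF assms]])

lemma haar_borel_measurable:
  fixes f :: "complex mat => 'b :: topological_space"
  assumes haar: "normalised_haar_measure n G \<mu>" and G: "carrier G \<subseteq> carrier_mat n n"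
    and f: "continuous_map (group_topology n G) euclidean f"
  shows "f \<in> borel_measurable \<mu>"
proof (rule borel_measurableI)
  fix S :: "'b set" assume "open S"
  hence "openin (group_topology n G) {x \<in> topspace (group_topology n G). f x \<in> S}"
    using f by (auto simp: continuous_map_def)
  moreover have "f -` S \<inter> space \<mu> = {x \<in> topspace (group_topology n G). f x \<in> S}"
    using haar by (auto simp: normalised_haar_measure_def topspace_group_topology[OF G])
  ultimately show "f -` S \<inter> space \<mu> \<in> sets \<mu>"
    using haar by (auto simp: normalised_haar_measure_def intro: sigma_sets.Basic)
qed

lemma mult_unitary_group: "g \<otimes>\<^bsub>unitary_group n\<^esub> h = g * h"
  by (simp only: unitary_group_def monoid.select_convs)

lemma mult_special_unitary_group: "g \<otimes>\<^bsub>special_unitary_group n\<^esub> h = g * h"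
  by (simp only: special_unitary_group_def monoid.select_convs)

lemma haar_unitary_mean:
  assumes haar: "normalised_haar_measure n G \<mu>"
    and G: "G = unitary_group n \<or> G = special_unitary_group n"
  shows "unitary_mean \<mu> n"
proof -
  have GU: "carrier G \<subseteq> U_grp n" using G SU_Ugrp by (elim disjE) auto
  hence Gc: "carrier G \<subseteq> carrier_mat n n" by auto
  have SG: "SU_grp n \<subseteq> carrier G" using G SU_Ugrp by (elim disjE) auto
  have mult: "g \<otimes>\<^bsub>G\<^esub> h = g * h" for g h
    using G mult_unitary_group mult_special_unitary_group by (elim disjE) (simp_all only:)
  have cl: "g * h \<in> carrier G" if "g \<in> carrier G" "h \<in> carrier G" for g h
    using G that by (elim disjE) (simp_all add: Ugrp_mult SU_mult)
  note top = topspace_group_topology[OF Gc]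
  have sp: "space \<mu> = carrier G" and se: "sets \<mu> = sigma_sets (carrier G) {S. openin (group_topology n G) S}"
    and ps: "prob_space \<mu>" and inv: "!!g S. g \<in> carrier G ==> S \<in> sets \<mu> ==> emeasure \<mu> ((\<lambda>h. g * h) ` S) = emeasure \<mu> S"
    using haar unfolding normalised_haar_measure_def mult by blast+
  have tm: "(\<lambda>g. h * g) \<in> measurable \<mu> \<mu>" if h: "h \<in> carrier G" for h
  proof (rule measurable_sigma_sets[OF se])
    show "{S. openin (group_topology n G) S} \<subseteq> Pow (carrier G)"
      using openin_subset[of "group_topology n G"] unfolding top by auto
    show "(*) h \<in> space \<mu> \<rightarrow> carrier G" using h sp cl by auto
    fix S assume S: "S \<in> {S. openin (group_topology n G) S}"
    have "continuous_map (group_topology n G) (group_topology n G) (\<lambda>g. h * g)"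
    proof (rule continuous_map_into_group_topology[OF Gc])
      fix i j assume ij: "i < n" "j < n"
      have "continuous_map (group_topology n G) euclidean (\<lambda>g. \<Sum>k<n. h $$ (i,k) * g $$ (k,j))"
        using ij by (intro continuous_map_sum continuous_map_mult continuous_map_group_entry) auto
      thus "continuous_map (group_topology n G) euclidean (\<lambda>x. (h * x) $$ (i,j))"
      proof (rule continuous_map_eq)
        fix g assume "g \<in> topspace (group_topology n G)"
        thus "(\<Sum>k<n. h $$ (i,k) * g $$ (k,j)) = (h * g) $$ (i,j)"
          using top h Gc ij by (intro mat_mult_index[symmetric]) auto
      qed
    qed (use h cl top in auto)
    hence "openin (group_topology n G) {x \<in> topspace (group_topology n G). h * x \<in> S}"
      using S by (auto simp: continuous_map_def)
    moreover have "(*) h -` S \<inter> space \<mu> = {x \<in> topspace (group_topology n G). h * x \<in> S}"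
      using sp top by auto
    ultimately show "(*) h -` S \<inter> space \<mu> \<in> sets \<mu>" unfolding se by (auto intro: sigma_sets.Basic)
  qed
  interpret prob_space \<mu> by (rule ps)
  show ?thesis
  proof
    show "space \<mu> \<subseteq> U_grp n" using sp GU by simp
    show "(\<lambda>g. g $$ (i,j)) \<in> borel_measurable \<mu>" if "i < n" "j < n" for i j
      by (rule haar_borel_measurable[OF haar Gc continuous_map_group_entry[OF that]])
    fix h assume "h \<in> SU_grp n"
    hence h: "h \<in> carrier G" and h': "mat_adjoint h \<in> carrier G" and hU: "h \<in> U_grp n"
      using SG SU_adjoint SU_Ugrp by auto
    show tmh: "(\<lambda>g. h * g) \<in> measurable \<mu> \<mu>" using tm[OF h] .
    show "distr \<mu> \<mu> (\<lambda>g. h * g) = \<mu>"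
    proof (rule measure_eqI)
      fix S assume "S \<in> sets (distr \<mu> \<mu> (\<lambda>g. h * g))"
      hence S: "S \<in> sets \<mu>" by simp
      have "S \<subseteq> carrier G" using S sets.sets_into_space sp by auto
      have hh: "h * (mat_adjoint h * s) = s" "mat_adjoint h * (h * s) = s" if "s \<in> carrier_mat n n" for s
        using that h h' Gc Ugrp_adjoint_right[OF hU] Ugrp_adjoint_left[OF hU]
        by (auto simp flip: assoc_mult_mat[of _ n n _ n _ n])
      \<comment> \<open>Haar invariance speaks of images of sets, the locale of push-forwards; a
        preimage under h is an image under the inverse of h.\<close>
      have "(\<lambda>g. h * g) -` S \<inter> space \<mu> = (\<lambda>g. mat_adjoint h * g) ` S"
      proof (intro equalityI subsetI)
        fix g assume "g \<in> (\<lambda>g. h * g) -` S \<inter> space \<mu>"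
        thus "g \<in> (\<lambda>g. mat_adjoint h * g) ` S"
          using hh(2)[of g] sp Gc by (intro image_eqI[of _ _ "h * g"]) auto
      next
        fix g assume "g \<in> (\<lambda>g. mat_adjoint h * g) ` S"
        then obtain s where "g = mat_adjoint h * s" "s \<in> S" by auto
        thus "g \<in> (\<lambda>g. h * g) -` S \<inter> space \<mu>"
          using \<open>S \<subseteq> carrier G\<close> hh(1)[of s] cl[OF h', of s] sp Gc by auto
      qed
      thus "emeasure (distr \<mu> \<mu> (\<lambda>g. h * g)) S = emeasure \<mu> S"
        using inv[OF h' S] by (simp add: emeasure_distr[OF tmh S])
    qed simp
  qed
qed

section \<open>The Hilbert series\<close>

lemma prod_has_sum_PiE:
  fixes f :: "'a => nat => complex"
  assumes A: "finite A" and f: "!!x. x \<in> A ==> summable (\<lambda>r. cmod (f x r))"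
  shows "((\<lambda>g. \<Prod>x\<in>A. f x (g x)) has_sum (\<Prod>x\<in>A. suminf (f x))) (A \<rightarrow>\<^sub>E UNIV)"
proof -
  have s: "(f x has_sum suminf (f x)) UNIV" if "x \<in> A" for x
    by (rule norm_summable_imp_has_sum[OF f[OF that] summable_sums[OF summable_norm_cancel[OF f[OF that]]]])
  have ab: "Infinite_Set_Sum.abs_summable_on (f x) UNIV" if "x \<in> A" for x
    unfolding abs_summable_equivalent[symmetric] summable_on_iff_abs_summable_on_complex[symmetric]
    by (rule has_sum_imp_summable[OF s[OF that]])
  have "Infinite_Set_Sum.abs_summable_on (\<lambda>g. \<Prod>x\<in>A. f x (g x)) (A \<rightarrow>\<^sub>E UNIV)"
    using A ab by (intro abs_summable_on_prod_PiE) auto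
  hence sm: "(\<lambda>g. \<Prod>x\<in>A. f x (g x)) summable_on (A \<rightarrow>\<^sub>E UNIV)"
    unfolding abs_summable_equivalent[symmetric] summable_on_iff_abs_summable_on_complex[symmetric] .
  hence "infsum (\<lambda>g. \<Prod>x\<in>A. f x (g x)) (A \<rightarrow>\<^sub>E UNIV) = (\<Prod>x\<in>A. infsum (f x) UNIV)"
    using A s by (intro infsum_prod_PiE) (auto simp: summable_on_def)
  also have "... = (\<Prod>x\<in>A. suminf (f x))" using s by (intro prod.cong refl infsumI)
  finally show ?thesis using sm by (metis has_sum_infsum)
qed

lemma dist_partial_sum_le:
  fixes f :: "'i => complex"
  assumes "(f has_sum S) I" "(w has_sum T) I" "!!i. i \<in> I ==> cmod (f i) \<le> w i" "finite K" "K \<subseteq> I"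
  shows "cmod (S - sum f K) \<le> T - sum w K"
proof (rule norm_infsum_le)
  show "(f has_sum (S - sum f K)) (I - K)" "(w has_sum (T - sum w K)) (I - K)"
    using assms by (auto intro!: has_sum_Diff has_sum_finite)
qed (use assms in auto)

text \<open>The Weierstrass test: the dominating family makes finite partial sums converge uniformly
  on the space, which gives both the measurability of F and the exchange with the integral.\<close>

lemma (in prob_space) integral_has_sum:
  fixes f :: "'i => 'a => complex"
  assumes f: "!!i. i \<in> I ==> f i \<in> borel_measurable M"
    and bd: "!!i x. i \<in> I ==> x \<in> space M ==> cmod (f i x) \<le> w i"
    and w: "w summable_on I"
    and F: "!!x. x \<in> space M ==> ((\<lambda>i. f i x) has_sum F x) I"
  shows "((\<lambda>i. LINT x|M. f i x) has_sum (LINT x|M. F x)) I"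
proof -
  let ?T = "infsum w I"
  have wT: "(w has_sum ?T) I" using w by (rule has_sum_infsum)
  have int: "integrable M (f i)" if "i \<in> I" for i
    using f[OF that] bd[OF that] by (intro integrable_const_bound[of _ "w i"]) auto
  have bi: "cmod (LINT x|M. f i x) \<le> w i" if "i \<in> I" for i
  proof -
    have "cmod (LINT x|M. f i x) \<le> (LINT x|M. cmod (f i x))" by (rule integral_norm_bound)
    also have "... \<le> (LINT x|M. w i)" using int[OF that] bd[OF that] by (intro integral_mono) auto
    finally show ?thesis by (simp add: prob_space)
  qed
  have "\<exists>K. finite K \<and> K \<subseteq> I \<and> ?T - sum w K \<le> e" if "e > 0" for e
    using infsum_finite_approximation[OF w that] by (auto simp: dist_real_def)
  \<comment> \<open>A sequence of finite index sets replaces the unordered sum by a sequential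
    limit, as measurability of the limit requires.\<close>
  hence "\<exists>K. \<forall>m. finite (K m) \<and> K m \<subseteq> I \<and> ?T - sum w (K m) \<le> 1 / Suc m"
    by (intro choice allI) auto
  then obtain K where K: "!!m. finite (K m)" "!!m. K m \<subseteq> I" "!!m. ?T - sum w (K m) \<le> 1 / Suc m" by blast
  have lim0: "(\<lambda>m. 1 / real (Suc m)) \<longlonglongrightarrow> 0" by (rule LIMSEQ_Suc) (simp add: lim_1_over_n)
  have close: "cmod (F x - (\<Sum>i\<in>K m. f i x)) \<le> 1 / Suc m" if "x \<in> space M" for x m
    using dist_partial_sum_le[OF F[OF that] wT bd[OF _ that] K(1,2)[of m]] K(3)[of m] by simp
  have Fm: "F \<in> borel_measurable M"
  proof (rule borel_measurable_LIMSEQ_metric)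
    show "(\<lambda>x. \<Sum>i\<in>K m. f i x) \<in> borel_measurable M" for m
      using K(2)[of m] f by (intro borel_measurable_sum) auto
    fix x assume x: "x \<in> space M"
    show "(\<lambda>m. \<Sum>i\<in>K m. f i x) \<longlonglongrightarrow> F x"
      unfolding tendsto_dist_iff[of _ "F x"]
      by (rule real_tendsto_sandwich[OF _ _ tendsto_const lim0])
        (use close[OF x] in \<open>auto simp: dist_norm norm_minus_commute\<close>)
  qed
  have FT: "cmod (F x) \<le> ?T" if "x \<in> space M" for x
    using norm_infsum_le[OF F[OF that] wT] bd that by blast
  have Fi: "integrable M F" using Fm FT by (intro integrable_const_bound[of _ ?T]) auto
  have "(\<lambda>i. cmod (LINT x|M. f i x)) summable_on I"
    by (rule Infinite_Sum.abs_summable_on_comparison_test'[OF w bi])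
  hence "(\<lambda>i. LINT x|M. f i x) summable_on I" by (simp add: summable_on_iff_abs_summable_on_complex)
  then obtain S where S: "((\<lambda>i. LINT x|M. f i x) has_sum S) I" by (auto simp: summable_on_def)
  have "cmod (S - (LINT x|M. F x)) \<le> 2 / Suc m" for m
  proof -
    have "cmod (S - (\<Sum>i\<in>K m. LINT x|M. f i x)) \<le> 1 / Suc m"
      using dist_partial_sum_le[OF S wT bi K(1,2)[of m]] K(3)[of m] by simp
    moreover have "cmod ((\<Sum>i\<in>K m. LINT x|M. f i x) - (LINT x|M. F x)) \<le> 1 / Suc m"
    proof -
      have Ki: "integrable M (\<lambda>x. \<Sum>i\<in>K m. f i x)" using K(2)[of m] int by (intro Bochner_Integration.integrable_sum) auto
      have "(\<Sum>i\<in>K m. LINT x|M. f i x) - (LINT x|M. F x) = (LINT x|M. (\<Sum>i\<in>K m. f i x) - F x)"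
        using K(2)[of m] int Fi Ki
        by (subst Bochner_Integration.integral_diff, simp, simp, subst Bochner_Integration.integral_sum) auto
      also have "cmod ... \<le> (LINT x|M. cmod ((\<Sum>i\<in>K m. f i x) - F x))" by (rule integral_norm_bound)
      also have "... \<le> (LINT x|M. 1 / Suc m)"
        using Ki Fi close by (intro integral_mono integrable_norm Bochner_Integration.integrable_diff) (auto simp: norm_minus_commute)
      finally show ?thesis by (simp add: prob_space)
    qed
    ultimately show ?thesis by (rule_tac order_trans[OF norm_diff_triangle_le]) auto
  qed
  moreover have "(\<lambda>m. 2 / real (Suc m)) \<longlonglongrightarrow> 0"
    using tendsto_mult_left[OF lim0, of 2] by simp
  ultimately have "cmod (S - (LINT x|M. F x)) \<le> 0"
    by (intro LIMSEQ_le_const[of "\<lambda>m. 2 / real (Suc m)"]) auto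
  thus ?thesis using S by simp
qed

lemma proots_char_poly_diagonalised:
  assumes V: "V \<in> SU_grp n" and g: "g = V * mat_diag n z * mat_adjoint V"
  shows "proots (char_poly g) = image_mset z (mset_set {..<n})"
proof -
  have c: "V \<in> carrier_mat n n" "mat_adjoint V \<in> carrier_mat n n" using V by auto
  have "similar_mat g (mat_diag n z)"
    unfolding similar_mat_def
    by (intro exI[of _ V] exI[of _ "mat_adjoint V"] similar_mat_witI[of _ _ n])
       (use c g Ugrp_adjoint_left[OF SU_Ugrp[OF V]] Ugrp_adjoint_right[OF SU_Ugrp[OF V]] in auto)
  hence "char_poly g = char_poly (mat_diag n z)" by (rule char_poly_similar)
  also have "... = (\<Prod>a\<leftarrow>diag_mat (mat_diag n z). [:- a, 1:])"
    by (rule char_poly_upper_triangular[of _ n]) (auto simp: upper_triangular_def mat_diag_def)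
  also have "diag_mat (mat_diag n z) = map z [0..<n]" by (auto simp: diag_mat_def mat_diag_def)
  also have "(\<Prod>a\<leftarrow>map z [0..<n]. [:- a, 1:]) = (\<Prod>i\<in>set [0..<n]. [:- z i, 1:])"
    by (subst prod.distinct_set_conv_list) (auto simp: o_def)
  finally have "char_poly g = (\<Prod>i<n. [:- z i, 1:])" by (simp add: atLeast0LessThan)
  hence "proots (char_poly g) = (\<Sum>i<n. proots [:- z i, 1:])" by (simp add: proots_prod)
  also have "... = (\<Sum>i<n. {#z i#})" by (simp add: proots_linear_factor)
  also have "... = image_mset z (mset_set {..<n})" by (induction n) (auto simp: lessThan_Suc)
  finally show ?thesis .
qed

text \<open>The fugacity of a monomial in the mesons depends only on the margins of its exponent
  table.\<close>

lemma prod_ctab: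
  fixes \<gamma> :: "nat + nat => complex"
  assumes "k \<in> ctab N a b"
  shows "(\<Prod>x\<in>mvars N. (\<gamma> (Inl (snd x)) * \<gamma> (Inr (fst x))) ^ k x) = (\<Prod>l\<in>qlabels N. \<gamma> l ^ case_sum a b l)"
proof -
  have "(\<Prod>x\<in>mvars N. (\<gamma> (Inl (snd x)) * \<gamma> (Inr (fst x))) ^ k x)
    = (\<Prod>i<N. \<Prod>j<N. \<gamma> (Inl j) ^ k (i,j)) * (\<Prod>i<N. \<Prod>j<N. \<gamma> (Inr i) ^ k (i,j))"
    by (simp add: mvars_def prod.cartesian_product' power_mult_distrib prod.distrib)
  also have "(\<Prod>i<N. \<Prod>j<N. \<gamma> (Inl j) ^ k (i,j)) = (\<Prod>j<N. \<gamma> (Inl j) ^ (\<Sum>i<N. k (i,j)))"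
    by (subst prod.swap) (simp add: power_sum)
  also have "(\<Prod>i<N. \<Prod>j<N. \<gamma> (Inr i) ^ k (i,j)) = (\<Prod>i<N. \<gamma> (Inr i) ^ (\<Sum>j<N. k (i,j)))"
    by (simp add: power_sum)
  also have "(\<Prod>j<N. \<gamma> (Inl j) ^ (\<Sum>i<N. k (i,j))) = (\<Prod>j<N. \<gamma> (Inl j) ^ a j)"
  proof (intro prod.cong refl arg_cong2[where f = "(^)"])
    fix j assume j: "j \<in> {..<N}"
    hence "mweights N (Inl j) = (\<lambda>i. (i,j)) ` {..<N}" by (auto simp: mweights_def mvars_def)
    hence "(\<Sum>x\<in>mweights N (Inl j). k x) = (\<Sum>i<N. k (i,j))" by (simp add: sum.reindex inj_on_def)
    thus "(\<Sum>i<N. k (i,j)) = a j" using assms j by (auto simp: ctab_def exps_def qlabels_def)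
  qed
  also have "(\<Prod>i<N. \<gamma> (Inr i) ^ (\<Sum>j<N. k (i,j))) = (\<Prod>i<N. \<gamma> (Inr i) ^ b i)"
  proof (intro prod.cong refl arg_cong2[where f = "(^)"])
    fix i assume i: "i \<in> {..<N}"
    hence "mweights N (Inr i) = (\<lambda>j. (i,j)) ` {..<N}" by (auto simp: mweights_def mvars_def)
    hence "(\<Sum>x\<in>mweights N (Inr i). k x) = (\<Sum>j<N. k (i,j))" by (simp add: sum.reindex inj_on_def)
    thus "(\<Sum>j<N. k (i,j)) = b i" using assms i by (auto simp: ctab_def exps_def qlabels_def)
  qed
  finally show ?thesis
    unfolding qlabels_def by (subst prod.union_disjoint) (auto simp: prod.reindex)
qed

lemma prod_qlabels: "(\<Prod>l\<in>qlabels N. f l) = (\<Prod>j<N. f (Inl j)) * (\<Prod>j<N. f (Inr j))"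
  unfolding qlabels_def by (subst prod.union_disjoint) (auto simp: prod.reindex)

lemma finite_qlabels [simp]: "finite (qlabels N)" by (simp add: qlabels_def)

text \<open>Expanding the product into geometric series yields a sum over all N x N tables; the left
  side groups them by their margins.\<close>

lemma has_sum_ctab:
  fixes \<gamma> :: "nat + nat => complex"
  assumes \<gamma>: "!!l. l \<in> qlabels N ==> cmod (\<gamma> l) < 1"
  shows "infsum (\<lambda>c. (\<Prod>l\<in>qlabels N. \<gamma> l ^ c l) * of_nat (card (ctab N (c \<circ> Inl) (c \<circ> Inr)))) (qlabels N \<rightarrow>\<^sub>E UNIV)
     = (\<Prod>x\<in>mvars N. 1 / (1 - \<gamma> (Inl (snd x)) * \<gamma> (Inr (fst x))))"
proof -
  let ?p = "\<lambda>x. \<gamma> (Inl (snd x)) * \<gamma> (Inr (fst x))"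
  have p: "cmod (?p x) < 1" if "x \<in> mvars N" for x
  proof -
    have "cmod (\<gamma> (Inl (snd x))) * cmod (\<gamma> (Inr (fst x))) < 1 * 1"
      using that by (intro mult_strict_mono' \<gamma>) (auto simp: mvars_def qlabels_def)
    thus ?thesis by (simp add: norm_mult)
  qed
  define T where "T = (\<lambda>c. ctab N (c \<circ> Inl) (c \<circ> Inr))"
  have Teq: "T c = exps (mvars N) (qlabels N) (mweights N) c" for c
    unfolding T_def ctab_def by (rule arg_cong[of _ _ "exps (mvars N) (qlabels N) (mweights N)"]) (auto simp: fun_eq_iff split: sum.split)
  have hs: "((\<lambda>k. \<Prod>x\<in>mvars N. ?p x ^ k x) has_sum (\<Prod>x\<in>mvars N. suminf (\<lambda>r. ?p x ^ r))) (mvars N \<rightarrow>\<^sub>E UNIV)"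
    using p by (intro prod_has_sum_PiE) (auto simp: norm_power intro!: summable_geometric)
  have bij: "bij_betw snd (Sigma (qlabels N \<rightarrow>\<^sub>E UNIV) T) (mvars N \<rightarrow>\<^sub>E UNIV)"
  proof (rule bij_betw_byWitness[where f' = "\<lambda>k. (\<lambda>l\<in>qlabels N. \<Sum>x\<in>mweights N l. k x, k)"])
    show "\<forall>z\<in>Sigma (qlabels N \<rightarrow>\<^sub>E UNIV) T. (\<lambda>l\<in>qlabels N. \<Sum>x\<in>mweights N l. snd z x, snd z) = z"
      by (auto simp: Teq exps_def fun_eq_iff PiE_iff extensional_def)
  qed (auto simp: Teq exps_def)
  have hS: "((\<lambda>z. \<Prod>x\<in>mvars N. ?p x ^ snd z x) has_sum (\<Prod>x\<in>mvars N. suminf (\<lambda>r. ?p x ^ r))) (Sigma (qlabels N \<rightarrow>\<^sub>E UNIV) T)"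
    using has_sum_reindex_bij_betw[OF bij, of "\<lambda>k. \<Prod>x\<in>mvars N. ?p x ^ k x"] hs by simp
  have "infsum (\<lambda>c. infsum (\<lambda>k. \<Prod>x\<in>mvars N. ?p x ^ snd (c,k) x) (T c)) (qlabels N \<rightarrow>\<^sub>E UNIV)
     = infsum (\<lambda>z. \<Prod>x\<in>mvars N. ?p x ^ snd z x) (Sigma (qlabels N \<rightarrow>\<^sub>E UNIV) T)"
    by (rule infsum_Sigma_banach) (use hS in \<open>auto simp: summable_on_def\<close>)
  also have "... = (\<Prod>x\<in>mvars N. suminf (\<lambda>r. ?p x ^ r))" using hS by (rule infsumI)
  also have "... = (\<Prod>x\<in>mvars N. 1 / (1 - ?p x))" using p by (intro prod.cong refl suminf_geometric)
  finally have e: "infsum (\<lambda>c. infsum (\<lambda>k. \<Prod>x\<in>mvars N. ?p x ^ k x) (T c)) (qlabels N \<rightarrow>\<^sub>E UNIV) = (\<Prod>x\<in>mvars N. 1 / (1 - ?p x))"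
    by simp
  have "infsum (\<lambda>k. \<Prod>x\<in>mvars N. ?p x ^ k x) (T c) = (\<Prod>l\<in>qlabels N. \<gamma> l ^ c l) * of_nat (card (T c))" for c
  proof -
    have fin: "finite (T c)" unfolding Teq by (rule m.finite_exps)
    have "infsum (\<lambda>k. \<Prod>x\<in>mvars N. ?p x ^ k x) (T c) = (\<Sum>k\<in>T c. \<Prod>x\<in>mvars N. ?p x ^ k x)"
      using fin by simp
    also have "... = (\<Sum>k\<in>T c. \<Prod>l\<in>qlabels N. \<gamma> l ^ c l)"
    proof (intro sum.cong refl)
      fix k assume "k \<in> T c"
      hence "k \<in> ctab N (c \<circ> Inl) (c \<circ> Inr)" by (simp add: T_def)
      from prod_ctab[OF this, of \<gamma>]
      show "(\<Prod>x\<in>mvars N. ?p x ^ k x) = (\<Prod>l\<in>qlabels N. \<gamma> l ^ c l)" by (simp add: prod_qlabels)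
    qed
    finally show ?thesis by simp
  qed
  with e show ?thesis by (simp add: T_def)
qed

context unitary_mean
begin

lemma bmf_op_trace: "bmf (\<lambda>g. q.op_trace n N d (act n (mat_adjoint g) g))"
  unfolding q.op_trace_def mcoeff_def divide_inverse
  by (intro bmf_sum bmf_mult bmf_const bmf_act[OF polyfun_mon])

text \<open>\<open>\<alpha>\<close> and \<open>\<beta>\<close> are the fugacities of the quarks and antiquarks.\<close>

theorem integral_flavour_product:
  assumes N: "N < n" and \<alpha>: "!!j. j < N ==> cmod (\<alpha> j) < 1" and \<beta>: "!!j. j < N ==> cmod (\<beta> j) < 1"
  shows "(LINT U|\<mu>. (\<Prod>z\<in>#proots (char_poly U). (\<Prod>j<N. 1 / (1 - \<alpha> j * inverse z)) * (\<Prod>j<N. 1 / (1 - \<beta> j * z))))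
    = (\<Prod>i<N. \<Prod>j<N. 1 / (1 - \<alpha> j * \<beta> i))"
proof -
  let ?F = "\<lambda>U. (\<Prod>z\<in>#proots (char_poly U). (\<Prod>j<N. 1 / (1 - \<alpha> j * inverse z)) * (\<Prod>j<N. 1 / (1 - \<beta> j * z)))"
  let ?I = "qlabels N \<rightarrow>\<^sub>E (UNIV :: nat set)"
  define \<gamma> where "\<gamma> = case_sum \<alpha> \<beta>"
  have \<gamma>: "cmod (\<gamma> l) < 1" if "l \<in> qlabels N" for l
    using that \<alpha> \<beta> by (auto simp: \<gamma>_def qlabels_def)
  define f where "f c g = (\<Prod>l\<in>qlabels N. \<gamma> l ^ c l) * q.op_trace n N (case_sum (c \<circ> Inl) (c \<circ> Inr)) (act n (mat_adjoint g) g)" for c g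
  \<comment> \<open>The majorant: all eigenvalues are replaced by 1 and all fugacities by their
    moduli, which turns the same product expansion into a convergent series independent of
    g.\<close>
  define W where "W c = (\<Prod>l\<in>qlabels N. hsum {..<n} (c l) (\<lambda>_. 1) * complex_of_real (cmod (\<gamma> l)) ^ c l)" for c
  define w where "w c = Re (W c)" for c
  have hs: "summable (\<lambda>r. cmod (hsum {..<n} r z * d ^ r))" "(\<lambda>r. hsum {..<n} r z * d ^ r) sums (\<Prod>i<n. 1 / (1 - d * z i))"
    if "cmod d < 1" "!!i. i < n ==> cmod (z i) = 1" for d z
    using that by (rule_tac hsum_sums; simp add: norm_mult)+
  have fz: "f c g = (\<Prod>l\<in>qlabels N. hsum {..<n} (c l) (\<lambda>i. case_sum (\<lambda>_. cnj (z i)) (\<lambda>_. z i) l) * \<gamma> l ^ c l)"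
    if "V \<in> SU_grp n" "g = V * mat_diag n z * mat_adjoint V" for c V g z
    unfolding f_def op_trace_act[OF that] prod_qlabels by (simp add: prod.distrib mult_ac)
  have bound: "cmod (f c g) \<le> w c" if g: "g \<in> space \<mu>" for c g
  proof -
    obtain V z where V: "V \<in> SU_grp n" "g = V * mat_diag n z * mat_adjoint V" "!!i. i < n ==> cmod (z i) = 1"
      using Ugrp_diagonalisation g space_sub by blast
    have "cmod (f c g) = (\<Prod>l\<in>qlabels N. cmod (hsum {..<n} (c l) (\<lambda>i. case_sum (\<lambda>_. cnj (z i)) (\<lambda>_. z i) l)) * cmod (\<gamma> l) ^ c l)"
      unfolding fz[OF V(1,2)] by (simp add: prod_norm[symmetric] norm_mult norm_power)
    also have "... \<le> (\<Prod>l\<in>qlabels N. Re (hsum {..<n} (c l) (\<lambda>_. 1)) * cmod (\<gamma> l) ^ c l)"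
    proof (intro prod_mono conjI mult_right_mono)
      fix l assume "l \<in> qlabels N"
      have "cmod (hsum {..<n} (c l) (\<lambda>i. case_sum (\<lambda>_. cnj (z i)) (\<lambda>_. z i) l)) \<le>
        Re (hsum {..<n} (c l) (\<lambda>i. complex_of_real (cmod (case_sum (\<lambda>_. cnj (z i)) (\<lambda>_. z i) l))))"
        by (rule norm_hsum_le)
      also have "... = Re (hsum {..<n} (c l) (\<lambda>i. 1))"
        by (intro arg_cong[where f=Re] hsum_cong) (auto simp: V(3) split: sum.split)
      finally show "cmod (hsum {..<n} (c l) (\<lambda>i. case_sum (\<lambda>_. cnj (z i)) (\<lambda>_. z i) l)) \<le> Re (hsum {..<n} (c l) (\<lambda>i. 1))" .
    qed auto
    also have "... = w c"
    proof -
      have "hsum {..<n} r (\<lambda>_. 1) = complex_of_real (Re (hsum {..<n} r (\<lambda>_. 1)))" for r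
        using hsum_of_real[of "{..<n}" r "\<lambda>_. 1"] by simp
      hence "W c = complex_of_real (\<Prod>l\<in>qlabels N. Re (hsum {..<n} (c l) (\<lambda>_. 1)) * cmod (\<gamma> l) ^ c l)"
        unfolding W_def by (simp flip: of_real_power of_real_mult of_real_prod) (metis (no_types, lifting) of_real_mult of_real_prod prod.cong)
      thus ?thesis by (simp only: w_def Re_complex_of_real)
    qed
    finally show ?thesis .
  qed
  have wsum: "w summable_on ?I"
  proof -
    have "(W has_sum (\<Prod>l\<in>qlabels N. suminf (\<lambda>r. hsum {..<n} r (\<lambda>_. 1) * complex_of_real (cmod (\<gamma> l)) ^ r))) ?I"
      unfolding W_def[abs_def] using \<gamma> by (intro prod_has_sum_PiE hs) auto
    thus ?thesis unfolding w_def[abs_def] by (intro summable_on_Re) (auto simp: summable_on_def)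
  qed
  have Fsum: "((\<lambda>c. f c g) has_sum ?F g) ?I" if g: "g \<in> space \<mu>" for g
  proof -
    obtain V z where V: "V \<in> SU_grp n" "g = V * mat_diag n z * mat_adjoint V" "!!i. i < n ==> cmod (z i) = 1"
      using Ugrp_diagonalisation g space_sub by blast
    have iv: "inverse (z i) = cnj (z i)" if "i < n" for i
    proof -
      have "z i * cnj (z i) = 1" using V(3)[OF that] by (simp flip: complex_norm_square)
      thus ?thesis by (metis inverse_unique)
    qed
    let ?z = "\<lambda>l i. case_sum (\<lambda>_. cnj (z i)) (\<lambda>_. z i) l"
    have z1: "cmod (?z l i) = 1" if "i < n" for l i using V(3)[OF that] by (auto split: sum.split)
    have "((\<lambda>c. \<Prod>l\<in>qlabels N. hsum {..<n} (c l) (?z l) * \<gamma> l ^ c l) has_sum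
       (\<Prod>l\<in>qlabels N. suminf (\<lambda>r. hsum {..<n} r (?z l) * \<gamma> l ^ r))) ?I"
      using \<gamma> z1 by (intro prod_has_sum_PiE hs) auto
    also have "(\<Prod>l\<in>qlabels N. suminf (\<lambda>r. hsum {..<n} r (?z l) * \<gamma> l ^ r)) = (\<Prod>l\<in>qlabels N. \<Prod>i<n. 1 / (1 - \<gamma> l * ?z l i))"
      using \<gamma> z1 by (intro prod.cong refl sums_unique[symmetric] hs) auto
    also have "... = (\<Prod>i<n. \<Prod>l\<in>qlabels N. 1 / (1 - \<gamma> l * ?z l i))" by (rule prod.swap)
    also have "... = (\<Prod>i<n. (\<Prod>j<N. 1 / (1 - \<alpha> j * inverse (z i))) * (\<Prod>j<N. 1 / (1 - \<beta> j * z i)))"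
      by (intro prod.cong refl) (simp add: prod_qlabels \<gamma>_def iv)
    also have "... = ?F g"
      unfolding proots_char_poly_diagonalised[OF V(1,2)] by (simp add: image_mset.compositionality o_def prod_unfold_prod_mset)
    finally show ?thesis unfolding fz[OF V(1,2)] .
  qed
  have fm: "f c \<in> borel_measurable \<mu>" for c
    using bmf_mult[OF bmf_const bmf_op_trace] by (auto simp: f_def[abs_def] bdd_measurable_def)
  have "((\<lambda>c. LINT g|\<mu>. f c g) has_sum (LINT g|\<mu>. ?F g)) ?I"
    using integral_has_sum[OF fm bound wsum Fsum] by blast
  hence "(LINT g|\<mu>. ?F g) = infsum (\<lambda>c. LINT g|\<mu>. f c g) ?I" by (rule infsumI[symmetric])
  also have "... = infsum (\<lambda>c. (\<Prod>l\<in>qlabels N. \<gamma> l ^ c l) * of_nat (card (ctab N (c \<circ> Inl) (c \<circ> Inr)))) ?I"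
    unfolding f_def using integral_op_trace[of N] N by (intro infsum_cong) simp
  also have "... = (\<Prod>x\<in>mvars N. 1 / (1 - \<gamma> (Inl (snd x)) * \<gamma> (Inr (fst x))))"
    by (rule has_sum_ctab[OF \<gamma>])
  also have "... = (\<Prod>i<N. \<Prod>j<N. 1 / (1 - \<alpha> j * \<beta> i))"
    by (simp add: mvars_def prod.cartesian_product' \<gamma>_def)
  finally show ?thesis .
qed

end

lemma hilbert_series_eq:
  assumes mean: "unitary_mean \<mu> Nc" and N: "Nf < Nc" and t: "cmod t < 1" and u: "cmod u < 1"
    and x: "!!j. j \<in> {1..Nf} ==> cmod (torus_coord Nf x j) = 1"
    and y: "!!j. j \<in> {1..Nf} ==> cmod (torus_coord Nf y j) = 1"
  shows "hilbert_series \<mu> Nf t u x y =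
    (\<Prod>i=1..Nf. \<Prod>j=1..Nf. 1 / (1 - t * u * torus_coord Nf x i * inverse (torus_coord Nf y j)))"
proof -
  interpret unitary_mean \<mu> Nc by (rule mean)
  define \<alpha> where "\<alpha> j = t * torus_coord Nf x (Suc j)" for j
  define \<beta> where "\<beta> j = u * inverse (torus_coord Nf y (Suc j))" for j
  have a: "cmod (\<alpha> j) < 1" "cmod (\<beta> j) < 1" if "j < Nf" for j
    using that t u x[of "Suc j"] y[of "Suc j"] by (auto simp: \<alpha>_def \<beta>_def norm_mult norm_inverse)
  have sh: "(\<Prod>i=1..Nf. f i) = (\<Prod>i<Nf. f (Suc i))" for f :: "nat => complex"
    using prod.atLeast_Suc_lessThan_Suc_shift[of f 0 Nf] by (simp add: atLeastLessThanSuc_atLeastAtMost atLeast0LessThan)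
  have "hilbert_series \<mu> Nf t u x y = (LINT U|\<mu>. (\<Prod>z\<in>#proots (char_poly U). (\<Prod>j<Nf. 1 / (1 - \<alpha> j * inverse z)) * (\<Prod>j<Nf. 1 / (1 - \<beta> j * z))))"
    unfolding hilbert_series_def flavour_factor_def sh \<alpha>_def \<beta>_def ..
  also have "... = (\<Prod>i<Nf. \<Prod>j<Nf. 1 / (1 - \<alpha> j * \<beta> i))"
    by (rule integral_flavour_product[OF N]) (rule a; assumption)+
  also have "... = (\<Prod>j<Nf. \<Prod>i<Nf. 1 / (1 - \<alpha> j * \<beta> i))" by (rule prod.swap)
  finally show ?thesis unfolding sh \<alpha>_def \<beta>_def by (simp add: mult_ac)
qed

section \<open>Haar measure on a smaller special unitary group\<close>

text \<open>Matrices as functions on all index pairs, extended by zero: on this type the product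
  topology provides separability, compactness and Borel sets.\<close>

definition mat_fun :: "nat => complex mat => nat \<times> nat => complex" where
  "mat_fun n g = (\<lambda>(i,j). if i < n \<and> j < n then g $$ (i,j) else 0)"

lemma polyfun_continuous_on: "polyfun X p ==> continuous_on S p"
proof (induction rule: polyfun.induct)
  case (polyfun_var x)
  show ?case by (rule continuous_on_subset[OF continuous_on_product_coordinates]) simp
qed (auto intro: continuous_intros)

text \<open>Density is phrased through the vanishing of polynomials. Countability is what allows
  almost-everywhere statements for all translates to be combined.\<close>

lemma SU_countable_dense:
  obtains D where "countable D" "D \<subseteq> SU_grp n"
    "!!X p g. polyfun X p ==> (!!h. h \<in> D ==> p (mat_fun n h) = 0) ==> g \<in> SU_grp n ==> p (mat_fun n g) = 0"
proof -
  obtain T where T: "countable T" "T \<subseteq> mat_fun n ` SU_grp n" "mat_fun n ` SU_grp n \<subseteq> closure T"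
    using separable[of "mat_fun n ` SU_grp n"] by blast
  obtain D where D: "countable D" "D \<subseteq> SU_grp n" "T = mat_fun n ` D"
    using T(1,2) by (metis countable_subset_image)
  show ?thesis
  proof (rule that[OF D(1,2)])
    fix X p g assume p: "polyfun X p" and z: "!!h. h \<in> D ==> p (mat_fun n h) = 0" and g: "g \<in> SU_grp n"
    have "closed {\<phi>. p \<phi> = 0}"
      by (intro closed_Collect_eq polyfun_continuous_on[OF p] continuous_on_const)
    hence "closure T \<subseteq> {\<phi>. p \<phi> = 0}" using z D(3) by (intro closure_minimal) auto
    thus "p (mat_fun n g) = 0" using T(3) g by auto
  qed
qed

text \<open>The image is cut out by continuous equations, hence closed, and lies in a product of
  closed unit discs because columns are unit vectors.\<close>

lemma compact_SU_fun: "compact (mat_fun n ` SU_grp n)"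
proof -
  let ?I = "{..<n} \<times> {..<n}"
  define K where "K = {\<phi> :: nat \<times> nat => complex. (\<forall>x. x \<notin> ?I --> \<phi> x = 0) \<and>
    (\<forall>i. i < n --> (\<forall>j. j < n --> (\<Sum>k<n. cnj (\<phi> (k,i)) * \<phi> (k,j)) = (if i = j then 1 else 0))) \<and>
    det (Matrix.mat n n (\<lambda>(i,j). \<phi> (i,j))) = 1}"
  have eq: "mat_fun n ` SU_grp n = K"
  proof (intro equalityI subsetI)
    fix \<phi> assume "\<phi> \<in> mat_fun n ` SU_grp n"
    then obtain g where g: "g \<in> SU_grp n" "\<phi> = mat_fun n g" by auto
    hence gc: "g \<in> carrier_mat n n" by simp
    have "(\<Sum>k<n. cnj (\<phi> (k,i)) * \<phi> (k,j)) = (if i = j then 1 else 0)" if "i < n" "j < n" for i j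
    proof -
      have "(mat_adjoint g * g) $$ (i,j) = (\<Sum>k<n. cnj (\<phi> (k,i)) * \<phi> (k,j))"
        using that gc by (subst mat_mult_index[OF mat_adjoint_carrier[OF gc] gc]) (auto simp: g(2) mat_fun_def)
      thus ?thesis using that Ugrp_adjoint_left[OF SU_Ugrp[OF g(1)]] by simp
    qed
    moreover have "Matrix.mat n n (\<lambda>(i,j). \<phi> (i,j)) = g" using gc by (auto simp: g(2) mat_fun_def)
    ultimately show "\<phi> \<in> K" using g by (auto simp: K_def SU_iff mat_fun_def)
  next
    fix \<phi> assume \<phi>: "\<phi> \<in> K"
    define g where "g = Matrix.mat n n (\<lambda>(i,j). \<phi> (i,j))"
    have gc: "g \<in> carrier_mat n n" by (simp add: g_def)
    have "mat_adjoint g * g = 1\<^sub>m n"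
    proof (rule eq_matI)
      fix i j assume "i < dim_row (1\<^sub>m n :: complex mat)" "j < dim_col (1\<^sub>m n :: complex mat)"
      hence ij: "i < n" "j < n" by auto
      have "(mat_adjoint g * g) $$ (i,j) = (\<Sum>k<n. cnj (\<phi> (k,i)) * \<phi> (k,j))"
        using ij gc by (subst mat_mult_index[OF mat_adjoint_carrier[OF gc] gc]) (auto simp: g_def)
      also have "... = (if i = j then 1 else 0)" using \<phi> ij by (simp add: K_def)
      finally show "(mat_adjoint g * g) $$ (i,j) = 1\<^sub>m n $$ (i,j)" using ij by simp
    qed (use gc in auto)
    moreover have "det g = 1" using \<phi> unfolding K_def g_def by blast
    ultimately have "g \<in> SU_grp n" using gc unfolding SU_iff Ugrp_iff by blast
    moreover have "\<phi> = mat_fun n g"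
    proof
      fix x
      have "\<phi> x = 0" if "x \<notin> ?I" using \<phi> that unfolding K_def by blast
      thus "\<phi> x = mat_fun n g x" by (cases x) (auto simp: mat_fun_def g_def)
    qed
    ultimately show "\<phi> \<in> mat_fun n ` SU_grp n" by blast
  qed
  have cc: "continuous_on UNIV (\<lambda>\<phi> :: nat \<times> nat => complex. \<phi> x)" for x
    by (rule continuous_on_product_coordinates)
  have "polyfun UNIV (\<lambda>\<phi> :: nat \<times> nat => complex. det (Matrix.mat n n (\<lambda>(i,j). \<phi> (i,j))))"
    by (intro polyfun_det polyfun_var) auto
  hence cd: "continuous_on UNIV (\<lambda>\<phi> :: nat \<times> nat => complex. det (Matrix.mat n n (\<lambda>(i,j). \<phi> (i,j))))"
    by (rule polyfun_continuous_on)
  have "K = (\<Inter>x\<in>-?I. {\<phi>. \<phi> x = 0}) \<inter>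
      (\<Inter>i\<in>{..<n}. \<Inter>j\<in>{..<n}. {\<phi>. (\<Sum>k<n. cnj (\<phi> (k,i)) * \<phi> (k,j)) = (if i = j then 1 else 0)}) \<inter>
      {\<phi>. det (Matrix.mat n n (\<lambda>(i,j). \<phi> (i,j))) = 1}"
    unfolding K_def by blast
  also have "closed ..."
    by (intro closed_Int closed_INT ballI closed_Collect_eq cd cc continuous_on_sum continuous_on_mult
        continuous_on_cnj continuous_on_const)
  finally have "closed K" .
  moreover have "K \<subseteq> (UNIV \<rightarrow>\<^sub>E cball 0 1)"
  proof
    fix \<phi> assume "\<phi> \<in> K"
    hence \<phi>: "!!x. x \<notin> ?I ==> \<phi> x = 0" "!!j. j < n ==> (\<Sum>k<n. cnj (\<phi> (k,j)) * \<phi> (k,j)) = 1"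
      by (auto simp: K_def)
    have "cmod (\<phi> x) \<le> 1" for x
    proof (cases "x \<in> ?I")
      case True
      then obtain i j where x: "x = (i,j)" "i < n" "j < n" by auto
      have "complex_of_real (\<Sum>k<n. (cmod (\<phi> (k,j)))\<^sup>2) = 1"
        using \<phi>(2)[OF x(3)] by (simp add: complex_norm_square mult.commute del: of_real_power)
      hence "(\<Sum>k<n. (cmod (\<phi> (k,j)))\<^sup>2) = 1" by (simp only: of_real_eq_1_iff)
      moreover have "(cmod (\<phi> (i,j)))\<^sup>2 \<le> (\<Sum>k<n. (cmod (\<phi> (k,j)))\<^sup>2)" using x by (intro member_le_sum) auto
      ultimately have "(cmod (\<phi> (i,j)))\<^sup>2 \<le> 1\<^sup>2" by simp
      thus ?thesis unfolding x(1) by (rule power2_le_imp_le) simp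
    qed (simp add: \<phi>(1))
    thus "\<phi> \<in> (UNIV \<rightarrow>\<^sub>E cball 0 1)" by auto
  qed
  moreover have "compact (UNIV \<rightarrow>\<^sub>E cball (0::complex) 1 :: (nat \<times> nat => complex) set)"
  proof -
    have "compactin (product_topology (\<lambda>_::nat \<times> nat. euclidean) UNIV) (UNIV \<rightarrow>\<^sub>E cball (0::complex) 1)"
      unfolding compactin_PiE by simp
    thus ?thesis by (simp add: euclidean_product_topology)
  qed
  ultimately have "compact K"
    using compact_Int_closed[of "UNIV \<rightarrow>\<^sub>E cball (0::complex) 1" K] by (simp add: Int_absorb1)
  thus ?thesis by (simp add: eq)
qed

lemma SU_continuous_bounded:
  fixes f :: "complex mat => complex"
  assumes f: "continuous_map (group_topology n (special_unitary_group n)) euclidean f"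
  obtains B where "!!g. g \<in> SU_grp n ==> cmod (f g) \<le> B"
proof -
  let ?K = "mat_fun n ` SU_grp n" and ?m = "\<lambda>\<phi>. Matrix.mat n n \<phi> :: complex mat"
  have inv: "?m (mat_fun n g) = g" if "g \<in> SU_grp n" for g
    using SU_carrier[OF that] by (intro eq_matI) (auto simp: mat_fun_def)
  have "continuous_map (top_of_set ?K) (group_topology n (special_unitary_group n)) ?m"
  proof (rule continuous_map_into_group_topology)
    fix i j assume "i < n" "j < n"
    thus "continuous_map (top_of_set ?K) euclidean (\<lambda>\<phi>. ?m \<phi> $$ (i,j))"
      using continuous_on_subset[OF continuous_on_product_coordinates[of "(i,j)"], of ?K] by simp
  qed (auto simp: inv)
  from continuous_map_compose[OF this f] have "continuous_on ?K (f \<circ> ?m)" by simp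
  hence "compact ((f \<circ> ?m) ` ?K)" by (rule compact_continuous_image[OF _ compact_SU_fun])
  hence "bounded ((f \<circ> ?m) ` ?K)" by (rule compact_imp_bounded)
  then obtain B where "\<forall>y\<in>(f \<circ> ?m) ` ?K. cmod y \<le> B" by (auto simp: bounded_iff)
  thus ?thesis using that[of B] inv by force
qed

lemma SU_subset: "SU_grp n \<subseteq> carrier_mat n n"
  by auto

text \<open>Open sets of the group are traces of open sets of functions on index pairs, and a map
  into such functions is Borel as soon as its coordinates are.\<close>

lemma measurable_into_group:
  assumes G: "carrier G \<subseteq> carrier_mat n n" and f: "f \<in> space M \<rightarrow> carrier G"
    and ent: "!!i j. i < n ==> j < n ==> (\<lambda>x. f x $$ (i,j)) \<in> borel_measurable M"
    and N: "sets N = sigma_sets (carrier G) {S. openin (group_topology n G) S}"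
  shows "f \<in> measurable M N"
proof (rule measurable_sigma_sets[OF N _ f])
  let ?I = "{..<n} \<times> {..<n}"
  show "{S. openin (group_topology n G) S} \<subseteq> Pow (carrier G)"
    using openin_subset[of "group_topology n G"] unfolding topspace_group_topology[OF G] by auto
  fix S assume "S \<in> {S. openin (group_topology n G) S}"
  then obtain S' where "openin (mat_topology n) S'" "S = S' \<inter> carrier G"
    by (auto simp: group_topology_def openin_subtopology)
  then obtain U where U: "openin (product_topology (\<lambda>_. euclidean) ?I) U"
      "S = ((\<lambda>A. \<lambda>ij\<in>?I. A $$ ij) -` U \<inter> carrier_mat n n) \<inter> carrier G"
    unfolding mat_topology_def openin_pullback_topology by auto
  define V where "V = {\<phi> :: nat \<times> nat => complex. restrict \<phi> ?I \<in> U}"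
  have "continuous_map euclidean (product_topology (\<lambda>_. euclidean) ?I) (\<lambda>\<phi> :: nat \<times> nat => complex. restrict \<phi> ?I)"
    unfolding continuous_map_componentwise by (auto intro!: continuous_on_product_coordinates)
  hence V: "open V" using U(1) by (auto simp: V_def continuous_map_def)
  have "(\<lambda>x. mat_fun n (f x)) \<in> borel_measurable M"
  proof (rule measurable_coordinatewise_then_product)
    fix x show "(\<lambda>y. mat_fun n (f y) x) \<in> borel_measurable M"
      by (cases x; cases "fst x < n \<and> snd x < n") (auto simp: mat_fun_def ent)
  qed
  hence "(\<lambda>x. mat_fun n (f x)) -` V \<inter> space M \<in> sets M" using V by (auto intro: measurable_sets)
  also have "(\<lambda>x. mat_fun n (f x)) -` V \<inter> space M = f -` S \<inter> space M"
  proof -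
    have "restrict (mat_fun n A) ?I = (\<lambda>ij\<in>?I. A $$ ij)" for A by (auto simp: mat_fun_def)
    thus ?thesis using f G by (auto simp: V_def U(2))
  qed
  finally show "f -` S \<inter> space M \<in> sets M" .
qed

lemma borel_measurable_cnj: "f \<in> borel_measurable M ==> (\<lambda>x. cnj (f x)) \<in> borel_measurable M"
  by (rule measurable_compose[OF _ borel_measurable_continuous_onI[OF continuous_on_cnj[OF continuous_on_id]]])

lemma borel_measurable_det:
  fixes f :: "'a => complex mat"
  assumes "!!x. f x \<in> carrier_mat n n" "!!i j. i < n ==> j < n ==> (\<lambda>x. f x $$ (i,j)) \<in> borel_measurable M"
  shows "(\<lambda>x. det (f x)) \<in> borel_measurable M"
  unfolding det_def'[OF assms(1)]
  by (intro borel_measurable_sum borel_measurable_times borel_measurable_const borel_measurable_prod assms(2))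
     (auto dest: permutes_in_image)

lemma borel_measurable_gs:
  assumes "!!i j. i < n ==> j < n ==> (\<lambda>x. B x $$ (i,j)) \<in> borel_measurable M" "k < n" "i < n"
  shows "(\<lambda>x. gs n (B x) k i) \<in> borel_measurable M"
  using assms(2,3)
proof (induction k arbitrary: i rule: less_induct)
  case (less k)
  have r: "(\<lambda>x. gs_res n (B x) k i) \<in> borel_measurable M" if "i < n" for i
    unfolding gs_res_def using less that
    by (intro borel_measurable_diff borel_measurable_sum borel_measurable_times borel_measurable_cnj assms(1)) auto
  have "(\<lambda>x. gs_norm n (B x) k) \<in> borel_measurable M"
    unfolding gs_norm_def using r
    by (intro measurable_compose[OF _ borel_measurable_sqrt] borel_measurable_sum borel_measurable_power borel_measurable_norm) auto
  thus ?case unfolding gs_eq using r less.prems by (intro borel_measurable_divide borel_measurable_of_real) auto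
qed

definition top_block :: "nat => complex mat => complex mat" where
  "top_block N g = Matrix.mat N N (\<lambda>(i,j). g $$ (i,j))"

text \<open>The phase that normalises the determinant multiplies from the right, so the left
  equivariance of \<open>gs_mat\<close> survives. On singular matrices the value is a
  default.\<close>

definition su_part :: "nat => complex mat => complex mat" where
  "su_part N B = (if det B = 0 then 1\<^sub>m N
     else gs_mat N B * mat_diag N (\<lambda>i. if i = 0 then cnj (det (gs_mat N B)) else 1))"

lemma top_block_carrier [simp]: "top_block N g \<in> carrier_mat N N"
  by (simp add: top_block_def)

lemma su_part_SU:
  assumes "B \<in> carrier_mat N N" shows "su_part N B \<in> SU_grp N"
proof (cases "det B = 0")
  case False
  let ?Q = "gs_mat N B" and ?D = "mat_diag N (\<lambda>i. if i = 0 then cnj (det (gs_mat N B)) else (1::complex))"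
  have Q: "?Q \<in> U_grp N" by (rule gs_mat_Ugrp[OF assms False])
  have D: "?D \<in> U_grp N" using Ugrp_det[OF Q] by (intro mat_diag_Ugrp) auto
  have "det ?D = (if N = 0 then 1 else cnj (det ?Q))"
    unfolding det_mat_diag by (simp add: prod.If_cases lessThan_def)
  moreover have "det ?Q = 1" if "N = 0" using that by simp
  ultimately have "det (?Q * ?D) = 1"
    using Ugrp_det[OF Q] by (auto simp: det_mult[of _ N] complex_norm_square[symmetric])
  thus ?thesis using Ugrp_mult[OF Q D] False by (simp add: su_part_def SU_iff)
qed (simp add: su_part_def SU_one)

lemma su_part_equivariant:
  assumes B: "B \<in> carrier_mat N N" "det B \<noteq> 0" and h: "h \<in> SU_grp N"
  shows "su_part N (h * B) = h * su_part N B"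
proof -
  have hU: "h \<in> U_grp N" "h \<in> carrier_mat N N" "det h = 1" using h by (auto simp: SU_iff)
  have d: "det (h * B) = det B" using hU B by (simp add: det_mult[of _ N])
  have e: "gs_mat N (h * B) = h * gs_mat N B" by (rule gs_mat_equivariant[OF hU(1) B(1)])
  have dQ: "det (gs_mat N (h * B)) = det (gs_mat N B)" using hU by (simp add: e det_mult[of _ N])
  show ?thesis unfolding su_part_def d dQ unfolding e using hU(2) B(2) by (simp add: assoc_mult_mat[of _ N N _ N _ N])
qed

definition su_embed :: "nat => nat => complex mat => complex mat" where
  "su_embed n N h = four_block_mat h (0\<^sub>m N (n - N)) (0\<^sub>m (n - N) N) (1\<^sub>m (n - N))"

lemma su_embed_SU:
  assumes h: "h \<in> SU_grp N" and N: "N \<le> n"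
  shows "su_embed n N h \<in> SU_grp n"
proof -
  let ?m = "n - N"
  have hc: "h \<in> carrier_mat N N" "mat_adjoint h \<in> carrier_mat N N" using h by auto
  have c: "su_embed n N h \<in> carrier_mat n n" using hc N by (auto simp: su_embed_def)
  have ad: "mat_adjoint (su_embed n N h) = su_embed n N (mat_adjoint h)"
    using hc N c by (intro eq_matI) (auto simp: su_embed_def)
  have "mat_adjoint (su_embed n N h) * su_embed n N h = su_embed n N (mat_adjoint h * h)"
    unfolding ad unfolding su_embed_def using hc
    by (subst mult_four_block_mat[of _ N N _ ?m _ ?m _ _ N _ ?m]) auto
  also have "... = 1\<^sub>m n" unfolding Ugrp_adjoint_left[OF SU_Ugrp[OF h]]
    using N by (intro eq_matI) (auto simp: su_embed_def)
  finally have "su_embed n N h \<in> U_grp n" using c by (simp add: Ugrp_iff)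
  moreover have "det (su_embed n N h) = 1"
    unfolding su_embed_def using hc h
    by (subst det_four_block_mat_upper_right_zero[of _ N _ ?m]) (auto simp: SU_iff)
  ultimately show ?thesis by (simp add: SU_iff)
qed

lemma top_block_su_embed:
  assumes h: "h \<in> carrier_mat N N" and g: "g \<in> carrier_mat n n" and N: "N \<le> n"
  shows "top_block N (su_embed n N h * g) = h * top_block N g"
proof (rule eq_matI)
  have c: "su_embed n N h \<in> carrier_mat n n" using h N by (auto simp: su_embed_def)
  fix i j assume "i < dim_row (h * top_block N g)" "j < dim_col (h * top_block N g)"
  hence ij: "i < N" "j < N" using h by (auto simp: top_block_def)
  have "top_block N (su_embed n N h * g) $$ (i,j) = (\<Sum>k<n. su_embed n N h $$ (i,k) * g $$ (k,j))"
    using ij N mat_mult_index[OF c g, of i j] by (simp add: top_block_def)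
  also have "... = (\<Sum>k<N. h $$ (i,k) * g $$ (k,j))"
    using ij N h by (intro sum.mono_neutral_cong_right) (auto simp: su_embed_def)
  also have "... = (h * top_block N g) $$ (i,j)"
    using ij by (subst mat_mult_index[OF h top_block_carrier]) (auto simp: top_block_def)
  finally show "top_block N (su_embed n N h * g) $$ (i,j) = (h * top_block N g) $$ (i,j)" .
qed (use h in \<open>auto simp: top_block_def\<close>)

text \<open>The unitary factor of the Gram--Schmidt decomposition of the upper left block is equivariant, so
  conditioning on the block being invertible and projecting gives an invariant measure.\<close>

lemma haar_SU_smaller:
  assumes haar: "normalised_haar_measure n (special_unitary_group n) \<mu>" and N: "N \<le> n"
  shows "\<exists>\<nu>. normalised_haar_measure N (special_unitary_group N) \<nu>"
proof -
  interpret unitary_mean \<mu> n using haar_unitary_mean[OF haar] by simp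
  have sp: "space \<mu> = SU_grp n" using haar by (simp add: normalised_haar_measure_def)
  define A where "A = {g \<in> space \<mu>. det (top_block N g) \<noteq> 0}"
  have bm: "(\<lambda>g. top_block N g $$ (i,j)) \<in> borel_measurable \<mu>" if "i < N" "j < N" for i j
    using that N entry_measurable[of i j] by (simp add: top_block_def)
  have dm: "(\<lambda>g. det (top_block N g)) \<in> borel_measurable \<mu>" by (rule borel_measurable_det[of _ N]) (auto intro: bm)
  have Am: "A \<in> sets \<mu>"
  proof -
    have "A = (\<lambda>g. det (top_block N g)) -` (- {0}) \<inter> space \<mu>" by (auto simp: A_def)
    thus ?thesis using dm by (auto intro: measurable_sets)
  qed
  \<comment> \<open>If the block were singular almost everywhere, then for some g the blocks of h g
    would be singular for all h in a countable dense set, hence for all h. Taking h inverse to g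
    contradicts the invertible block of the identity.\<close>
  have A0: "emeasure \<mu> A \<noteq> 0"
  proof
    assume "emeasure \<mu> A = 0"
    hence AE0: "AE g in \<mu>. det (top_block N g) = 0"
      by (intro AE_I[of _ _ A]) (auto simp: A_def Am[unfolded A_def])
    obtain D where D: "countable D" "D \<subseteq> SU_grp n" and dense:
      "!!X p g. polyfun X p ==> (!!h. h \<in> D ==> p (mat_fun n h) = 0) ==> g \<in> SU_grp n ==> p (mat_fun n g) = 0"
      using SU_countable_dense[of n] by metis
    have "AE g in \<mu>. det (top_block N (h * g)) = 0" if "h \<in> D" for h
    proof -
      have "AE g in distr \<mu> \<mu> (\<lambda>g. h * g). det (top_block N g) = 0"
        unfolding translate_distr[OF subsetD[OF D(2) that]] by (rule AE0)
      thus ?thesis using that D(2) dm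
        by (subst (asm) AE_distr_iff[OF translate_measurable]) auto
    qed
    hence "AE g in \<mu>. \<forall>h\<in>D. det (top_block N (h * g)) = 0"
      using D(1) by (simp add: AE_ball_countable)
    moreover have "\<not> (\<forall>h\<in>D. det (top_block N (h * g)) = 0)" if g: "g \<in> space \<mu>" for g
    proof
      assume z: "\<forall>h\<in>D. det (top_block N (h * g)) = 0"
      have gS: "g \<in> SU_grp n" "g \<in> carrier_mat n n" using g sp by auto
      define p where "p \<phi> = det (Matrix.mat N N (\<lambda>(i,j). \<Sum>k<n. \<phi> (i,k) * g $$ (k,j)))" for \<phi> :: "nat \<times> nat => complex"
      have pp: "polyfun UNIV p" unfolding p_def[abs_def]
        by (intro polyfun_det polyfun_sum polyfun_mult polyfun_var polyfun_const) auto
      have ph: "p (mat_fun n h) = det (top_block N (h * g))" if "h \<in> carrier_mat n n" for h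
        unfolding p_def top_block_def using N mat_mult_index[OF that gS(2)]
        by (intro arg_cong[of _ _ det] eq_matI) (auto simp: mat_fun_def)
      have "p (mat_fun n h) = 0" if "h \<in> D" for h using ph[of h] z D(2) that by auto
      hence "p (mat_fun n (mat_adjoint g)) = 0"
        using dense[OF pp _ SU_adjoint[OF gS(1)]] by blast
      hence "det (top_block N (1\<^sub>m n)) = 0"
        using ph[of "mat_adjoint g"] gS Ugrp_adjoint_left[OF SU_Ugrp[OF gS(1)]] by simp
      moreover have "top_block N (1\<^sub>m n :: complex mat) = 1\<^sub>m N" using N by (intro eq_matI) (auto simp: top_block_def)
      ultimately show False by simp
    qed
    ultimately have "AE g in \<mu>. False" by (auto elim: AE_mp intro!: AE_I2)
    thus False by simp
  qed
  define s where "s g = su_part N (top_block N g)" for g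
  let ?G = "special_unitary_group N"
  let ?O = "{S. openin (group_topology N ?G) S}"
  let ?u = "uniform_measure \<mu> A"
  define MS where "MS = sigma (SU_grp N) ?O"
  have Osub: "?O \<subseteq> Pow (SU_grp N)"
    using openin_subset[of "group_topology N ?G"] topspace_group_topology[OF SU_subset] by blast
  have MS: "space MS = SU_grp N" "sets MS = sigma_sets (SU_grp N) ?O"
    unfolding MS_def using Osub by (simp_all add: space_measure_of sets_measure_of)
  have sSU: "s g \<in> SU_grp N" for g by (simp add: s_def su_part_SU)
  have sm: "s \<in> measurable \<mu> MS"
  proof (rule measurable_into_group[of ?G N, OF _ _ _ MS(2)])
    fix i j assume ij: "i < N" "j < N"
    let ?Q = "\<lambda>g. gs_mat N (top_block N g)"
    have q: "(\<lambda>g. ?Q g $$ (i,j)) \<in> borel_measurable \<mu>" if "i < N" "j < N" for i j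
      using that borel_measurable_gs[of N "top_block N" \<mu> j i] bm by (simp add: gs_mat_def)
    have dQ: "(\<lambda>g. det (?Q g)) \<in> borel_measurable \<mu>" by (rule borel_measurable_det[of _ N]) (auto intro: q)
    have "s g $$ (i,j) = (if det (top_block N g) = 0 then (if i = j then 1 else 0)
        else ?Q g $$ (i,j) * (if j = 0 then cnj (det (?Q g)) else 1))" for g
      using ij by (simp add: s_def su_part_def mat_diag_mult_right[of _ N N])
    moreover have "{g \<in> space \<mu>. det (top_block N g) = 0} \<in> sets \<mu>"
    proof -
      have "{g \<in> space \<mu>. det (top_block N g) = 0} = (\<lambda>g. det (top_block N g)) -` {0} \<inter> space \<mu>" by auto
      thus ?thesis using dm by (auto intro: measurable_sets)
    qed
    ultimately show "(\<lambda>g. s g $$ (i,j)) \<in> borel_measurable \<mu>"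
      using q[OF ij] borel_measurable_cnj[OF dQ] by (auto intro!: measurable_If borel_measurable_times)
  qed (use sSU in auto)
  define \<nu> where "\<nu> = distr ?u MS s"
  have sm': "s \<in> measurable ?u MS" using sm by (simp cong: measurable_cong_sets)
  have em: "emeasure \<nu> S = emeasure \<mu> {g \<in> A. s g \<in> S} / emeasure \<mu> A" if "S \<in> sets MS" for S
  proof -
    have "emeasure \<nu> S = emeasure ?u (s -` S \<inter> space \<mu>)"
      unfolding \<nu>_def using emeasure_distr[OF sm' that] by simp
    also have "... = emeasure \<mu> (A \<inter> (s -` S \<inter> space \<mu>)) / emeasure \<mu> A"
      using Am measurable_sets[OF sm that] by (rule emeasure_uniform_measure)
    also have "A \<inter> (s -` S \<inter> space \<mu>) = {g \<in> A. s g \<in> S}" by (auto simp: A_def)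
    finally show ?thesis .
  qed
  have "prob_space \<nu>"
    unfolding \<nu>_def using A0 emeasure_finite
    by (intro prob_space.prob_space_distr[OF prob_space_uniform_measure sm']) auto
  moreover have "emeasure \<nu> ((\<lambda>k. h * k) ` S) = emeasure \<nu> S" if h: "h \<in> SU_grp N" and S: "S \<in> sets MS" for h S
  proof -
    let ?h = "mat_adjoint h"
    have h': "?h \<in> SU_grp N" by (rule SU_adjoint[OF h])
    have c: "h \<in> carrier_mat N N" "?h \<in> carrier_mat N N" using h by auto
    have hh: "h * (?h * k) = k" "?h * (h * k) = k" if "k \<in> carrier_mat N N" for k
      using that c Ugrp_adjoint_right[OF SU_Ugrp[OF h]] Ugrp_adjoint_left[OF SU_Ugrp[OF h]]
      by (auto simp flip: assoc_mult_mat[of _ N N _ N _ N])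
    have Ssub: "S \<subseteq> SU_grp N" using S sets.sets_into_space MS by blast
    have mt: "(\<lambda>k. ?h * k) \<in> measurable MS MS"
    proof (rule measurable_into_group[of ?G N, OF _ _ _ MS(2)])
      fix i j assume ij: "i < N" "j < N"
      have em: "(\<lambda>k. k $$ (a,b)) \<in> borel_measurable MS" if "a < N" "b < N" for a b
      proof (rule borel_measurableI)
        fix T :: "complex set" assume "open T"
        hence "openin (group_topology N ?G) {k \<in> topspace (group_topology N ?G). k $$ (a,b) \<in> T}"
          using continuous_map_group_entry[OF that] by (auto simp: continuous_map_def)
        moreover have "topspace (group_topology N ?G) = SU_grp N" by (rule topspace_group_topology) auto
        moreover have "(\<lambda>k. k $$ (a,b)) -` T \<inter> space MS = {k \<in> SU_grp N. k $$ (a,b) \<in> T}" using MS by auto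
        ultimately show "(\<lambda>k. k $$ (a,b)) -` T \<inter> space MS \<in> sets MS" unfolding MS(2) by auto
      qed
      have "(\<lambda>k. \<Sum>l<N. ?h $$ (i,l) * k $$ (l,j)) \<in> borel_measurable MS"
        using ij by (intro borel_measurable_sum borel_measurable_times borel_measurable_const em) auto
      moreover have "(?h * k) $$ (i,j) = (\<Sum>l<N. ?h $$ (i,l) * k $$ (l,j))" if "k \<in> space MS" for k
        using that MS ij c by (intro mat_mult_index) auto
      ultimately show "(\<lambda>k. (?h * k) $$ (i,j)) \<in> borel_measurable MS" by (simp cong: measurable_cong)
    qed (use h' MS SU_mult in auto)
    have img: "(\<lambda>k. h * k) ` S = (\<lambda>k. ?h * k) -` S \<inter> space MS"
    proof (intro equalityI subsetI)
      fix x assume "x \<in> (\<lambda>k. h * k) ` S"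
      then obtain k where k: "x = h * k" "k \<in> S" by auto
      moreover from this have "k \<in> SU_grp N" using Ssub by auto
      ultimately show "x \<in> (\<lambda>k. ?h * k) -` S \<inter> space MS" using hh(2)[of k] SU_mult[OF h] MS by auto
    next
      fix x assume "x \<in> (\<lambda>k. ?h * k) -` S \<inter> space MS"
      thus "x \<in> (\<lambda>k. h * k) ` S" using hh(1)[of x] MS by (intro image_eqI[of _ _ "?h * x"]) auto
    qed
    have imgS: "(\<lambda>k. h * k) ` S \<in> sets MS" unfolding img by (rule measurable_sets[OF mt S])
    \<comment> \<open>Translation by the inverse of h in the small group is induced by this
      translation in the large one, which preserves both the measure and the set A.\<close>
    let ?e = "su_embed n N ?h"
    have eS: "?e \<in> SU_grp n" by (rule su_embed_SU[OF h' N])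
    have tb: "top_block N (?e * g) = ?h * top_block N g" if "g \<in> space \<mu>" for g
      using that sp c N by (intro top_block_su_embed) auto
    have dt: "det (top_block N (?e * g)) = det (top_block N g)" if "g \<in> space \<mu>" for g
      unfolding tb[OF that] using h' c by (simp add: det_mult[of _ N] SU_iff)
    have st: "s (?e * g) = ?h * s g" if "g \<in> A" for g
      using that su_part_equivariant[OF top_block_carrier _ h', of g] tb[of g] by (auto simp: A_def s_def)
    have pre: "{g \<in> A. s g \<in> (\<lambda>k. h * k) ` S} = (\<lambda>g. ?e * g) -` {g \<in> A. s g \<in> S} \<inter> space \<mu>"
    proof -
      have "g \<in> A \<longleftrightarrow> ?e * g \<in> A" if "g \<in> space \<mu>" for g
        using that dt[OF that] translate_space[OF eS that] by (simp add: A_def)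
      moreover have "s g \<in> (\<lambda>k. h * k) ` S \<longleftrightarrow> s (?e * g) \<in> S" if "g \<in> A" for g
        unfolding img using MS sSU by (simp add: st[OF that])
      ultimately show ?thesis by (auto simp: A_def)
    qed
    have B: "{g \<in> A. s g \<in> S} \<in> sets \<mu>"
    proof -
      have "{g \<in> A. s g \<in> S} = A \<inter> (s -` S \<inter> space \<mu>)" by (auto simp: A_def)
      thus ?thesis using Am measurable_sets[OF sm S] by simp
    qed
    have "emeasure \<mu> {g \<in> A. s g \<in> (\<lambda>k. h * k) ` S} = emeasure (distr \<mu> \<mu> (\<lambda>g. ?e * g)) {g \<in> A. s g \<in> S}"
      unfolding pre by (rule emeasure_distr[OF translate_measurable[OF eS] B, symmetric])
    also have "... = emeasure \<mu> {g \<in> A. s g \<in> S}" by (simp add: translate_distr[OF eS])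
    finally show ?thesis by (simp add: em[OF S] em[OF imgS])
  qed
  ultimately have "normalised_haar_measure N ?G \<nu>"
    unfolding normalised_haar_measure_def mult_special_unitary_group
    by (simp add: \<nu>_def MS)
  thus ?thesis by blast
qed

section \<open>Schur orthogonality\<close>

lemma complex_mat_eigenvector:
  fixes P :: "complex mat"
  assumes P: "P \<in> carrier_mat d d" and d: "d > 0"
  obtains c v where "v \<in> carrier_vec d" "v \<noteq> 0\<^sub>v d" "P *\<^sub>v v = c \<cdot>\<^sub>v v"
proof -
  obtain es where es: "char_poly P = (\<Prod>a\<leftarrow>es. [:- a, 1:])" "length es = d"
    using char_poly_factorized[OF P] by auto
  then obtain a es' where "es = a # es'" using d by (cases es) auto
  hence "poly (char_poly P) a = 0" by (simp add: es(1))
  hence "eigenvalue P a" using eigenvalue_root_char_poly[OF P] by simp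
  thus ?thesis using that P by (auto simp: eigenvalue_def eigenvector_def)
qed

lemma mat_trace_mult_comm:
  assumes "A \<in> carrier_mat n n" "B \<in> carrier_mat n n"
  shows "mat_trace (A * B) = mat_trace (B * A)"
proof -
  have "mat_trace (A * B) = (\<Sum>i<n. \<Sum>k<n. A $$ (i,k) * B $$ (k,i))"
    using assms unfolding mat_trace_def by (intro sum.cong) (auto simp: mat_mult_index[of _ n n _ n] simp del: index_mult_mat(1))
  also have "... = (\<Sum>k<n. \<Sum>i<n. B $$ (k,i) * A $$ (i,k))" by (subst sum.swap) (simp add: mult.commute)
  also have "... = mat_trace (B * A)"
    using assms unfolding mat_trace_def by (intro sum.cong) (auto simp: mat_mult_index[of _ n n _ n] simp del: index_mult_mat(1))
  finally show ?thesis .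
qed

locale SU_rep =
  fixes N d :: nat and \<rho> :: "complex mat \<times> complex mat => complex mat"
  assumes rep: "representation N d \<rho>"
begin

lemma rho_carrier [simp]: "g \<in> SU_grp N ==> h \<in> SU_grp N ==> \<rho> (g,h) \<in> carrier_mat d d"
  using rep by (auto simp: representation_def hom_def general_linear_group_def Pi_iff)

lemma rho_mult:
  assumes "g \<in> SU_grp N" "h \<in> SU_grp N" "g' \<in> SU_grp N" "h' \<in> SU_grp N"
  shows "\<rho> (g * g', h * h') = \<rho> (g,h) * \<rho> (g',h')"
proof -
  let ?G = "special_unitary_group N"
  have "\<rho> ((g,h) \<otimes>\<^bsub>?G \<times>\<times> ?G\<^esub> (g',h')) = \<rho> (g,h) \<otimes>\<^bsub>general_linear_group d\<^esub> \<rho> (g',h')"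
    using rep assms unfolding representation_def hom_def by auto
  moreover have "A \<otimes>\<^bsub>general_linear_group d\<^esub> B = A * B" for A B
    by (simp only: general_linear_group_def monoid.select_convs)
  ultimately show ?thesis by (simp only: mult_DirProd mult_special_unitary_group)
qed

lemma rho_one: "\<rho> (1\<^sub>m N, 1\<^sub>m N) = 1\<^sub>m d"
proof -
  let ?E = "\<rho> (1\<^sub>m N, 1\<^sub>m N)"
  have E: "?E \<in> carrier_mat d d" by (simp add: SU_one)
  have "?E \<in> carrier (general_linear_group d)"
    using rep by (auto simp: representation_def hom_def Pi_iff SU_one)
  then obtain B where B: "inverts_mat ?E B" "inverts_mat B ?E"
    by (auto simp: general_linear_group_def invertible_mat_def)
  have Bc: "B \<in> carrier_mat d d"
    using B E unfolding inverts_mat_def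
    by (metis carrier_matD carrier_matI index_mult_mat(2,3) index_one_mat(2,3))
  have "?E = ?E * ?E" using rho_mult[of "1\<^sub>m N" "1\<^sub>m N" "1\<^sub>m N" "1\<^sub>m N"] by (simp add: SU_one)
  hence "B * ?E = B * (?E * ?E)" by simp
  also have "... = (B * ?E) * ?E" using Bc E by (simp add: assoc_mult_mat[of _ d d _ d _ d])
  finally have "B * ?E = (B * ?E) * ?E" .
  moreover have "B * ?E = 1\<^sub>m d" using B(2) Bc by (simp add: inverts_mat_def)
  ultimately have "1\<^sub>m d = 1\<^sub>m d * ?E" by simp
  thus ?thesis using E by simp
qed

lemma rho_adjoint_left:
  assumes "g \<in> SU_grp N" "h \<in> SU_grp N"
  shows "\<rho> (mat_adjoint g, mat_adjoint h) * \<rho> (g,h) = 1\<^sub>m d"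
  using rho_mult[of "mat_adjoint g" "mat_adjoint h" g h] assms
  by (simp add: SU_adjoint rho_one Ugrp_adjoint_left[OF SU_Ugrp[OF assms(1)]] Ugrp_adjoint_left[OF SU_Ugrp[OF assms(2)]])

text \<open>Turns the matrix entries into finite sums of products of functions of one factor each,
  so that measurability for the product measure follows from continuity in each factor.\<close>

lemma rho_split: "g \<in> SU_grp N ==> h \<in> SU_grp N ==> \<rho> (g,h) = \<rho> (g, 1\<^sub>m N) * \<rho> (1\<^sub>m N, h)"
  using rho_mult[of g "1\<^sub>m N" "1\<^sub>m N" h] by (simp add: SU_one)

lemma rho_continuous_left:
  assumes "i < d" "j < d"
  shows "continuous_map (group_topology N (special_unitary_group N)) euclidean (\<lambda>g. \<rho> (g, 1\<^sub>m N) $$ (i,j))"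
    and "continuous_map (group_topology N (special_unitary_group N)) euclidean (\<lambda>h. \<rho> (1\<^sub>m N, h) $$ (i,j))"
proof -
  let ?T = "group_topology N (special_unitary_group N)"
  have top: "topspace ?T = SU_grp N" by (rule topspace_group_topology[OF SU_subset])
  have r: "continuous_map (prod_topology ?T ?T) (group_topology d (general_linear_group d)) \<rho>"
    using rep by (simp add: representation_def)
  note e = continuous_map_compose[OF r continuous_map_group_entry[OF assms], unfolded o_def]
  have "continuous_map ?T (prod_topology ?T ?T) (\<lambda>g. (g, 1\<^sub>m N))" "continuous_map ?T (prod_topology ?T ?T) (\<lambda>h. (1\<^sub>m N, h))"
    by (auto simp: continuous_map_paired top SU_one)
  from this[THEN continuous_map_compose, OF e]
  show "continuous_map ?T euclidean (\<lambda>g. \<rho> (g, 1\<^sub>m N) $$ (i,j))"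
    and "continuous_map ?T euclidean (\<lambda>h. \<rho> (1\<^sub>m N, h) $$ (i,j))" by (simp_all add: o_def)
qed

end

locale SU_irrep_haar = SU_rep +
  fixes \<nu> :: "complex mat measure"
  assumes irr: "irreducible_representation N d \<rho>"
    and haar: "normalised_haar_measure N (special_unitary_group N) \<nu>"
begin

sublocale mean: unitary_mean \<nu> N
  using haar_unitary_mean[OF haar] by simp

sublocale pair: pair_prob_space \<nu> \<nu>
  by unfold_locales

lemma space_nu: "space \<nu> = SU_grp N"
  using haar by (simp add: normalised_haar_measure_def)

lemma bdd_measurable_continuous:
  fixes f :: "complex mat => complex"
  assumes "continuous_map (group_topology N (special_unitary_group N)) euclidean f"
  shows "bdd_measurable \<nu> f"
proof -
  obtain B where "!!g. g \<in> SU_grp N ==> cmod (f g) \<le> B" using SU_continuous_bounded[OF assms] by blast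
  thus ?thesis
    using haar_borel_measurable[OF haar SU_subset assms] by (auto simp: bdd_measurable_def space_nu)
qed

lemma bdd_measurable_fst: "bdd_measurable \<nu> f ==> bdd_measurable (\<nu> \<Otimes>\<^sub>M \<nu>) (\<lambda>p. f (fst p))"
  unfolding bdd_measurable_def by (auto simp: space_pair_measure intro: measurable_compose[OF measurable_fst])

lemma bdd_measurable_snd: "bdd_measurable \<nu> f ==> bdd_measurable (\<nu> \<Otimes>\<^sub>M \<nu>) (\<lambda>p. f (snd p))"
  unfolding bdd_measurable_def by (auto simp: space_pair_measure intro: measurable_compose[OF measurable_snd])

lemma integral_pair_product:
  assumes "bdd_measurable \<nu> f" "bdd_measurable \<nu> h"
  shows "(LINT p|(\<nu> \<Otimes>\<^sub>M \<nu>). f (fst p) * h (snd p)) = (LINT g|\<nu>. f g) * (LINT g|\<nu>. h g)"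
proof -
  have "integrable (\<nu> \<Otimes>\<^sub>M \<nu>) (\<lambda>p. f (fst p) * h (snd p))"
    by (intro pair.bmf_integrable bmf_mult bdd_measurable_fst bdd_measurable_snd assms)
  from pair.integral_fst'[OF this] show ?thesis by simp
qed

lemma integral_pair_translate:
  fixes f :: "complex mat \<times> complex mat => complex"
  assumes "g0 \<in> SU_grp N" "h0 \<in> SU_grp N" "f \<in> borel_measurable (\<nu> \<Otimes>\<^sub>M \<nu>)"
  shows "(LINT p|(\<nu> \<Otimes>\<^sub>M \<nu>). f (g0 * fst p, h0 * snd p)) = (LINT p|(\<nu> \<Otimes>\<^sub>M \<nu>). f p)"
proof -
  note t = mean.translate_measurable[OF assms(1)] mean.translate_measurable[OF assms(2)]
  have m: "(\<lambda>p. (g0 * fst p, h0 * snd p)) \<in> measurable (\<nu> \<Otimes>\<^sub>M \<nu>) (\<nu> \<Otimes>\<^sub>M \<nu>)"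
    by (intro measurable_Pair measurable_compose[OF measurable_fst t(1)] measurable_compose[OF measurable_snd t(2)])
  have "\<nu> \<Otimes>\<^sub>M \<nu> = distr \<nu> \<nu> (\<lambda>g. g0 * g) \<Otimes>\<^sub>M distr \<nu> \<nu> (\<lambda>h. h0 * h)"
    by (simp add: mean.translate_distr assms)
  also have "... = distr (\<nu> \<Otimes>\<^sub>M \<nu>) (\<nu> \<Otimes>\<^sub>M \<nu>) (\<lambda>(x,y). (g0 * x, h0 * y))"
    using t by (intro pair_measure_distr) (simp_all add: mean.translate_distr assms mean.sigma_finite_measure_axioms)
  finally have "(LINT p|(\<nu> \<Otimes>\<^sub>M \<nu>). f p) = (LINT p|(distr (\<nu> \<Otimes>\<^sub>M \<nu>) (\<nu> \<Otimes>\<^sub>M \<nu>) (\<lambda>p. (g0 * fst p, h0 * snd p))). f p)"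
    by (simp add: case_prod_unfold)
  also have "... = (LINT p|(\<nu> \<Otimes>\<^sub>M \<nu>). f (g0 * fst p, h0 * snd p))"
    by (rule integral_distr[OF m assms(3)])
  finally show ?thesis by simp
qed

text \<open>The inverse in SU(N) x SU(N). It takes the place of complex conjugation in the inner
  product of characters, since \<rho> need not be unitary.\<close>

definition adj2 :: "complex mat \<times> complex mat => complex mat \<times> complex mat" where
  "adj2 p = (mat_adjoint (fst p), mat_adjoint (snd p))"

lemma bdd_measurable_rho:
  assumes "i < d" "j < d"
  shows "bdd_measurable (\<nu> \<Otimes>\<^sub>M \<nu>) (\<lambda>p. \<rho> p $$ (i,j))"
    and "bdd_measurable (\<nu> \<Otimes>\<^sub>M \<nu>) (\<lambda>p. \<rho> (adj2 p) $$ (i,j))"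
proof -
  let ?T = "group_topology N (special_unitary_group N)"
  have top: "topspace ?T = SU_grp N" by (rule topspace_group_topology[OF SU_subset])
  have adj: "continuous_map ?T ?T mat_adjoint"
  proof (rule continuous_map_into_group_topology[OF SU_subset])
    fix i j assume ij: "i < N" "j < N"
    have "continuous_map ?T euclidean (cnj \<circ> (\<lambda>g. g $$ (j,i)))"
      using continuous_map_compose[OF continuous_map_group_entry[OF ij(2,1)], of euclidean cnj]
      by (simp add: continuous_on_cnj continuous_on_id)
    thus "continuous_map ?T euclidean (\<lambda>g. mat_adjoint g $$ (i,j))"
      by (rule continuous_map_eq) (use ij in \<open>auto simp: top mat_adjoint_index_cnj[of _ N N]\<close>)
  qed (auto simp: top SU_adjoint)
  have sp: "fst p \<in> SU_grp N" "snd p \<in> SU_grp N" if "p \<in> space (\<nu> \<Otimes>\<^sub>M \<nu>)" for p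
    using that by (auto simp: space_pair_measure space_nu)
  have e: "\<rho> (g,h) $$ (i,j) = (\<Sum>k<d. \<rho> (g, 1\<^sub>m N) $$ (i,k) * \<rho> (1\<^sub>m N, h) $$ (k,j))"
    if "g \<in> SU_grp N" "h \<in> SU_grp N" for g h
    using that assms by (subst rho_split) (auto simp: SU_one intro!: mat_mult_index simp del: index_mult_mat(1))
  have "bdd_measurable (\<nu> \<Otimes>\<^sub>M \<nu>) (\<lambda>p. \<Sum>k<d. \<rho> (fst p, 1\<^sub>m N) $$ (i,k) * \<rho> (1\<^sub>m N, snd p) $$ (k,j))"
    using assms by (intro bmf_sum bmf_mult bdd_measurable_fst bdd_measurable_snd bdd_measurable_continuous rho_continuous_left) auto
  moreover have "\<rho> p $$ (i,j) = (\<Sum>k<d. \<rho> (fst p, 1\<^sub>m N) $$ (i,k) * \<rho> (1\<^sub>m N, snd p) $$ (k,j))"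
    if "p \<in> space (\<nu> \<Otimes>\<^sub>M \<nu>)" for p using e[OF sp[OF that]] by simp
  ultimately show "bdd_measurable (\<nu> \<Otimes>\<^sub>M \<nu>) (\<lambda>p. \<rho> p $$ (i,j))" by (subst bmf_cong) auto
  note c = continuous_map_compose[OF adj rho_continuous_left(1), unfolded o_def] continuous_map_compose[OF adj rho_continuous_left(2), unfolded o_def]
  have "bdd_measurable (\<nu> \<Otimes>\<^sub>M \<nu>) (\<lambda>p. \<Sum>k<d. \<rho> (mat_adjoint (fst p), 1\<^sub>m N) $$ (i,k) * \<rho> (1\<^sub>m N, mat_adjoint (snd p)) $$ (k,j))"
    using assms by (intro bmf_sum bmf_mult bdd_measurable_fst[of "\<lambda>g. \<rho> (mat_adjoint g, 1\<^sub>m N) $$ (i,_)"]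
       bdd_measurable_snd[of "\<lambda>g. \<rho> (1\<^sub>m N, mat_adjoint g) $$ (_,j)"] bdd_measurable_continuous c) auto
  moreover have "\<rho> (adj2 p) $$ (i,j) = (\<Sum>k<d. \<rho> (mat_adjoint (fst p), 1\<^sub>m N) $$ (i,k) * \<rho> (1\<^sub>m N, mat_adjoint (snd p)) $$ (k,j))"
    if "p \<in> space (\<nu> \<Otimes>\<^sub>M \<nu>)" for p unfolding adj2_def using sp[OF that] by (intro e SU_adjoint)
  ultimately show "bdd_measurable (\<nu> \<Otimes>\<^sub>M \<nu>) (\<lambda>p. \<rho> (adj2 p) $$ (i,j))" by (subst bmf_cong) auto
qed

text \<open>Schur orthogonality: averaging \<rho>(p) E \<rho>(p)^-1 for a matrix unit E gives the
  intertwiner \<open>P j k\<close>. Irreducibility makes it scalar, and its trace determines the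
  scalar.\<close>

theorem integral_character_square:
  "(LINT p|(\<nu> \<Otimes>\<^sub>M \<nu>). mat_trace (\<rho> p) * mat_trace (\<rho> (adj2 p))) = 1"
proof -
  let ?\<kappa> = "\<nu> \<Otimes>\<^sub>M \<nu>"
  have d: "d > 0" using irr by (simp add: irreducible_representation_def)
  define \<Phi> where "\<Phi> i j k l = (LINT p|?\<kappa>. \<rho> p $$ (i,j) * \<rho> (adj2 p) $$ (k,l))" for i j k l
  define P where "P j k = Matrix.mat d d (\<lambda>(i,l). \<Phi> i j k l)" for j k
  have Pc: "P j k \<in> carrier_mat d d" for j k by (simp add: P_def)
  have bm: "bdd_measurable ?\<kappa> (\<lambda>p. \<rho> p $$ (i,j) * \<rho> (adj2 p) $$ (k,l))" if "i < d" "j < d" "k < d" "l < d" for i j k l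
    using that by (intro bmf_mult bdd_measurable_rho)
  have sp: "fst p \<in> SU_grp N" "snd p \<in> SU_grp N" if "p \<in> space ?\<kappa>" for p
    using that by (auto simp: space_pair_measure space_nu)
  have comm: "\<rho> (g,h) * P j k = P j k * \<rho> (g,h)" if gh: "g \<in> SU_grp N" "h \<in> SU_grp N" and jk: "j < d" "k < d" for g h j k
  proof (rule eq_matI)
    have rc: "\<rho> (g,h) \<in> carrier_mat d d" using gh by simp
    fix i l assume "i < dim_row (P j k * \<rho> (g,h))" "l < dim_col (P j k * \<rho> (g,h))"
    hence il: "i < d" "l < d" using rc Pc[of j k] by auto
    let ?F = "\<lambda>p. \<rho> p $$ (i,j) * (\<Sum>b<d. \<rho> (adj2 p) $$ (k,b) * \<rho> (g,h) $$ (b,l))"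
    have Fm: "bdd_measurable ?\<kappa> ?F"
      using il jk by (intro bmf_mult bmf_sum bmf_const bdd_measurable_rho) auto
    have "(\<rho> (g,h) * P j k) $$ (i,l) = (\<Sum>a<d. \<rho> (g,h) $$ (i,a) * \<Phi> a j k l)"
      using il by (subst mat_mult_index[OF rc Pc]) (auto simp: P_def)
    also have "... = (LINT p|?\<kappa>. (\<Sum>a<d. \<rho> (g,h) $$ (i,a) * (\<rho> p $$ (a,j) * \<rho> (adj2 p) $$ (k,l))))"
      unfolding \<Phi>_def using il jk
      by (subst Bochner_Integration.integral_sum) (auto intro!: pair.bmf_integrable bmf_mult bmf_const bdd_measurable_rho)
    also have "... = (LINT p|?\<kappa>. ?F (g * fst p, h * snd p))"
    proof (intro Bochner_Integration.integral_cong refl)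
      fix p assume p: "p \<in> space ?\<kappa>"
      note s = sp[OF p]
      have c: "\<rho> p \<in> carrier_mat d d" "\<rho> (adj2 p) \<in> carrier_mat d d" "\<rho> (mat_adjoint g, mat_adjoint h) \<in> carrier_mat d d"
        using s gh rho_carrier[of "fst p" "snd p"] by (auto simp: adj2_def SU_adjoint)
      have "\<rho> (g * fst p, h * snd p) = \<rho> (g,h) * \<rho> p" using rho_mult[OF gh s] by simp
      moreover have "\<rho> (adj2 (g * fst p, h * snd p)) = \<rho> (adj2 p) * \<rho> (mat_adjoint g, mat_adjoint h)"
        using rho_mult[of "mat_adjoint (fst p)" "mat_adjoint (snd p)" "mat_adjoint g" "mat_adjoint h"] s gh
        by (simp add: adj2_def SU_adjoint mat_adjoint_mult[of _ N N _ N])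
      moreover have "(\<Sum>b<d. (\<rho> (adj2 p) * \<rho> (mat_adjoint g, mat_adjoint h)) $$ (k,b) * \<rho> (g,h) $$ (b,l)) = \<rho> (adj2 p) $$ (k,l)"
      proof -
        have "(\<Sum>b<d. (\<rho> (adj2 p) * \<rho> (mat_adjoint g, mat_adjoint h)) $$ (k,b) * \<rho> (g,h) $$ (b,l))
          = (\<rho> (adj2 p) * \<rho> (mat_adjoint g, mat_adjoint h) * \<rho> (g,h)) $$ (k,l)"
          using jk il c rc by (intro mat_mult_index[symmetric]) auto
        also have "\<rho> (adj2 p) * \<rho> (mat_adjoint g, mat_adjoint h) * \<rho> (g,h) = \<rho> (adj2 p)"
          using c rc rho_adjoint_left[OF gh] by (simp add: assoc_mult_mat[of _ d d _ d _ d])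
        finally show ?thesis .
      qed
      moreover have "(\<Sum>a<d. \<rho> (g,h) $$ (i,a) * \<rho> p $$ (a,j)) = (\<rho> (g,h) * \<rho> p) $$ (i,j)"
        using jk il c rc by (intro mat_mult_index[symmetric]) auto
      ultimately show "(\<Sum>a<d. \<rho> (g,h) $$ (i,a) * (\<rho> p $$ (a,j) * \<rho> (adj2 p) $$ (k,l))) = ?F (g * fst p, h * snd p)"
        by (simp add: mult.assoc[symmetric] sum_distrib_right[symmetric] del: index_mult_mat)
    qed
    also have "... = (LINT p|?\<kappa>. ?F p)"
      using Fm by (intro integral_pair_translate gh) (simp add: bdd_measurable_def)
    also have "... = (LINT p|?\<kappa>. (\<Sum>b<d. \<rho> p $$ (i,j) * \<rho> (adj2 p) $$ (k,b) * \<rho> (g,h) $$ (b,l)))"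
      by (simp add: sum_distrib_left mult.assoc)
    also have "... = (\<Sum>b<d. \<Phi> i j k b * \<rho> (g,h) $$ (b,l))"
      unfolding \<Phi>_def using il jk
      by (subst Bochner_Integration.integral_sum) (auto intro!: pair.bmf_integrable bmf_mult bmf_const bdd_measurable_rho)
    also have "... = (P j k * \<rho> (g,h)) $$ (i,l)"
      using il by (subst mat_mult_index[OF Pc rc]) (auto simp: P_def)
    finally show "(\<rho> (g,h) * P j k) $$ (i,l) = (P j k * \<rho> (g,h)) $$ (i,l)" .
  qed (use Pc[of j k] carrier_matD[OF rho_carrier[OF gh]] in auto)
  \<comment> \<open>Schur's lemma: an eigenspace of an intertwiner is an invariant subspace, hence
    everything.\<close>
  have scalar: "\<exists>c. P j k = c \<cdot>\<^sub>m 1\<^sub>m d" if jk: "j < d" "k < d" for j k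
  proof -
    obtain c v where v: "v \<in> carrier_vec d" "v \<noteq> 0\<^sub>v d" "P j k *\<^sub>v v = c \<cdot>\<^sub>v v"
      using complex_mat_eigenvector[OF Pc d] by blast
    define W where "W = {v \<in> carrier_vec d. P j k *\<^sub>v v = c \<cdot>\<^sub>v v}"
    have "invariant_subspace N d \<rho> W"
      unfolding invariant_subspace_def
    proof (intro conjI ballI allI)
      show "0\<^sub>v d \<in> W" using Pc[of j k] by (auto simp: W_def intro!: eq_vecI)
      fix v assume v: "v \<in> W"
      { fix w assume "w \<in> W"
        thus "v + w \<in> W" using v Pc[of j k] by (auto simp: W_def mult_add_distrib_mat_vec[of _ d d] smult_add_distrib_vec[of _ d]) }
      { fix a show "a \<cdot>\<^sub>v v \<in> W" using v Pc[of j k]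
          by (auto simp: W_def mult_mat_vec[of _ d d] smult_smult_assoc mult.commute) }
      fix p assume "p \<in> carrier (special_unitary_group N \<times>\<times> special_unitary_group N)"
      then obtain g h where p: "p = (g,h)" "g \<in> SU_grp N" "h \<in> SU_grp N" by auto
      have rc: "\<rho> (g,h) \<in> carrier_mat d d" using p by simp
      have vc: "v \<in> carrier_vec d" "P j k *\<^sub>v v = c \<cdot>\<^sub>v v" using v by (auto simp: W_def)
      have "P j k *\<^sub>v (\<rho> p *\<^sub>v v) = (P j k * \<rho> (g,h)) *\<^sub>v v"
        using p rc Pc vc by (simp add: assoc_mult_mat_vec[of _ d d _ d])
      also have "... = \<rho> (g,h) *\<^sub>v (P j k *\<^sub>v v)"
        unfolding comm[OF p(2,3) jk, symmetric] using rc Pc vc by (intro assoc_mult_mat_vec) auto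
      also have "... = c \<cdot>\<^sub>v (\<rho> p *\<^sub>v v)" using vc rc p by (simp add: mult_mat_vec[of _ d d])
      finally show "\<rho> p *\<^sub>v v \<in> W"
        using p mult_mat_vec_carrier[OF rc vc(1)] by (auto simp: W_def)
    qed (auto simp: W_def)
    moreover have "W \<noteq> {0\<^sub>v d}" using v by (auto simp: W_def)
    ultimately have W: "W = carrier_vec d" using irr by (auto simp: irreducible_representation_def)
    have "P j k $$ (i,l) = (c \<cdot>\<^sub>m 1\<^sub>m d) $$ (i,l)" if "i < d" "l < d" for i l
    proof -
      have "unit_vec d l \<in> W" unfolding W using that by simp
      hence "P j k *\<^sub>v unit_vec d l = c \<cdot>\<^sub>v unit_vec d l" by (simp add: W_def)
      hence "vec_index (P j k *\<^sub>v unit_vec d l) i = vec_index (c \<cdot>\<^sub>v unit_vec d l) i" by simp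
      thus ?thesis using that Pc[of j k] by (simp add: scalar_prod_right_unit[of _ d])
    qed
    hence "P j k = c \<cdot>\<^sub>m 1\<^sub>m d" using Pc[of j k] by (intro eq_matI) auto
    thus ?thesis by blast
  qed
  have val: "\<Phi> j j k k = (if j = k then 1 / of_nat d else 0)" if jk: "j < d" "k < d" for j k
  proof -
    obtain c where c: "P j k = c \<cdot>\<^sub>m 1\<^sub>m d" using scalar[OF jk] by blast
    have diag: "\<Phi> i j k l = (if i = l then c else 0)" if "i < d" "l < d" for i l
    proof -
      have "P j k $$ (i,l) = (c \<cdot>\<^sub>m 1\<^sub>m d) $$ (i,l)" using c by simp
      thus ?thesis using that by (simp add: P_def)
    qed
    have "of_nat d * c = (\<Sum>i<d. \<Phi> i j k i)" by (simp add: diag)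
    also have "... = (LINT p|?\<kappa>. (\<Sum>i<d. \<rho> p $$ (i,j) * \<rho> (adj2 p) $$ (k,i)))"
      unfolding \<Phi>_def using jk
      by (subst Bochner_Integration.integral_sum) (auto intro!: pair.bmf_integrable bmf_mult bmf_const bdd_measurable_rho)
    also have "... = (LINT p|?\<kappa>. (if j = k then 1 else 0))"
    proof (intro Bochner_Integration.integral_cong refl)
      fix p assume p: "p \<in> space ?\<kappa>"
      note s = sp[OF p]
      have c: "\<rho> p \<in> carrier_mat d d" "\<rho> (adj2 p) \<in> carrier_mat d d"
        using s rho_carrier[of "fst p" "snd p"] by (auto simp: adj2_def SU_adjoint)
      have "(\<Sum>i<d. \<rho> p $$ (i,j) * \<rho> (adj2 p) $$ (k,i)) = (\<rho> (adj2 p) * \<rho> p) $$ (k,j)"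
        using mat_mult_index[OF c(2,1) jk(2,1)] by (simp add: mult.commute)
      also have "\<rho> (adj2 p) * \<rho> p = 1\<^sub>m d" using rho_adjoint_left[OF s] by (simp add: adj2_def)
      finally show "(\<Sum>i<d. \<rho> p $$ (i,j) * \<rho> (adj2 p) $$ (k,i)) = (if j = k then 1 else 0)" using jk by auto
    qed
    also have "... = (if j = k then 1 else 0)" by (simp add: pair.prob_space)
    finally have "c = (if j = k then 1 / of_nat d else 0)" using d by (auto simp: field_simps)
    thus ?thesis using jk by (simp add: diag)
  qed
  have "(LINT p|?\<kappa>. mat_trace (\<rho> p) * mat_trace (\<rho> (adj2 p))) = (LINT p|?\<kappa>. (\<Sum>j<d. \<Sum>k<d. \<rho> p $$ (j,j) * \<rho> (adj2 p) $$ (k,k)))"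
  proof (intro Bochner_Integration.integral_cong refl)
    fix p assume p: "p \<in> space ?\<kappa>"
    have "\<rho> p \<in> carrier_mat d d" "\<rho> (adj2 p) \<in> carrier_mat d d"
      using sp[OF p] rho_carrier[of "fst p" "snd p"] by (auto simp: adj2_def SU_adjoint)
    thus "mat_trace (\<rho> p) * mat_trace (\<rho> (adj2 p)) = (\<Sum>j<d. \<Sum>k<d. \<rho> p $$ (j,j) * \<rho> (adj2 p) $$ (k,k))"
      by (simp add: mat_trace_def sum_product)
  qed
  also have "... = (\<Sum>j<d. LINT p|?\<kappa>. (\<Sum>k<d. \<rho> p $$ (j,j) * \<rho> (adj2 p) $$ (k,k)))"
    by (intro Bochner_Integration.integral_sum pair.bmf_integrable bmf_sum bm) auto
  also have "... = (\<Sum>j<d. \<Sum>k<d. \<Phi> j j k k)"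
    unfolding \<Phi>_def
    by (intro sum.cong refl Bochner_Integration.integral_sum pair.bmf_integrable bm) auto
  also have "... = 1" using d by (simp add: val)
  finally show ?thesis .
qed

end

section \<open>Weight decomposition\<close>

text \<open>After unitary triangularisation the diagonal entries are 0 or 1, and the trace counts
  the ones. If there are none, the strictly triangular idempotent is zero. The traces become the
  weight multiplicities.\<close>

lemma idempotent_trace:
  fixes P :: "complex mat"
  assumes P: "P \<in> carrier_mat d d" and idem: "P * P = P"
  obtains m :: nat where "mat_trace P = of_nat m" "m \<le> d" "m = 0 \<longleftrightarrow> P = 0\<^sub>m d d"
proof -
  obtain V where V: "V \<in> U_grp d" and ut: "upper_triangular (mat_adjoint V * P * V)"
    using unitary_triangularisation[OF P] by blast
  note assoc = assoc_mult_mat[of _ d d _ d _ d]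
  have c: "V \<in> carrier_mat d d" "mat_adjoint V \<in> carrier_mat d d" using V by auto
  define T where "T = mat_adjoint V * P * V"
  have T: "T \<in> carrier_mat d d" using c P by (simp add: T_def)
  have VV: "V * (mat_adjoint V * X) = X" if "X \<in> carrier_mat d d" for X
    using that c Ugrp_adjoint_right[OF V] by (simp flip: assoc)
  have TT: "T * T = T"
  proof -
    have "T * T = mat_adjoint V * ((P * P) * V)" unfolding T_def using c P by (simp add: assoc VV)
    thus ?thesis unfolding idem T_def using c P by (simp add: assoc)
  qed
  have tr: "mat_trace P = mat_trace T"
  proof -
    have "mat_trace T = mat_trace (V * (mat_adjoint V * P))"
      unfolding T_def using c P by (intro mat_trace_mult_comm) auto
    thus ?thesis using VV P by simp
  qed
  have ut': "T $$ (i,j) = 0" if "j < i" "i < d" for i j using upper_triangularD[OF ut] that T by (auto simp: T_def)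
  have ent: "T $$ (i,j) = (\<Sum>k\<in>{i..j}. T $$ (i,k) * T $$ (k,j))" if "i \<le> j" "j < d" for i j
  proof -
    have "T $$ (i,j) = (\<Sum>k<d. T $$ (i,k) * T $$ (k,j))"
      using that mat_mult_index[OF T T, of i j] TT by simp
    also have "... = (\<Sum>k\<in>{i..j}. T $$ (i,k) * T $$ (k,j))"
      using that ut' by (intro sum.mono_neutral_right) (auto simp: not_le)
    finally show ?thesis .
  qed
  have dg: "T $$ (i,i) = 0 \<or> T $$ (i,i) = 1" if "i < d" for i
    using ent[of i i] that by auto
  define m where "m = card {i. i < d \<and> T $$ (i,i) = 1}"
  have "mat_trace T = (\<Sum>i<d. if T $$ (i,i) = 1 then 1 else 0)"
    unfolding mat_trace_def using dg T by (intro sum.cong) auto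
  also have "... = of_nat m" unfolding m_def by (simp add: sum.If_cases Int_def)
  finally have tm: "mat_trace P = of_nat m" using tr by simp
  have md: "m \<le> d" unfolding m_def using card_mono[of "{..<d}" "{i. i < d \<and> T $$ (i,i) = 1}"] by auto
  have "P = 0\<^sub>m d d" if "m = 0"
  proof -
    have "{i. i < d \<and> T $$ (i,i) = 1} = {}" using that unfolding m_def by (subst (asm) card_0_eq) auto
    hence d0: "T $$ (i,i) = 0" if "i < d" for i using dg[OF that] that by auto
    have "T $$ (i,j) = 0" if "i \<le> j" "j < d" for i j
      using that
    \<comment> \<open>In T T = T every product on the right involves an entry on the diagonal or
      nearer to it.\<close>
    proof (induction "j - i" arbitrary: i j rule: less_induct)
      case less
      show ?case
      proof (cases "i = j")
        case False
        have "T $$ (i,k) * T $$ (k,j) = 0" if k: "k \<in> {i..j}" for k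
        proof (cases "k = i")
          case True thus ?thesis using d0 less.prems by auto
        next
          case f: False
          hence "j - k < j - i" using k less.prems by auto
          thus ?thesis using less.hyps[of j k] less.prems k by auto
        qed
        hence "(\<Sum>k\<in>{i..j}. T $$ (i,k) * T $$ (k,j)) = 0" by (intro sum.neutral) auto
        thus ?thesis using ent[OF less.prems] by simp
      qed (use d0 less.prems in auto)
    qed
    hence "T = 0\<^sub>m d d" using T ut' by (intro eq_matI) (auto, metis not_le)
    moreover have "P = V * T * mat_adjoint V"
    proof -
      have "V * T * mat_adjoint V = (V * (mat_adjoint V * P)) * (V * mat_adjoint V)"
        unfolding T_def using c P by (simp add: assoc)
      thus ?thesis using VV[OF P] Ugrp_adjoint_right[OF V] P by simp
    qed
    ultimately show ?thesis using c by simp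
  qed
  moreover have "m = 0" if "P = 0\<^sub>m d d"
    using tm that by (simp add: mat_trace_def)
  ultimately show ?thesis using that tm md by blast
qed

section \<open>Fourier coefficients on the unit circle\<close>

lemma cis_powi: "cis t powi k = cis (of_int k * t)"
proof (cases "k \<ge> 0")
  case True
  thus ?thesis by (simp add: power_int_def Complex.DeMoivre)
next
  case False
  thus ?thesis by (simp add: power_int_def Complex.DeMoivre cis_inverse)
qed

lemma powi_mult_unit: "cmod z = 1 ==> z powi a * z powi b = z powi (a + b)"
  by (subst power_int_add) auto

definition fourier :: "(complex => complex) => int => complex" where
  "fourier f k = integral {0..2*pi} (\<lambda>t. f (cis t) * cis (- of_int k * t)) / of_real (2 * pi)"

lemma continuous_on_cis_comp:
  assumes "continuous_on (sphere 0 1) f" shows "continuous_on S (\<lambda>t. f (cis t))"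
  by (rule continuous_on_compose2[OF assms]) (auto intro!: continuous_intros)

lemma fourier_integrable:
  assumes "continuous_on (sphere 0 1) f"
  shows "(\<lambda>t. f (cis t) * cis (a * t)) integrable_on {0..2*pi}"
  by (intro integrable_continuous_interval continuous_intros continuous_on_cis_comp assms)

lemma fourier_sum:
  assumes "finite I" "!!i. i \<in> I ==> continuous_on (sphere 0 1) (f i)"
  shows "fourier (\<lambda>z. \<Sum>i\<in>I. c i * f i z) k = (\<Sum>i\<in>I. c i * fourier (f i) k)"
proof -
  have "integral {0..2*pi} (\<lambda>t. (\<Sum>i\<in>I. c i * f i (cis t)) * cis (- of_int k * t)) =
    integral {0..2*pi} (\<lambda>t. \<Sum>i\<in>I. c i * (f i (cis t) * cis (- of_int k * t)))"
    by (simp add: sum_distrib_right mult.assoc)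
  also have "... = (\<Sum>i\<in>I. c i * integral {0..2*pi} (\<lambda>t. f i (cis t) * cis (- of_int k * t)))"
    using assms by (subst integral_sum) (auto intro!: integrable_continuous_interval continuous_intros continuous_on_cis_comp)
  finally show ?thesis by (simp add: fourier_def sum_divide_distrib)
qed

text \<open>Rotation invariance of the integral: the shifted interval is cut at 2 pi and the
  overhang is moved back by periodicity.\<close>

lemma fourier_translate:
  assumes f: "continuous_on (sphere 0 1) f" and w: "cmod w = 1"
  shows "fourier (\<lambda>z. f (w * z)) k = w powi k * fourier f k"
proof -
  obtain s where s: "w = cis s" "0 \<le> s" "s < 2 * pi"
    using complex_unimodular_polar[OF w] by (auto simp: complex_eq_iff)
  define g where "g t = f (cis t) * cis (- of_int k * t)" for t
  have gi: "g integrable_on {a..b}" for a b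
    unfolding g_def by (intro integrable_continuous_interval continuous_intros continuous_on_cis_comp f)
  have per: "g (t + 2 * pi) = g t" for t
  proof -
    have "cis (t + 2 * pi) = cis t" by (simp flip: cis_mult)
    moreover have "cis (- of_int k * (t + 2 * pi)) = cis (- of_int k * t)"
    proof -
      have "cis (- of_int k * (t + 2 * pi)) = cis (- of_int k * t) * cis (2 * pi * of_int (-k))"
        by (simp add: cis_mult algebra_simps)
      thus ?thesis by (simp only: cis_multiple_2pi[OF Ints_of_int] mult_1_right)
    qed
    ultimately show ?thesis unfolding g_def by simp
  qed
  have "integral {0..2*pi} (\<lambda>t. g (t + s)) = integral {s..2*pi+s} g"
    using integral_shift_real_ivl[of s s "2*pi+s" g] by simp
  also have "... = integral {s..2*pi} g + integral {2*pi..2*pi+s} g"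
    by (rule Henstock_Kurzweil_Integration.integral_combine[symmetric]) (use s gi in auto)
  also have "integral {2*pi..2*pi+s} g = integral {0..s} (\<lambda>t. g (t + 2*pi))"
    using integral_shift_real_ivl[of "2*pi" "2*pi" "2*pi+s" g] by simp
  also have "... = integral {0..s} g" by (simp add: per)
  also have "integral {s..2*pi} g + integral {0..s} g = integral {0..2*pi} g"
    using Henstock_Kurzweil_Integration.integral_combine[of 0 s "2*pi" g] s gi by (simp add: add.commute)
  finally have e: "integral {0..2*pi} (\<lambda>t. g (t + s)) = integral {0..2*pi} g" .
  have "f (w * cis t) * cis (- of_int k * t) = cis (of_int k * s) * g (t + s)" for t
  proof -
    have "cis (of_int k * s) * cis (- of_int k * (t + s)) = cis (- of_int k * t)"
      by (simp add: cis_mult algebra_simps)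
    moreover have "w * cis t = cis (t + s)" by (simp add: s(1) cis_mult add.commute)
    ultimately show ?thesis unfolding g_def by (simp add: mult.left_commute mult.commute)
  qed
  hence "integral {0..2*pi} (\<lambda>t. f (w * cis t) * cis (- of_int k * t)) = cis (of_int k * s) * integral {0..2*pi} g"
    using e by simp
  thus ?thesis by (simp add: fourier_def s(1) cis_powi g_def[abs_def])
qed

lemma fourier_powi: "fourier (\<lambda>z. z powi l) k = (if k = l then 1 else 0)"
proof (cases "k = l")
  case True
  thus ?thesis by (simp add: fourier_def cis_powi cis_mult scaleR_conv_of_real)
next
  case False
  define n where "n = real_of_int (l - k)"
  have n: "n \<noteq> 0" using False by (simp add: n_def)
  have "((\<lambda>t. cis (n * t)) has_integral (cis (n * (2*pi)) / (\<i> * of_real n) - cis (n * 0) / (\<i> * of_real n))) {0..2*pi}"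
  proof (rule fundamental_theorem_of_calculus)
    fix t assume "t \<in> {0..2*pi}"
    have "((\<lambda>t. cis (n * t)) has_vector_derivative (n *\<^sub>R (\<i> * cis (n * t)))) (at t within {0..2*pi})"
      unfolding cis_conv_exp
      by (rule has_vector_derivative_real_field derivative_eq_intros refl | simp add: scaleR_conv_of_real)+
    from has_vector_derivative_mult_right[OF this, of "1 / (\<i> * of_real n)"]
    show "((\<lambda>t. cis (n * t) / (\<i> * of_real n)) has_vector_derivative cis (n * t)) (at t within {0..2*pi})"
      using n by (simp add: scaleR_conv_of_real)
  qed simp
  moreover have "cis (n * (2*pi)) = 1"
    using cis_multiple_2pi[of n] by (simp add: n_def mult.commute)
  ultimately have "integral {0..2*pi} (\<lambda>t. cis (n * t)) = 0" by (simp add: integral_unique)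
  moreover have "cis t powi l * cis (- of_int k * t) = cis (n * t)" for t
    by (simp add: cis_powi cis_mult n_def algebra_simps)
  ultimately show ?thesis using False by (simp add: fourier_def)
qed

definition trig :: "(complex => complex) => bool" where
  "trig h \<longleftrightarrow> (\<exists>xs :: (complex \<times> int) list. \<forall>z. cmod z = 1 --> h z = (\<Sum>(a,e)\<leftarrow>xs. a * z powi e))"

lemma trig_monom: "trig (\<lambda>z. a * z powi e)"
  unfolding trig_def by (intro exI[of _ "[(a,e)]"]) simp

lemma trig_const: "trig (\<lambda>z. a)"
  using trig_monom[of a 0] by simp

lemma trig_add: assumes "trig f" "trig g" shows "trig (\<lambda>z. f z + g z)"
proof -
  obtain xs ys where "\<forall>z. cmod z = 1 --> f z = (\<Sum>(a,e)\<leftarrow>xs. a * z powi e)" "\<forall>z. cmod z = 1 --> g z = (\<Sum>(a,e)\<leftarrow>ys. a * z powi e)"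
    using assms by (auto simp: trig_def)
  thus ?thesis unfolding trig_def by (intro exI[of _ "xs @ ys"]) simp
qed

lemma trig_mult: assumes "trig f" "trig g" shows "trig (\<lambda>z. f z * g z)"
proof -
  obtain xs ys where f: "\<forall>z. cmod z = 1 --> f z = (\<Sum>(a,e)\<leftarrow>xs. a * z powi e)" and g: "\<forall>z. cmod z = 1 --> g z = (\<Sum>(a,e)\<leftarrow>ys. a * z powi e)"
    using assms by (auto simp: trig_def)
  have "\<exists>us. \<forall>z. cmod z = 1 --> (\<Sum>(a,e)\<leftarrow>xs. a * z powi e) * g z = (\<Sum>(a,e)\<leftarrow>us. a * z powi e)"
  proof (induction xs)
    case Nil
    show ?case by (intro exI[of _ "[]"]) simp
  next
    case (Cons x xs)
    obtain a e where x: "x = (a,e)" by (cases x)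
    obtain us where us: "\<forall>z. cmod z = 1 --> (\<Sum>(a,e)\<leftarrow>xs. a * z powi e) * g z = (\<Sum>(a,e)\<leftarrow>us. a * z powi e)"
      using Cons by blast
    have "a * z powi e * (\<Sum>(b,f)\<leftarrow>ys. b * z powi f) = (\<Sum>(b,f)\<leftarrow>map (\<lambda>(b,f). (a * b, e + f)) ys. b * z powi f)"
      if "cmod z = 1" for z
      using that by (induction ys) (auto simp: algebra_simps powi_mult_unit[symmetric])
    thus ?case using us g
      by (intro exI[of _ "map (\<lambda>(b,f). (a * b, e + f)) ys @ us"]) (simp add: x distrib_right)
  qed
  thus ?thesis using f unfolding trig_def by simp
qed

text \<open>On the circle the inverse of z is its conjugate, so Re z and Im z are combinations of z
  and its inverse. This makes the Stone--Weierstrass approximants trigonometric.\<close>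

lemma trig_real_polynomial: "real_polynomial_function q ==> trig (\<lambda>z. of_real (q z))"
proof (induction rule: real_polynomial_function.induct)
  case (linear f)
  have fz: "f z = Re z * f 1 + Im z * f \<i>" for z
  proof -
    have "f z = f (Re z *\<^sub>R 1 + Im z *\<^sub>R \<i>)" by (rule arg_cong[of _ _ f]) (simp add: complex_eq_iff)
    thus ?thesis using linear by (simp only: linear_simps real_scaleR_def)
  qed
  have unit: "z powi 1 + z powi (-1) = 2 * of_real (Re z)" "z powi 1 - z powi (-1) = 2 * \<i> * of_real (Im z)" if "cmod z = 1" for z
  proof -
    have "z * cnj z = 1" using that by (simp flip: complex_norm_square)
    hence "inverse z = cnj z" by (rule inverse_unique)
    thus "z powi 1 + z powi (-1) = 2 * of_real (Re z)" "z powi 1 - z powi (-1) = 2 * \<i> * of_real (Im z)"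
      by (simp_all add: power_int_minus complex_eq_iff)
  qed
  have "complex_of_real (f z) = (\<Sum>(a,e)\<leftarrow>[(f 1 / 2 - \<i> * f \<i> / 2, 1), (f 1 / 2 + \<i> * f \<i> / 2, -1)]. a * z powi e)" if "cmod z = 1" for z
  proof -
    have "(\<Sum>(a,e)\<leftarrow>[(f 1 / 2 - \<i> * f \<i> / 2, 1), (f 1 / 2 + \<i> * f \<i> / 2, -1)]. a * z powi e) =
      f 1 / 2 * (z powi 1 + z powi (-1)) - \<i> * f \<i> / 2 * (z powi 1 - z powi (-1))"
      by (simp add: field_simps)
    also have "... = of_real (f z)" unfolding unit[OF that] fz[of z] by (simp add: algebra_simps)
    finally show ?thesis by simp
  qed
  thus ?case unfolding trig_def by blast
next
  case (const c)
  show ?case by (rule trig_const)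
next
  case (add f g)
  thus ?case using trig_add by fastforce
next
  case (mult f g)
  thus ?case using trig_mult by fastforce
qed

text \<open>The function is orthogonal to all trigonometric polynomials. Approximating its conjugate
  by one within e bounds the integral of |f|^2 by e times the integral of |f|, for every e >
  0.\<close>

lemma fourier_unique:
  assumes f: "continuous_on (sphere 0 1) f" and zero: "!!k. fourier f k = 0" and z: "cmod z = 1"
  shows "f z = 0"
proof -
  have cf: "continuous_on {0..2*pi} (\<lambda>t. f (cis t))" by (rule continuous_on_cis_comp[OF f])
  have orth: "integral {0..2*pi} (\<lambda>t. f (cis t) * h (cis t)) = 0" if h: "trig h" for h
  proof -
    obtain xs where h: "!!z. cmod z = 1 ==> h z = (\<Sum>(a,e)\<leftarrow>xs. a * z powi e)" using h unfolding trig_def by blast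
    have i: "((\<lambda>t. f (cis t) * (\<Sum>(a,e)\<leftarrow>xs. a * cis t powi e)) has_integral 0) {0..2*pi}"
    proof (induction xs)
      case (Cons x xs)
      obtain a e where x: "x = (a,e)" by (cases x)
      have "integral {0..2*pi} (\<lambda>t. f (cis t) * cis (- of_int (- e) * t)) = 0"
        using zero[of "-e"] by (simp add: fourier_def)
      hence "((\<lambda>t. f (cis t) * cis (- of_int (- e) * t)) has_integral 0) {0..2*pi}"
        using fourier_integrable[OF f, of "- of_int (- e)"] by (metis integrable_integral)
      hence "((\<lambda>t. f (cis t) * cis t powi e * a) has_integral 0 * a) {0..2*pi}"
        by (intro has_integral_mult_left) (simp add: cis_powi)
      from has_integral_add[OF this Cons.IH] show ?case by (simp add: x algebra_simps)
    qed simp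
    thus ?thesis using h by (simp add: integral_unique)
  qed
  define n where "n t = (cmod (f (cis t)))\<^sup>2" for t
  have cn: "continuous_on {0..2*pi} n" unfolding n_def by (intro continuous_intros cf)
  define L where "L = integral {0..2*pi} (\<lambda>t. cmod (f (cis t)))"
  have bound: "integral {0..2*pi} n \<le> e * L" if e: "e > 0" for e
  proof -
    have c: "continuous_on (sphere 0 1) (\<lambda>z. cnj (f z))" by (intro continuous_intros f)
    obtain g where g: "polynomial_function g" "\<forall>z\<in>sphere 0 1. cmod (cnj (f z) - g z) < e"
      using Stone_Weierstrass_polynomial_function[OF compact_sphere c e] by (elim exE conjE)
    have cg: "continuous_on S g" for S using g(1) by (rule continuous_on_polymonial_function)
    have "real_polynomial_function (Re \<circ> g)" "real_polynomial_function (Im \<circ> g)"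
      using g(1) bounded_linear_Re bounded_linear_Im unfolding polynomial_function_def by blast+
    hence "trig (\<lambda>z. of_real ((Re \<circ> g) z) + \<i> * of_real ((Im \<circ> g) z))"
      by (intro trig_add trig_mult trig_const trig_real_polynomial)
    hence "trig g" by (simp add: complex_eq[symmetric])
    from orth[OF this] have o: "integral {0..2*pi} (\<lambda>t. f (cis t) * g (cis t)) = 0" .
    have cgc: "continuous_on {0..2*pi} (\<lambda>t. g (cis t))" by (rule continuous_on_cis_comp[OF cg])
    have "complex_of_real (integral {0..2*pi} n) = integral {0..2*pi} (\<lambda>t. f (cis t) * cnj (f (cis t)))"
    proof -
      have "((\<lambda>t. complex_of_real (n t)) has_integral complex_of_real (integral {0..2*pi} n)) {0..2*pi}"
        using has_integral_linear[OF integrable_integral[OF integrable_continuous_interval[OF cn]] bounded_linear_of_real]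
        by (simp add: o_def)
      hence "((\<lambda>t. f (cis t) * cnj (f (cis t))) has_integral complex_of_real (integral {0..2*pi} n)) {0..2*pi}"
        by (simp only: n_def complex_norm_square)
      thus ?thesis by (rule integral_unique[symmetric])
    qed
    also have "... = integral {0..2*pi} (\<lambda>t. f (cis t) * (cnj (f (cis t)) - g (cis t)))"
      using o by (simp add: right_diff_distrib, subst integral_diff)
        (auto intro!: integrable_continuous_interval continuous_intros cf cgc)
    finally have "complex_of_real (integral {0..2*pi} n) = integral {0..2*pi} (\<lambda>t. f (cis t) * (cnj (f (cis t)) - g (cis t)))" .
    hence "integral {0..2*pi} n \<le> cmod (integral {0..2*pi} (\<lambda>t. f (cis t) * (cnj (f (cis t)) - g (cis t))))"
      by (metis abs_ge_self norm_of_real)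
    also have "... \<le> integral {0..2*pi} (\<lambda>t. e * cmod (f (cis t)))"
    proof (rule integral_norm_bound_integral)
      fix t assume "t \<in> {0..2*pi}"
      have "cmod (cnj (f (cis t)) - g (cis t)) \<le> e" using bspec[OF g(2), of "cis t"] by simp
      thus "cmod (f (cis t) * (cnj (f (cis t)) - g (cis t))) \<le> e * cmod (f (cis t))"
        unfolding norm_mult by (metis mult.commute mult_left_mono norm_ge_zero)
    qed (intro integrable_continuous_interval continuous_intros cf cgc)+
    finally show ?thesis by (simp add: L_def)
  qed
  have "integral {0..2*pi} n \<le> 0"
  proof (rule ccontr)
    assume c: "\<not> ?thesis"
    have "L \<ge> 0" unfolding L_def by (intro integral_nonneg integrable_continuous_interval continuous_intros cf) auto
    \<comment> \<open>The accuracy e is the integral of |f|^2 divided by L + 1; the added 1 avoids a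
      case distinction for L = 0.\<close>
    hence "integral {0..2*pi} n / (L + 1) * L < integral {0..2*pi} n" using c by (simp add: field_simps)
    moreover have "integral {0..2*pi} n \<le> integral {0..2*pi} n / (L + 1) * L"
      using c \<open>L \<ge> 0\<close> by (intro bound divide_pos_pos) auto
    ultimately show False by simp
  qed
  moreover have "integral {0..2*pi} n \<ge> 0"
    by (intro integral_nonneg integrable_continuous_interval cn) (simp add: n_def)
  ultimately have "integral {0..2*pi} n = 0" by simp
  hence "(n has_integral 0) (cbox 0 (2*pi))"
    using integrable_integral[OF integrable_continuous_interval[OF cn]] by simp
  obtain s where s: "z = cis s" "0 \<le> s" "s < 2 * pi"
    using complex_unimodular_polar[OF z] by (auto simp: complex_eq_iff)
  have "n s = 0"
    by (rule has_integral_0_cbox_imp_0[of 0 "2*pi" n]) (use cn s \<open>(n has_integral 0) _\<close> in \<open>auto simp: n_def box_real\<close>)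
  thus ?thesis by (simp add: n_def s(1))
qed

subsection \<open>Representations of tori\<close>

text \<open>The Fourier coefficients of a homomorphism are mutually orthogonal idempotents, the
  projections onto weight spaces. Only finitely many are nonzero, so the Fourier series is a finite
  sum and equals the function by \<open>fourier_unique\<close>.\<close>

lemma circle_decomposition:
  fixes \<phi> :: "complex => complex mat"
  assumes car: "!!z. cmod z = 1 ==> \<phi> z \<in> carrier_mat d d"
    and hom: "!!z w. cmod z = 1 ==> cmod w = 1 ==> \<phi> (z * w) = \<phi> z * \<phi> w"
    and cont: "!!i j. i < d ==> j < d ==> continuous_on (sphere 0 1) (\<lambda>z. \<phi> z $$ (i,j))"
  shows "\<exists>J A. finite J \<and> (\<forall>k\<in>J. A k \<in> carrier_mat d d) \<and>
    (\<forall>z i j. cmod z = 1 --> i < d --> j < d --> \<phi> z $$ (i,j) = (\<Sum>k\<in>J. A k $$ (i,j) * z powi k))"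
proof -
  define A where "A k = Matrix.mat d d (\<lambda>(i,j). fourier (\<lambda>z. \<phi> z $$ (i,j)) k)" for k
  have Ac: "A k \<in> carrier_mat d d" for k by (simp add: A_def)
  have eig: "(\<phi> w * A k) $$ (i,j) = w powi k * A k $$ (i,j)" if w: "cmod w = 1" and ij: "i < d" "j < d" for w k i j
  proof -
    have "(\<phi> w * A k) $$ (i,j) = (\<Sum>a<d. \<phi> w $$ (i,a) * fourier (\<lambda>z. \<phi> z $$ (a,j)) k)"
      using ij by (subst mat_mult_index[OF car[OF w] Ac]) (auto simp: A_def)
    also have "... = fourier (\<lambda>z. \<Sum>a<d. \<phi> w $$ (i,a) * \<phi> z $$ (a,j)) k"
      using ij by (intro fourier_sum[symmetric] cont) auto
    also have "... = fourier (\<lambda>z. \<phi> (w * z) $$ (i,j)) k"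
    proof -
      have "(\<Sum>a<d. \<phi> w $$ (i,a) * \<phi> (cis t) $$ (a,j)) = \<phi> (w * cis t) $$ (i,j)" for t
        using mat_mult_index[OF car[OF w] car ij, of "cis t"] hom[OF w, of "cis t"] by simp
      thus ?thesis by (simp add: fourier_def)
    qed
    also have "... = w powi k * fourier (\<lambda>z. \<phi> z $$ (i,j)) k"
      by (rule fourier_translate[OF cont[OF ij] w])
    finally show ?thesis using ij by (simp add: A_def)
  qed
  have AA: "A k * A l = (if k = l then A k else 0\<^sub>m d d)" for k l
  proof (rule eq_matI)
    fix i j assume "i < dim_row (if k = l then A k else 0\<^sub>m d d)" "j < dim_col (if k = l then A k else 0\<^sub>m d d)"
    hence ij: "i < d" "j < d" using Ac[of k] by (auto split: if_splits)
    have "(A k * A l) $$ (i,j) = (\<Sum>a<d. A l $$ (a,j) * fourier (\<lambda>z. \<phi> z $$ (i,a)) k)"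
      using ij by (subst mat_mult_index[OF Ac Ac]) (auto simp: A_def mult.commute)
    also have "... = fourier (\<lambda>z. \<Sum>a<d. A l $$ (a,j) * \<phi> z $$ (i,a)) k"
      using ij by (intro fourier_sum[symmetric] cont) auto
    also have "... = fourier (\<lambda>z. \<Sum>a\<in>{()}. A l $$ (i,j) * z powi l) k"
    proof -
      have "(\<Sum>a<d. A l $$ (a,j) * \<phi> (cis t) $$ (i,a)) = A l $$ (i,j) * cis t powi l" for t
        using eig[of "cis t" i j l] mat_mult_index[OF car Ac ij, of "cis t" l] ij by (simp add: mult.commute)
      thus ?thesis by (simp add: fourier_def)
    qed
    also have "... = A l $$ (i,j) * fourier (\<lambda>z. z powi l) k"
      by (subst fourier_sum) (auto intro!: continuous_intros)
    finally show "(A k * A l) $$ (i,j) = (if k = l then A k else 0\<^sub>m d d) $$ (i,j)"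
      using ij by (simp add: fourier_powi)
  qed (use Ac[of k] Ac[of l] in auto)
  define J where "J = {k. A k \<noteq> 0\<^sub>m d d}"
  \<comment> \<open>A sum of orthogonal idempotents is idempotent, so its trace is at most d, while
    every nonzero summand contributes at least 1.\<close>
  have card_le: "card K \<le> d" if K: "finite K" "K \<subseteq> J" for K
  proof -
    define E where "E = Matrix.mat d d (\<lambda>(i,j). \<Sum>k\<in>K. A k $$ (i,j))"
    have E: "E \<in> carrier_mat d d" by (simp add: E_def)
    have EE: "E * E = E"
    proof (rule eq_matI)
      fix i j assume "i < dim_row E" "j < dim_col E"
      hence ij: "i < d" "j < d" by (auto simp: E_def)
      have "(E * E) $$ (i,j) = (\<Sum>a<d. (\<Sum>k\<in>K. A k $$ (i,a)) * (\<Sum>l\<in>K. A l $$ (a,j)))"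
        using ij by (subst mat_mult_index[OF E E]) (auto simp: E_def)
      also have "... = (\<Sum>a<d. \<Sum>k\<in>K. \<Sum>l\<in>K. A k $$ (i,a) * A l $$ (a,j))"
        by (simp add: sum_product)
      also have "... = (\<Sum>k\<in>K. \<Sum>l\<in>K. \<Sum>a<d. A k $$ (i,a) * A l $$ (a,j))"
        by (subst sum.swap, rule sum.cong[OF refl], rule sum.swap)
      also have "... = (\<Sum>k\<in>K. \<Sum>l\<in>K. if k = l then A k $$ (i,j) else 0)"
      proof (intro sum.cong refl)
        fix k l
        have "(\<Sum>a<d. A k $$ (i,a) * A l $$ (a,j)) = (A k * A l) $$ (i,j)"
          by (rule mat_mult_index[OF Ac Ac ij, symmetric])
        thus "(\<Sum>a<d. A k $$ (i,a) * A l $$ (a,j)) = (if k = l then A k $$ (i,j) else 0)"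
          using ij by (simp add: AA del: index_mult_mat)
      qed
      also have "... = (\<Sum>k\<in>K. A k $$ (i,j))" using K(1) by simp
      finally show "(E * E) $$ (i,j) = E $$ (i,j)" using ij by (simp add: E_def)
    qed (use E in auto)
    have "\<forall>k. \<exists>m. mat_trace (A k) = of_nat m \<and> (m = 0 \<longleftrightarrow> A k = 0\<^sub>m d d)"
      using idempotent_trace[OF Ac] AA by metis
    then obtain m where m: "!!k. mat_trace (A k) = of_nat (m k)" "!!k. m k = 0 \<longleftrightarrow> A k = 0\<^sub>m d d" by metis
    have "mat_trace E = (\<Sum>i<d. \<Sum>k\<in>K. A k $$ (i,i))" by (simp add: mat_trace_def E_def)
    also have "... = (\<Sum>k\<in>K. mat_trace (A k))" using Ac by (subst sum.swap) (simp add: mat_trace_def A_def)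
    also have "... = of_nat (\<Sum>k\<in>K. m k)" by (simp add: m)
    finally have "mat_trace E = of_nat (\<Sum>k\<in>K. m k)" .
    moreover obtain e where "mat_trace E = of_nat e" "e \<le> d" using idempotent_trace[OF E EE] by metis
    ultimately have "(\<Sum>k\<in>K. m k) \<le> d" by (simp only: of_nat_eq_iff)
    moreover have "(\<Sum>k\<in>K. 1) \<le> (\<Sum>k\<in>K. m k)"
    proof (rule sum_mono)
      fix k assume "k \<in> K"
      hence "m k \<noteq> 0" using K(2) m(2) by (auto simp: J_def)
      thus "1 \<le> m k" by simp
    qed
    ultimately show ?thesis by simp
  qed
  have fin: "finite J"
  proof (rule ccontr)
    assume "infinite J"
    then obtain K where "K \<subseteq> J" "finite K" "card K = Suc d" using infinite_arbitrarily_large by blast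
    thus False using card_le by fastforce
  qed
  have "\<phi> z $$ (i,j) = (\<Sum>k\<in>J. A k $$ (i,j) * z powi k)" if z: "cmod z = 1" and ij: "i < d" "j < d" for z i j
  proof -
    \<comment> \<open>The difference is written as one finite sum, with \<open>None\<close> standing
      for \<phi> and \<open>Some k\<close> for the powers, so that \<open>fourier_sum\<close>
      applies.\<close>
    define f where "f z = (\<Sum>s\<in>insert None (Some ` J). (case s of None => 1 | Some k => - A k $$ (i,j)) *
       (case s of None => \<phi> z $$ (i,j) | Some k => z powi k))" for z
    have fe: "f z = \<phi> z $$ (i,j) - (\<Sum>k\<in>J. A k $$ (i,j) * z powi k)" for z
      unfolding f_def using fin by (subst sum.insert) (auto simp: sum.reindex sum_negf)
    have cc: "continuous_on (sphere 0 1) (\<lambda>z. case s of None => \<phi> z $$ (i,j) | Some k => z powi k)" for s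
      using cont[OF ij] by (cases s) (auto intro!: continuous_intros)
    have "f z = 0"
    proof (rule fourier_unique[OF _ _ z])
      show "continuous_on (sphere 0 1) f" unfolding f_def by (intro continuous_intros cc)
      fix l
      have "fourier f l = fourier (\<lambda>z. \<phi> z $$ (i,j)) l - (\<Sum>k\<in>J. A k $$ (i,j) * fourier (\<lambda>z. z powi k) l)"
        unfolding f_def using fin cc
        by (subst fourier_sum) (auto simp: sum.insert sum.reindex sum_negf)
      also have "fourier (\<lambda>z. \<phi> z $$ (i,j)) l = A l $$ (i,j)" using ij by (simp add: A_def)
      also have "(\<Sum>k\<in>J. A k $$ (i,j) * fourier (\<lambda>z. z powi k) l) = (if l \<in> J then A l $$ (i,j) else 0)"
        using fin by (simp add: fourier_powi if_distrib cong: if_cong)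
      also have "... = A l $$ (i,j)" using ij by (auto simp: J_def)
      finally show "fourier f l = 0" by simp
    qed
    thus ?thesis by (simp add: fe)
  qed
  thus ?thesis using fin Ac by blast
qed

definition chr :: "'x set => ('x => int) => ('x => complex) => complex" where
  "chr X w z = (\<Prod>x\<in>X. z x powi w x)"

definition unit_pt :: "('x => complex) => bool" where "unit_pt z \<longleftrightarrow> (\<forall>x. cmod (z x) = 1)"

lemma unit_pt_mult: "unit_pt z ==> unit_pt w ==> unit_pt (\<lambda>x. z x * w x)"
  by (simp add: unit_pt_def norm_mult)

lemma unit_pt_upd: "unit_pt z ==> cmod s = 1 ==> unit_pt (z(y := s))"
  by (simp add: unit_pt_def)

lemma chr_mult: "chr X w (\<lambda>x. z x * z' x) = chr X w z * chr X w z'"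
  by (simp add: chr_def power_int_mult_distrib prod.distrib)

text \<open>Multiplication by a fixed character with large exponent B makes all exponents natural
  and reduces the claim to \<open>mon_independent\<close>.\<close>

lemma chr_independent:
  assumes X: "finite X" and S: "finite S" "S \<subseteq> X \<rightarrow>\<^sub>E UNIV"
    and zero: "!!z. unit_pt z ==> (\<Sum>w\<in>S. c w * chr X w z) = 0" and w0: "w0 \<in> S"
  shows "c w0 = 0"
proof -
  define B where "B = (\<Sum>w\<in>S. \<Sum>x\<in>X. \<bar>w x\<bar>)"
  have B: "w x + B \<ge> 0" if "w \<in> S" "x \<in> X" for w x
  proof -
    have "\<bar>w x\<bar> \<le> (\<Sum>x\<in>X. \<bar>w x\<bar>)" using that X by (intro member_le_sum) auto
    also have "... \<le> B" unfolding B_def using that S by (intro member_le_sum[where f = "\<lambda>w. \<Sum>x\<in>X. \<bar>w x\<bar>"]) (auto intro: sum_nonneg)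
    finally show ?thesis by linarith
  qed
  define e where "e w = (\<lambda>x\<in>X. nat (w x + B))" for w
  have inj: "inj_on e S"
  proof (rule inj_onI)
    fix w w' assume w: "w \<in> S" "w' \<in> S" "e w = e w'"
    have "w x = w' x" if "x \<in> X" for x
      using fun_cong[OF w(3), of x] B[OF w(1) that] B[OF w(2) that] that by (simp add: e_def)
    thus "w = w'" using w S(2) by (intro PiE_ext[of w X "\<lambda>_. UNIV" w']) auto
  qed
  define c' where "c' m = c (inv_into S e m)" for m
  have "c' (e w0) = 0"
  proof (rule mon_independent[OF X, of "e ` S"])
    fix v :: "'a => complex" assume v: "!!x. cmod (v x) = 1"
    have "mon X (e w) v = chr X w v * chr X (\<lambda>_. B) v" if "w \<in> S" for w
      unfolding mon_def chr_def prod.distrib[symmetric]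
    proof (intro prod.cong refl)
      fix x assume x: "x \<in> X"
      have "v x powi (w x + B) = v x ^ nat (w x + B)" using B[OF that x] by (simp add: power_int_def)
      thus "v x ^ e w x = v x powi w x * v x powi B" using x v[of x] by (simp add: e_def powi_mult_unit)
    qed
    hence "(\<Sum>m\<in>e ` S. c' m * mon X m v) = (\<Sum>w\<in>S. c w * chr X w v) * chr X (\<lambda>_. B) v"
      by (simp add: sum.reindex[OF inj] c'_def inj sum_distrib_right mult.assoc)
    thus "(\<Sum>m\<in>e ` S. c' m * mon X m v) = 0" using zero[of v] v by (simp add: unit_pt_def)
    next
    show "e w0 \<in> e ` S" using w0 by simp
  qed (use S in \<open>auto simp: e_def\<close>)
  thus ?thesis using inj w0 by (simp add: c'_def)
qed

text \<open>Induction on the circle factors: F(z) is the product of its value with coordinate y set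
  to 1 and of a one-parameter subgroup, to which \<open>circle_decomposition\<close>
  applies.\<close>

lemma torus_decomposition:
  fixes F :: "('x => complex) => complex mat"
  assumes "finite X"
    and "!!z. unit_pt z ==> F z \<in> carrier_mat d d"
    and "!!z w. unit_pt z ==> unit_pt w ==> F (\<lambda>x. z x * w x) = F z * F w"
    and "!!z w. unit_pt z ==> unit_pt w ==> (!!x. x \<in> X ==> z x = w x) ==> F z = F w"
    and "F (\<lambda>_. 1) = 1\<^sub>m d"
    and "!!x i j. x \<in> X ==> i < d ==> j < d ==> continuous_on (sphere 0 1) (\<lambda>s. F ((\<lambda>_. 1)(x := s)) $$ (i,j))"
  shows "\<exists>S P. finite S \<and> S \<subseteq> X \<rightarrow>\<^sub>E UNIV \<and> (\<forall>w\<in>S. P w \<in> carrier_mat d d) \<and>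
    (\<forall>z i j. unit_pt z --> i < d --> j < d --> F z $$ (i,j) = (\<Sum>w\<in>S. P w $$ (i,j) * chr X w z))"
  using assms
proof (induction X arbitrary: F rule: finite_induct)
  case empty
  have "F z = 1\<^sub>m d" if "unit_pt z" for z
    using empty(3)[OF that, of "\<lambda>_. 1"] empty(4) by (simp add: unit_pt_def)
  thus ?case by (intro exI[of _ "{\<lambda>_. undefined}"] exI[of _ "\<lambda>_. 1\<^sub>m d"]) (auto simp: chr_def)
next
  case (insert y X)
  note car = insert.prems(1) and hom = insert.prems(2) and cong = insert.prems(3) and one = insert.prems(4) and cont = insert.prems(5)
  have u1: "unit_pt (\<lambda>_. 1)" by (simp add: unit_pt_def)
  define F' where "F' z = F (z(y := 1))" for z
  have u: "unit_pt (z(y := 1))" if "unit_pt z" for z using that by (intro unit_pt_upd) auto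
  have "\<exists>S P. finite S \<and> S \<subseteq> X \<rightarrow>\<^sub>E UNIV \<and> (\<forall>w\<in>S. P w \<in> carrier_mat d d) \<and>
    (\<forall>z i j. unit_pt z --> i < d --> j < d --> F' z $$ (i,j) = (\<Sum>w\<in>S. P w $$ (i,j) * chr X w z))"
  proof (rule insert.IH)
    fix z w :: "'x => complex" assume z: "unit_pt z" and w: "unit_pt w"
    have "(\<lambda>x. z x * w x)(y := 1) = (\<lambda>x. (z(y := 1)) x * (w(y := 1)) x)" by auto
    from trans[OF arg_cong[OF this, of F] hom[OF u[OF z] u[OF w]]]
    show "F' (\<lambda>x. z x * w x) = F' z * F' w" unfolding F'_def .
    show "F' z = F' w" if "!!x. x \<in> X ==> z x = w x"
      unfolding F'_def using that by (intro cong u z w) auto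
  next
    fix x i j assume x: "x \<in> X" and ij: "i < d" "j < d"
    have eq: "((\<lambda>_. 1)(x := s))(y := 1) = ((\<lambda>_. 1)(x := s))" for s :: complex using x insert.hyps by auto
    thus "continuous_on (sphere 0 1) (\<lambda>s. F' ((\<lambda>_. 1)(x := s)) $$ (i,j))"
      unfolding F'_def eq using x by (intro cont ij) simp
  qed (use car u one in \<open>auto simp: F'_def fun_upd_idem\<close>)
  then obtain S P where S: "finite S" "S \<subseteq> X \<rightarrow>\<^sub>E UNIV" and Pc: "!!w. w \<in> S ==> P w \<in> carrier_mat d d" and
    P: "!!z i j. unit_pt z ==> i < d ==> j < d ==> F' z $$ (i,j) = (\<Sum>w\<in>S. P w $$ (i,j) * chr X w z)" by blast
  have "\<exists>J A. finite J \<and> (\<forall>k\<in>J. A k \<in> carrier_mat d d) \<and>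
    (\<forall>s i j. cmod s = 1 --> i < d --> j < d --> F ((\<lambda>_. 1)(y := s)) $$ (i,j) = (\<Sum>k\<in>J. A k $$ (i,j) * s powi k))"
  proof (rule circle_decomposition)
    show "F ((\<lambda>_. 1)(y := s)) \<in> carrier_mat d d" if "cmod s = 1" for s using that by (intro car unit_pt_upd u1)
    fix s t :: complex assume st: "cmod s = 1" "cmod t = 1"
    have "(\<lambda>_. 1)(y := s * t) = (\<lambda>x. ((\<lambda>_. 1)(y := s)) x * ((\<lambda>_. 1)(y := t)) x)" by auto
    from trans[OF arg_cong[OF this, of F] hom[OF unit_pt_upd[OF u1 st(1)] unit_pt_upd[OF u1 st(2)]]]
    show "F ((\<lambda>_. 1)(y := s * t)) = F ((\<lambda>_. 1)(y := s)) * F ((\<lambda>_. 1)(y := t))" .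
  qed (rule cont; simp)
  then obtain J A where J: "finite J" and Ac: "!!k. k \<in> J ==> A k \<in> carrier_mat d d" and
    A: "!!s i j. cmod s = 1 ==> i < d ==> j < d ==> F ((\<lambda>_. 1)(y := s)) $$ (i,j) = (\<Sum>k\<in>J. A k $$ (i,j) * s powi k)" by blast
  let ?m = "\<lambda>(w,k). w(y := k)"
  \<comment> \<open>Resetting y to \<open>undefined\<close> recovers the weight on X as an
    extensional function.\<close>
  let ?P = "\<lambda>w. P (w(y := undefined)) * A (w y)"
  have und: "w(y := undefined) = w" if "w \<in> S" for w
  proof (rule ext)
    fix x show "(w(y := undefined)) x = w x"
      using that S(2) insert.hyps by (auto simp: PiE_iff extensional_def subset_iff)
  qed
  have inj: "inj_on ?m (S \<times> J)"
  proof (rule inj_onI, clarify)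
    fix w k w' k' assume a: "w \<in> S" "w' \<in> S" "w(y := k) = w'(y := k')"
    from arg_cong[OF a(3), of "\<lambda>f. f(y := undefined)"]
    have "w(y := undefined) = w'(y := undefined)" by (simp only: fun_upd_upd)
    hence "w = w'" using und a(1,2) by (simp only:)
    thus "w = w' \<and> k = k'" using fun_cong[OF a(3), of y] by simp
  qed
  show ?case
  proof (intro exI[of _ "?m ` (S \<times> J)"] exI[of _ ?P] conjI allI impI)
    show "finite (?m ` (S \<times> J))" using S J by simp
    show "?m ` (S \<times> J) \<subseteq> insert y X \<rightarrow>\<^sub>E UNIV" using S(2) by (auto simp: PiE_iff extensional_def subset_iff)
    show "\<forall>w\<in>?m ` (S \<times> J). ?P w \<in> carrier_mat d d" using Pc Ac und by auto
    fix z :: "'x => complex" and i j assume z: "unit_pt z" and ij: "i < d" "j < d"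
    have zy: "cmod (z y) = 1" using z by (simp add: unit_pt_def)
    have "z = (\<lambda>x. (z(y := 1)) x * ((\<lambda>_. 1)(y := z y)) x)" by auto
    from trans[OF arg_cong[OF this, of F] hom[OF u[OF z] unit_pt_upd[OF u1 zy]]]
    have "F z = F' z * F ((\<lambda>_. 1)(y := z y))" unfolding F'_def .
    hence "F z $$ (i,j) = (\<Sum>a<d. F' z $$ (i,a) * F ((\<lambda>_. 1)(y := z y)) $$ (a,j))"
      using mat_mult_index[OF car[OF u[OF z], folded F'_def] car[OF unit_pt_upd[OF u1 zy, of y]] ij] by (simp only:)
    also have "... = (\<Sum>a<d. (\<Sum>w\<in>S. P w $$ (i,a) * chr X w z) * (\<Sum>k\<in>J. A k $$ (a,j) * z y powi k))"
      using ij P[OF z] A[OF zy] by (intro sum.cong refl arg_cong2[of _ _ _ _ "(*)"]) (simp_all only: lessThan_iff)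
    also have "... = (\<Sum>a<d. \<Sum>(w,k)\<in>S \<times> J. P w $$ (i,a) * A k $$ (a,j) * (chr X w z * z y powi k))"
      by (simp add: sum_product sum.cartesian_product mult_ac)
    also have "... = (\<Sum>(w,k)\<in>S \<times> J. (\<Sum>a<d. P w $$ (i,a) * A k $$ (a,j)) * (chr X w z * z y powi k))"
      by (subst sum.swap) (simp add: sum_distrib_right case_prod_unfold)
    also have "... = (\<Sum>(w,k)\<in>S \<times> J. ?P (w(y := k)) $$ (i,j) * chr (insert y X) (w(y := k)) z)"
    proof (intro sum.cong refl, clarify)
      fix w k assume wk: "w \<in> S" "k \<in> J"
      have "chr (insert y X) (w(y := k)) z = z y powi k * (\<Prod>x\<in>X. z x powi (w(y := k)) x)"
        using insert.hyps by (simp add: chr_def)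
      also have "(\<Prod>x\<in>X. z x powi (w(y := k)) x) = chr X w z"
        unfolding chr_def using insert.hyps by (intro prod.cong) auto
      finally have e: "chr (insert y X) (w(y := k)) z = chr X w z * z y powi k" by (simp only: mult.commute)
      have "(w(y := k)) y = k" by simp
      thus "(\<Sum>a<d. P w $$ (i,a) * A k $$ (a,j)) * (chr X w z * z y powi k) =
          ?P (w(y := k)) $$ (i,j) * chr (insert y X) (w(y := k)) z"
        unfolding e using mat_mult_index[OF Pc[OF wk(1)] Ac[OF wk(2)] ij] und[OF wk(1)] by (simp only: fun_upd_upd)
    qed
    also have "... = (\<Sum>w\<in>?m ` (S \<times> J). ?P w $$ (i,j) * chr (insert y X) w z)"
      unfolding sum.reindex[OF inj] by (simp add: case_prod_unfold)
    finally show "F z $$ (i,j) = (\<Sum>w\<in>?m ` (S \<times> J). ?P w $$ (i,j) * chr (insert y X) w z)" .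
  qed
qed

text \<open>The multiplicities are the traces of the projections onto the weight spaces.\<close>

lemma torus_weights:
  fixes F :: "('x => complex) => complex mat"
  assumes X: "finite X"
    and car: "!!z. unit_pt z ==> F z \<in> carrier_mat d d"
    and hom: "!!z w. unit_pt z ==> unit_pt w ==> F (\<lambda>x. z x * w x) = F z * F w"
    and cong: "!!z w. unit_pt z ==> unit_pt w ==> (!!x. x \<in> X ==> z x = w x) ==> F z = F w"
    and one: "F (\<lambda>_. 1) = 1\<^sub>m d"
    and cont: "!!x i j. x \<in> X ==> i < d ==> j < d ==> continuous_on (sphere 0 1) (\<lambda>s. F ((\<lambda>_. 1)(x := s)) $$ (i,j))"
  shows "\<exists>S M. finite S \<and> S \<subseteq> X \<rightarrow>\<^sub>E UNIV \<and> (\<forall>w\<in>S. (M w :: nat) > 0) \<and>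
    (\<forall>z. unit_pt z --> mat_trace (F z) = (\<Sum>w\<in>S. of_nat (M w) * chr X w z)) \<and>
    (\<forall>w\<in>X \<rightarrow>\<^sub>E UNIV. w \<in> S \<longleftrightarrow> (\<exists>v\<in>carrier_vec d. v \<noteq> 0\<^sub>v d \<and> (\<forall>z. unit_pt z --> F z *\<^sub>v v = chr X w z \<cdot>\<^sub>v v)))"
proof -
  have "\<exists>S P. finite S \<and> S \<subseteq> X \<rightarrow>\<^sub>E UNIV \<and> (\<forall>w\<in>S. P w \<in> carrier_mat d d) \<and>
    (\<forall>z i j. unit_pt z --> i < d --> j < d --> F z $$ (i,j) = (\<Sum>w\<in>S. P w $$ (i,j) * chr X w z))"
    by (rule torus_decomposition; fact)
  then obtain S P where S: "finite S" "S \<subseteq> X \<rightarrow>\<^sub>E UNIV" and Pc: "!!w. w \<in> S ==> P w \<in> carrier_mat d d" and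
    P: "!!z i j. unit_pt z ==> i < d ==> j < d ==> F z $$ (i,j) = (\<Sum>w\<in>S. P w $$ (i,j) * chr X w z)" by blast
  \<comment> \<open>Compare the coefficients of the characters of z' in F(z z') = F(z)
    F(z').\<close>
  have eig: "(F z * P w) $$ (i,j) = chr X w z * P w $$ (i,j)" if z: "unit_pt z" and w: "w \<in> S" and ij: "i < d" "j < d" for z w i j
  proof -
    have "chr X w z * P w $$ (i,j) - (F z * P w) $$ (i,j) = 0"
    proof (rule chr_independent[OF X S _ w])
      fix z' :: "'x => complex" assume z': "unit_pt z'"
      have "(\<Sum>w\<in>S. P w $$ (i,j) * (chr X w z * chr X w z')) = F (\<lambda>x. z x * z' x) $$ (i,j)"
        using P[OF unit_pt_mult[OF z z'] ij] by (simp add: chr_mult)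
      also have "... = (\<Sum>a<d. F z $$ (i,a) * F z' $$ (a,j))"
        using hom[OF z z'] mat_mult_index[OF car[OF z] car[OF z'] ij] by simp
      also have "... = (\<Sum>a<d. \<Sum>w\<in>S. F z $$ (i,a) * P w $$ (a,j) * chr X w z')"
        using ij P[OF z'] by (intro sum.cong refl) (simp add: sum_distrib_left mult.assoc)
      also have "... = (\<Sum>w\<in>S. (F z * P w) $$ (i,j) * chr X w z')"
        using mat_mult_index[OF car[OF z] Pc ij] by (subst sum.swap) (simp add: sum_distrib_right)
      finally show "(\<Sum>w\<in>S. (chr X w z * P w $$ (i,j) - (F z * P w) $$ (i,j)) * chr X w z') = 0"
        by (simp add: left_diff_distrib sum_subtractf right_diff_distrib mult_ac)
    qed
    thus ?thesis by simp
  qed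
  have idem: "P w * P w = P w" if w: "w \<in> S" for w
  proof (rule eq_matI)
    fix i j assume "i < dim_row (P w)" "j < dim_col (P w)"
    hence ij: "i < d" "j < d" using Pc[OF w] by auto
    have "(P w * P w) $$ (i,j) - P w $$ (i,j) = 0"
    proof -
      define c where "c w' = (P w' * P w) $$ (i,j) - (if w' = w then P w $$ (i,j) else 0)" for w'
      have "c w = 0"
      proof (rule chr_independent[OF X S _ w])
        fix z :: "'x => complex" assume z: "unit_pt z"
        have "(\<Sum>w'\<in>S. (P w' * P w) $$ (i,j) * chr X w' z) = (\<Sum>w'\<in>S. \<Sum>a<d. P w' $$ (i,a) * P w $$ (a,j) * chr X w' z)"
          using mat_mult_index[OF Pc Pc[OF w] ij] by (simp add: sum_distrib_right)
        also have "... = (\<Sum>a<d. F z $$ (i,a) * P w $$ (a,j))"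
          using ij P[OF z] by (subst sum.swap) (simp add: sum_distrib_left mult_ac)
        also have "... = chr X w z * P w $$ (i,j)"
          using eig[OF z w ij] mat_mult_index[OF car[OF z] Pc[OF w] ij] by simp
        finally show "(\<Sum>w'\<in>S. c w' * chr X w' z) = 0"
          using w S(1) unfolding c_def left_diff_distrib sum_subtractf
          by (simp add: if_distrib if_distribR mult.commute cong: if_cong)
      qed
      thus ?thesis by (simp add: c_def)
    qed
    thus "(P w * P w) $$ (i,j) = P w $$ (i,j)" by simp
  qed (use Pc[OF w] in auto)
  have "\<forall>w\<in>S. \<exists>m :: nat. mat_trace (P w) = of_nat m \<and> (m = 0 \<longleftrightarrow> P w = 0\<^sub>m d d)"
    using idempotent_trace[OF Pc idem] by metis
  then obtain M :: "('x => int) => nat" where M: "!!w. w \<in> S ==> mat_trace (P w) = of_nat (M w)"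
      "!!w. w \<in> S ==> M w = 0 \<longleftrightarrow> P w = 0\<^sub>m d d" by metis
  define S' where "S' = {w \<in> S. P w \<noteq> 0\<^sub>m d d}"
  have tr: "mat_trace (F z) = (\<Sum>w\<in>S'. of_nat (M w) * chr X w z)" if z: "unit_pt z" for z
  proof -
    have "mat_trace (F z) = (\<Sum>i<d. \<Sum>w\<in>S. P w $$ (i,i) * chr X w z)"
      using P[OF z] car[OF z] by (simp add: mat_trace_def)
    also have "... = (\<Sum>w\<in>S. mat_trace (P w) * chr X w z)"
      using Pc by (subst sum.swap) (auto simp: mat_trace_def sum_distrib_right intro!: sum.cong)
    also have "... = (\<Sum>w\<in>S. of_nat (M w) * chr X w z)" by (simp add: M)
    also have "... = (\<Sum>w\<in>S'. of_nat (M w) * chr X w z)"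
      using S(1) M(2) by (intro sum.mono_neutral_right) (auto simp: S'_def)
    finally show ?thesis .
  qed
  have wtv: "w \<in> S' \<longleftrightarrow> (\<exists>v\<in>carrier_vec d. v \<noteq> 0\<^sub>v d \<and> (\<forall>z. unit_pt z --> F z *\<^sub>v v = chr X w z \<cdot>\<^sub>v v))"
    if wX: "w \<in> X \<rightarrow>\<^sub>E UNIV" for w
  proof
    assume "w \<in> S'"
    hence w: "w \<in> S" "P w \<noteq> 0\<^sub>m d d" by (auto simp: S'_def)
    have "\<exists>i<d. \<exists>j<d. P w $$ (i,j) \<noteq> 0"
    proof (rule ccontr)
      assume "\<not> ?thesis"
      hence "P w = 0\<^sub>m d d" using Pc[OF w(1)] by (intro eq_matI) auto
      thus False using w by simp
    qed
    then obtain i j where ij: "i < d" "j < d" "P w $$ (i,j) \<noteq> 0" by blast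
    let ?v = "col (P w) j"
    have "vec_index ?v i \<noteq> 0" using ij Pc[OF w(1)] by simp
    hence "?v \<noteq> 0\<^sub>v d" using ij by auto
    moreover have "F z *\<^sub>v ?v = chr X w z \<cdot>\<^sub>v ?v" if z: "unit_pt z" for z
    proof (rule eq_vecI)
      fix k assume "k < dim_vec (chr X w z \<cdot>\<^sub>v ?v)"
      hence k: "k < d" using Pc[OF w(1)] by simp
      have "vec_index (F z *\<^sub>v ?v) k = (F z * P w) $$ (k,j)"
        using k ij car[OF z] Pc[OF w(1)] by simp
      thus "vec_index (F z *\<^sub>v ?v) k = vec_index (chr X w z \<cdot>\<^sub>v ?v) k"
        using eig[OF z w(1) k ij(2)] k ij Pc[OF w(1)] by simp
    qed (use car[OF z] Pc[OF w(1)] in simp)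
    moreover have "?v \<in> carrier_vec d" using Pc[OF w(1)] by (auto intro!: carrier_vecI)
    ultimately show "\<exists>v\<in>carrier_vec d. v \<noteq> 0\<^sub>v d \<and> (\<forall>z. unit_pt z --> F z *\<^sub>v v = chr X w z \<cdot>\<^sub>v v)" by blast
  next
    assume "\<exists>v\<in>carrier_vec d. v \<noteq> 0\<^sub>v d \<and> (\<forall>z. unit_pt z --> F z *\<^sub>v v = chr X w z \<cdot>\<^sub>v v)"
    then obtain v where v: "v \<in> carrier_vec d" "v \<noteq> 0\<^sub>v d" "!!z. unit_pt z ==> F z *\<^sub>v v = chr X w z \<cdot>\<^sub>v v" by blast
    show "w \<in> S'"
    proof (rule ccontr)
      assume nw: "w \<notin> S'"
      have "vec_index v i = 0" if i: "i < d" for i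
      proof -
        \<comment> \<open>The eigenvector equation compared character by character; w may lie
          outside S, hence the case distinction and the index set \<open>insert w S\<close>.\<close>
        define c where "c w' = (if w' \<in> S then \<Sum>a<d. P w' $$ (i,a) * vec_index v a else 0) - (if w' = w then vec_index v i else 0)" for w'
        have "c w = 0"
        proof (rule chr_independent[OF X, of "insert w S"])
          fix z :: "'x => complex" assume z: "unit_pt z"
          have "(\<Sum>w'\<in>insert w S. (if w' \<in> S then \<Sum>a<d. P w' $$ (i,a) * vec_index v a else 0) * chr X w' z)
            = (\<Sum>w'\<in>S. (\<Sum>a<d. P w' $$ (i,a) * vec_index v a) * chr X w' z)"
            using S(1) by (intro sum.mono_neutral_cong_right) auto
          also have "... = (\<Sum>a<d. F z $$ (i,a) * vec_index v a)"
            using P[OF z i] by (simp add: sum_distrib_left mult_ac) (subst sum.swap, simp add: mult_ac)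
          also have "... = vec_index (F z *\<^sub>v v) i"
            using i car[OF z] v(1) by (auto simp: scalar_prod_def atLeast0LessThan intro!: sum.cong)
          also have "... = chr X w z * vec_index v i" using v(3)[OF z] i v(1) by simp
          also have "... = (\<Sum>w'\<in>insert w S. if w' = w then chr X w z * vec_index v i else 0)"
            using S(1) by (simp del: sum.insert)
          also have "... = (\<Sum>w'\<in>insert w S. (if w' = w then vec_index v i else 0) * chr X w' z)"
            by (intro sum.cong) auto
          finally show "(\<Sum>w'\<in>insert w S. c w' * chr X w' z) = 0"
            unfolding c_def left_diff_distrib sum_subtractf by simp
        qed (use S wX in auto)
        moreover have "(if w \<in> S then \<Sum>a<d. P w $$ (i,a) * vec_index v a else 0) = 0"
          using nw i by (auto simp: S'_def)
        ultimately show ?thesis by (simp add: c_def)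
      qed
      hence "v = 0\<^sub>v d" using v(1) by (intro eq_vecI) auto
      thus False using v by simp
    qed
  qed
  show ?thesis
  proof (intro exI[of _ S'] exI[of _ M] conjI ballI allI impI)
    show "finite S'" "S' \<subseteq> X \<rightarrow>\<^sub>E UNIV" using S by (auto simp: S'_def)
    show "M w > 0" if "w \<in> S'" for w using that M(2) by (auto simp: S'_def)
  qed (use tr wtv in auto)
qed

subsection \<open>Schur functions\<close>

lemma isCont_polyfun:
  assumes "polyfun X p" and "!!x. x \<in> X ==> isCont (\<lambda>s. w s x) a"
  shows "isCont (\<lambda>s::complex. p (w s)) a"
  using assms(1) by induction (auto intro!: continuous_intros assms(2))

text \<open>Points with distinct coordinates, where the Weyl denominator does not vanish, are dense:
  moving along the direction (0, 1, 2, ...) separates the coordinates for all but finitely many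
  s.\<close>

lemma eq_of_inj:
  fixes f g :: "(nat => complex) => complex"
  assumes f: "isCont (\<lambda>s. f (\<lambda>i. z i + s * of_nat i)) 0" and g: "isCont (\<lambda>s. g (\<lambda>i. z i + s * of_nat i)) 0"
    and eq: "eventually (\<lambda>s. inj_on (\<lambda>i. z i + s * of_nat i) {..<N} -->
      f (\<lambda>i. z i + s * of_nat i) = g (\<lambda>i. z i + s * of_nat i)) (at 0)"
  shows "f z = g z"
proof -
  let ?w = "\<lambda>(s::complex) i. z i + s * of_nat i"
  \<comment> \<open>The pairs i = j contribute the value 0, which the punctured neighbourhood of 0
    excludes anyway.\<close>
  define Bad where "Bad = (\<Union>i\<in>{..<N}. \<Union>j\<in>{..<N}. {(z j - z i) / (of_nat i - of_nat j)})"
  have inj: "inj_on (?w s) {..<N}" if s: "s \<notin> Bad" for s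
  proof (rule inj_onI, rule ccontr)
    fix i j assume ij: "i \<in> {..<N}" "j \<in> {..<N}" "?w s i = ?w s j" "i \<noteq> j"
    have "of_nat i - of_nat j \<noteq> (0::complex)" using ij(4) by simp
    moreover have "s * (of_nat i - of_nat j) = z j - z i" using ij(3) by (simp add: algebra_simps)
    ultimately have "s = (z j - z i) / (of_nat i - of_nat j)" by (simp add: field_simps)
    thus False using s ij(1,2) unfolding Bad_def by blast
  qed
  have "eventually (\<lambda>s. s \<notin> Bad) (at 0)"
    using islimpt_finite[of Bad 0] by (auto simp: Bad_def islimpt_iff_eventually)
  with eq have ev: "eventually (\<lambda>s. f (?w s) - g (?w s) = 0) (at 0)"
    by eventually_elim (use inj in auto)
  have "isCont (\<lambda>s. f (?w s) - g (?w s)) 0" by (intro continuous_intros f g)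
  hence "((\<lambda>s. f (?w s) - g (?w s)) \<longlongrightarrow> f (?w 0) - g (?w 0)) (at 0)" by (simp add: isCont_def)
  moreover have "((\<lambda>s. f (?w s) - g (?w s)) \<longlongrightarrow> 0) (at 0)" by (rule tendsto_eventually[OF ev])
  ultimately have "f (?w 0) - g (?w 0) = 0" by (rule tendsto_unique[rotated]) simp
  thus ?thesis by simp
qed

lemma polyfun_eq_of_inj:
  assumes f: "polyfun {..<N} f" and g: "polyfun {..<N} g"
    and eq: "!!w :: nat => complex. inj_on w {..<N} ==> f w = g w"
  shows "f z = g z"
  by (rule eq_of_inj[where N = N]) (auto intro!: isCont_polyfun[OF f] isCont_polyfun[OF g] continuous_intros simp: eq)

abbreviation perms :: "nat => (nat => nat) set" where "perms N \<equiv> {p. p permutes {..<N}}"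

lemma det_perms:
  "A \<in> carrier_mat N N ==> det A = (\<Sum>p\<in>perms N. signof p * (\<Prod>i<N. A $$ (i, p i)))"
  by (simp add: det_def' atLeast0LessThan)

lemma permutes_less: "p permutes {..<N} ==> i < N ==> p i < N"
  using permutes_in_image[of p "{..<N}" i] by simp

lemma cnj_signof [simp]: "cnj (signof p) = signof p" by (simp add: sign_def)

lemma signof_sq [simp]: "signof p * signof p = (1 :: complex)" by (simp add: sign_def)

text \<open>The exponents \<open>\<delta>\<close> of the Weyl denominator, shifted to be natural numbers.\<close>

definition stair :: "nat => nat => nat" where "stair N i = N - Suc i"

text \<open>The numerator of the bialternant formula; for l = \<open>stair N\<close> it is the Weyl
  denominator, a Vandermonde determinant.\<close>

definition alternant :: "nat => (nat => nat) => (nat => complex) => complex" where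
  "alternant N l z = det (mat N N (\<lambda>(j,i). z i ^ l j))"

text \<open>Jacobi--Trudi; here \<open>l\<close> is the partition shifted by \<^const>\<open>stair\<close>.\<close>

definition schur :: "nat => (nat => nat) => (nat => complex) => complex" where
  "schur N l z = det (mat N N (\<lambda>(j,i). if stair N i \<le> l j then hsum {..<N} (l j - stair N i) z else 0))"

text \<open>The permutations whose Jacobi--Trudi term has no negative index; on them the subtraction
  of naturals is exact.\<close>

definition jt_perms :: "nat => (nat => nat) => (nat => nat) set" where
  "jt_perms N l = {p \<in> perms N. \<forall>j<N. stair N (p j) \<le> l j}"

lemma finite_jt_perms [simp]: "finite (jt_perms N l)"
  by (simp add: jt_perms_def finite_permutations)

lemma alternant_sum: "alternant N l z = (\<Sum>p\<in>perms N. signof p * (\<Prod>i<N. z i ^ l (p i)))"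
proof -
  have "alternant N l z = (\<Sum>p\<in>perms N. signof p * (\<Prod>j<N. z (p j) ^ l j))"
    unfolding alternant_def by (subst det_perms) (auto intro!: sum.cong prod.cong simp: permutes_less)
  also have "... = (\<Sum>p\<in>perms N. signof (inv_into UNIV p) * (\<Prod>j<N. z (inv_into UNIV p j) ^ l j))"
    by (rule sum_permutations_inverse)
  also have "... = (\<Sum>p\<in>perms N. signof p * (\<Prod>i<N. z i ^ l (p i)))"
  proof (intro sum.cong refl, clarify)
    fix p :: "nat => nat" assume p: "p permutes {..<N}"
    have "(\<Prod>j<N. z (inv_into UNIV p j) ^ l j) = (\<Prod>i<N. z (inv_into UNIV p (p i)) ^ l (p i))"
      by (subst prod.permute[OF p]) (simp add: o_def)
    thus "signof (inv_into UNIV p) * (\<Prod>j<N. z (inv_into UNIV p j) ^ l j) = signof p * (\<Prod>i<N. z i ^ l (p i))"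
      using p by (simp add: signof_inv[OF finite_lessThan p] permutes_inverses(2)[OF p])
  qed
  finally show ?thesis .
qed

lemma schur_sum:
  "schur N l z = (\<Sum>p\<in>jt_perms N l. signof p * (\<Prod>j<N. hsum {..<N} (l j - stair N (p j)) z))"
proof -
  have "schur N l z = (\<Sum>p\<in>perms N. signof p * (\<Prod>j<N. if stair N (p j) \<le> l j then hsum {..<N} (l j - stair N (p j)) z else 0))"
    unfolding schur_def by (subst det_perms) (auto intro!: sum.cong prod.cong simp: permutes_less)
  also have "... = (\<Sum>p\<in>jt_perms N l. signof p * (\<Prod>j<N. hsum {..<N} (l j - stair N (p j)) z))"
    by (rule sum.mono_neutral_cong_right) (auto simp: jt_perms_def finite_permutations intro!: prod_zero)
  finally show ?thesis .
qed

lemma polyfun_hsum: "polyfun {..<N} (hsum {..<N} r)"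
  unfolding hsum_def[abs_def] by (intro polyfun_sum polyfun_prod polyfun_power polyfun_var)

lemma polyfun_schur: "polyfun {..<N} (schur N l)"
  unfolding schur_sum[abs_def] by (intro polyfun_sum polyfun_mult polyfun_const polyfun_prod polyfun_hsum)

lemma schur_cnj: "schur N l (\<lambda>i. cnj (z i)) = cnj (schur N l z)"
  by (simp add: schur_sum hsum_cnj)

lemma schur_label_cong: "(!!i. i < N ==> l i = l' i) ==> schur N l = schur N l'"
  unfolding schur_def by (intro ext arg_cong[of _ _ det] eq_matI) auto

lemma schur_permute:
  assumes p: "p permutes {..<N}"
  shows "schur N (l \<circ> p) z = signof p * schur N l z"
proof -
  let ?A = "mat N N (\<lambda>(j,i). if stair N i \<le> l j then hsum {..<N} (l j - stair N i) z else 0)"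
  have "mat N N (\<lambda>(j,i). if stair N i \<le> (l \<circ> p) j then hsum {..<N} ((l \<circ> p) j - stair N i) z else 0)
    = mat N N (\<lambda>(i,j). ?A $$ (p i, j))"
    by (intro eq_matI) (auto simp: permutes_less[OF p])
  thus ?thesis using det_permute_rows[of ?A N p] p by (simp add: schur_def atLeast0LessThan)
qed

lemma alternant_permute:
  assumes p: "p permutes {..<N}"
  shows "alternant N (l \<circ> p) z = signof p * alternant N l z"
proof -
  let ?A = "mat N N (\<lambda>(j,i). z i ^ l j)"
  have "mat N N (\<lambda>(j,i). z i ^ (l \<circ> p) j) = mat N N (\<lambda>(i,j). ?A $$ (p i, j))"
    by (intro eq_matI) (auto simp: permutes_less[OF p])
  thus ?thesis using det_permute_rows[of ?A N p] p by (simp add: alternant_def atLeast0LessThan)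
qed

lemma schur_not_inj: 
  assumes "\<not> inj_on l {..<N}" shows "schur N l z = 0"
proof -
  obtain i j where ij: "i < N" "j < N" "i \<noteq> j" "l i = l j" using assms by (auto simp: inj_on_def)
  show ?thesis unfolding schur_def
    by (rule det_identical_rows[OF _ ij(3,1,2)]) (use ij in \<open>auto intro!: eq_vecI\<close>)
qed

lemma linear_factors_nth:
  "finite B ==> card B < m ==> fps_nth (\<Prod>b\<in>B. 1 - fps_const (z b :: complex) * fps_X) m = 0"
proof (induction B arbitrary: m rule: finite_induct)
  case (insert b B)
  obtain k where m: "m = Suc k" using insert.prems by (cases m) auto
  have "fps_nth ((1 - fps_const (z b) * fps_X) * F) m = fps_nth F m - z b * fps_nth F k" for F
    by (simp add: left_diff_distrib mult.assoc m)
  thus ?case using insert m by simp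
qed simp

text \<open>The complete homogeneous functions have generating series \<open>1 / \<Prod>\<^sub>b (1 - z\<^sub>b X)\<close>, so
  multiplying by the factors with \<open>b \<noteq> a\<close> leaves \<open>1 / (1 - z\<^sub>a X)\<close>.\<close>

lemma power_eq_hsum:
  fixes z :: "nat => complex"
  assumes a: "a < N"
  obtains e where "!!l. z a ^ l = (\<Sum>i<N. (if stair N i \<le> l then hsum {..<N} (l - stair N i) z else 0) * e i)"
proof -
  let ?G = "\<lambda>b. Abs_fps (\<lambda>n. z b ^ n)" and ?L = "\<lambda>b. 1 - fps_const (z b) * fps_X"
  let ?B = "{..<N} - {a}"
  define E where "E = (\<Prod>b\<in>?B. ?L b)"
  have E0: "fps_nth E m = 0" if "\<not> m < N" for m
    unfolding E_def by (rule linear_factors_nth) (use a that in auto)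
  have "E * Abs_fps (\<lambda>r. hsum {..<N} r z) = E * (?G a * (\<Prod>b\<in>?B. ?G b))"
    using a by (simp add: hsum_fps[symmetric] prod.remove[of "{..<N}" a])
  also have "... = ?G a * (\<Prod>b\<in>?B. ?L b * ?G b)" by (simp add: E_def prod.distrib mult_ac)
  also have "(\<Prod>b\<in>?B. ?L b * ?G b) = 1" by (intro prod.neutral ballI geometric_fps)
  finally have eq: "E * Abs_fps (\<lambda>r. hsum {..<N} r z) = ?G a" by simp
  have "z a ^ l = (\<Sum>i<N. (if stair N i \<le> l then hsum {..<N} (l - stair N i) z else 0) * fps_nth E (stair N i))" for l
  proof -
    have "z a ^ l = fps_nth (E * Abs_fps (\<lambda>r. hsum {..<N} r z)) l" unfolding eq by simp
    also have "... = (\<Sum>m\<in>{0..l}. fps_nth E m * hsum {..<N} (l - m) z)" by (simp add: fps_mult_nth)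
    also have "... = (\<Sum>m\<in>{0..l} \<inter> {..<N}. fps_nth E m * hsum {..<N} (l - m) z)"
      by (rule sum.mono_neutral_right) (auto simp: E0)
    also have "... = (\<Sum>m<N. (if m \<le> l then hsum {..<N} (l - m) z else 0) * fps_nth E m)"
      by (rule sum.mono_neutral_cong_left) auto
    also have "... = (\<Sum>i<N. (if stair N i \<le> l then hsum {..<N} (l - stair N i) z else 0) * fps_nth E (stair N i))"
      unfolding stair_def by (rule sum.nat_diff_reindex[symmetric])
    finally show ?thesis .
  qed
  thus ?thesis by (rule that)
qed

lemma schur_stair: "schur N (stair N) z = 1"
proof -
  let ?A = "mat N N (\<lambda>(j,i). if stair N i \<le> stair N j then hsum {..<N} (stair N j - stair N i) z else 0)"
  have "det ?A = prod_list (diag_mat ?A)"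
    by (rule det_upper_triangular[of _ N]) (auto simp: upper_triangular_def stair_def)
  also have "diag_mat ?A = map (\<lambda>_. 1) [0..<N]" by (auto simp: diag_mat_def)
  finally show ?thesis by (simp add: schur_def map_replicate_const prod_list_replicate)
qed

text \<open>\<open>power_eq_hsum\<close> factors the alternant matrix as the Jacobi--Trudi matrix
  times a matrix that does not depend on l. The case l = \<open>stair N\<close> identifies its
  determinant.\<close>

lemma alternant_eq_schur: "alternant N l z = alternant N (stair N) z * schur N l z"
proof -
  have "\<forall>a\<in>{..<N}. \<exists>e. \<forall>l. z a ^ l = (\<Sum>i<N. (if stair N i \<le> l then hsum {..<N} (l - stair N i) z else 0) * e i)"
  proof
    fix a assume "a \<in> {..<N}"
    hence "a < N" by simp
    from power_eq_hsum[OF this, of z]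
    show "\<exists>e. \<forall>l. z a ^ l = (\<Sum>i<N. (if stair N i \<le> l then hsum {..<N} (l - stair N i) z else 0) * e i)" by metis
  qed
  from bchoice[OF this] obtain e where
    "\<forall>a\<in>{..<N}. \<forall>l. z a ^ l = (\<Sum>i<N. (if stair N i \<le> l then hsum {..<N} (l - stair N i) z else 0) * e a i)" by (elim exE) (rule that)
  hence e: "z a ^ l = (\<Sum>i<N. (if stair N i \<le> l then hsum {..<N} (l - stair N i) z else 0) * e a i)" if "a < N" for a l
    using that by simp
  define C where "C = mat N N (\<lambda>(i,a). e a i)"
  have "alternant N l z = schur N l z * det C" for l
  proof -
    let ?H = "mat N N (\<lambda>(j,i). if stair N i \<le> l j then hsum {..<N} (l j - stair N i) z else 0)"
    have "mat N N (\<lambda>(j,i). z i ^ l j) = ?H * C"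
    proof (rule eq_matI)
      fix j a assume "j < dim_row (?H * C)" "a < dim_col (?H * C)"
      hence ja: "j < N" "a < N" by (auto simp: C_def)
      have "(?H * C) $$ (j,a) = (\<Sum>i<N. ?H $$ (j,i) * C $$ (i,a))"
        by (rule mat_mult_index[of _ N N _ N]) (use ja in \<open>auto simp: C_def\<close>)
      thus "mat N N (\<lambda>(j,i). z i ^ l j) $$ (j,a) = (?H * C) $$ (j,a)"
        using ja e[OF ja(2), of "l j"] by (simp add: C_def)
    qed (auto simp: C_def)
    moreover have "det (?H * C) = det ?H * det C" by (rule det_mult[of _ N]) (auto simp: C_def)
    ultimately show ?thesis by (simp add: alternant_def schur_def)
  qed
  note eq = this
  show ?thesis unfolding eq schur_stair by simp
qed

text \<open>A kernel vector would list the coefficients of a nonzero polynomial of degree below N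
  with N distinct roots.\<close>

lemma alternant_stair_nonzero:
  assumes z: "inj_on z {..<N}" shows "alternant N (stair N) z \<noteq> 0"
proof
  let ?A = "mat N N (\<lambda>(j,i). z i ^ stair N j)"
  let ?T = "mat N N (\<lambda>(i,j). z i ^ stair N j)"
  assume "alternant N (stair N) z = 0"
  moreover have "transpose_mat ?A = ?T" by (intro eq_matI) auto
  ultimately have "det ?T = 0" using det_transpose[of ?A N] by (simp add: alternant_def)
  then obtain v where v: "v \<in> carrier_vec N" "v \<noteq> 0\<^sub>v N" "?T *\<^sub>v v = 0\<^sub>v N"
    using det_0_iff_vec_prod_zero[of ?T N] by auto
  define p where "p = (\<Sum>m<N. monom (vec_index v (stair N m)) m)"
  have "poly p (z i) = 0" if i: "i < N" for i
  proof -
    have "poly p (z i) = (\<Sum>m<N. vec_index v (stair N m) * z i ^ m)" by (simp add: p_def poly_sum poly_monom)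
    also have "... = (\<Sum>j<N. vec_index v (stair N (N - Suc j)) * z i ^ (N - Suc j))"
      by (rule sum.nat_diff_reindex[symmetric])
    also have "... = vec_index (?T *\<^sub>v v) i"
      using i v(1) by (auto simp: scalar_prod_def atLeast0LessThan stair_def intro!: sum.cong)
    finally show ?thesis using v(3) i by simp
  qed
  hence sub: "z ` {..<N} \<subseteq> {x. poly p x = 0}" by auto
  have co: "coeff p m = (if m < N then vec_index v (stair N m) else 0)" for m
    by (simp add: p_def coeff_sum)
  have p0: "p = 0"
  proof (rule ccontr)
    assume p: "p \<noteq> 0"
    have "N \<le> card {x. poly p x = 0}"
      using card_mono[OF poly_roots_finite[OF p] sub] card_image[OF z] by simp
    also have "... \<le> degree p" by (rule poly_roots_degree[OF p])
    finally have "coeff p (degree p) = 0" by (simp add: co)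
    thus False using p by simp
  qed
  have "v = 0\<^sub>v N"
  proof (rule eq_vecI)
    fix i assume "i < dim_vec (0\<^sub>v N :: complex vec)"
    hence i: "i < N" by simp
    hence "coeff p (stair N i) = vec_index v i" by (simp add: co stair_def)
    thus "vec_index v i = vec_index (0\<^sub>v N) i" using p0 i by simp
  qed (use v in simp)
  thus False using v by simp
qed

lemma schur_eq_of_alternant:
  assumes f: "polyfun {..<N} f" and "!!w. f w * alternant N (stair N) w = alternant N l w"
  shows "f z = schur N l z"
proof (rule polyfun_eq_of_inj[OF f polyfun_schur])
  fix w :: "nat => complex" assume "inj_on w {..<N}"
  from alternant_stair_nonzero[OF this] show "f w = schur N l w"
    using assms(2)[of w] alternant_eq_schur[of N l w] by simp
qed

text \<open>Full columns are powers of the determinant, hence invisible on SU(N).\<close>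

lemma schur_shift: "schur N (\<lambda>i. l i + c) z = (\<Prod>i<N. z i) ^ c * schur N l z"
proof (rule schur_eq_of_alternant[symmetric])
  show "polyfun {..<N} (\<lambda>z. (\<Prod>i<N. z i) ^ c * schur N l z)"
    by (intro polyfun_mult polyfun_power polyfun_prod polyfun_var polyfun_schur) auto
  fix w :: "nat => complex"
  have "alternant N (\<lambda>i. l i + c) w = (\<Prod>i<N. w i) ^ c * alternant N l w"
    by (simp add: alternant_sum power_add prod.distrib prod_power_distrib sum_distrib_left mult_ac)
  thus "(\<Prod>i<N. w i) ^ c * schur N l w * alternant N (stair N) w = alternant N (\<lambda>i. l i + c) w"
    using alternant_eq_schur[of N l w] by simp
qed

text \<open>Homogeneity, with the degree of the denominator moved to the left so that no difference
  of naturals appears.\<close>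

lemma schur_scale: "s ^ (\<Sum>j<N. stair N j) * schur N l (\<lambda>i. s * z i) = s ^ (\<Sum>j<N. l j) * schur N l z"
proof -
  have "s ^ (\<Sum>j<N. stair N j) * (\<Prod>j<N. hsum {..<N} (l j - stair N (p j)) (\<lambda>i. s * z i)) =
     s ^ (\<Sum>j<N. l j) * (\<Prod>j<N. hsum {..<N} (l j - stair N (p j)) z)" if p: "p \<in> jt_perms N l" for p
  proof -
    have "(\<Sum>j<N. stair N j) = (\<Sum>j<N. stair N (p j))"
      using p by (subst sum.permute[of p]) (auto simp: jt_perms_def o_def)
    hence e: "(\<Sum>j<N. stair N j) + (\<Sum>j<N. l j - stair N (p j)) = (\<Sum>j<N. l j)"
      using p by (simp add: sum.distrib[symmetric] jt_perms_def)
    show ?thesis unfolding e[symmetric]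
      by (simp add: hsum_scale prod.distrib power_add power_sum mult_ac)
  qed
  thus ?thesis unfolding schur_sum sum_distrib_left by (intro sum.cong refl) (simp add: mult.left_commute)
qed

section \<open>Strictly decreasing labels and their sorting\<close>

definition strict :: "nat => (nat => nat) => bool" where
  "strict N l \<longleftrightarrow> (\<forall>i j. i < j --> j < N --> l j < l i)"

lemma strict_inj: "strict N l ==> inj_on l {..<N}"
  unfolding strict_def by (intro linorder_inj_onI) (auto dest: less_not_refl2)

lemma strict_card: "strict N l ==> i < N ==> card {j \<in> {..<N}. l i < l j} = i"
proof -
  assume l: "strict N l" and i: "i < N"
  have "{j \<in> {..<N}. l i < l j} = {..<i}"
  proof (intro Set.set_eqI iffI)
    fix j assume j: "j \<in> {j \<in> {..<N}. l i < l j}"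
    show "j \<in> {..<i}"
    proof (rule ccontr)
      assume "j \<notin> {..<i}"
      hence "j = i \<or> i < j" by auto
      thus False using l j unfolding strict_def by fastforce
    qed
  qed (use l i in \<open>auto simp: strict_def\<close>)
  thus ?thesis by simp
qed

text \<open>In a strictly decreasing sequence the position of an entry is the number of larger
  entries, which a permutation preserves.\<close>

lemma strict_permute_id:
  assumes "strict N k" "strict N l" and p: "p permutes {..<N}" and eq: "!!j. j < N ==> k j = l (p j)"
  shows "p = id"
proof
  fix i show "p i = id i"
  proof (cases "i < N")
    case True
    have "p ` {j \<in> {..<N}. k i < k j} = {j \<in> {..<N}. l (p i) < l j}"
    proof (intro Set.set_eqI iffI)
      fix j assume j: "j \<in> {j \<in> {..<N}. l (p i) < l j}"
      have pj: "p (inv_into UNIV p j) = j" using p by (simp add: permutes_inverses)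
      have "inv_into UNIV p j < N" using permutes_less[OF permutes_inv[OF p]] j by simp
      thus "j \<in> p ` {j \<in> {..<N}. k i < k j}" using j pj True eq by (intro image_eqI[of _ _ "inv_into UNIV p j"]) auto
    qed (use eq True permutes_less[OF p] in auto)
    hence "card {j \<in> {..<N}. k i < k j} = card {j \<in> {..<N}. l (p i) < l j}"
      using card_image[OF permutes_inj_on[OF p]] by metis
    thus ?thesis using strict_card[OF assms(1) True] strict_card[OF assms(2) permutes_less[OF p True]] by simp
  next
    case False
    thus ?thesis using p by (simp add: permutes_not_in)
  qed
qed

lemma strict_sorting:
  assumes l: "inj_on l {..<N}"
  obtains p where "p permutes {..<N}" "strict N (l \<circ> p)"
proof -
  have "card (l ` {..<N}) = N" using card_image[OF l] by simp
  then obtain h where h: "bij_betw h {..<N} (l ` {..<N})" "strict_mono_on {..<N} h"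
    using ex_bij_betw_strict_mono_card[of "l ` {..<N}"] by (metis finite_imageI finite_lessThan)
  define p where "p j = (if j < N then inv_into {..<N} l (h (N - Suc j)) else j)" for j
  have r: "bij_betw (\<lambda>j. N - Suc j) {..<N} {..<N}"
    by (rule bij_betwI[of _ _ _ "\<lambda>j. N - Suc j"]) auto
  have "bij_betw (inv_into {..<N} l \<circ> (h \<circ> (\<lambda>j. N - Suc j))) {..<N} {..<N}"
    using bij_betw_trans[OF bij_betw_trans[OF r h(1)] bij_betw_inv_into[of l "{..<N}" "l ` {..<N}"]] l
    by (simp add: bij_betw_def)
  hence "bij_betw p {..<N} {..<N}" by (rule bij_betw_cong[THEN iffD1, rotated]) (simp add: p_def)
  hence pp: "p permutes {..<N}" by (rule bij_imp_permutes) (simp add: p_def)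
  have lp: "l (p j) = h (N - Suc j)" if "j < N" for j
    using that f_inv_into_f[of "h (N - Suc j)" l "{..<N}"] bij_betw_apply[OF h(1), of "N - Suc j"] by (simp add: p_def)
  have "strict N (l \<circ> p)" unfolding strict_def
    using h(2) by (auto simp: lp strict_mono_on_def)
  with pp show ?thesis by (rule that)
qed

text \<open>Expanding the complete functions produces tables with row sums b; the coefficient
  selects those with column sums k - e. Counts of tables thus become coefficients, from which
  alternants can be reassembled.\<close>

lemma mcoeff_mon_hsum:
  assumes k: "!!j. j < N ==> k j < D" and D: "(\<Sum>j<N. e j) + (\<Sum>j<N. b j) < D"
  shows "mcoeff {..<N} D (restrict k {..<N}) (\<lambda>v. (\<Prod>j<N. v j ^ e j) * (\<Prod>i<N. hsum {..<N} (b i) v)) =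
    (if \<forall>j<N. e j \<le> k j then of_nat (card (ctab N (\<lambda>j. k j - e j) b)) else 0)"
proof -
  let ?W = "\<lambda>i. {i} \<times> {..<N}"
  let ?E = "exps (mvars N) {..<N} ?W b"
  let ?k = "restrict k {..<N}"
  have mv: "mvars N = {..<N} \<times> {..<N}" by (auto simp: mvars_def)
  define c where "c m = (\<lambda>j\<in>{..<N}. e j + (\<Sum>i<N. m (i,j)))" for m :: "nat \<times> nat => nat"
  interpret w: grading "mvars N" "{..<N}" ?W by unfold_locales (auto simp: mv)
  have fE: "finite ?E" by (rule w.finite_exps)
  have exp: "(\<Prod>j<N. v j ^ e j) * (\<Prod>i<N. hsum {..<N} (b i) v) = (\<Sum>m\<in>?E. 1 * mon {..<N} (c m) v)" for v
  proof -
    have "(\<Prod>i<N. hsum {..<N} (b i) v) = (\<Prod>i<N. hsum (?W i) (b i) (\<lambda>x. v (snd x)))"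
    proof (intro prod.cong refl)
      fix i
      have "hsum (Pair i ` {..<N}) (b i) (\<lambda>x. v (snd x)) = hsum {..<N} (b i) (\<lambda>j. v (snd (Pair i j)))"
        by (rule hsum_image) (auto simp: inj_on_def)
      moreover have "Pair i ` {..<N} = ?W i" by auto
      ultimately show "hsum {..<N} (b i) v = hsum (?W i) (b i) (\<lambda>x. v (snd x))" by simp
    qed
    also have "... = (\<Sum>m\<in>?E. mon (mvars N) m (\<lambda>x. v (snd x)))"
      by (rule sum_exps_eq_prod_hsum[symmetric, where lab = fst]) (auto simp: mv)
    finally have "(\<Prod>j<N. v j ^ e j) * (\<Prod>i<N. hsum {..<N} (b i) v) =
      (\<Sum>m\<in>?E. (\<Prod>j<N. v j ^ e j) * mon (mvars N) m (\<lambda>x. v (snd x)))" by (simp add: sum_distrib_left)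
    also have "... = (\<Sum>m\<in>?E. 1 * mon {..<N} (c m) v)"
    proof (intro sum.cong refl)
      fix m
      have "mon (mvars N) m (\<lambda>x. v (snd x)) = (\<Prod>j<N. \<Prod>i<N. v j ^ m (i,j))"
        unfolding mon_def mv by (subst prod.swap) (simp add: prod.cartesian_product case_prod_unfold)
      thus "(\<Prod>j<N. v j ^ e j) * mon (mvars N) m (\<lambda>x. v (snd x)) = 1 * mon {..<N} (c m) v"
        by (simp add: mon_def c_def power_add prod.distrib power_sum)
    qed
    finally show ?thesis .
  qed
  have cD: "c m \<in> {..<N} \<rightarrow>\<^sub>E {..<D}" if m: "m \<in> ?E" for m
  proof -
    have "e j + (\<Sum>i<N. m (i,j)) < D" if j: "j < N" for j
    proof -
      have "e j \<le> (\<Sum>j<N. e j)" using j by (intro member_le_sum) auto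
      moreover have "(\<Sum>i<N. m (i,j)) \<le> (\<Sum>i<N. \<Sum>j<N. m (i,j))"
        using j by (intro sum_mono member_le_sum) auto
      moreover have "(\<Sum>i<N. \<Sum>j<N. m (i,j)) = (\<Sum>i<N. b i)"
      proof (intro sum.cong refl)
        fix i assume i: "i \<in> {..<N}"
        have "Pair i ` {..<N} = ?W i" by auto
        hence "sum m (?W i) = (\<Sum>j<N. m (i,j))" using sum.reindex[of "Pair i" "{..<N}" m] by (simp add: inj_on_def)
        thus "(\<Sum>j<N. m (i,j)) = b i" using m i by (simp add: exps_def)
      qed
      ultimately show ?thesis using D by linarith
    qed
    thus ?thesis by (auto simp: c_def)
  qed
  have "mcoeff {..<N} D ?k (\<lambda>v. (\<Prod>j<N. v j ^ e j) * (\<Prod>i<N. hsum {..<N} (b i) v)) =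
    (\<Sum>m\<in>?E. 1 * mcoeff {..<N} D ?k (mon {..<N} (c m)))"
    unfolding exp by (rule mcoeff_sum)
  also have "... = (\<Sum>m\<in>?E. if ?k = c m then 1 else 0)"
    using k cD by (intro sum.cong refl) (subst mcoeff_mon, auto)
  also have "... = of_nat (card {m \<in> ?E. ?k = c m})"
    using fE by (simp add: sum.If_cases Int_def)
  also have "... = (if \<forall>j<N. e j \<le> k j then of_nat (card (ctab N (\<lambda>j. k j - e j) b)) else 0)"
  proof (cases "\<forall>j<N. e j \<le> k j")
    case True
    have "?k = c m \<longleftrightarrow> (\<forall>j<N. (\<Sum>i<N. m (i,j)) = k j - e j)" for m
    proof
      assume a: "?k = c m"
      show "\<forall>j<N. (\<Sum>i<N. m (i,j)) = k j - e j"
      proof (intro allI impI)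
        fix j assume "j < N"
        thus "(\<Sum>i<N. m (i,j)) = k j - e j" using fun_cong[OF a, of j] by (simp add: c_def)
      qed
    qed (use True in \<open>auto simp: c_def intro!: ext\<close>)
    moreover have "m \<in> ctab N (\<lambda>j. k j - e j) b \<longleftrightarrow> m \<in> ?E \<and> (\<forall>j<N. (\<Sum>i<N. m (i,j)) = k j - e j)" for m
    proof -
      have 1: "mweights N (Inl j) = (\<lambda>i. (i,j)) ` {..<N}" if "j < N" for j using that by (auto simp: mweights_def mv)
      have 2: "mweights N (Inr i) = ?W i" if "i < N" for i using that by (auto simp: mweights_def mv)
      have 3: "(\<Sum>x\<in>(\<lambda>i. (i,j)) ` {..<N}. m x) = (\<Sum>i<N. m (i,j))" for j
        by (subst sum.reindex) (auto simp: inj_on_def)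
      show ?thesis by (auto simp: ctab_def exps_def qlabels_def ball_Un 1 2 3)
    qed
    ultimately have "{m \<in> ?E. ?k = c m} = ctab N (\<lambda>j. k j - e j) b" by blast
    thus ?thesis using True by simp
  next
    case False
    then obtain j where j: "j < N" "k j < e j" by (auto simp: not_le)
    have "?k \<noteq> c m" for m
    proof
      assume "?k = c m"
      from fun_cong[OF this, of j] show False using j by (simp add: c_def)
    qed
    hence e: "{m \<in> ?E. ?k = c m} = {}" by blast
    show ?thesis unfolding e by (simp only: if_not_P[OF False] card.empty of_nat_0)
  qed
  finally show ?thesis .
qed

section \<open>Orthonormality of Schur functions on SU(n)\<close>

text \<open>The class function conj(s_k) s_l, assembled from traces so that its measurability and
  integral come from \<open>op_trace\<close>.\<close>

definition schur_pair :: "nat => (nat => nat) => (nat => nat) => complex mat => complex" where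
  "schur_pair N k l g = (\<Sum>p\<in>jt_perms N k. \<Sum>p'\<in>jt_perms N l. (signof p * signof p') *
     q.op_trace N N (case_sum (\<lambda>j. k j - stair N (p j)) (\<lambda>j. l j - stair N (p' j))) (act N (mat_adjoint g) g))"

lemma schur_pair_diagonalised:
  assumes V: "V \<in> SU_grp N" and g: "g = V * mat_diag N z * mat_adjoint V"
  shows "schur_pair N k l g = cnj (schur N k z) * schur N l z"
  unfolding schur_pair_def op_trace_act[OF V g] schur_cnj[symmetric]
  unfolding schur_sum sum_product
  by (simp add: mult_ac)

context unitary_mean
begin

lemma bmf_schur_pair: "bmf (schur_pair n k l)"
  unfolding schur_pair_def[abs_def] by (intro bmf_sum bmf_mult[OF bmf_const] bmf_op_trace)

text \<open>Each trace integrates to a number of contingency tables, that is, to a coefficient of a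
  monomial times complete functions. With signs these monomials sum to the Weyl denominator and the
  products to s_l, so the integral is the coefficient of the monomial k in the alternant of
  l.\<close>

lemma integral_schur_pair:
  assumes n: "n > 0" and kl: "(\<Sum>j<n. k j) = (\<Sum>j<n. l j)"
  shows "(LINT g|\<mu>. schur_pair n k l g) = (\<Sum>p\<in>perms n. signof p * (if \<forall>j<n. k j = l (p j) then 1 else 0))"
proof -
  let ?b = "\<lambda>p j. l j - stair n (p j)" and ?a = "\<lambda>p j. k j - stair n (p j)"
  define D where "D = Suc ((\<Sum>j<n. k j) + (\<Sum>j<n. l j) + (\<Sum>j<n. stair n j))"
  have st: "(\<Sum>j<n. stair n (p j)) = (\<Sum>j<n. stair n j)" if "p permutes {..<n}" for p
    using sum.permute[OF that, of "stair n"] by (simp add: o_def)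
  have sub: "(\<Sum>j<n. f j - stair n (p j)) + (\<Sum>j<n. stair n j) = (\<Sum>j<n. f j)" if "p \<in> jt_perms n f" for p f
    using that by (simp add: st[symmetric, of p] sum.distrib[symmetric] jt_perms_def)
  have kD: "k j < D" "l j < D" if "j < n" for j
    using member_le_sum[of j "{..<n}" k] member_le_sum[of j "{..<n}" l] that by (auto simp: D_def)
  let ?c = "mcoeff {..<n} D (restrict k {..<n})"
  have i: "integrable \<mu> (\<lambda>g. q.op_trace n n d (act n (mat_adjoint g) g))" for d
    by (rule bmf_integrable[OF bmf_op_trace])
  have "(LINT g|\<mu>. schur_pair n k l g) = (\<Sum>p\<in>jt_perms n k. \<Sum>p'\<in>jt_perms n l. (signof p * signof p') *
     (LINT g|\<mu>. q.op_trace n n (case_sum (?a p) (?b p')) (act n (mat_adjoint g) g)))"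
    unfolding schur_pair_def
    by (simp add: Bochner_Integration.integral_sum Bochner_Integration.integrable_sum Bochner_Integration.integrable_mult_right[OF i])
  also have "... = (\<Sum>p\<in>jt_perms n k. \<Sum>p'\<in>jt_perms n l. (signof p * signof p') * of_nat (card (ctab n (?a p) (?b p'))))"
  proof (intro sum.cong refl arg_cong2[of _ _ _ _ "(*)"])
    fix p p' assume "p \<in> jt_perms n k" "p' \<in> jt_perms n l"
    from sub[OF this(1)] sub[OF this(2)] kl have "(\<Sum>j<n. ?a p j) = (\<Sum>j<n. ?b p' j)" by simp
    thus "(LINT g|\<mu>. q.op_trace n n (case_sum (?a p) (?b p')) (act n (mat_adjoint g) g)) = of_nat (card (ctab n (?a p) (?b p')))"
      using n by (intro integral_op_trace) auto
  qed
  also have "... = (\<Sum>p\<in>perms n. \<Sum>p'\<in>jt_perms n l. (signof p * signof p') *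
      (if \<forall>j<n. stair n (p j) \<le> k j then of_nat (card (ctab n (?a p) (?b p'))) else 0))"
  proof (rule sum.mono_neutral_cong_left)
    show "\<forall>p\<in>perms n - jt_perms n k. (\<Sum>p'\<in>jt_perms n l. (signof p * signof p') *
      (if \<forall>j<n. stair n (p j) \<le> k j then of_nat (card (ctab n (?a p) (?b p'))) else 0)) = (0 :: complex)"
    proof
      fix p assume "p \<in> perms n - jt_perms n k"
      hence "\<not> (\<forall>j<n. stair n (p j) \<le> k j)" by (simp add: jt_perms_def)
      thus "(\<Sum>p'\<in>jt_perms n l. (signof p * signof p') *
        (if \<forall>j<n. stair n (p j) \<le> k j then of_nat (card (ctab n (?a p) (?b p'))) else 0)) = (0 :: complex)"
        by (simp only: if_False mult_zero_right sum.neutral_const)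
    qed
  qed (auto simp: jt_perms_def finite_permutations)
  also have "... = (\<Sum>p\<in>perms n. \<Sum>p'\<in>jt_perms n l. (signof p * signof p') *
      ?c (\<lambda>v. (\<Prod>j<n. v j ^ stair n (p j)) * (\<Prod>i<n. hsum {..<n} (?b p' i) v)))"
  proof (intro sum.cong refl arg_cong2[of _ _ _ _ "(*)"])
    fix p p' assume "p \<in> perms n" "p' \<in> jt_perms n l"
    hence "(\<Sum>j<n. stair n (p j)) + (\<Sum>j<n. ?b p' j) < D" using sub[of p' l] st[of p] by (simp add: D_def)
    from mcoeff_mon_hsum[OF kD(1) this]
    show "(if \<forall>j<n. stair n (p j) \<le> k j then of_nat (card (ctab n (?a p) (?b p'))) else 0) =
      ?c (\<lambda>v. (\<Prod>j<n. v j ^ stair n (p j)) * (\<Prod>i<n. hsum {..<n} (?b p' i) v))" by simp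
  qed
  also have "... = (\<Sum>q\<in>perms n \<times> jt_perms n l. (signof (fst q) * signof (snd q)) *
      ?c (\<lambda>v. (\<Prod>j<n. v j ^ stair n (fst q j)) * (\<Prod>i<n. hsum {..<n} (?b (snd q) i) v)))"
    by (simp add: sum.cartesian_product case_prod_unfold)
  also have "... = ?c (\<lambda>v. \<Sum>q\<in>perms n \<times> jt_perms n l. (signof (fst q) * signof (snd q)) *
      ((\<Prod>j<n. v j ^ stair n (fst q j)) * (\<Prod>i<n. hsum {..<n} (?b (snd q) i) v)))"
    by (rule mcoeff_sum[symmetric])
  also have "(\<lambda>v. \<Sum>q\<in>perms n \<times> jt_perms n l. (signof (fst q) * signof (snd q)) *
      ((\<Prod>j<n. v j ^ stair n (fst q j)) * (\<Prod>i<n. hsum {..<n} (?b (snd q) i) v))) =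
      (\<lambda>v. alternant n l v)"
    unfolding alternant_eq_schur[of n l] 
    by (simp add: alternant_sum schur_sum sum_product sum.cartesian_product case_prod_unfold mult_ac)
  also have "... = (\<lambda>v. \<Sum>p\<in>perms n. signof p * mon {..<n} (restrict (l \<circ> p) {..<n}) v)"
    by (simp add: alternant_sum mon_def)
  also have "?c ... = (\<Sum>p\<in>perms n. signof p * ?c (mon {..<n} (restrict (l \<circ> p) {..<n})))"
    by (rule mcoeff_sum)
  also have "... = (\<Sum>p\<in>perms n. signof p * (if \<forall>j<n. k j = l (p j) then 1 else 0))"
  proof (intro sum.cong refl arg_cong2[of _ _ _ _ "(*)"])
    fix p assume p: "p \<in> perms n"
    have "restrict k {..<n} = restrict (l \<circ> p) {..<n} \<longleftrightarrow> (\<forall>j<n. k j = l (p j))"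
    proof
      assume a: "restrict k {..<n} = restrict (l \<circ> p) {..<n}"
      show "\<forall>j<n. k j = l (p j)"
      proof (intro allI impI)
        fix j assume "j < n"
        thus "k j = l (p j)" using fun_cong[OF a, of j] by simp
      qed
    qed (auto intro!: restrict_ext)
    thus "?c (mon {..<n} (restrict (l \<circ> p) {..<n})) = (if \<forall>j<n. k j = l (p j) then 1 else 0)"
      using p kD permutes_less[of p n] by (subst mcoeff_mon) auto
  qed
  finally show ?thesis .
qed

text \<open>Translation by the central element \<open>\<zeta> 1\<close> with \<open>\<zeta>\<close> a primitive \<open>n\<close>-th root of unity.\<close>

lemma integral_schur_pair_center:
  assumes n: "n > 0" and ne: "(\<Sum>j<n. k j) \<noteq> (\<Sum>j<n. l j)"
    and lt: "(\<Sum>j<n. k j) < (\<Sum>j<n. l j) + n" "(\<Sum>j<n. l j) < (\<Sum>j<n. k j) + n"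
    and sp: "space \<mu> = SU_grp n"
  shows "(LINT g|\<mu>. schur_pair n k l g) = 0"
proof -
  define \<zeta> where "\<zeta> = cis (2 * pi / real n)"
  have u: "cmod \<zeta> = 1" by (simp add: \<zeta>_def)
  have pw: "\<zeta> ^ m = cis (2 * pi * real m / real n)" for m by (simp add: \<zeta>_def Complex.DeMoivre mult_ac)
  have inj: "inj_on (\<lambda>m. \<zeta> ^ m) {..<n}"
    using Complex.bij_betw_roots_unity[OF n] by (simp add: bij_betw_def pw)
  have ne1: "\<zeta> ^ m \<noteq> 1" if "0 < m" "m < n" for m
    using inj_onD[OF inj, of m 0] that by auto
  \<comment> \<open>The two degrees differ, but by less than n, so the central element acts by a
    nontrivial n-th root of unity.\<close>
  have ne2: "cnj (\<zeta> ^ a) * \<zeta> ^ b \<noteq> 1" if "a \<noteq> b" "a < b + n" "b < a + n" for a b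
  proof (cases "a \<le> b")
    case True
    have "cnj (\<zeta> ^ a) * \<zeta> ^ b = (cnj (\<zeta> ^ a) * \<zeta> ^ a) * \<zeta> ^ (b - a)"
      using True by (simp add: power_add[symmetric] mult.assoc)
    also have "cnj (\<zeta> ^ a) * \<zeta> ^ a = 1"
      using complex_norm_square[of "\<zeta> ^ a"] u by (simp add: norm_power mult.commute)
    finally show ?thesis using ne1[of "b - a"] that True by simp
  next
    case False
    have "cnj (cnj (\<zeta> ^ a) * \<zeta> ^ b) = (cnj (\<zeta> ^ b) * \<zeta> ^ b) * \<zeta> ^ (a - b)"
      using False by (simp add: power_add[symmetric] mult.assoc mult.commute)
    also have "cnj (\<zeta> ^ b) * \<zeta> ^ b = 1"
      using complex_norm_square[of "\<zeta> ^ b"] u by (simp add: norm_power mult.commute)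
    finally have "cnj (cnj (\<zeta> ^ a) * \<zeta> ^ b) \<noteq> 1" using ne1[of "a - b"] that False by simp
    thus ?thesis by (metis complex_cnj_one)
  qed
  let ?h = "mat_diag n (\<lambda>_. \<zeta>)"
  have "\<zeta> ^ n = 1" using n by (simp add: pw)
  hence h: "?h \<in> SU_grp n" using u by (simp add: SU_iff mat_diag_Ugrp det_mat_diag)
  have tr: "schur_pair n k l (?h * g) = cnj (\<zeta> ^ (\<Sum>j<n. k j)) * \<zeta> ^ (\<Sum>j<n. l j) * schur_pair n k l g"
    if g: "g \<in> SU_grp n" for g
  proof -
    obtain V z where V: "V \<in> SU_grp n" and gV: "g = V * mat_diag n z * mat_adjoint V"
      using Ugrp_diagonalisation[OF SU_Ugrp[OF g]] by metis
    have Vc: "V \<in> carrier_mat n n" "mat_adjoint V \<in> carrier_mat n n" using V by auto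
    have hm: "?h * A = \<zeta> \<cdot>\<^sub>m A" if "A \<in> carrier_mat n n" for A
      using that by (intro eq_matI) (auto simp: mat_diag_mult_left[of _ n n])
    have "?h * g = \<zeta> \<cdot>\<^sub>m (V * mat_diag n z * mat_adjoint V)" using g by (subst hm) (auto simp: gV)
    also have "... = V * (\<zeta> \<cdot>\<^sub>m mat_diag n z) * mat_adjoint V"
      using Vc by (simp add: mult_smult_assoc_mat[of _ n n _ n] mult_smult_distrib[of _ n n _ n])
    also have "\<zeta> \<cdot>\<^sub>m mat_diag n z = mat_diag n (\<lambda>i. \<zeta> * z i)"
      by (intro eq_matI) (auto simp: mat_diag_def)
    finally have "?h * g = V * mat_diag n (\<lambda>i. \<zeta> * z i) * mat_adjoint V" .
    from schur_pair_diagonalised[OF V this]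
    have s: "schur_pair n k l (?h * g) = cnj (schur n k (\<lambda>i. \<zeta> * z i)) * schur n l (\<lambda>i. \<zeta> * z i)" .
    let ?d = "\<zeta> ^ (\<Sum>j<n. stair n j)"
    have d: "cnj ?d * ?d = 1" using complex_norm_square[of ?d] u by (simp add: norm_power mult.commute)
    have "schur_pair n k l (?h * g) = (cnj ?d * ?d) * (cnj (schur n k (\<lambda>i. \<zeta> * z i)) * schur n l (\<lambda>i. \<zeta> * z i))"
      unfolding d s by simp
    also have "... = cnj (?d * schur n k (\<lambda>i. \<zeta> * z i)) * (?d * schur n l (\<lambda>i. \<zeta> * z i))" by simp
    also have "... = cnj (\<zeta> ^ (\<Sum>j<n. k j)) * \<zeta> ^ (\<Sum>j<n. l j) * (cnj (schur n k z) * schur n l z)"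
      unfolding schur_scale by simp
    finally show ?thesis unfolding schur_pair_diagonalised[OF V gV] .
  qed
  have m: "schur_pair n k l \<in> borel_measurable \<mu>" using bmf_schur_pair by (simp add: bdd_measurable_def)
  let ?I = "LINT g|\<mu>. schur_pair n k l g"
  have "?I = (LINT g|\<mu>. schur_pair n k l (?h * g))" using integral_translate[OF h m] by simp
  also have "... = (LINT g|\<mu>. cnj (\<zeta> ^ (\<Sum>j<n. k j)) * \<zeta> ^ (\<Sum>j<n. l j) * schur_pair n k l g)"
    by (intro Bochner_Integration.integral_cong refl tr) (simp add: sp)
  also have "... = cnj (\<zeta> ^ (\<Sum>j<n. k j)) * \<zeta> ^ (\<Sum>j<n. l j) * ?I" by simp
  finally have "(1 - cnj (\<zeta> ^ (\<Sum>j<n. k j)) * \<zeta> ^ (\<Sum>j<n. l j)) * ?I = 0" by (simp add: algebra_simps)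
  thus ?thesis using ne2[OF ne lt] by simp
qed

text \<open>Strictly decreasing labels can only be matched by the identity permutation, so one
  signed term survives. Unequal degrees are left to the centre.\<close>

lemma schur_orthonormal:
  assumes n: "n > 0" and sp: "space \<mu> = SU_grp n" and k: "strict n k" and l: "strict n l"
    and lt: "(\<Sum>j<n. k j) < (\<Sum>j<n. l j) + n" "(\<Sum>j<n. l j) < (\<Sum>j<n. k j) + n"
  shows "(LINT g|\<mu>. schur_pair n k l g) = (if \<forall>j<n. k j = l j then 1 else 0)"
proof (cases "(\<Sum>j<n. k j) = (\<Sum>j<n. l j)")
  case True
  have id: "id \<in> perms n" by (simp add: permutes_id)
  have "(LINT g|\<mu>. schur_pair n k l g) = (\<Sum>p\<in>perms n. signof p * (if \<forall>j<n. k j = l (p j) then 1 else 0))"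
    by (rule integral_schur_pair[OF n True])
  also have "... = (\<Sum>p\<in>{id}. signof p * (if \<forall>j<n. k j = l (p j) then 1 else 0))"
    using id strict_permute_id[OF k l] by (intro sum.mono_neutral_right) (auto simp: finite_permutations)
  also have "... = (if \<forall>j<n. k j = l j then 1 else 0)" by (simp add: sign_id)
  finally show ?thesis .
next
  case False
  have "\<not> (\<forall>j<n. k j = l j)"
  proof
    assume "\<forall>j<n. k j = l j"
    hence "(\<Sum>j<n. k j) = (\<Sum>j<n. l j)" by (intro sum.cong) auto
    with False show False ..
  qed
  thus ?thesis using integral_schur_pair_center[OF n False lt sp] by simp
qed

end

subsection \<open>Weights of representations of \<open>SU(N) \<times> SU(N)\<close>\<close>

definition tpt :: "nat => (nat => complex) => bool" where
  "tpt N \<xi> \<longleftrightarrow> (\<forall>i<N. cmod (\<xi> i) = 1) \<and> (\<Prod>i<N. \<xi> i) = 1"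

lemma tpt_SU: "tpt N \<xi> ==> mat_diag N \<xi> \<in> SU_grp N"
  by (simp add: tpt_def SU_iff mat_diag_Ugrp det_mat_diag)

text \<open>Padding by 1 realises x_0 = x_N = 1 and turns \<open>torus_coord\<close> into a plain
  quotient.\<close>

definition fpad :: "nat => (nat => complex) => nat => complex" where
  "fpad N x k = (if k \<in> {1..<N} then x k else 1)"

lemma torus_coord_fpad: "i < N ==> torus_coord N x (Suc i) = fpad N x (Suc i) / fpad N x i"
  by (auto simp: torus_coord_def fpad_def)

lemma fpad_unit: "fugacities N x ==> cmod (fpad N x k) = 1"
  by (simp add: fugacities_def fpad_def)

text \<open>Summation by parts in multiplicative form: exponents of the eigenvalues become
  consecutive differences in the basis of fundamental weights.\<close>

lemma torus_monomial:
  assumes x: "fugacities N x" and N: "N > 0"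
  shows "(\<Prod>i<N. torus_coord N x (Suc i) ^ p i) = (\<Prod>k\<in>{1..<N}. x k powi (int (p (k - 1)) - int (p k)))"
proof -
  let ?X = "fpad N x"
  have nz: "?X k \<noteq> 0" for k using fpad_unit[OF x, of k] by auto
  have *: "(\<Prod>i<Suc n. (?X (Suc i) / ?X i) ^ p i) =
     ?X (Suc n) ^ p n * (\<Prod>k\<in>{1..<Suc n}. ?X k powi (int (p (k - 1)) - int (p k)))" for n
  proof (induction n)
    case 0
    show ?case by (simp add: fpad_def)
  next
    case (Suc n)
    have "?X (Suc n) powi (int (p n) - int (p (Suc n))) = ?X (Suc n) ^ p n / ?X (Suc n) ^ p (Suc n)"
      using nz by (simp add: power_int_diff)
    thus ?case using Suc.IH by (simp add: power_divide)
  qed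
  obtain n where n: "N = Suc n" using N by (cases N) auto
  have "(\<Prod>i<N. torus_coord N x (Suc i) ^ p i) = (\<Prod>i<N. (?X (Suc i) / ?X i) ^ p i)"
    by (intro prod.cong) (auto simp: torus_coord_fpad)
  also have "... = ?X N ^ p n * (\<Prod>k\<in>{1..<N}. ?X k powi (int (p (k - 1)) - int (p k)))"
    using *[of n] unfolding n .
  also have "... = (\<Prod>k\<in>{1..<N}. x k powi (int (p (k - 1)) - int (p k)))"
    by (simp add: fpad_def)
  finally show ?thesis .
qed

lemma tpt_torus_coord:
  assumes x: "fugacities N x" and N: "N > 0"
  shows "tpt N (\<lambda>i. torus_coord N x (Suc i))"
  unfolding tpt_def using torus_monomial[OF x N, of "\<lambda>_. 1"] fpad_unit[OF x]
  by (simp add: torus_coord_fpad norm_divide)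

lemma torus_element_SU: "fugacities N x ==> N > 0 ==> torus_element N x \<in> SU_grp N"
  unfolding torus_element_def by (intro tpt_SU tpt_torus_coord)

lemma torus_coord_surj:
  assumes "tpt N \<xi>"
  obtains x where "!!k. cmod (x k) = 1" "!!i. i < N ==> torus_coord N x (Suc i) = \<xi> i"
proof
  define x where "x k = (if k \<le> N then \<Prod>i<k. \<xi> i else 1)" for k
  show u: "cmod (x k) = 1" for k using assms by (simp add: x_def tpt_def prod_norm[symmetric])
  fix i assume i: "i < N"
  have "x i = (\<Prod>i<i. \<xi> i)" using i by (simp add: x_def)
  hence nz: "(\<Prod>i<i. \<xi> i) \<noteq> 0" using u[of i] by (metis norm_zero zero_neq_one)
  show "torus_coord N x (Suc i) = \<xi> i"
  proof (cases "Suc i < N")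
    case True
    thus ?thesis using nz by (auto simp: torus_coord_def x_def)
  next
    case False
    hence "N = Suc i" using i by simp
    thus ?thesis using nz assms by (auto simp: torus_coord_def x_def tpt_def field_simps)
  qed
qed

text \<open>A permutation matrix, with a phase in its first row that brings the determinant to
  one.\<close>

lemma weyl_element:
  assumes s: "s permutes {..<N}" and N: "N > 0"
  obtains W where "W \<in> SU_grp N" "!!f. W * mat_diag N f = mat_diag N (f \<circ> s) * W"
proof -
  define Q :: "complex mat" where "Q = mat N N (\<lambda>(i,j). if j = s i then 1 else 0)"
  have Qc: "Q \<in> carrier_mat N N" by (simp add: Q_def)
  have si: "s i < N" if "i < N" for i using permutes_in_image[OF s, of i] that by simp
  have QQ: "mat_adjoint Q * Q = 1\<^sub>m N"
  proof (rule eq_matI)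
    fix i j assume "i < dim_row (1\<^sub>m N :: complex mat)" "j < dim_col (1\<^sub>m N :: complex mat)"
    hence ij: "i < N" "j < N" by auto
    have "(mat_adjoint Q * Q) $$ (i,j) = (\<Sum>k<N. mat_adjoint Q $$ (i,k) * Q $$ (k,j))"
      using ij Qc by (intro mat_mult_index[of _ N N _ N]) auto
    also have "... = (\<Sum>k<N. (\<lambda>m. (if i = m then 1 else 0) * (if j = m then 1 else 0)) (s k))"
      using ij Qc by (intro sum.cong refl) (auto simp: mat_adjoint_index_cnj[of _ N N] Q_def)
    also have "... = (\<Sum>m<N. (if i = m then 1 else 0) * (if j = m then 1 else 0))"
      using sum.permute[OF s, of "\<lambda>m. (if i = m then 1 else 0) * (if j = m then 1 else 0)", symmetric] by (simp add: o_def)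
    also have "... = (\<Sum>m<N. if i = m then (if j = m then 1 else 0) else 0)"
      by (intro sum.cong) auto
    also have "... = 1\<^sub>m N $$ (i,j)" using ij by auto
    finally show "(mat_adjoint Q * Q) $$ (i,j) = 1\<^sub>m N $$ (i,j)" .
  qed (auto simp: Q_def)
  hence QU: "Q \<in> U_grp N" using Qc by (simp add: Ugrp_iff)
  define c where "c i = (if i = 0 then 1 / det Q else 1)" for i :: nat
  have cu: "cmod (c i) = 1" for i using Ugrp_det[OF QU] by (simp add: c_def norm_divide)
  have "det Q \<noteq> 0" using Ugrp_det[OF QU] by auto
  moreover have "(\<Prod>i<N. c i) = 1 / det Q"
  proof -
    have "(\<Prod>i<N. c i) = (\<Prod>i\<in>{0}. c i)"
      using N by (intro prod.mono_neutral_right) (auto simp: c_def)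
    thus ?thesis by (simp add: c_def)
  qed
  ultimately have "det (mat_diag N c * Q) = 1"
    by (subst det_mult[of _ N]) (auto simp: det_mat_diag Qc)
  moreover have "mat_diag N c * Q \<in> U_grp N" using cu QU by (intro Ugrp_mult mat_diag_Ugrp)
  ultimately have W: "mat_diag N c * Q \<in> SU_grp N" by (simp add: SU_iff)
  moreover have "(mat_diag N c * Q) * mat_diag N f = mat_diag N (f \<circ> s) * (mat_diag N c * Q)" for f
  proof -
    have "mat_diag N c * Q = mat N N (\<lambda>(i,j). c i * Q $$ (i,j))" by (rule mat_diag_mult_left[OF Qc])
    hence i: "(mat_diag N c * Q) $$ (i,j) = c i * (if j = s i then 1 else 0)" if "i < N" "j < N" for i j
      using that by (simp add: Q_def)
    note WC = SU_carrier[OF W]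
    show ?thesis unfolding mat_diag_mult_left[OF WC] mat_diag_mult_right[OF WC]
      by (intro eq_matI) (auto simp: i)
  qed
  ultimately show ?thesis by (rule that)
qed

text \<open>Every weight of \<open>SU(N)\<close> has exactly one representative with natural exponents whose sum lies
  in a given window of length \<open>N\<close>.\<close>

definition window :: "nat => nat => (nat => nat) set" where
  "window N w = {p \<in> {..<N} \<rightarrow>\<^sub>E UNIV. w \<le> (\<Sum>i<N. p i) \<and> (\<Sum>i<N. p i) < w + N}"

text \<open>Equal differences leave a common shift c, which changes the total by N c; two totals in
  the window differ by less than N.\<close>

lemma window_inj:
  assumes p: "p \<in> window N w" "p' \<in> window N w"
    and eq: "!!k. k \<in> {1..<N} ==> int (p (k - 1)) - int (p k) = int (p' (k - 1)) - int (p' k)"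
  shows "p = p'"
proof -
  define c where "c = int (p 0) - int (p' 0)"
  have c: "int (p i) = int (p' i) + c" if "i < N" for i
    using that
  proof (induction i)
    case (Suc i)
    thus ?case using eq[of "Suc i"] by simp
  qed (simp add: c_def)
  have "(\<Sum>i<N. int (p i)) = (\<Sum>i<N. int (p' i) + c)" by (intro sum.cong) (auto simp: c)
  hence s: "int (\<Sum>i<N. p i) = int (\<Sum>i<N. p' i) + int N * c" by (simp add: sum.distrib)
  define A where "A = (\<Sum>i<N. p i)"
  define B where "B = (\<Sum>i<N. p' i)"
  have "int A = int B + int N * c" using s unfolding A_def B_def .
  moreover have "w \<le> A" "A < w + N" "w \<le> B" "B < w + N" using p by (simp_all add: window_def A_def B_def)
  ultimately have "int N * c < int N * 1" "int N * (-1) < int N * c" by linarith+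
  moreover from this have "0 < int N" by (cases N) auto
  ultimately have "c < 1" "-1 < c" by (simp_all only: mult_less_cancel_left_pos)
  hence "p i = p' i" if "i < N" for i using c[OF that] by simp
  thus ?thesis using p by (intro PiE_ext[of p "{..<N}" "\<lambda>_. UNIV" p']) (auto simp: window_def)
qed

text \<open>The integer exponents with consecutive differences m and last entry 0.\<close>

definition lift :: "nat => (nat => int) => nat => int" where
  "lift N m i = (\<Sum>k\<in>{Suc i..<N}. m k)"

lemma window_surj:
  assumes K: "!!i. i < N ==> \<bar>lift N m i\<bar> \<le> int K" and N: "N > 0"
  obtains p where "p \<in> window N (2 * N * K)" "!!k. k \<in> {1..<N} ==> int (p (k - 1)) - int (p k) = m k"
proof -
  define L where "L = (\<Sum>i<N. lift N m i)"
  \<comment> \<open>A common shift c adds N c to the total, so c is found by division. The window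
    begins at 2 N K because L is at most N K, which leaves c at least K and all entries
    nonnegative.\<close>
  define T where "T = int (2 * N * K) + int N - 1 - L"
  define c where "c = T div int N"
  define r where "r = T mod int N"
  have r: "0 \<le> r" "r < int N" "int N * c = T - r" using N by (auto simp: c_def r_def minus_mod_eq_mult_div)
  have "L \<le> (\<Sum>i<N. int K)" unfolding L_def by (intro sum_mono) (use K in \<open>auto simp: abs_le_iff\<close>)
  hence "int N * (int K - 1) < int N * c" using r by (simp add: T_def algebra_simps)
  hence cK: "c \<ge> int K" using N by simp
  define p where "p = (\<lambda>i\<in>{..<N}. nat (lift N m i + c))"
  have p: "int (p i) = lift N m i + c" if "i < N" for i
    using K[OF that] cK that by (simp add: p_def abs_le_iff)
  have "int (\<Sum>i<N. p i) = (\<Sum>i<N. lift N m i + c)" by (simp add: p)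
  also have "... = int (2 * N * K) + int N - 1 - r" using r by (simp add: sum.distrib L_def[symmetric] T_def)
  finally have e: "int (\<Sum>i<N. p i) = int (2 * N * K) + int N - 1 - r" .
  define A where "A = (\<Sum>i<N. p i)"
  define B where "B = 2 * N * K"
  have "int A = int B + int N - 1 - r" using e unfolding A_def B_def .
  hence "B \<le> A" "A < B + N" using r by linarith+
  moreover have "p \<in> {..<N} \<rightarrow>\<^sub>E UNIV" by (simp add: p_def)
  ultimately have "p \<in> window N (2 * N * K)" by (simp add: window_def A_def B_def)
  moreover have "int (p (k - 1)) - int (p k) = m k" if "k \<in> {1..<N}" for k
  proof -
    have "{Suc (k - 1)..<N} = insert k {Suc k..<N}" using that by auto
    thus ?thesis using that by (subst (1 2) p) (auto simp: lift_def)
  qed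
  ultimately show ?thesis by (rule that)
qed

context SU_rep
begin

text \<open>Weights as natural exponents of the eigenvalues, on which the Weyl group acts by
  permutation; a common shift gives the same weight.\<close>

definition wt :: "(nat => nat) => (nat => nat) => bool" where
  "wt p q \<longleftrightarrow> (\<exists>v\<in>carrier_vec d. v \<noteq> 0\<^sub>v d \<and> (\<forall>\<xi> \<eta>. tpt N \<xi> --> tpt N \<eta> -->
     \<rho> (mat_diag N \<xi>, mat_diag N \<eta>) *\<^sub>v v = ((\<Prod>i<N. \<xi> i ^ p i) * (\<Prod>i<N. \<eta> i ^ q i)) \<cdot>\<^sub>v v))"

lemma torus_element_eq: "(!!i. i < N ==> torus_coord N x (Suc i) = \<xi> i) ==> torus_element N x = mat_diag N \<xi>"
  unfolding torus_element_def by (rule mat_diag_cong)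

lemma is_weight_iff_wt:
  assumes N: "N > 0"
  shows "is_weight N d \<rho> (\<lambda>k. int (p (k - 1)) - int (p k)) (\<lambda>k. int (q (k - 1)) - int (q k)) \<longleftrightarrow> wt p q"
    (is "?L \<longleftrightarrow> ?R")
proof
  assume ?L
  then obtain v where v: "v \<in> carrier_vec d" "v \<noteq> 0\<^sub>v d"
    and e: "!!x y. fugacities N x ==> fugacities N y ==> \<rho> (torus_element N x, torus_element N y) *\<^sub>v v =
      ((\<Prod>i<N. torus_coord N x (Suc i) ^ p i) * (\<Prod>i<N. torus_coord N y (Suc i) ^ q i)) \<cdot>\<^sub>v v"
    unfolding is_weight_def by (auto simp: torus_monomial N)
  have "\<rho> (mat_diag N \<xi>, mat_diag N \<eta>) *\<^sub>v v = ((\<Prod>i<N. \<xi> i ^ p i) * (\<Prod>i<N. \<eta> i ^ q i)) \<cdot>\<^sub>v v"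
    if t: "tpt N \<xi>" "tpt N \<eta>" for \<xi> \<eta>
  proof -
    obtain x where x: "!!k. cmod (x k) = 1" "!!i. i < N ==> torus_coord N x (Suc i) = \<xi> i" using torus_coord_surj[OF t(1)] by blast
    obtain y where y: "!!k. cmod (y k) = 1" "!!i. i < N ==> torus_coord N y (Suc i) = \<eta> i" using torus_coord_surj[OF t(2)] by blast
    show ?thesis using e[of x y] x y by (simp add: fugacities_def torus_element_eq[OF x(2)] torus_element_eq[OF y(2)])
  qed
  thus ?R using v unfolding wt_def by blast
next
  assume ?R
  then obtain v where v: "v \<in> carrier_vec d" "v \<noteq> 0\<^sub>v d"
    and e: "!!\<xi> \<eta>. tpt N \<xi> ==> tpt N \<eta> ==>
     \<rho> (mat_diag N \<xi>, mat_diag N \<eta>) *\<^sub>v v = ((\<Prod>i<N. \<xi> i ^ p i) * (\<Prod>i<N. \<eta> i ^ q i)) \<cdot>\<^sub>v v"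
    unfolding wt_def by blast
  show ?L unfolding is_weight_def
  proof (intro bexI[of _ v] conjI allI impI v)
    fix x y assume xy: "fugacities N x" "fugacities N y"
    show "\<rho> (torus_element N x, torus_element N y) *\<^sub>v v =
       ((\<Prod>k\<in>{1..<N}. x k powi (int (p (k - 1)) - int (p k))) * (\<Prod>k\<in>{1..<N}. y k powi (int (q (k - 1)) - int (q k)))) \<cdot>\<^sub>v v"
      unfolding torus_element_def torus_monomial[OF xy(1) N, symmetric] torus_monomial[OF xy(2) N, symmetric]
      by (intro e tpt_torus_coord xy N)
  qed
qed

lemma tpt_permute: "s permutes {..<N} ==> tpt N \<xi> ==> tpt N (\<xi> \<circ> s)"
  using prod.permute[of s "{..<N}" \<xi>] permutes_in_image[of s "{..<N}"] by (simp add: tpt_def)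

lemma wt_permute:
  assumes N: "N > 0" and s: "s permutes {..<N}" and t: "t permutes {..<N}" and w: "wt p q"
  shows "wt (p \<circ> s) (q \<circ> t)"
proof -
  obtain v where v: "v \<in> carrier_vec d" "v \<noteq> 0\<^sub>v d"
    and e: "!!\<xi> \<eta>. tpt N \<xi> ==> tpt N \<eta> ==>
     \<rho> (mat_diag N \<xi>, mat_diag N \<eta>) *\<^sub>v v = ((\<Prod>i<N. \<xi> i ^ p i) * (\<Prod>i<N. \<eta> i ^ q i)) \<cdot>\<^sub>v v"
    using w unfolding wt_def by blast
  obtain W where W: "W \<in> SU_grp N" "!!f. W * mat_diag N f = mat_diag N (f \<circ> s) * W" using weyl_element[OF s N] by blast
  obtain W' where W': "W' \<in> SU_grp N" "!!f. W' * mat_diag N f = mat_diag N (f \<circ> t) * W'" using weyl_element[OF t N] by blast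
  have R: "\<rho> (W,W') \<in> carrier_mat d d" using W W' by simp
  let ?v = "\<rho> (W,W') *\<^sub>v v"
  have vc: "?v \<in> carrier_vec d" by (rule mult_mat_vec_carrier[OF R v(1)])
  have "?v \<noteq> 0\<^sub>v d"
  proof
    assume 0: "?v = 0\<^sub>v d"
    have "v = (\<rho> (mat_adjoint W, mat_adjoint W') * \<rho> (W,W')) *\<^sub>v v"
      using v(1) by (simp add: rho_adjoint_left W W')
    also have "... = \<rho> (mat_adjoint W, mat_adjoint W') *\<^sub>v ?v"
      by (rule assoc_mult_mat_vec[of _ d d _ d]) (use R v W W' SU_adjoint in auto)
    also have "... = 0\<^sub>v d" unfolding 0
      using rho_carrier[OF SU_adjoint[OF W(1)] SU_adjoint[OF W'(1)]] by (intro eq_vecI) auto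
    finally show False using v by simp
  qed
  moreover have "\<rho> (mat_diag N \<xi>, mat_diag N \<eta>) *\<^sub>v ?v = ((\<Prod>i<N. \<xi> i ^ (p \<circ> s) i) * (\<Prod>i<N. \<eta> i ^ (q \<circ> t) i)) \<cdot>\<^sub>v ?v"
    if tp: "tpt N \<xi>" "tpt N \<eta>" for \<xi> \<eta>
  proof -
    let ?\<xi> = "\<xi> \<circ> inv_into UNIV s" and ?\<eta> = "\<eta> \<circ> inv_into UNIV t"
    have tp': "tpt N ?\<xi>" "tpt N ?\<eta>" using tp by (auto intro!: tpt_permute permutes_inv s t)
    note D = tpt_SU[OF tp(1)] tpt_SU[OF tp(2)] tpt_SU[OF tp'(1)] tpt_SU[OF tp'(2)]
    have i: "?\<xi> \<circ> s = \<xi>" "?\<eta> \<circ> t = \<eta>" by (auto simp: o_def permutes_inverses[OF s] permutes_inverses[OF t])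
    have sw: "\<rho> (mat_diag N \<xi>, mat_diag N \<eta>) * \<rho> (W,W') = \<rho> (W,W') * \<rho> (mat_diag N ?\<xi>, mat_diag N ?\<eta>)"
      using W(2)[of ?\<xi>] W'(2)[of ?\<eta>] unfolding i
      by (simp add: rho_mult[symmetric] D W(1) W'(1))
    have "\<rho> (mat_diag N \<xi>, mat_diag N \<eta>) *\<^sub>v ?v = (\<rho> (mat_diag N \<xi>, mat_diag N \<eta>) * \<rho> (W,W')) *\<^sub>v v"
      by (rule assoc_mult_mat_vec[symmetric, of _ d d _ d]) (use R v D in auto)
    also have "... = \<rho> (W,W') *\<^sub>v (\<rho> (mat_diag N ?\<xi>, mat_diag N ?\<eta>) *\<^sub>v v)"
      unfolding sw by (rule assoc_mult_mat_vec[of _ d d _ d]) (use R v D in auto)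
    also have "... = ((\<Prod>i<N. ?\<xi> i ^ p i) * (\<Prod>i<N. ?\<eta> i ^ q i)) \<cdot>\<^sub>v ?v"
      unfolding e[OF tp'] by (rule mult_mat_vec[OF R v(1)])
    also have "(\<Prod>i<N. ?\<xi> i ^ p i) = (\<Prod>i<N. \<xi> i ^ (p \<circ> s) i)"
      using prod.permute[OF s, of "\<lambda>i. ?\<xi> i ^ p i"] by (simp add: o_def permutes_inverses[OF s])
    also have "(\<Prod>i<N. ?\<eta> i ^ q i) = (\<Prod>i<N. \<eta> i ^ (q \<circ> t) i)"
      using prod.permute[OF t, of "\<lambda>i. ?\<eta> i ^ q i"] by (simp add: o_def permutes_inverses[OF t])
    finally show ?thesis .
  qed
  ultimately show ?thesis unfolding wt_def using vc by blast
qed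

lemma trace_conj:
  assumes "V \<in> SU_grp N" "W \<in> SU_grp N" "a \<in> SU_grp N" "b \<in> SU_grp N"
  shows "mat_trace (\<rho> (V * a * mat_adjoint V, W * b * mat_adjoint W)) = mat_trace (\<rho> (a,b))"
proof -
  note adj = SU_adjoint[OF assms(1)] SU_adjoint[OF assms(2)]
  note c = rho_carrier[OF assms(1,2)] rho_carrier[OF assms(3,4)] rho_carrier[OF adj]
  have "\<rho> (V * a * mat_adjoint V, W * b * mat_adjoint W) = \<rho> (V,W) * \<rho> (a,b) * \<rho> (mat_adjoint V, mat_adjoint W)"
    using assms adj by (simp add: rho_mult SU_mult)
  hence "mat_trace (\<rho> (V * a * mat_adjoint V, W * b * mat_adjoint W)) =
    mat_trace (\<rho> (V,W) * \<rho> (a,b) * \<rho> (mat_adjoint V, mat_adjoint W))" by simp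
  also have "... = mat_trace (\<rho> (mat_adjoint V, mat_adjoint W) * (\<rho> (V,W) * \<rho> (a,b)))"
    by (rule mat_trace_mult_comm[of _ d]) (use c in auto)
  also have "\<rho> (mat_adjoint V, mat_adjoint W) * (\<rho> (V,W) * \<rho> (a,b)) =
     \<rho> (mat_adjoint V, mat_adjoint W) * \<rho> (V,W) * \<rho> (a,b)"
    by (rule assoc_mult_mat[symmetric, of _ d d _ d _ d]) (use c in auto)
  also have "... = \<rho> (a,b)" using c by (simp add: rho_adjoint_left assms)
  finally show ?thesis .
qed

lemma character_permute:
  assumes N: "N > 0" and s: "s permutes {..<N}" and t: "t permutes {..<N}" and tp: "tpt N \<xi>" "tpt N \<eta>"
  shows "mat_trace (\<rho> (mat_diag N (\<xi> \<circ> s), mat_diag N (\<eta> \<circ> t))) = mat_trace (\<rho> (mat_diag N \<xi>, mat_diag N \<eta>))"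
proof -
  obtain W where W: "W \<in> SU_grp N" "!!f. W * mat_diag N f = mat_diag N (f \<circ> s) * W" using weyl_element[OF s N] by blast
  obtain W' where W': "W' \<in> SU_grp N" "!!f. W' * mat_diag N f = mat_diag N (f \<circ> t) * W'" using weyl_element[OF t N] by blast
  have "mat_diag N (f \<circ> s) * W * mat_adjoint W = mat_diag N (f \<circ> s)" for f
    using W(1) Ugrp_adjoint_right[OF SU_Ugrp[OF W(1)]] by (simp add: assoc_mult_mat[of _ N N _ N _ N])
  moreover have "mat_diag N (f \<circ> t) * W' * mat_adjoint W' = mat_diag N (f \<circ> t)" for f
    using W'(1) Ugrp_adjoint_right[OF SU_Ugrp[OF W'(1)]] by (simp add: assoc_mult_mat[of _ N N _ N _ N])
  ultimately show ?thesis
    using trace_conj[OF W(1) W'(1) tpt_SU[OF tp(1)] tpt_SU[OF tp(2)]] W(2) W'(2) by simp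
qed

lemma torus_element_cong: "(!!k. k \<in> {1..<N} ==> x k = y k) ==> torus_element N x = torus_element N y"
  unfolding torus_element_def by (intro mat_diag_cong) (auto simp: torus_coord_def)

lemma torus_element_mult: "torus_element N (\<lambda>k. x k * y k) = torus_element N x * torus_element N y"
  unfolding torus_element_def by (simp, intro mat_diag_cong) (auto simp: torus_coord_def)

lemma torus_element_one: "torus_element N (\<lambda>_. 1) = 1\<^sub>m N"
  unfolding torus_element_def by (intro eq_matI) (auto simp: torus_coord_def mat_diag_def)

lemma continuous_torus_element:
  assumes "N > 0"
  shows "continuous_map (top_of_set (sphere 0 1)) (group_topology N (special_unitary_group N))
    (\<lambda>s. torus_element N ((\<lambda>_. 1)(k := s)))"
proof (rule continuous_map_into_group_topology[OF SU_subset])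
  show "torus_element N ((\<lambda>_. 1)(k := s)) \<in> SU_grp N" if "s \<in> topspace (top_of_set (sphere 0 1))" for s
    using that assms by (intro torus_element_SU) (auto simp: fugacities_def)
  fix i j assume "i < N" "j < N"
  have "continuous_on (sphere 0 1) (\<lambda>s. if i = j then torus_coord N ((\<lambda>_. 1)(k := s)) (Suc i) else 0)"
  proof (cases "i = j")
    case True
    have 1: "continuous_on (sphere 0 1) (\<lambda>s::complex. ((\<lambda>_. 1)(k := s)) l :: complex)" for l
      by (cases "l = k") (simp_all add: continuous_on_id)
    have 2: "((\<lambda>_. 1)(k := s)) l \<noteq> 0" if "s \<in> sphere 0 1" for l and s :: complex
      using that by auto
    show ?thesis unfolding torus_coord_def if_P[OF True]
      by (intro continuous_on_divide; (cases "Suc i < N"; cases "Suc i = 1"; (simp only: if_True if_False simp_thms)?; (rule 1 continuous_on_const ballI 2 one_neq_zero | assumption)+)?)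
  qed simp
  thus "continuous_map (top_of_set (sphere 0 1)) euclidean (\<lambda>s. torus_element N ((\<lambda>_. 1)(k := s)) $$ (i,j))"
    using \<open>i < N\<close> \<open>j < N\<close> by (cases "i = j") (simp_all add: torus_element_def mat_diag_def)
qed

text \<open>\<open>torus_weights\<close> in fugacity coordinates, translated to natural exponents.
  One window is large enough because there are finitely many weights.\<close>

lemma character_expansion:
  assumes N: "N > 0"
  obtains w S and M :: "(nat => nat) \<times> (nat => nat) => nat" where
    "finite S" "S \<subseteq> window N w \<times> window N w" "!!pq. pq \<in> S ==> M pq > 0"
    "!!\<xi> \<eta>. tpt N \<xi> ==> tpt N \<eta> ==> mat_trace (\<rho> (mat_diag N \<xi>, mat_diag N \<eta>)) =
       (\<Sum>pq\<in>S. of_nat (M pq) * ((\<Prod>i<N. \<xi> i ^ fst pq i) * (\<Prod>i<N. \<eta> i ^ snd pq i)))"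
    "!!p q. p \<in> window N w ==> q \<in> window N w ==> (p,q) \<in> S \<longleftrightarrow> wt p q"
    "!!m l. is_weight N d \<rho> m l ==> \<exists>p q. (p,q) \<in> S \<and>
       (\<forall>k\<in>{1..<N}. int (p (k - 1)) - int (p k) = m k \<and> int (q (k - 1)) - int (q k) = l k)"
proof -
  define X :: "(nat + nat) set" where "X = Inl ` {1..<N} \<union> Inr ` {1..<N}"
  define F where "F z = \<rho> (torus_element N (z \<circ> Inl), torus_element N (z \<circ> Inr))" for z :: "nat + nat => complex"
  have fug: "fugacities N (z \<circ> Inl)" "fugacities N (z \<circ> Inr)" if "unit_pt z" for z
    using that by (auto simp: fugacities_def unit_pt_def)
  note te = torus_element_SU[OF fug(1) N] torus_element_SU[OF fug(2) N]
  have chr: "chr X w z = (\<Prod>k\<in>{1..<N}. z (Inl k) powi w (Inl k)) * (\<Prod>k\<in>{1..<N}. z (Inr k) powi w (Inr k))" for w z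
    unfolding chr_def X_def by (subst prod.union_disjoint) (auto simp: prod.reindex)
  have one: "((\<lambda>_. 1)(Inl k := s)) \<circ> Inl = (\<lambda>_. 1)(k := s)" "((\<lambda>_. 1)(Inl k := s)) \<circ> Inr = (\<lambda>_. 1)"
     "((\<lambda>_. 1)(Inr k := s)) \<circ> Inr = (\<lambda>_. 1)(k := s)" "((\<lambda>_. 1)(Inr k := s)) \<circ> Inl = (\<lambda>_. 1)" for k and s :: complex
    by auto
  have "\<exists>S M. finite S \<and> S \<subseteq> X \<rightarrow>\<^sub>E UNIV \<and> (\<forall>w\<in>S. (M w :: nat) > 0) \<and>
    (\<forall>z. unit_pt z --> mat_trace (F z) = (\<Sum>w\<in>S. of_nat (M w) * chr X w z)) \<and>
    (\<forall>w\<in>X \<rightarrow>\<^sub>E UNIV. w \<in> S \<longleftrightarrow> (\<exists>v\<in>carrier_vec d. v \<noteq> 0\<^sub>v d \<and> (\<forall>z. unit_pt z --> F z *\<^sub>v v = chr X w z \<cdot>\<^sub>v v)))"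
  proof (rule torus_weights)
    show "finite X" by (simp add: X_def)
    show "F z \<in> carrier_mat d d" if "unit_pt z" for z using te[OF that] by (simp add: F_def)
    show "F (\<lambda>x. z x * w x) = F z * F w" if "unit_pt z" "unit_pt w" for z w
      using te[OF that(1)] te[OF that(2)] unfolding F_def
      by (simp add: rho_mult[symmetric] torus_element_mult[symmetric] o_def)
    show "F z = F w" if "!!x. x \<in> X ==> z x = w x" for z w
      unfolding F_def using that by (intro arg_cong[of _ _ \<rho>] arg_cong2[of _ _ _ _ Pair] torus_element_cong) (auto simp: X_def)
    show "F (\<lambda>_. 1) = 1\<^sub>m d" by (simp add: F_def o_def torus_element_one rho_one)
    fix x i j assume x: "x \<in> X" and ij: "i < d" "j < d"
    note c = continuous_map_compose[OF continuous_torus_element[OF N] rho_continuous_left(1)[OF ij], unfolded o_def]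
      continuous_map_compose[OF continuous_torus_element[OF N] rho_continuous_left(2)[OF ij], unfolded o_def]
    show "continuous_on (sphere 0 1) (\<lambda>s. F ((\<lambda>_. 1)(x := s)) $$ (i,j))"
    proof (cases x)
      case (Inl k)
      show ?thesis unfolding F_def Inl one torus_element_one using c(1)[of k] by (simp only: continuous_map_iff_continuous)
    next
      case (Inr k)
      show ?thesis unfolding F_def Inr one torus_element_one using c(2)[of k] by (simp only: continuous_map_iff_continuous)
    qed
  qed
  then obtain S0 M0 where A: "finite S0 \<and> S0 \<subseteq> X \<rightarrow>\<^sub>E UNIV \<and> (\<forall>w\<in>S0. (M0 w :: nat) > 0) \<and>
    (\<forall>z. unit_pt z --> mat_trace (F z) = (\<Sum>w\<in>S0. of_nat (M0 w) * chr X w z)) \<and>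
    (\<forall>w\<in>X \<rightarrow>\<^sub>E UNIV. w \<in> S0 \<longleftrightarrow> (\<exists>v\<in>carrier_vec d. v \<noteq> 0\<^sub>v d \<and> (\<forall>z. unit_pt z --> F z *\<^sub>v v = chr X w z \<cdot>\<^sub>v v)))"
    by (elim exE) (rule that)
  note A' = A[THEN conjunct2] A[THEN conjunct2, THEN conjunct2]
  have S0: "finite S0" "S0 \<subseteq> X \<rightarrow>\<^sub>E UNIV" by (rule A[THEN conjunct1], rule A'(1)[THEN conjunct1])
  note M0 = A'(2)[THEN conjunct1, rule_format] and tr = A'(2)[THEN conjunct2, THEN conjunct1, rule_format]
    and S0v = A'(2)[THEN conjunct2, THEN conjunct2, rule_format]
  have S0w: "w \<in> S0 \<longleftrightarrow> is_weight N d \<rho> (w \<circ> Inl) (w \<circ> Inr)" if w: "w \<in> X \<rightarrow>\<^sub>E UNIV" for w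
  proof -
    have "(\<forall>z. unit_pt z --> F z *\<^sub>v v = chr X w z \<cdot>\<^sub>v v) \<longleftrightarrow>
      (\<forall>x y. fugacities N x --> fugacities N y --> \<rho> (torus_element N x, torus_element N y) *\<^sub>v v =
          ((\<Prod>k\<in>{1..<N}. x k powi (w \<circ> Inl) k) * (\<Prod>k\<in>{1..<N}. y k powi (w \<circ> Inr) k)) \<cdot>\<^sub>v v)" (is "?A \<longleftrightarrow> ?B") for v
    proof
      assume a: ?A
      show ?B
      proof (intro allI impI)
        fix x y assume xy: "fugacities N x" "fugacities N y"
        \<comment> \<open>\<open>unit_pt\<close> constrains every coordinate whereas fugacities are
          constrained only between 1 and N - 1, hence the padding.\<close>
        let ?z = "case_sum (fpad N x) (fpad N y)"
        have "unit_pt ?z" using fpad_unit[OF xy(1)] fpad_unit[OF xy(2)] by (auto simp: unit_pt_def split: sum.split)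
        moreover have "torus_element N (?z \<circ> Inl) = torus_element N x" "torus_element N (?z \<circ> Inr) = torus_element N y"
          by (auto intro!: torus_element_cong simp: fpad_def)
        ultimately have "\<rho> (torus_element N x, torus_element N y) *\<^sub>v v = chr X w ?z \<cdot>\<^sub>v v"
          using a[rule_format, of ?z] by (simp only: F_def)
        also have "chr X w ?z = (\<Prod>k\<in>{1..<N}. x k powi (w \<circ> Inl) k) * (\<Prod>k\<in>{1..<N}. y k powi (w \<circ> Inr) k)"
          unfolding chr by (simp add: fpad_def)
        finally show "\<rho> (torus_element N x, torus_element N y) *\<^sub>v v =
          ((\<Prod>k\<in>{1..<N}. x k powi (w \<circ> Inl) k) * (\<Prod>k\<in>{1..<N}. y k powi (w \<circ> Inr) k)) \<cdot>\<^sub>v v" .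
      qed
    next
      assume b: ?B
      show ?A
      proof (intro allI impI)
        fix z :: "nat + nat => complex" assume z: "unit_pt z"
        show "F z *\<^sub>v v = chr X w z \<cdot>\<^sub>v v"
          using b[rule_format, OF fug[OF z]] by (simp add: F_def chr)
      qed
    qed
    thus ?thesis unfolding S0v[OF w] is_weight_def by simp
  qed
  \<comment> \<open>A bound on all lifted weights of both factors, as required by
    \<open>window_surj\<close>.\<close>
  define K where "K = nat (\<Sum>w\<in>S0. \<Sum>i<N. \<bar>lift N (w \<circ> Inl) i\<bar> + \<bar>lift N (w \<circ> Inr) i\<bar>)"
  have K: "\<bar>lift N (w \<circ> Inl) i\<bar> \<le> int K" "\<bar>lift N (w \<circ> Inr) i\<bar> \<le> int K" if "w \<in> S0" "i < N" for w i
  proof -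
    let ?f = "\<lambda>w i. \<bar>lift N (w \<circ> Inl) i\<bar> + \<bar>lift N (w \<circ> Inr) i\<bar>"
    have "?f w i \<le> (\<Sum>i<N. ?f w i)" using that by (intro member_le_sum[where f = "?f w"]) auto
    also have "... \<le> (\<Sum>w\<in>S0. \<Sum>i<N. ?f w i)"
      using that S0 by (intro member_le_sum[where f = "\<lambda>w. \<Sum>i<N. ?f w i"]) (auto intro: sum_nonneg)
    also have "... = int K" unfolding K_def by (simp add: sum_nonneg)
    finally show "\<bar>lift N (w \<circ> Inl) i\<bar> \<le> int K" "\<bar>lift N (w \<circ> Inr) i\<bar> \<le> int K" by linarith+
  qed
  let ?w = "2 * N * K"
  \<comment> \<open>From exponents to coordinates in fundamental weights; on the window this is
    injective.\<close>
  define \<psi> where "\<psi> pq = (\<lambda>x\<in>X. case x of Inl k => int (fst pq (k - 1)) - int (fst pq k)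
      | Inr k => int (snd pq (k - 1)) - int (snd pq k))" for pq :: "(nat => nat) \<times> (nat => nat)"
  have \<psi>X: "\<psi> pq \<in> X \<rightarrow>\<^sub>E UNIV" for pq by (simp add: \<psi>_def)
  have \<psi>v: "\<psi> pq (Inl k) = int (fst pq (k - 1)) - int (fst pq k)" "\<psi> pq (Inr k) = int (snd pq (k - 1)) - int (snd pq k)"
    if "k \<in> {1..<N}" for pq k using that by (auto simp: \<psi>_def X_def)
  have inj: "inj_on \<psi> (window N ?w \<times> window N ?w)"
  proof (rule inj_onI)
    fix a b assume ab: "a \<in> window N ?w \<times> window N ?w" "b \<in> window N ?w \<times> window N ?w" "\<psi> a = \<psi> b"
    have "fst a = fst b"
      by (rule window_inj[of _ N ?w]) (use ab \<psi>v(1)[of _ a] \<psi>v(1)[of _ b] in auto)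
    moreover have "snd a = snd b"
      by (rule window_inj[of _ N ?w]) (use ab \<psi>v(2)[of _ a] \<psi>v(2)[of _ b] in auto)
    ultimately show "a = b" by (rule prod_eqI)
  qed
  define S where "S = {pq \<in> window N ?w \<times> window N ?w. \<psi> pq \<in> S0}"
  have Ssub: "S \<subseteq> window N ?w \<times> window N ?w" by (auto simp: S_def)
  have injS: "inj_on \<psi> S" by (rule inj_on_subset[OF inj Ssub])
  have im: "\<psi> ` S = S0"
  proof (intro equalityI subsetI)
    fix w assume w: "w \<in> S0"
    obtain p where p: "p \<in> window N ?w" "!!k. k \<in> {1..<N} ==> int (p (k - 1)) - int (p k) = (w \<circ> Inl) k"
      using window_surj[of N "w \<circ> Inl" K] K[OF w] N by metis
    obtain q where q: "q \<in> window N ?w" "!!k. k \<in> {1..<N} ==> int (q (k - 1)) - int (q k) = (w \<circ> Inr) k"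
      using window_surj[of N "w \<circ> Inr" K] K[OF w] N by metis
    have "\<psi> (p,q) x = w x" if "x \<in> X" for x
      using that p(2) q(2) \<psi>v[of _ "(p,q)"] by (auto simp: X_def)
    hence "\<psi> (p,q) = w" using \<psi>X w S0(2) by (intro PiE_ext[of _ X "\<lambda>_. UNIV"]) auto
    thus "w \<in> \<psi> ` S" using p q w by (intro image_eqI[of _ _ "(p,q)"]) (auto simp: S_def)
  qed (auto simp: S_def)
  have iw: "is_weight N d \<rho> m l \<longleftrightarrow> is_weight N d \<rho> m' l'" 
    if "!!k. k \<in> {1..<N} ==> m k = m' k" "!!k. k \<in> {1..<N} ==> l k = l' k" for m m' l l'
    unfolding is_weight_def using that by simp
  show ?thesis
  proof (rule that[of S ?w "M0 \<circ> \<psi>"])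
    show "finite S" using im S0(1) injS by (metis finite_imageD)
    show "S \<subseteq> window N ?w \<times> window N ?w" by (rule Ssub)
    show "(M0 \<circ> \<psi>) pq > 0" if "pq \<in> S" for pq using that M0 by (simp add: S_def)
    show "(p,q) \<in> S \<longleftrightarrow> wt p q" if "p \<in> window N ?w" "q \<in> window N ?w" for p q
    proof -
      have "(p,q) \<in> S \<longleftrightarrow> \<psi> (p,q) \<in> S0" using that by (simp add: S_def)
      also have "... \<longleftrightarrow> is_weight N d \<rho> (\<lambda>k. int (p (k - 1)) - int (p k)) (\<lambda>k. int (q (k - 1)) - int (q k))"
        unfolding S0w[OF \<psi>X] by (rule iw) (simp_all add: \<psi>v)
      finally show ?thesis unfolding is_weight_iff_wt[OF N] .
    qed
    show "\<exists>p q. (p,q) \<in> S \<and>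
       (\<forall>k\<in>{1..<N}. int (p (k - 1)) - int (p k) = m k \<and> int (q (k - 1)) - int (q k) = l k)"
      if ml: "is_weight N d \<rho> m l" for m l
    proof -
      define w where "w = restrict (case_sum m l) X"
      have wX: "w (Inl k) = m k" "w (Inr k) = l k" if "k \<in> {1..<N}" for k using that by (auto simp: w_def X_def)
      have "w \<in> S0" using ml iw[of "w \<circ> Inl" m "w \<circ> Inr" l] wX by (subst S0w) (auto simp: w_def)
      then obtain pq where pq: "pq \<in> S" "\<psi> pq = w" using im by blast
      show ?thesis
        by (intro exI[of _ "fst pq"] exI[of _ "snd pq"] conjI ballI) (use pq wX \<psi>v[of _ pq] in auto)
    qed
    fix \<xi> \<eta> assume t: "tpt N \<xi>" "tpt N \<eta>"
    obtain x where x: "!!k. cmod (x k) = 1" "!!i. i < N ==> torus_coord N x (Suc i) = \<xi> i" using torus_coord_surj[OF t(1)] by blast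
    obtain y where y: "!!k. cmod (y k) = 1" "!!i. i < N ==> torus_coord N y (Suc i) = \<eta> i" using torus_coord_surj[OF t(2)] by blast
    let ?z = "case_sum x y"
    have z: "unit_pt ?z" using x y by (auto simp: unit_pt_def split: sum.split)
    have xf: "fugacities N x" "fugacities N y" using x y by (auto simp: fugacities_def)
    have c: "chr X (\<psi> pq) ?z = (\<Prod>i<N. \<xi> i ^ fst pq i) * (\<Prod>i<N. \<eta> i ^ snd pq i)" for pq
    proof -
      have "chr X (\<psi> pq) ?z = (\<Prod>k\<in>{1..<N}. x k powi (int (fst pq (k - 1)) - int (fst pq k))) *
        (\<Prod>k\<in>{1..<N}. y k powi (int (snd pq (k - 1)) - int (snd pq k)))"
        unfolding chr by (simp add: \<psi>v)
      thus ?thesis unfolding torus_monomial[OF xf(1) N, symmetric] torus_monomial[OF xf(2) N, symmetric]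
        by (simp add: x y)
    qed
    have "F ?z = \<rho> (mat_diag N \<xi>, mat_diag N \<eta>)"
      unfolding F_def using torus_element_eq[OF x(2)] torus_element_eq[OF y(2)] by (simp add: o_def)
    with tr[OF z] have "mat_trace (\<rho> (mat_diag N \<xi>, mat_diag N \<eta>)) = (\<Sum>w\<in>\<psi> ` S. of_nat (M0 w) * chr X w ?z)"
      by (simp add: im)
    also have "... = (\<Sum>pq\<in>S. of_nat (M0 (\<psi> pq)) * chr X (\<psi> pq) ?z)" by (simp add: sum.reindex[OF injS])
    finally show "mat_trace (\<rho> (mat_diag N \<xi>, mat_diag N \<eta>)) =
       (\<Sum>pq\<in>S. of_nat ((M0 \<circ> \<psi>) pq) * ((\<Prod>i<N. \<xi> i ^ fst pq i) * (\<Prod>i<N. \<eta> i ^ snd pq i)))"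
      by (simp add: c)
  qed
qed

end

subsection \<open>The character of an irreducible representation\<close>

text \<open>Times the Weyl denominator, the symmetrised monomial becomes a sum of alternants with
  labels p o s + \<open>stair N\<close>. This is how a Weyl-symmetric character turns into Schur
  functions.\<close>

lemma symmetrised_monomial:
  "(\<Sum>s\<in>perms N. \<Prod>i<N. z (s i) ^ p i) = (\<Sum>s\<in>perms N. schur N (\<lambda>i. p (s i) + stair N i) z)"
proof (rule polyfun_eq_of_inj[of N "\<lambda>z. \<Sum>s\<in>perms N. \<Prod>i<N. z (s i) ^ p i"])
  show "polyfun {..<N} (\<lambda>z. \<Sum>s\<in>perms N. \<Prod>i<N. z (s i) ^ p i)"
    by (intro polyfun_sum polyfun_prod polyfun_power polyfun_var) (auto simp: permutes_less)
  show "polyfun {..<N} (\<lambda>z. \<Sum>s\<in>perms N. schur N (\<lambda>i. p (s i) + stair N i) z)"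
    by (intro polyfun_sum polyfun_schur)
  fix z :: "nat => complex" assume z: "inj_on z {..<N}"
  let ?A = "alternant N (stair N) z"
  have "(\<Sum>s\<in>perms N. \<Prod>i<N. z (s i) ^ p i) = (\<Sum>s\<in>perms N. \<Prod>i<N. z (inv_into UNIV s i) ^ p i)"
    by (rule sum_permutations_inverse)
  also have "... = (\<Sum>s\<in>perms N. \<Prod>i<N. z i ^ p (s i))"
  proof (intro sum.cong refl, clarify)
    fix s :: "nat => nat" assume s: "s permutes {..<N}"
    show "(\<Prod>i<N. z (inv_into UNIV s i) ^ p i) = (\<Prod>i<N. z i ^ p (s i))"
      using prod.permute[OF s, of "\<lambda>i. z (inv_into UNIV s i) ^ p i"] by (simp add: o_def permutes_inverses[OF s])
  qed
  finally have eq: "(\<Sum>s\<in>perms N. \<Prod>i<N. z (s i) ^ p i) = (\<Sum>s\<in>perms N. \<Prod>i<N. z i ^ p (s i))" .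
  have "(\<Sum>s\<in>perms N. \<Prod>i<N. z (s i) ^ p i) * ?A =
      (\<Sum>t\<in>perms N. \<Sum>s\<in>perms N. signof t * (\<Prod>i<N. z i ^ p (s i) * z i ^ stair N (t i)))"
    unfolding eq alternant_sum sum_product by (subst sum.swap) (simp add: prod.distrib mult_ac)
  also have "... = (\<Sum>t\<in>perms N. \<Sum>s\<in>perms N. signof t * (\<Prod>i<N. z i ^ (p (s (t i)) + stair N (t i))))"
  proof (rule sum.cong[OF refl], clarify)
    fix t :: "nat => nat" assume t: "t permutes {..<N}"
    show "(\<Sum>s\<in>perms N. signof t * (\<Prod>i<N. z i ^ p (s i) * z i ^ stair N (t i))) =
      (\<Sum>s\<in>perms N. signof t * (\<Prod>i<N. z i ^ (p (s (t i)) + stair N (t i))))"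
      by (subst sum_permutations_compose_right[OF t]) (simp add: power_add)
  qed
  also have "... = (\<Sum>s\<in>perms N. alternant N (\<lambda>i. p (s i) + stair N i) z)"
    unfolding alternant_sum by (rule sum.swap)
  also have "... = (\<Sum>s\<in>perms N. schur N (\<lambda>i. p (s i) + stair N i) z) * ?A"
    unfolding sum_distrib_right by (intro sum.cong refl) (subst alternant_eq_schur, simp)
  finally show "(\<Sum>s\<in>perms N. \<Prod>i<N. z (s i) ^ p i) = (\<Sum>s\<in>perms N. schur N (\<lambda>i. p (s i) + stair N i) z)"
    using alternant_stair_nonzero[OF z] by simp
qed

definition sorting :: "nat => (nat => nat) => nat => nat" where
  "sorting N l = (SOME p. p permutes {..<N} \<and> strict N (l \<circ> p))"

lemma sorting:
  assumes "inj_on l {..<N}"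
  shows "sorting N l permutes {..<N}" "strict N (l \<circ> sorting N l)"
proof -
  have "\<exists>p. p permutes {..<N} \<and> strict N (l \<circ> p)" using strict_sorting[OF assms] by blast
  from someI_ex[OF this] show "sorting N l permutes {..<N}" "strict N (l \<circ> sorting N l)"
    by (simp_all add: sorting_def)
qed

lemma strict_label_cong: "(!!i. i < N ==> l i = l' i) ==> strict N l = strict N l'"
  unfolding strict_def by (metis order.strict_trans)

definition sorted_label :: "nat => (nat => nat) => nat => nat" where
  "sorted_label N l = restrict (l \<circ> sorting N l) {..<N}"

lemma sorted_label:
  assumes "inj_on l {..<N}"
  shows "strict N (sorted_label N l)" "(\<Sum>i<N. sorted_label N l i) = (\<Sum>i<N. l i)"
    and "schur N l z = signof (sorting N l) * schur N (sorted_label N l) z"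
proof -
  note s = sorting[OF assms]
  show "strict N (sorted_label N l)"
    using s(2) strict_label_cong[of N "sorted_label N l" "l \<circ> sorting N l"] by (simp add: sorted_label_def)
  show "(\<Sum>i<N. sorted_label N l i) = (\<Sum>i<N. l i)"
    using sum.permute[OF s(1), of l] by (simp add: sorted_label_def o_def)
  have "schur N (sorted_label N l) = schur N (l \<circ> sorting N l)"
    by (rule schur_label_cong) (simp add: sorted_label_def)
  thus "schur N l z = signof (sorting N l) * schur N (sorted_label N l) z"
    using schur_permute[OF s(1), of l z] by (simp add: mult.assoc[symmetric])
qed

lemma sorted_label_strict:
  assumes "strict N l" shows "sorting N l = id" "sorted_label N l = restrict l {..<N}"
proof -
  note s = sorting[OF strict_inj[OF assms]]
  show i: "sorting N l = id" by (rule strict_permute_id[OF s(2) assms s(1)]) simp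
  show "sorted_label N l = restrict l {..<N}" by (simp add: sorted_label_def i)
qed

lemma cartan_sum:
  assumes j: "j \<in> {1..<N}" and e: "!!k. e k = (if k \<in> {1..<N} then int (c k) else 0)"
  shows "(\<Sum>k\<in>{1..<N}. int (c k) * cartan k j) = 2 * e j - e (j - 1) - e (Suc j)"
proof -
  have "(\<Sum>k\<in>{1..<N}. int (c k) * cartan k j) =
    (\<Sum>k\<in>{1..<N}. (if k = j then 2 * e k else 0) - (if k = j - 1 then e k else 0) - (if k = Suc j then e k else 0))"
    using j by (intro sum.cong refl) (auto simp: cartan_def e)
  also have "... = 2 * e j - e (j - 1) - e (Suc j)"
    using j unfolding sum_subtractf by (simp add: sum.delta e)
  finally show ?thesis .
qed

text \<open>Subtracting a simple root lowers the pairing with \<open>stair N\<close>, a shifted Weyl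
  vector, by one. The common window forces the shift t between the two exponent vectors to be
  zero.\<close>

lemma dominance_stair:
  assumes p: "p \<in> window N w" "p0 \<in> window N w" and N: "N > 0"
    and le: "weight_le N (\<lambda>k. int (p (k - 1)) - int (p k)) a"
    and a: "!!k. k \<in> {1..<N} ==> a k = int (p0 (k - 1)) - int (p0 k)"
  shows "(\<Sum>i<N. int (p i) * int (stair N i)) \<le> (\<Sum>i<N. int (p0 i) * int (stair N i))"
proof -
  obtain c where c: "!!j. j \<in> {1..<N} ==> int (p (j - 1)) - int (p j) = a j - (\<Sum>k\<in>{1..<N}. int (c k) * cartan k j)"
    using le unfolding weight_le_def by blast
  define e where "e k = (if k \<in> {1..<N} then int (c k) else 0)" for k
  define u where "u i = int (p i) - int (p0 i)" for i
  define t where "t = u 0 + e 1"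
  have ut: "u i = t - (e (Suc i) - e i)" if "i < N" for i
    using that
  proof (induction i)
    case 0
    show ?case by (simp add: t_def e_def)
  next
    case (Suc i)
    have "u i - u (Suc i) = - (2 * e (Suc i) - e i - e (Suc (Suc i)))"
      using c[of "Suc i"] a[of "Suc i"] cartan_sum[of "Suc i" N e c] Suc.prems by (simp add: u_def e_def)
    thus ?case using Suc by simp
  qed
  have "(\<Sum>i<N. u i) = (\<Sum>i<N. t - (e (Suc i) - e i))" by (simp add: ut)
  also have "... = (\<Sum>i<N. t) - (\<Sum>i<N. e (Suc i) - e i)" by (rule sum_subtractf)
  also have "... = int N * t" unfolding sum_lessThan_telescope by (simp add: e_def)
  finally have Su: "(\<Sum>i<N. u i) = int N * t" .
  define A where "A = (\<Sum>i<N. p i)"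
  define B where "B = (\<Sum>i<N. p0 i)"
  have "(\<Sum>i<N. u i) = int A - int B" by (simp add: u_def sum_subtractf A_def B_def)
  moreover have "w \<le> A" "A < w + N" "w \<le> B" "B < w + N" using p by (simp_all add: window_def A_def B_def)
  ultimately have "int N * t < int N * 1" "int N * (-1) < int N * t" using Su by linarith+
  moreover have "0 < int N" using N by simp
  ultimately have "t < 1" "-1 < t" by (simp_all only: mult_less_cancel_left_pos)
  hence t0: "t = 0" by simp
  \<comment> \<open>Summation by parts; f vanishes at both ends because e does.\<close>
  define f where "f i = e i * (int N - 1 - int i)" for i
  have "(\<Sum>i<N. u i * int (stair N i)) = (\<Sum>i<N. - (f (Suc i) - f i) - e (Suc i))"
  proof (intro sum.cong refl)
    fix i assume i: "i \<in> {..<N}"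
    have st: "int (stair N i) = int N - 1 - int i" using i by (simp add: stair_def)
    have u: "u i = e i - e (Suc i)" using ut[of i] i t0 by simp
    show "u i * int (stair N i) = - (f (Suc i) - f i) - e (Suc i)"
      unfolding st u f_def by (simp add: algebra_simps)
  qed
  also have "... = (\<Sum>i<N. - (f (Suc i) - f i)) - (\<Sum>i<N. e (Suc i))" by (rule sum_subtractf)
  also have "(\<Sum>i<N. - (f (Suc i) - f i)) = - (f N - f 0)" unfolding sum_negf sum_lessThan_telescope ..
  also have "- (f N - f 0) - (\<Sum>i<N. e (Suc i)) = - (\<Sum>i<N. e (Suc i))" by (simp add: f_def e_def)
  also have "... \<le> 0" by (simp add: e_def sum_nonneg)
  finally show ?thesis by (simp add: u_def left_diff_distrib sum_subtractf)
qed

text \<open>The inequality says that the pairing of the permuted staircase with the staircase is at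
  least the squared length of the latter. Since both have the same length, their squared distance is
  at most 0.\<close>

lemma stair_permute_id:
  assumes k: "k permutes {..<N}"
    and eq: "!!i. i < N ==> p i + stair N (k i) = p0 i + stair N i"
    and le: "(\<Sum>i<N. int (p i) * int (stair N i)) \<le> (\<Sum>i<N. int (p0 i) * int (stair N i))"
  shows "k = id"
proof -
  let ?s = "\<lambda>i. int (stair N i)"
  have d: "int (p0 i) - int (p i) = ?s (k i) - ?s i" if "i < N" for i using eq[OF that] by linarith
  have "0 \<le> (\<Sum>i<N. (int (p0 i) - int (p i)) * ?s i)" using le by (simp add: left_diff_distrib sum_subtractf)
  also have "... = (\<Sum>i<N. ?s (k i) * ?s i) - (\<Sum>i<N. ?s i * ?s i)"
    by (simp add: d left_diff_distrib sum_subtractf)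
  finally have 1: "(\<Sum>i<N. ?s i * ?s i) \<le> (\<Sum>i<N. ?s (k i) * ?s i)" by simp
  have 2: "(\<Sum>i<N. ?s (k i) * ?s (k i)) = (\<Sum>i<N. ?s i * ?s i)"
    using sum.permute[OF k, of "\<lambda>i. ?s i * ?s i"] by (simp add: o_def)
  have "(\<Sum>i<N. (?s (k i) - ?s i)\<^sup>2) = (\<Sum>i<N. ?s (k i) * ?s (k i)) + (\<Sum>i<N. ?s i * ?s i) - 2 * (\<Sum>i<N. ?s (k i) * ?s i)"
    by (simp add: power2_eq_square algebra_simps sum.distrib sum_subtractf sum_distrib_left)
  also have "... \<le> 0" using 1 2 by linarith
  finally have "(\<Sum>i<N. (?s (k i) - ?s i)\<^sup>2) \<le> 0" .
  hence "(\<Sum>i<N. (?s (k i) - ?s i)\<^sup>2) = 0" by (intro antisym sum_nonneg) auto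
  hence z: "\<forall>i\<in>{..<N}. (?s (k i) - ?s i)\<^sup>2 = 0" by (subst (asm) sum_nonneg_eq_0_iff) auto
  show ?thesis
  proof
    fix i show "k i = id i"
    proof (cases "i < N")
      case True
      hence "(?s (k i) - ?s i)\<^sup>2 = 0" using z by blast
      hence "stair N (k i) = stair N i" by simp
      thus ?thesis using permutes_less[OF k True] True unfolding stair_def id_def by linarith
    qed (use k in \<open>simp add: permutes_not_in\<close>)
  qed
qed

context SU_irrep_haar
begin

lemma diagonalise_SU:
  assumes g: "g \<in> SU_grp N"
  obtains V \<xi> where "V \<in> SU_grp N" "g = V * mat_diag N \<xi> * mat_adjoint V" "tpt N \<xi>"
    "mat_adjoint g = V * mat_diag N (\<lambda>i. cnj (\<xi> i)) * mat_adjoint V" "tpt N (\<lambda>i. cnj (\<xi> i))"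
proof -
  obtain V \<xi> where V: "V \<in> SU_grp N" and gV: "g = V * mat_diag N \<xi> * mat_adjoint V" and u: "!!i. i < N ==> cmod (\<xi> i) = 1"
    using Ugrp_diagonalisation[OF SU_Ugrp[OF g]] by blast
  have V': "mat_adjoint V \<in> SU_grp N" by (rule SU_adjoint[OF V])
  note c = SU_carrier[OF V] SU_carrier[OF V'] mat_diag_dim[of N \<xi>]
  have "det (V * mat_diag N \<xi> * mat_adjoint V) = det (V * mat_diag N \<xi>) * det (mat_adjoint V)"
    by (rule det_mult[of _ N]) (use c in auto)
  moreover have "det (V * mat_diag N \<xi>) = det V * det (mat_diag N \<xi>)"
    by (rule det_mult[of _ N]) (use c in auto)
  ultimately have "det g = det V * det (mat_diag N \<xi>) * det (mat_adjoint V)" unfolding gV by (simp only:)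
  hence "(\<Prod>i<N. \<xi> i) = 1" using g V V' by (simp add: SU_iff det_mat_diag)
  hence t: "tpt N \<xi>" using u by (simp add: tpt_def)
  have "(\<Prod>i<N. cnj (\<xi> i)) = cnj (\<Prod>i<N. \<xi> i)" by simp
  hence t': "tpt N (\<lambda>i. cnj (\<xi> i))" using t unfolding tpt_def by (metis complex_cnj_one complex_mod_cnj)
  have "mat_adjoint g = mat_adjoint (mat_adjoint V) * mat_adjoint (V * mat_diag N \<xi>)"
    unfolding gV by (rule mat_adjoint_mult[of _ N N _ N]) (use c in auto)
  also have "... = V * (mat_diag N (\<lambda>i. cnj (\<xi> i)) * mat_adjoint V)"
    using c by (simp add: mat_adjoint_mult[of _ N N _ N] mat_adjoint_adjoint[of _ N N] mat_adjoint_diag)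
  also have "... = V * mat_diag N (\<lambda>i. cnj (\<xi> i)) * mat_adjoint V"
    using c by (simp add: assoc_mult_mat[of _ N N _ N _ N])
  finally show ?thesis by (rule that[OF V gV t _ t'])
qed

text \<open>The character is an integer combination of the orthonormal functions
  \<open>s\<^sub>k \<otimes> s\<^sub>l\<close>, and \<open>\<integral>|\<chi>|\<^sup>2 = 1\<close> leaves room for a single one, the one of the highest weight.\<close>

theorem irreducible_character:
  assumes N: "N > 0" and hw: "is_weight N d \<rho> (\<lambda>k. int (a k)) (\<lambda>k. int (b k))"
    and dom: "!!m l. is_weight N d \<rho> m l ==> weight_le N m (\<lambda>k. int (a k)) \<and> weight_le N l (\<lambda>k. int (b k))"
    and t: "tpt N \<xi>" "tpt N \<eta>"
  shows "mat_trace (\<rho> (mat_diag N \<xi>, mat_diag N \<eta>)) =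
    schur N (\<lambda>i. (\<Sum>k\<in>{Suc i..<N}. a k) + stair N i) \<xi> * schur N (\<lambda>i. (\<Sum>k\<in>{Suc i..<N}. b k) + stair N i) \<eta>"
proof -
  obtain w S M where S: "finite S" "S \<subseteq> window N w \<times> window N w" and M: "!!pq. pq \<in> S ==> (M pq :: nat) > 0"
    and tr: "!!\<xi> \<eta>. tpt N \<xi> ==> tpt N \<eta> ==> mat_trace (\<rho> (mat_diag N \<xi>, mat_diag N \<eta>)) =
       (\<Sum>pq\<in>S. of_nat (M pq) * ((\<Prod>i<N. \<xi> i ^ fst pq i) * (\<Prod>i<N. \<eta> i ^ snd pq i)))"
    and Swt: "!!p q. p \<in> window N w ==> q \<in> window N w ==> (p,q) \<in> S \<longleftrightarrow> wt p q"
    and Sw: "!!m l. is_weight N d \<rho> m l ==> \<exists>p q. (p,q) \<in> S \<and>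
       (\<forall>k\<in>{1..<N}. int (p (k - 1)) - int (p k) = m k \<and> int (q (k - 1)) - int (q k) = l k)"
  proof (rule character_expansion[OF N], goal_cases)
    case (1 w S M)
    show ?case by (rule 1(1)[OF 1(2-7)])
  qed
  obtain p0 q0 where pq0: "(p0,q0) \<in> S" and p0: "!!k. k \<in> {1..<N} ==> int (p0 (k - 1)) - int (p0 k) = int (a k)"
    and q0: "!!k. k \<in> {1..<N} ==> int (q0 (k - 1)) - int (q0 k) = int (b k)"
    using Sw[OF hw] by blast
  let ?\<chi> = "\<lambda>\<xi> \<eta>. mat_trace (\<rho> (mat_diag N \<xi>, mat_diag N \<eta>))"
  define F where "F = real (fact N)"
  have F0: "F > 0" by (simp add: F_def)
  have cp: "card (perms N) = fact N" by (rule card_permutations) auto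
  have fp: "finite (perms N)" by (simp add: finite_permutations)
  define I where "I = S \<times> perms N \<times> perms N"
  have fI: "finite I" using S fp by (simp add: I_def)
  define P where "P \<iota> = (\<lambda>i. fst (fst \<iota>) (fst (snd \<iota>) i) + stair N i)" for \<iota> :: "((nat => nat) \<times> (nat => nat)) \<times> (nat => nat) \<times> (nat => nat)"
  define Q where "Q \<iota> = (\<lambda>i. snd (fst \<iota>) (snd (snd \<iota>) i) + stair N i)" for \<iota> :: "((nat => nat) \<times> (nat => nat)) \<times> (nat => nat) \<times> (nat => nat)"
  \<comment> \<open>The multiplicity shared among the terms of an average over both Weyl groups,
    hence the square of N!.\<close>
  define c where "c \<iota> = real (M (fst \<iota>)) / F\<^sup>2" for \<iota> :: "((nat => nat) \<times> (nat => nat)) \<times> (nat => nat) \<times> (nat => nat)"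
  have exp1: "?\<chi> \<xi> \<eta> = (\<Sum>\<iota>\<in>I. of_real (c \<iota>) * (schur N (P \<iota>) \<xi> * schur N (Q \<iota>) \<eta>))"
    if t: "tpt N \<xi>" "tpt N \<eta>" for \<xi> \<eta>
  proof -
    have "of_real (F\<^sup>2) * ?\<chi> \<xi> \<eta> = (\<Sum>s\<in>perms N. \<Sum>s'\<in>perms N. ?\<chi> \<xi> \<eta>)"
      by (simp add: cp F_def power2_eq_square)
    also have "... = (\<Sum>s\<in>perms N. \<Sum>s'\<in>perms N. ?\<chi> (\<xi> \<circ> s) (\<eta> \<circ> s'))"
      by (intro sum.cong refl) (simp add: character_permute[OF N _ _ t])
    also have "... = (\<Sum>s\<in>perms N. \<Sum>s'\<in>perms N. \<Sum>pq\<in>S. of_nat (M pq) * ((\<Prod>i<N. (\<xi> \<circ> s) i ^ fst pq i) * (\<Prod>i<N. (\<eta> \<circ> s') i ^ snd pq i)))"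
      by (intro sum.cong refl tr tpt_permute t) auto
    also have "... = (\<Sum>s\<in>perms N. \<Sum>pq\<in>S. \<Sum>s'\<in>perms N. of_nat (M pq) * ((\<Prod>i<N. (\<xi> \<circ> s) i ^ fst pq i) * (\<Prod>i<N. (\<eta> \<circ> s') i ^ snd pq i)))"
      by (intro sum.cong refl sum.swap)
    also have "... = (\<Sum>pq\<in>S. \<Sum>s\<in>perms N. \<Sum>s'\<in>perms N. of_nat (M pq) * ((\<Prod>i<N. (\<xi> \<circ> s) i ^ fst pq i) * (\<Prod>i<N. (\<eta> \<circ> s') i ^ snd pq i)))"
      by (rule sum.swap)
    also have "... = (\<Sum>pq\<in>S. of_nat (M pq) * ((\<Sum>s\<in>perms N. \<Prod>i<N. \<xi> (s i) ^ fst pq i) * (\<Sum>s\<in>perms N. \<Prod>i<N. \<eta> (s i) ^ snd pq i)))"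
      unfolding sum_product unfolding sum_distrib_left by (simp add: o_def)
    also have "... = (\<Sum>pq\<in>S. \<Sum>s\<in>perms N. \<Sum>s'\<in>perms N. of_nat (M pq) * (schur N (P (pq,s,s')) \<xi> * schur N (Q (pq,s,s')) \<eta>))"
      unfolding symmetrised_monomial sum_product unfolding sum_distrib_left by (simp add: P_def Q_def)
    also have "... = (\<Sum>\<iota>\<in>I. of_nat (M (fst \<iota>)) * (schur N (P \<iota>) \<xi> * schur N (Q \<iota>) \<eta>))"
      unfolding I_def by (simp only: sum.cartesian_product case_prod_unfold prod.collapse fst_conv)
    also have "... = of_real (F\<^sup>2) * (\<Sum>\<iota>\<in>I. of_real (c \<iota>) * (schur N (P \<iota>) \<xi> * schur N (Q \<iota>) \<eta>))"
      unfolding sum_distrib_left using F0 by (intro sum.cong refl) (simp add: c_def)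
    finally show ?thesis using F0 by simp
  qed
  have ni: "inj_on l {..<N}" if "schur N l z \<noteq> 0" for l z using schur_not_inj that by blast
  \<comment> \<open>Labels with repeated entries have vanishing Schur function and are
    dropped.\<close>
  define J where "J = {\<iota> \<in> I. inj_on (P \<iota>) {..<N} \<and> inj_on (Q \<iota>) {..<N}}"
  have fJ: "finite J" using fI by (simp add: J_def)
  define \<omega> where "\<omega> \<iota> = (sorted_label N (P \<iota>), sorted_label N (Q \<iota>))" for \<iota>
  define sg where "sg \<iota> = real_of_int (sign (sorting N (P \<iota>))) * real_of_int (sign (sorting N (Q \<iota>)))" for \<iota>
  define B where "B o' = (\<Sum>\<iota>\<in>{\<iota>\<in>J. \<omega> \<iota> = o'}. c \<iota> * sg \<iota>)" for o'
  let ?\<Omega> = "\<omega> ` J"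
  have f\<Omega>: "finite ?\<Omega>" using fJ by simp
  have exp2: "?\<chi> \<xi> \<eta> = (\<Sum>o'\<in>?\<Omega>. of_real (B o') * (schur N (fst o') \<xi> * schur N (snd o') \<eta>))"
    if t: "tpt N \<xi>" "tpt N \<eta>" for \<xi> \<eta>
  proof -
    have "?\<chi> \<xi> \<eta> = (\<Sum>\<iota>\<in>J. of_real (c \<iota>) * (schur N (P \<iota>) \<xi> * schur N (Q \<iota>) \<eta>))"
      unfolding exp1[OF t] using fI by (intro sum.mono_neutral_right) (auto simp: J_def intro: ni)
    also have "... = (\<Sum>\<iota>\<in>J. of_real (c \<iota> * sg \<iota>) * (schur N (fst (\<omega> \<iota>)) \<xi> * schur N (snd (\<omega> \<iota>)) \<eta>))"
    proof (intro sum.cong refl)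
      fix \<iota> assume "\<iota> \<in> J"
      hence i: "inj_on (P \<iota>) {..<N}" "inj_on (Q \<iota>) {..<N}" by (auto simp: J_def)
      show "of_real (c \<iota>) * (schur N (P \<iota>) \<xi> * schur N (Q \<iota>) \<eta>) =
        of_real (c \<iota> * sg \<iota>) * (schur N (fst (\<omega> \<iota>)) \<xi> * schur N (snd (\<omega> \<iota>)) \<eta>)"
        unfolding sorted_label(3)[OF i(1)] sorted_label(3)[OF i(2)] \<omega>_def sg_def by (simp add: mult_ac)
    qed
    also have "... = (\<Sum>o'\<in>?\<Omega>. \<Sum>\<iota>\<in>{\<iota>\<in>J. \<omega> \<iota> = o'}. of_real (c \<iota> * sg \<iota>) * (schur N (fst (\<omega> \<iota>)) \<xi> * schur N (snd (\<omega> \<iota>)) \<eta>))"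
      by (rule sum.group[symmetric]) (use fJ in auto)
    also have "... = (\<Sum>o'\<in>?\<Omega>. of_real (B o') * (schur N (fst o') \<xi> * schur N (snd o') \<eta>))"
      unfolding B_def of_real_sum sum_distrib_right by (intro sum.cong refl) auto
    finally show ?thesis .
  qed
  have win: "p \<circ> s \<in> window N w" if "p \<in> window N w" "s permutes {..<N}" for p s
    using that sum.permute[OF that(2), of p] permutes_in_image[OF that(2)]
    by (auto simp: window_def PiE_iff extensional_def permutes_not_in)
  \<comment> \<open>All totals lie in one window of length N, as the orthonormality statement
    demands.\<close>
  have sumP: "w + (\<Sum>i<N. stair N i) \<le> (\<Sum>i<N. fst o' i)" "(\<Sum>i<N. fst o' i) < w + (\<Sum>i<N. stair N i) + N"
       "w + (\<Sum>i<N. stair N i) \<le> (\<Sum>i<N. snd o' i)" "(\<Sum>i<N. snd o' i) < w + (\<Sum>i<N. stair N i) + N"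
       "strict N (fst o')" "strict N (snd o')" "fst o' \<in> {..<N} \<rightarrow>\<^sub>E UNIV" "snd o' \<in> {..<N} \<rightarrow>\<^sub>E UNIV"
    if o'm: "o' \<in> ?\<Omega>" for o'
  proof -
    obtain \<iota> where \<iota>: "\<iota> \<in> J" "o' = \<omega> \<iota>" using o'm by blast
    obtain p q s s' where "\<iota> = ((p,q),s,s')" by (metis prod.collapse)
    with \<iota> have i: "((p,q),s,s') \<in> J" and o': "o' = \<omega> ((p,q),s,s')" by simp_all
    hence inj: "inj_on (P ((p,q),s,s')) {..<N}" "inj_on (Q ((p,q),s,s')) {..<N}" 
      and pq: "p \<in> window N w" "q \<in> window N w" "s permutes {..<N}" "s' permutes {..<N}" using S(2) by (auto simp: J_def I_def)
    note l = sorted_label[OF inj(1)] sorted_label[OF inj(2)]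
    show "strict N (fst o')" "strict N (snd o')" "fst o' \<in> {..<N} \<rightarrow>\<^sub>E UNIV" "snd o' \<in> {..<N} \<rightarrow>\<^sub>E UNIV"
      using l by (simp_all add: o' \<omega>_def, simp_all add: sorted_label_def)
    have "(\<Sum>i<N. P ((p,q),s,s') i) = (\<Sum>i<N. (p \<circ> s) i) + (\<Sum>i<N. stair N i)"
      "(\<Sum>i<N. Q ((p,q),s,s') i) = (\<Sum>i<N. (q \<circ> s') i) + (\<Sum>i<N. stair N i)"
      by (simp_all add: P_def Q_def sum.distrib)
    with win[OF pq(1,3)] win[OF pq(2,4)] l(2,5)
    show "w + (\<Sum>i<N. stair N i) \<le> (\<Sum>i<N. fst o' i)" "(\<Sum>i<N. fst o' i) < w + (\<Sum>i<N. stair N i) + N"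
       "w + (\<Sum>i<N. stair N i) \<le> (\<Sum>i<N. snd o' i)" "(\<Sum>i<N. snd o' i) < w + (\<Sum>i<N. stair N i) + N"
      by (simp_all add: o' \<omega>_def window_def)
  qed
  have ext_eq: "(\<forall>j<N. k j = l j) \<longleftrightarrow> k = l" if "k \<in> {..<N} \<rightarrow>\<^sub>E UNIV" "l \<in> {..<N} \<rightarrow>\<^sub>E UNIV" for k l :: "nat => nat"
    using PiE_ext[OF that] by auto
  let ?sp = "\<lambda>o1 o2 p. schur_pair N (fst o1) (fst o2) (fst p) * schur_pair N (snd o1) (snd o2) (snd p)"
  have "1 = (LINT p|(\<nu> \<Otimes>\<^sub>M \<nu>). mat_trace (\<rho> p) * mat_trace (\<rho> (adj2 p)))"
    by (rule integral_character_square[symmetric])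
  also have "... = (LINT p|(\<nu> \<Otimes>\<^sub>M \<nu>). (\<Sum>o1\<in>?\<Omega>. \<Sum>o2\<in>?\<Omega>. of_real (B o1 * B o2) * ?sp o2 o1 p))"
  proof (rule Bochner_Integration.integral_cong[OF refl])
    fix p assume "p \<in> space (\<nu> \<Otimes>\<^sub>M \<nu>)"
    hence gh: "fst p \<in> SU_grp N" "snd p \<in> SU_grp N" by (auto simp: space_pair_measure space_nu)
    obtain V \<xi> where V: "V \<in> SU_grp N" "fst p = V * mat_diag N \<xi> * mat_adjoint V" "tpt N \<xi>"
      "mat_adjoint (fst p) = V * mat_diag N (\<lambda>i. cnj (\<xi> i)) * mat_adjoint V" "tpt N (\<lambda>i. cnj (\<xi> i))"
      using diagonalise_SU[OF gh(1)] by blast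
    obtain W \<eta> where W: "W \<in> SU_grp N" "snd p = W * mat_diag N \<eta> * mat_adjoint W" "tpt N \<eta>"
      "mat_adjoint (snd p) = W * mat_diag N (\<lambda>i. cnj (\<eta> i)) * mat_adjoint W" "tpt N (\<lambda>i. cnj (\<eta> i))"
      using diagonalise_SU[OF gh(2)] by blast
    have "mat_trace (\<rho> p) = mat_trace (\<rho> (fst p, snd p))" by simp
    also have "... = ?\<chi> \<xi> \<eta>" unfolding V(2) W(2) by (intro trace_conj V(1) W(1) tpt_SU V(3) W(3))
    finally have 1: "mat_trace (\<rho> p) = ?\<chi> \<xi> \<eta>" .
    have 2: "mat_trace (\<rho> (adj2 p)) = ?\<chi> (\<lambda>i. cnj (\<xi> i)) (\<lambda>i. cnj (\<eta> i))"
      unfolding adj2_def V(4) W(4) by (intro trace_conj V(1) W(1) tpt_SU V(5) W(5))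
    show "mat_trace (\<rho> p) * mat_trace (\<rho> (adj2 p)) = (\<Sum>o1\<in>?\<Omega>. \<Sum>o2\<in>?\<Omega>. of_real (B o1 * B o2) * ?sp o2 o1 p)"
      unfolding 1 2 exp2[OF V(3) W(3)] exp2[OF V(5) W(5)] sum_product schur_cnj
        schur_pair_diagonalised[OF V(1,2)] schur_pair_diagonalised[OF W(1,2)]
      by (intro sum.cong refl) (simp add: mult_ac)
  qed
  also have "... = (\<Sum>o1\<in>?\<Omega>. \<Sum>o2\<in>?\<Omega>. of_real (B o1 * B o2) * (LINT p|(\<nu> \<Otimes>\<^sub>M \<nu>). ?sp o2 o1 p))"
  proof -
    have "integrable (\<nu> \<Otimes>\<^sub>M \<nu>) (?sp o2 o1)" for o1 o2
      by (intro pair.bmf_integrable bmf_mult bdd_measurable_fst bdd_measurable_snd mean.bmf_schur_pair)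
    thus ?thesis
      by (simp add: Bochner_Integration.integral_sum Bochner_Integration.integrable_sum Bochner_Integration.integrable_mult_right del: of_real_mult)
  qed
  also have "... = (\<Sum>o1\<in>?\<Omega>. \<Sum>o2\<in>?\<Omega>. if o2 = o1 then of_real (B o1 * B o2) else 0)"
  proof (intro sum.cong refl)
    fix o1 o2 assume o: "o1 \<in> ?\<Omega>" "o2 \<in> ?\<Omega>"
    have "(LINT p|(\<nu> \<Otimes>\<^sub>M \<nu>). ?sp o2 o1 p) =
      (LINT g|\<nu>. schur_pair N (fst o2) (fst o1) g) * (LINT g|\<nu>. schur_pair N (snd o2) (snd o1) g)"
      by (intro integral_pair_product mean.bmf_schur_pair)
    also have "(LINT g|\<nu>. schur_pair N (fst o2) (fst o1) g) = (if \<forall>j<N. fst o2 j = fst o1 j then 1 else 0)"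
      using sumP[OF o(1)] sumP[OF o(2)] by (intro mean.schur_orthonormal N space_nu) auto
    also have "(LINT g|\<nu>. schur_pair N (snd o2) (snd o1) g) = (if \<forall>j<N. snd o2 j = snd o1 j then 1 else 0)"
      using sumP[OF o(1)] sumP[OF o(2)] by (intro mean.schur_orthonormal N space_nu) auto
    finally show "of_real (B o1 * B o2) * (LINT p|(\<nu> \<Otimes>\<^sub>M \<nu>). ?sp o2 o1 p) =
       (if o2 = o1 then of_real (B o1 * B o2) else (0::complex))"
      using ext_eq[OF sumP(7)[OF o(2)] sumP(7)[OF o(1)]] ext_eq[OF sumP(8)[OF o(2)] sumP(8)[OF o(1)]]
      by (simp add: prod_eq_iff del: of_real_mult)
  qed
  also have "... = (\<Sum>o1\<in>?\<Omega>. of_real (B o1 * B o1))" using f\<Omega> by simp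
  finally have "complex_of_real (\<Sum>o1\<in>?\<Omega>. B o1 * B o1) = complex_of_real 1" by simp
  hence norm1: "(\<Sum>o1\<in>?\<Omega>. B o1 * B o1) = 1" by (simp only: of_real_eq_iff)
  have w0: "p0 \<in> window N w" "q0 \<in> window N w" using pq0 S(2) by auto
  have strict0: "strict N (\<lambda>i. r i + stair N i)" if r: "!!k. k \<in> {1..<N} ==> int (r (k - 1)) - int (r k) = int (a' k)"
    for r a' :: "nat => nat"
  proof -
    have step: "r (i + m) \<le> r i" if "i + m < N" for i m
      using that
    proof (induction m)
      case (Suc m)
      have "int (r (i + m)) - int (r (Suc (i + m))) = int (a' (Suc (i + m)))" using r[of "Suc (i + m)"] Suc.prems by simp
      thus ?case using Suc by simp
    qed simp
    show ?thesis unfolding strict_def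
    proof (intro allI impI)
      fix i j assume ij: "i < j" "j < N"
      have "r j \<le> r i" using step[of i "j - i"] ij by simp
      thus "r j + stair N j < r i + stair N i" using ij by (simp add: stair_def)
    qed
  qed
  define P0 where "P0 i = p0 i + stair N i" for i
  define Q0 where "Q0 i = q0 i + stair N i" for i
  have st: "strict N P0" "strict N Q0" unfolding P0_def[abs_def] Q0_def[abs_def] by (rule strict0, rule p0, simp) (rule strict0, rule q0, simp)
  define o0 where "o0 = (restrict P0 {..<N}, restrict Q0 {..<N})"
  \<comment> \<open>No cancellation occurs at the highest label: a nontrivial sorting permutation
    would require a weight whose pairing with the staircase exceeds that of the highest
    weight.\<close>
  have pos: "sg \<iota> = 1" if \<iota>: "\<iota> \<in> J" "\<omega> \<iota> = o0" for \<iota>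
  proof -
    obtain p q s s' where i: "\<iota> = ((p,q),s,s')" by (metis prod.collapse)
    hence inj: "inj_on (P \<iota>) {..<N}" "inj_on (Q \<iota>) {..<N}" 
      and pq: "(p,q) \<in> S" "p \<in> window N w" "q \<in> window N w" "s permutes {..<N}" "s' permutes {..<N}"
      using \<iota> S(2) by (auto simp: J_def I_def)
    note so = sorting(1)[OF inj(1)] sorting(1)[OF inj(2)]
    let ?p = "p \<circ> (s \<circ> sorting N (P \<iota>))" and ?q = "q \<circ> (s' \<circ> sorting N (Q \<iota>))"
    have perm: "(s \<circ> sorting N (P \<iota>)) permutes {..<N}" "(s' \<circ> sorting N (Q \<iota>)) permutes {..<N}"
      by (intro permutes_compose so pq)+
    have "wt ?p ?q" using pq Swt[of p q] by (intro wt_permute[OF N] perm) auto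
    hence "is_weight N d \<rho> (\<lambda>k. int (?p (k - 1)) - int (?p k)) (\<lambda>k. int (?q (k - 1)) - int (?q k))"
      by (simp only: is_weight_iff_wt[OF N])
    from dom[OF this] have le: "weight_le N (\<lambda>k. int (?p (k - 1)) - int (?p k)) (\<lambda>k. int (a k))"
       "weight_le N (\<lambda>k. int (?q (k - 1)) - int (?q k)) (\<lambda>k. int (b k))" by blast+
    have e: "fst (\<omega> \<iota>) = restrict P0 {..<N}" "snd (\<omega> \<iota>) = restrict Q0 {..<N}" using \<iota>(2) by (auto simp: o0_def)
    have "sorting N (P \<iota>) = id"
    proof (rule stair_permute_id[OF so(1) _ dominance_stair[OF win[OF pq(2) perm(1)] w0(1) N le(1)]])
      fix j assume "j < N"
      thus "?p j + stair N (sorting N (P \<iota>) j) = p0 j + stair N j"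
        using fun_cong[OF e(1), of j] by (simp add: \<omega>_def sorted_label_def P_def i P0_def)
    qed (use p0 in simp)
    moreover have "sorting N (Q \<iota>) = id"
    proof (rule stair_permute_id[OF so(2) _ dominance_stair[OF win[OF pq(3) perm(2)] w0(2) N le(2)]])
      fix j assume "j < N"
      thus "?q j + stair N (sorting N (Q \<iota>) j) = q0 j + stair N j"
        using fun_cong[OF e(2), of j] by (simp add: \<omega>_def sorted_label_def Q_def i Q0_def)
    qed (use q0 in simp)
    ultimately show ?thesis by (simp add: sg_def sign_id)
  qed
  \<comment> \<open>The Weyl orbit of the highest weight: the exponents moved by the inverse of s
    return to the highest label when symmetrised with s. These (N!)^2 terms alone give a coefficient
    of at least 1.\<close>
  define em where "em s = ((p0 \<circ> inv_into UNIV (fst s), q0 \<circ> inv_into UNIV (snd s)), s)" for s :: "(nat => nat) \<times> (nat => nat)"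
  have em: "em s \<in> J" "\<omega> (em s) = o0" if s: "s \<in> perms N \<times> perms N" for s
  proof -
    have s': "fst s permutes {..<N}" "snd s permutes {..<N}" using s by auto
    note iv = permutes_inv[OF s'(1)] permutes_inv[OF s'(2)]
    have PQ: "P (em s) = P0" "Q (em s) = Q0"
      by (simp_all add: P_def Q_def em_def P0_def[abs_def] Q0_def[abs_def] permutes_inverses[OF s'(1)] permutes_inverses[OF s'(2)])
    have "wt (p0 \<circ> inv_into UNIV (fst s)) (q0 \<circ> inv_into UNIV (snd s))"
      using pq0 Swt[OF w0] by (intro wt_permute[OF N] iv) auto
    hence "(p0 \<circ> inv_into UNIV (fst s), q0 \<circ> inv_into UNIV (snd s)) \<in> S"
      using Swt[OF win[OF w0(1) iv(1)] win[OF w0(2) iv(2)]] by simp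
    thus "em s \<in> J" using s' st[THEN strict_inj] PQ by (simp add: J_def I_def, simp add: em_def mem_Times_iff)
    show "\<omega> (em s) = o0" by (simp add: \<omega>_def PQ sorted_label_strict st o0_def)
  qed
  have id: "(id,id) \<in> perms N \<times> perms N" by (simp add: permutes_id)
  have o0: "o0 \<in> ?\<Omega>" using em[OF id] by (metis imageI)
  have "inj_on em (perms N \<times> perms N)" by (auto simp: inj_on_def em_def)
  hence card: "card (em ` (perms N \<times> perms N)) = fact N * fact N" by (simp add: card_image card_cartesian_product cp)
  have "1 = (\<Sum>\<iota>\<in>em ` (perms N \<times> perms N). 1 / F\<^sup>2)" unfolding sum_constant card using F0 by (simp add: F_def power2_eq_square)
  also have "... \<le> (\<Sum>\<iota>\<in>em ` (perms N \<times> perms N). c \<iota> * sg \<iota>)"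
  proof (intro sum_mono)
    fix \<iota> assume "\<iota> \<in> em ` (perms N \<times> perms N)"
    hence \<iota>: "\<iota> \<in> J" "\<omega> \<iota> = o0" using em by auto
    hence "M (fst \<iota>) > 0" using M by (auto simp: J_def I_def)
    thus "1 / F\<^sup>2 \<le> c \<iota> * sg \<iota>" using pos[OF \<iota>] F0 by (simp add: c_def divide_le_cancel)
  qed
  also have "... \<le> B o0"
    unfolding B_def using fJ em pos by (intro sum_mono2) (auto simp: c_def)
  finally have B1: "B o0 \<ge> 1" .
  have split: "(\<Sum>o1\<in>?\<Omega>. B o1 * B o1) = B o0 * B o0 + (\<Sum>o1\<in>?\<Omega> - {o0}. B o1 * B o1)"
    by (rule sum.remove[OF f\<Omega> o0])
  have nn: "(\<Sum>o1\<in>?\<Omega> - {o0}. B o1 * B o1) \<ge> 0" by (intro sum_nonneg) simp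
  have B1': "B o0 * 1 \<le> B o0 * B o0" using B1 by (intro mult_left_mono) auto
  have Be: "B o0 = 1" and rest: "(\<Sum>o1\<in>?\<Omega> - {o0}. B o1 * B o1) = 0"
    using B1 B1' nn split norm1 by linarith+
  have B0: "B o1 = 0" if "o1 \<in> ?\<Omega> - {o0}" for o1
    using rest that f\<Omega> by (subst (asm) sum_nonneg_eq_0_iff) auto
  have "?\<chi> \<xi> \<eta> = schur N (fst o0) \<xi> * schur N (snd o0) \<eta>"
    unfolding exp2[OF t] sum.remove[OF f\<Omega> o0] Be by (simp add: B0)
  also have "schur N (fst o0) = schur N P0" by (rule schur_label_cong) (simp add: o0_def)
  also have "schur N (snd o0) = schur N Q0" by (rule schur_label_cong) (simp add: o0_def)
  also have "schur N P0 \<xi> * schur N Q0 \<eta> =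
    schur N (\<lambda>i. (\<Sum>k\<in>{Suc i..<N}. a k) + stair N i) \<xi> * schur N (\<lambda>i. (\<Sum>k\<in>{Suc i..<N}. b k) + stair N i) \<eta>"
  proof -
    \<comment> \<open>The exponents exceed the partial sums of Dynkin labels by their constant last
      entry, a power of the determinant.\<close>
    have shift: "schur N (\<lambda>i. r i + stair N i) z = schur N (\<lambda>i. (\<Sum>k\<in>{Suc i..<N}. a' k) + stair N i) z"
      if r: "!!k. k \<in> {1..<N} ==> int (r (k - 1)) - int (r k) = int (a' k)" and z: "tpt N z"
      for r a' :: "nat => nat" and z
    proof -
      have rm: "r (N - Suc m) = (\<Sum>k\<in>{N - m..<N}. a' k) + r (N - 1)" if "m < N" for m
        using that
      proof (induction m)
        case (Suc m)
        have "{N - Suc m..<N} = insert (N - Suc m) {N - m..<N}" using Suc.prems by auto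
        hence "(\<Sum>k\<in>{N - Suc m..<N}. a' k) = a' (N - Suc m) + (\<Sum>k\<in>{N - m..<N}. a' k)"
          using Suc.prems by (simp only:) (subst sum.insert, auto)
        moreover have "int (r (N - Suc (Suc m))) - int (r (N - Suc m)) = int (a' (N - Suc m))"
          using r[of "N - Suc m"] Suc.prems by simp
        ultimately have "r (N - Suc (Suc m)) + (\<Sum>k\<in>{N - m..<N}. a' k) = (\<Sum>k\<in>{N - Suc m..<N}. a' k) + r (N - Suc m)"
          by linarith
        moreover have "r (N - Suc m) = (\<Sum>k\<in>{N - m..<N}. a' k) + r (N - 1)" using Suc.prems by (intro Suc.IH) simp
        ultimately show ?case by linarith
      qed simp
      have ri: "r i = (\<Sum>k\<in>{Suc i..<N}. a' k) + r (N - 1)" if "i < N" for i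
      proof -
        have "N - Suc (N - Suc i) = i" "N - (N - Suc i) = Suc i" "N - Suc i < N" using that by auto
        with rm[of "N - Suc i"] show ?thesis by (simp only:)
      qed
      have "schur N (\<lambda>i. r i + stair N i) z = schur N (\<lambda>i. ((\<Sum>k\<in>{Suc i..<N}. a' k) + stair N i) + r (N - 1)) z"
      proof (rule fun_cong[OF schur_label_cong])
        fix i assume "i < N"
        from ri[OF this] show "r i + stair N i = ((\<Sum>k\<in>{Suc i..<N}. a' k) + stair N i) + r (N - 1)" by linarith
      qed
      also have "... = schur N (\<lambda>i. (\<Sum>k\<in>{Suc i..<N}. a' k) + stair N i) z"
        unfolding schur_shift using z by (simp add: tpt_def)
      finally show ?thesis .
    qed
    show ?thesis unfolding P0_def[abs_def] Q0_def[abs_def]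
      by (rule arg_cong2[of _ _ _ _ "(*)", OF shift[of p0 a \<xi>, OF p0 t(1)] shift[of q0 b \<eta>, OF q0 t(2)]])
  qed
  finally show ?thesis .
qed

end

text \<open>Complementing exponents in a rectangle of width C replaces z by its inverse up to a
  power of the product; reversing the indices costs a sign.\<close>

lemma alternant_reverse:
  assumes z: "!!i. i < N ==> z i \<noteq> 0" and C: "!!i. i < N ==> l i \<le> C"
  shows "alternant N (\<lambda>i. C - l (N - Suc i)) z =
    (\<Prod>i<N. z i) ^ C * (signof (\<lambda>i. if i < N then N - Suc i else i) * alternant N l (\<lambda>i. inverse (z i)))"
proof -
  let ?r = "\<lambda>i. if i < N then N - Suc i else i"
  have "bij_betw ?r {..<N} {..<N}" by (rule bij_betwI[of _ _ _ ?r]) auto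
  hence r: "?r permutes {..<N}" by (rule bij_imp_permutes) auto
  have "alternant N (\<lambda>i. C - l (N - Suc i)) z = (\<Sum>p\<in>perms N. signof p * (\<Prod>i<N. z i ^ C * inverse (z i) ^ (l \<circ> ?r) (p i)))"
    unfolding alternant_sum
  proof (rule sum.cong[OF refl], clarify)
    fix p :: "nat => nat" assume p: "p permutes {..<N}"
    have "z i ^ (C - l (N - Suc (p i))) = z i ^ C * inverse (z i) ^ (l \<circ> ?r) (p i)" if i: "i < N" for i
    proof -
      have "p i < N" by (rule permutes_less[OF p i])
      thus ?thesis using z[OF i] C[of "N - Suc (p i)"] by (simp add: power_diff power_inverse divide_inverse)
    qed
    thus "signof p * (\<Prod>i<N. z i ^ (C - l (N - Suc (p i)))) = signof p * (\<Prod>i<N. z i ^ C * inverse (z i) ^ (l \<circ> ?r) (p i))"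
      by (intro arg_cong2[of _ _ _ _ "(*)"] refl prod.cong) auto
  qed
  also have "... = (\<Prod>i<N. z i) ^ C * alternant N (l \<circ> ?r) (\<lambda>i. inverse (z i))"
    unfolding alternant_sum prod.distrib sum_distrib_left
    by (intro sum.cong refl) (simp add: prod_power_distrib mult_ac)
  finally show ?thesis unfolding alternant_permute[OF r] .
qed

text \<open>Dividing \<open>alternant_reverse\<close> by its staircase case cancels the sign. The
  right side is not polynomial in z, so the passage from distinct coordinates uses continuity
  through \<open>eq_of_inj\<close>.\<close>

lemma schur_inverse:
  assumes z: "!!i. i < N ==> z i \<noteq> 0" and C: "!!i. i < N ==> l i \<le> C" and N: "N > 0"
  shows "(\<Prod>i<N. z i) ^ (N - 1) * schur N (\<lambda>i. C - l (N - Suc i)) z = (\<Prod>i<N. z i) ^ C * schur N l (\<lambda>i. inverse (z i))"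
proof (rule eq_of_inj[of "\<lambda>z. (\<Prod>i<N. z i) ^ (N - 1) * schur N (\<lambda>i. C - l (N - Suc i)) z" z
      "\<lambda>z. (\<Prod>i<N. z i) ^ C * schur N l (\<lambda>i. inverse (z i))" N])
  let ?w = "\<lambda>(s::complex) i. z i + s * of_nat i"
  have wc: "isCont (\<lambda>s. ?w s i) 0" for i by (intro continuous_intros)
  show "isCont (\<lambda>s. (\<Prod>i<N. ?w s i) ^ (N - 1) * schur N (\<lambda>i. C - l (N - Suc i)) (?w s)) 0"
    by (intro continuous_intros isCont_polyfun[OF polyfun_schur])
  have "isCont (\<lambda>s. inverse (?w s i)) 0" if "i \<in> {..<N}" for i
    using z[of i] that by (intro continuous_intros) auto
  thus "isCont (\<lambda>s. (\<Prod>i<N. ?w s i) ^ C * schur N l (\<lambda>i. inverse (?w s i))) 0"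
    by (intro isCont_mult isCont_polyfun[OF polyfun_schur, where w = "\<lambda>s i. inverse (?w s i)"]) (auto intro!: continuous_intros)
  have "eventually (\<lambda>s. ?w s i \<noteq> 0) (at 0)" if "i \<in> {..<N}" for i
    using wc[of i] z[of i] that by (intro tendsto_imp_eventually_ne[of _ "?w 0 i"]) (auto simp: isCont_def)
  hence "eventually (\<lambda>s. \<forall>i\<in>{..<N}. ?w s i \<noteq> 0) (at 0)" by (intro eventually_ball_finite) auto
  thus "eventually (\<lambda>s. inj_on (?w s) {..<N} --> (\<Prod>i<N. ?w s i) ^ (N - 1) * schur N (\<lambda>i. C - l (N - Suc i)) (?w s) =
     (\<Prod>i<N. ?w s i) ^ C * schur N l (\<lambda>i. inverse (?w s i))) (at 0)"
  proof (rule eventually_mono, intro impI)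
    fix s assume nz: "\<forall>i\<in>{..<N}. ?w s i \<noteq> 0" and inj: "inj_on (?w s) {..<N}"
    define v where "v = ?w s"
    have v: "v i \<noteq> 0" if "i < N" for i using nz that by (simp add: v_def)
    let ?s = "signof (\<lambda>i. if i < N then N - Suc i else i) :: complex"
    let ?P = "\<Prod>i<N. v i" and ?v = "\<lambda>i. inverse (v i)"
    have "inj_on ?v {..<N}" using inj by (simp add: inj_on_def v_def)
    hence A2: "alternant N (stair N) ?v \<noteq> 0" by (rule alternant_stair_nonzero)
    have s: "?s \<noteq> 0" by (simp add: sign_def)
    have "alternant N (\<lambda>i. N - 1 - stair N (N - Suc i)) v = alternant N (stair N) v"
      unfolding alternant_def by (intro arg_cong[of _ _ det] eq_matI) (auto simp: stair_def)
    hence 1: "alternant N (stair N) v = ?P ^ (N - 1) * (?s * alternant N (stair N) ?v)"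
      using alternant_reverse[of N v "stair N" "N - 1", OF v] by (simp add: stair_def)
    have "?P ^ (N - 1) * (?s * alternant N (stair N) ?v) * schur N (\<lambda>i. C - l (N - Suc i)) v = alternant N (\<lambda>i. C - l (N - Suc i)) v"
      unfolding 1[symmetric] by (rule alternant_eq_schur[symmetric])
    also have "... = ?P ^ C * (?s * (alternant N (stair N) ?v * schur N l ?v))"
      using alternant_reverse[of N v l C, OF v C] unfolding alternant_eq_schur[of N l ?v] by simp
    finally have "(?s * alternant N (stair N) ?v) * (?P ^ (N - 1) * schur N (\<lambda>i. C - l (N - Suc i)) v) =
       (?s * alternant N (stair N) ?v) * (?P ^ C * schur N l ?v)" by (simp only: mult_ac)
    note eq = this
    have nz: "?s * alternant N (stair N) ?v \<noteq> 0" using A2 s by (simp only: mult_eq_0_iff simp_thms)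
    have "?P ^ (N - 1) * schur N (\<lambda>i. C - l (N - Suc i)) v = ?P ^ C * schur N l ?v"
      by (rule iffD1[OF mult_left_cancel[OF nz] eq])
    thus "(\<Prod>i<N. ?w s i) ^ (N - 1) * schur N (\<lambda>i. C - l (N - Suc i)) (?w s) =
     (\<Prod>i<N. ?w s i) ^ C * schur N l (\<lambda>i. inverse (?w s i))" unfolding v_def .
  qed
qed

text \<open>The shifted partition with \<open>n k\<close> columns of length \<open>k\<close>.\<close>

definition dynkin :: "nat => (nat => nat) => nat => nat" where
  "dynkin N n i = (\<Sum>k\<in>{Suc i..<N}. n k) + stair N i"

text \<open>Reversed Dynkin labels describe the dual representation: the complement of the partition
  in the rectangle spanned by its first row.\<close>

lemma schur_dynkin_dual:
  assumes z: "tpt N z" and N: "N > 0"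
  shows "schur N (dynkin N (\<lambda>k. n (N - k))) z = schur N (dynkin N n) (\<lambda>i. inverse (z i))"
proof -
  let ?C = "dynkin N n 0"
  have nz: "z i \<noteq> 0" if "i < N" for i using z that by (auto simp: tpt_def)
  have le: "dynkin N n i \<le> ?C" if "i < N" for i
    unfolding dynkin_def by (intro add_mono sum_mono2) (auto simp: stair_def)
  have "schur N (dynkin N (\<lambda>k. n (N - k))) = schur N (\<lambda>i. ?C - dynkin N n (N - Suc i))"
  proof (rule schur_label_cong)
    fix i assume i: "i < N"
    have s: "Suc (N - Suc i) = N - i" using i by auto
    have "(\<Sum>k\<in>{Suc i..<N}. n (N - k)) = (\<Sum>k\<in>{1..<N - i}. n k)"
      by (rule sum.reindex_bij_witness[of _ "\<lambda>k. N - k" "\<lambda>k. N - k"]) auto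
    moreover have "{1..<N} = {1..<N - i} \<union> {N - i..<N}" "{1..<N - i} \<inter> {N - i..<N} = {}" using i by auto
    hence "(\<Sum>k\<in>{1..<N}. n k) = (\<Sum>k\<in>{1..<N - i}. n k) + (\<Sum>k\<in>{N - i..<N}. n k)"
      by (simp add: sum.union_disjoint)
    ultimately show "dynkin N (\<lambda>k. n (N - k)) i = ?C - dynkin N n (N - Suc i)"
      using i by (simp add: dynkin_def stair_def s)
  qed
  thus ?thesis using schur_inverse[of N z "dynkin N n" ?C, OF nz le N] z by (simp add: tpt_def)
qed

lemma tpt_inverse: "tpt N z ==> tpt N (\<lambda>i. inverse (z i))"
  using prod_inversef[of z "{..<N}"] by (simp add: tpt_def norm_inverse o_def)

subsection \<open>The Cauchy identity\<close>

lemma has_sum_by_degree: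
  fixes f :: "'a => complex" and deg :: "'a => nat"
  assumes "(f has_sum T) A" and fin: "!!r. finite {a \<in> A. deg a = r}"
  shows "((\<lambda>r. \<Sum>a\<in>{a \<in> A. deg a = r}. f a) has_sum T) UNIV"
proof (rule has_sum_SigmaD[where f = "\<lambda>(r,a). f a" and B = "\<lambda>r. {a \<in> A. deg a = r}"])
  have "bij_betw (\<lambda>a. (deg a, a)) A (SIGMA r:UNIV. {a \<in> A. deg a = r})"
    by (rule bij_betwI[of _ _ _ snd]) auto
  from has_sum_reindex_bij_betw[OF this, of "\<lambda>(r,a). f a" T] assms(1)
  show "((\<lambda>(r,a). f a) has_sum T) (SIGMA r:UNIV. {a \<in> A. deg a = r})" by simp
qed (use fin in simp)

definition labels :: "nat => nat => (nat => nat) set" where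
  "labels N r = {l \<in> {..<N} \<rightarrow>\<^sub>E UNIV. (\<Sum>j<N. l j) = r}"

lemma finite_labels [simp]: "finite (labels N r)"
  unfolding labels_def by (rule finite_hsum_index) simp

definition strict_labels :: "nat => (nat => nat) set" where
  "strict_labels N = {l \<in> {..<N} \<rightarrow>\<^sub>E UNIV. strict N l}"

lemma sum_labels_shift:
  assumes p: "p permutes {..<N}"
  shows "(\<Sum>c\<in>labels N r. \<Prod>j<N. hsum {..<N} (c j) x * y j ^ c j * y j ^ stair N (p j)) =
    (\<Sum>l\<in>{l \<in> labels N (r + (\<Sum>j<N. stair N j)). p \<in> jt_perms N l}.
      (\<Prod>j<N. hsum {..<N} (l j - stair N (p j)) x) * (\<Prod>j<N. y j ^ l j))"
proof (rule sum.reindex_bij_witness[of _ "\<lambda>l. restrict (\<lambda>j. l j - stair N (p j)) {..<N}" "\<lambda>c. restrict (\<lambda>j. c j + stair N (p j)) {..<N}"])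
  have st: "(\<Sum>j<N. stair N (p j)) = (\<Sum>j<N. stair N j)"
    using sum.permute[OF p, of "stair N"] by (simp add: o_def)
  fix c assume c: "c \<in> labels N r"
  show "restrict (\<lambda>j. restrict (\<lambda>j. c j + stair N (p j)) {..<N} j - stair N (p j)) {..<N} = c"
    using c by (intro PiE_ext[of _ "{..<N}" "\<lambda>_. UNIV"]) (auto simp: labels_def)
  show "restrict (\<lambda>j. c j + stair N (p j)) {..<N} \<in> {l \<in> labels N (r + (\<Sum>j<N. stair N j)). p \<in> jt_perms N l}"
    using c p by (simp add: labels_def jt_perms_def sum.distrib st)
  show "(\<Prod>j<N. hsum {..<N} (restrict (\<lambda>j. c j + stair N (p j)) {..<N} j - stair N (p j)) x) *
      (\<Prod>j<N. y j ^ restrict (\<lambda>j. c j + stair N (p j)) {..<N} j) =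
    (\<Prod>j<N. hsum {..<N} (c j) x * y j ^ c j * y j ^ stair N (p j))"
    by (simp add: prod.distrib power_add mult.assoc)
next
  have st: "(\<Sum>j<N. stair N (p j)) = (\<Sum>j<N. stair N j)"
    using sum.permute[OF p, of "stair N"] by (simp add: o_def)
  fix l assume l: "l \<in> {l \<in> labels N (r + (\<Sum>j<N. stair N j)). p \<in> jt_perms N l}"
  hence le: "stair N (p j) \<le> l j" if "j < N" for j using that by (simp add: jt_perms_def)
  show "restrict (\<lambda>j. restrict (\<lambda>j. l j - stair N (p j)) {..<N} j + stair N (p j)) {..<N} = l"
    using l le by (intro PiE_ext[of _ "{..<N}" "\<lambda>_. UNIV"]) (auto simp: labels_def)
  have "(\<Sum>j<N. l j - stair N (p j)) + (\<Sum>j<N. stair N (p j)) = (\<Sum>j<N. l j)"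
    by (simp add: sum.distrib[symmetric] le)
  thus "restrict (\<lambda>j. l j - stair N (p j)) {..<N} \<in> labels N r"
    using l by (simp add: labels_def st)
qed

text \<open>A label with distinct entries is in exactly one way a strict label composed with a
  permutation.\<close>

lemma sum_labels_sorted:
  fixes f :: "(nat => nat) => complex"
  assumes f: "!!l. \<not> inj_on l {..<N} ==> f l = 0"
  shows "(\<Sum>l\<in>labels N r. f l) = (\<Sum>k\<in>{k \<in> labels N r. strict N k}. \<Sum>p\<in>perms N. f (k \<circ> p))"
proof -
  let ?I = "{l \<in> labels N r. inj_on l {..<N}}" and ?K = "{k \<in> labels N r. strict N k}"
  have ext: "k \<circ> p \<in> labels N r" if k: "k \<in> labels N r" and p: "p permutes {..<N}" for k p
    using k permutes_less[OF p] permutes_not_in[OF p] sum.permute[OF p, of k]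
    by (auto simp: labels_def PiE_iff extensional_def)
  have "(\<Sum>l\<in>labels N r. f l) = (\<Sum>l\<in>?I. f l)" by (rule sum.mono_neutral_right) (auto simp: f)
  also have "... = (\<Sum>kp\<in>?K \<times> perms N. f (fst kp \<circ> snd kp))"
  proof (rule sum.reindex_bij_witness[of _ "\<lambda>kp. fst kp \<circ> snd kp" "\<lambda>l. (sorted_label N l, inv_into UNIV (sorting N l))"])
    fix l assume l: "l \<in> ?I"
    note s = sorting[OF conjunct2[OF l[unfolded mem_Collect_eq]]] and sl = sorted_label[OF conjunct2[OF l[unfolded mem_Collect_eq]]]
    note si = permutes_inv[OF s(1)]
    show e: "fst (sorted_label N l, inv_into UNIV (sorting N l)) \<circ> snd (sorted_label N l, inv_into UNIV (sorting N l)) = l"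
    proof
      fix i show "(fst (sorted_label N l, inv_into UNIV (sorting N l)) \<circ> snd (sorted_label N l, inv_into UNIV (sorting N l))) i = l i"
        using l permutes_less[OF si, of i] permutes_not_in[OF si, of i]
        by (cases "i < N") (auto simp: sorted_label_def permutes_inverses[OF s(1)] labels_def PiE_iff extensional_def)
    qed
    have "sorted_label N l \<in> labels N r" using l sl(2) by (simp add: labels_def) (simp add: sorted_label_def)
    thus "(sorted_label N l, inv_into UNIV (sorting N l)) \<in> ?K \<times> perms N" using sl(1) si by simp
    show "f (fst (sorted_label N l, inv_into UNIV (sorting N l)) \<circ> snd (sorted_label N l, inv_into UNIV (sorting N l))) = f l"
      unfolding e ..
  next
    fix kp assume "kp \<in> ?K \<times> perms N"
    then obtain k p where kp: "kp = (k,p)" and k: "k \<in> labels N r" "strict N k" and p: "p permutes {..<N}" by auto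
    have inj: "inj_on (k \<circ> p) {..<N}"
      using strict_inj[OF k(2)] permutes_inj_on[OF p] permutes_image[OF p] by (intro comp_inj_on) auto
    note s = sorting[OF inj]
    have "p \<circ> sorting N (k \<circ> p) = id"
      by (rule strict_permute_id[OF s(2) k(2) permutes_compose[OF s(1) p]]) simp
    hence ps: "p (sorting N (k \<circ> p) i) = i" for i by (metis comp_apply id_apply)
    have "inv_into UNIV (sorting N (k \<circ> p)) = p"
    proof
      fix i
      have "p (sorting N (k \<circ> p) (inv_into UNIV (sorting N (k \<circ> p)) i)) = p i"
        by (simp add: permutes_inverses[OF s(1)])
      thus "inv_into UNIV (sorting N (k \<circ> p)) i = p i" by (simp add: ps)
    qed
    moreover have "sorted_label N (k \<circ> p) = k"
    proof
      fix i show "sorted_label N (k \<circ> p) i = k i"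
        using k by (cases "i < N") (auto simp: sorted_label_def ps labels_def PiE_iff extensional_def)
    qed
    ultimately show "(sorted_label N (fst kp \<circ> snd kp), inv_into UNIV (sorting N (fst kp \<circ> snd kp))) = kp"
      by (simp add: kp)
    show "fst kp \<circ> snd kp \<in> ?I" using ext[OF k(1) p] inj by (simp add: kp)
  qed
  also have "... = (\<Sum>k\<in>?K. \<Sum>p\<in>perms N. f (k \<circ> p))" by (simp add: sum.cartesian_product case_prod_unfold)
  finally show ?thesis .
qed

text \<open>Multiplication by the Weyl denominator in y shifts exponents by permuted staircases and
  turns the left side into the sum of s_l(x) y^l over all labels. Grouping by Weyl orbits gives
  s_k(x) times the alternant of k in y.\<close>

lemma cauchy_degree:
  "(\<Sum>c\<in>labels N r. \<Prod>j<N. hsum {..<N} (c j) x * y j ^ c j) =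
   (\<Sum>k\<in>{k \<in> labels N (r + (\<Sum>j<N. stair N j)). strict N k}. schur N k x * schur N k y)"
proof (rule polyfun_eq_of_inj[of N "\<lambda>y. \<Sum>c\<in>labels N r. \<Prod>j<N. hsum {..<N} (c j) x * y j ^ c j"])
  show "polyfun {..<N} (\<lambda>y. \<Sum>c\<in>labels N r. \<Prod>j<N. hsum {..<N} (c j) x * y j ^ c j)"
    by (intro polyfun_sum polyfun_prod polyfun_mult polyfun_const polyfun_power polyfun_var)
  show "polyfun {..<N} (\<lambda>y. \<Sum>k\<in>{k \<in> labels N (r + (\<Sum>j<N. stair N j)). strict N k}. schur N k x * schur N k y)"
    by (intro polyfun_sum polyfun_mult polyfun_const polyfun_schur)
  fix y :: "nat => complex" assume y: "inj_on y {..<N}"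
  let ?A = "alternant N (stair N) y" and ?L = "labels N (r + (\<Sum>j<N. stair N j))"
  let ?h = "\<lambda>p l. (\<Prod>j<N. hsum {..<N} (l j - stair N (p j)) x)" and ?m = "\<lambda>l. (\<Prod>j<N. y j ^ l j)"
  have "(\<Sum>c\<in>labels N r. \<Prod>j<N. hsum {..<N} (c j) x * y j ^ c j) * ?A =
    (\<Sum>p\<in>perms N. signof p * (\<Sum>c\<in>labels N r. \<Prod>j<N. hsum {..<N} (c j) x * y j ^ c j * y j ^ stair N (p j)))"
    unfolding alternant_sum sum_distrib_left[of _ _ "perms N"]
    by (rule sum.cong[OF refl]) (simp add: sum_distrib_left sum_distrib_right prod.distrib mult_ac)
  also have "... = (\<Sum>p\<in>perms N. signof p * (\<Sum>l\<in>{l \<in> ?L. p \<in> jt_perms N l}. ?h p l * ?m l))"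
  proof (rule sum.cong[OF refl], clarify)
    fix p :: "nat => nat" assume p: "p permutes {..<N}"
    show "signof p * (\<Sum>c\<in>labels N r. \<Prod>j<N. hsum {..<N} (c j) x * y j ^ c j * y j ^ stair N (p j)) =
      signof p * (\<Sum>l\<in>{l \<in> ?L. p \<in> jt_perms N l}. ?h p l * ?m l)"
      unfolding sum_labels_shift[OF p] ..
  qed
  also have "... = (\<Sum>p\<in>perms N. \<Sum>l\<in>?L. if p \<in> jt_perms N l then signof p * ?h p l * ?m l else 0)"
    by (simp add: sum.inter_filter sum_distrib_left mult.assoc, intro sum.cong refl) simp
  also have "... = (\<Sum>l\<in>?L. \<Sum>p\<in>perms N. if p \<in> jt_perms N l then signof p * ?h p l * ?m l else 0)" by (rule sum.swap)
  also have "... = (\<Sum>l\<in>?L. \<Sum>p\<in>jt_perms N l. signof p * ?h p l * ?m l)"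
    by (rule sum.cong[OF refl], rule sum.mono_neutral_cong_right) (auto simp: jt_perms_def finite_permutations)
  also have "... = (\<Sum>l\<in>?L. schur N l x * ?m l)" by (simp add: schur_sum sum_distrib_right)
  also have "... = (\<Sum>k\<in>{k \<in> ?L. strict N k}. \<Sum>p\<in>perms N. schur N (k \<circ> p) x * ?m (k \<circ> p))"
    by (rule sum_labels_sorted) (simp add: schur_not_inj)
  also have "... = (\<Sum>k\<in>{k \<in> ?L. strict N k}. schur N k x * alternant N k y)"
    unfolding alternant_sum sum_distrib_left
    by (rule sum.cong[OF refl], rule sum.cong[OF refl]) (simp add: schur_permute mult_ac)
  also have "... = (\<Sum>k\<in>{k \<in> ?L. strict N k}. schur N k x * schur N k y) * ?A"
    unfolding sum_distrib_right by (rule sum.cong[OF refl]) (subst alternant_eq_schur, simp add: mult_ac)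
  finally show "(\<Sum>c\<in>labels N r. \<Prod>j<N. hsum {..<N} (c j) x * y j ^ c j) =
     (\<Sum>k\<in>{k \<in> ?L. strict N k}. schur N k x * schur N k y)"
    using alternant_stair_nonzero[OF y] by simp
qed

text \<open>The exponent of q is the size of the partition; on strict labels the subtraction is
  exact by \<open>strict_ge_stair\<close>.\<close>

definition cauchy_term :: "nat => real => (nat => complex) => (nat => complex) => (nat => nat) => complex" where
  "cauchy_term N q x y l = schur N l x * schur N l y * of_real (q ^ ((\<Sum>j<N. l j) - (\<Sum>j<N. stair N j)))"

lemma strict_ge_stair:
  assumes "strict N l" "i < N" shows "stair N i \<le> l i"
proof -
  have "m < N ==> m \<le> l (N - Suc m)" for m
  proof (induction m)
    case (Suc m)
    have "N - Suc (Suc m) < N - Suc m" "N - Suc m < N" using Suc.prems by auto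
    hence "l (N - Suc m) < l (N - Suc (Suc m))" using assms(1) unfolding strict_def by blast
    thus ?case using Suc by simp
  qed simp
  from this[of "stair N i"] show ?thesis using assms(2) by (simp add: stair_def)
qed

text \<open>Convergence only after grouping by degree; summability over the labels themselves is a
  separate matter, since terms of one degree may cancel.\<close>

lemma cauchy_by_degree:
  assumes x: "!!i. i < N ==> cmod (x i) = 1" and y: "!!i. i < N ==> cmod (y i) = 1" and q: "0 \<le> q" "q < 1"
  shows "((\<lambda>r. \<Sum>k\<in>{k \<in> strict_labels N. (\<Sum>j<N. k j) - (\<Sum>j<N. stair N j) = r}. cauchy_term N q x y k) has_sum
    (\<Prod>j<N. \<Prod>i<N. 1 / (1 - of_real q * x i * y j))) UNIV" (is "(?S has_sum ?T) UNIV")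
    and "finite {k \<in> strict_labels N. (\<Sum>j<N. k j) - (\<Sum>j<N. stair N j) = r}"
proof -
  let ?D = "\<Sum>j<N. stair N j"
  have set: "{k \<in> strict_labels N. (\<Sum>j<N. k j) - ?D = r} = {k \<in> labels N (r + ?D). strict N k}" for r
  proof (rule Set.set_eqI)
    fix k
    show "k \<in> {k \<in> strict_labels N. (\<Sum>j<N. k j) - ?D = r} \<longleftrightarrow> k \<in> {k \<in> labels N (r + ?D). strict N k}"
    proof (cases "strict N k")
      case True
      have "?D \<le> (\<Sum>j<N. k j)" using strict_ge_stair[OF True] by (intro sum_mono) simp
      hence "(\<Sum>j<N. k j) - ?D = r \<longleftrightarrow> (\<Sum>j<N. k j) = r + ?D" by linarith
      thus ?thesis using True by (simp only: strict_labels_def labels_def mem_Collect_eq simp_thms)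
    next
      case False
      thus ?thesis by (simp only: strict_labels_def mem_Collect_eq simp_thms)
    qed
  qed
  show "finite {k \<in> strict_labels N. (\<Sum>j<N. k j) - ?D = r}" unfolding set by simp
  let ?f = "\<lambda>j r. hsum {..<N} r x * (of_real q * y j) ^ r"
  have b: "cmod (of_real q * y j * x i) < 1" if "j < N" "i < N" for i j
    using that q by (simp add: norm_mult x y)
  have s: "summable (\<lambda>r. cmod (?f j r))" "?f j sums (\<Prod>i<N. 1 / (1 - of_real q * y j * x i))" if "j \<in> {..<N}" for j
    using hsum_sums[of "{..<N}" "of_real q * y j" x] b that by auto
  have "((\<lambda>c. \<Prod>j<N. ?f j (c j)) has_sum (\<Prod>j<N. suminf (?f j))) ({..<N} \<rightarrow>\<^sub>E UNIV)"
    by (rule prod_has_sum_PiE[OF finite_lessThan s(1)])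
  also have "(\<Prod>j<N. suminf (?f j)) = ?T"
  proof (intro prod.cong refl)
    fix j assume "j \<in> {..<N}"
    from sums_unique[OF s(2)[OF this]]
    show "suminf (?f j) = (\<Prod>i<N. 1 / (1 - of_real q * x i * y j))" by (simp add: mult_ac)
  qed
  finally have "((\<lambda>c. \<Prod>j<N. ?f j (c j)) has_sum ?T) ({..<N} \<rightarrow>\<^sub>E UNIV)" .
  from has_sum_by_degree[OF this, of "\<lambda>c. \<Sum>j<N. c j"]
  have "((\<lambda>r. \<Sum>c\<in>labels N r. \<Prod>j<N. ?f j (c j)) has_sum ?T) UNIV"
    using finite_labels by (simp add: labels_def)
  moreover have "(\<Sum>c\<in>labels N r. \<Prod>j<N. ?f j (c j)) = ?S r" for r
  proof -
    have "(\<Sum>c\<in>labels N r. \<Prod>j<N. ?f j (c j)) = of_real q ^ r * (\<Sum>c\<in>labels N r. \<Prod>j<N. hsum {..<N} (c j) x * y j ^ c j)"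
      unfolding sum_distrib_left
    proof (rule sum.cong[OF refl])
      fix c assume "c \<in> labels N r"
      hence r: "r = (\<Sum>j<N. c j)" by (simp add: labels_def)
      show "(\<Prod>j<N. ?f j (c j)) = of_real q ^ r * (\<Prod>j<N. hsum {..<N} (c j) x * y j ^ c j)"
        unfolding r power_sum prod.distrib[symmetric]
        by (rule prod.cong[OF refl]) (simp only: power_mult_distrib mult_ac)
    qed
    also have "... = ?S r" unfolding cauchy_degree set sum_distrib_left
      by (rule sum.cong[OF refl]) (simp add: cauchy_term_def labels_def)
    finally show ?thesis .
  qed
  ultimately show "(?S has_sum ?T) UNIV" by simp
qed

text \<open>Taking \<open>y = cnj \<circ> x\<close> makes all terms nonnegative, whence summability of
  \<open>\<bar>s\<^sub>l(x)\<bar>\<^sup>2 q\<^bsup>\<bar>l\<bar>\<^esup>\<close> from that of the degree-wise sums.\<close>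

lemma cauchy_identity:
  assumes x: "!!i. i < N ==> cmod (x i) = 1" and y: "!!i. i < N ==> cmod (y i) = 1" and q: "0 \<le> q" "q < 1"
  shows "(cauchy_term N q x y has_sum (\<Prod>j<N. \<Prod>i<N. 1 / (1 - of_real q * x i * y j))) (strict_labels N)"
proof -
  let ?deg = "\<lambda>k. (\<Sum>j<N. k j) - (\<Sum>j<N. stair N j)"
  define G where "G x l = (cmod (schur N l x))\<^sup>2 * q ^ ?deg l" for x l
  have G0: "G x l \<ge> 0" for x l using q by (simp add: G_def)
  have sG: "G x summable_on strict_labels N" if x: "!!i. i < N ==> cmod (x i) = 1" for x
  proof (rule nonneg_bdd_above_summable_on[OF G0])
    have cx: "cmod (cnj (x i)) = 1" if "i < N" for i using x[OF that] by simp
    have ct: "cauchy_term N q x (\<lambda>i. cnj (x i)) k = of_real (G x k)" for k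
      unfolding cauchy_term_def schur_cnj G_def by (simp only: of_real_mult complex_norm_square)
    note c = cauchy_by_degree[of N x "\<lambda>i. cnj (x i)", OF x cx q]
    obtain T where "((\<lambda>r. \<Sum>k\<in>{k \<in> strict_labels N. ?deg k = r}. cauchy_term N q x (\<lambda>i. cnj (x i)) k) has_sum T) UNIV"
      using c(1) by blast
    from has_sum_Re[OF this]
    have h: "((\<lambda>r. \<Sum>k\<in>{k \<in> strict_labels N. ?deg k = r}. G x k) has_sum Re T) UNIV" by (simp add: ct)
    have "sum (G x) F \<le> Re T" if F: "F \<subseteq> strict_labels N" "finite F" for F
    proof -
      have "sum (G x) F = (\<Sum>r\<in>?deg ` F. \<Sum>k\<in>{k \<in> F. ?deg k = r}. G x k)"
        by (rule sum.group[symmetric]) (use F in auto)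
      also have "... \<le> (\<Sum>r\<in>?deg ` F. \<Sum>k\<in>{k \<in> strict_labels N. ?deg k = r}. G x k)"
        using F by (intro sum_mono sum_mono2 c(2) G0) auto
      also have "... \<le> Re T" by (rule finite_sum_le_has_sum[OF h]) (use F G0 in \<open>auto intro: sum_nonneg\<close>)
      finally show ?thesis .
    qed
    thus "bdd_above (sum (G x) ` {F. F \<subseteq> strict_labels N \<and> finite F})" by (intro bdd_aboveI[of _ "Re T"]) auto
  qed
  have "(\<lambda>l. norm (cauchy_term N q x y l)) summable_on strict_labels N"
  proof (rule Infinite_Sum.abs_summable_on_comparison_test')
    show "(\<lambda>l. G x l + G y l) summable_on strict_labels N" by (intro summable_on_add sG x y)
    fix l assume "l \<in> strict_labels N"
    have "cmod (schur N l x) * cmod (schur N l y) \<le> (cmod (schur N l x))\<^sup>2 + (cmod (schur N l y))\<^sup>2"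
    proof -
      have "0 \<le> cmod (schur N l x) * cmod (schur N l y)" by simp
      with sum_squares_bound[of "cmod (schur N l x)" "cmod (schur N l y)"] show ?thesis by linarith
    qed
    hence "cmod (schur N l x) * cmod (schur N l y) * q ^ ?deg l \<le> ((cmod (schur N l x))\<^sup>2 + (cmod (schur N l y))\<^sup>2) * q ^ ?deg l"
      using q by (intro mult_right_mono) auto
    thus "norm (cauchy_term N q x y l) \<le> G x l + G y l"
      using q by (simp add: cauchy_term_def G_def norm_mult norm_power distrib_right)
  qed
  hence "cauchy_term N q x y summable_on strict_labels N" by (rule Infinite_Sum.abs_summable_summable)
  then obtain T' where T': "(cauchy_term N q x y has_sum T') (strict_labels N)" by (auto simp: summable_on_def)
  note c = cauchy_by_degree[OF x y q]
  have "T' = (\<Prod>j<N. \<Prod>i<N. 1 / (1 - of_real q * x i * y j))"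
    by (rule has_sum_unique[OF has_sum_by_degree[OF T' c(2)] c(1)])
  with T' show ?thesis by simp
qed

text \<open>For \<open>SU(N)\<close> points a shift of all parts by \<open>k\<close> only multiplies the term by \<open>q\<^bsup>N k\<^esup>\<close>.\<close>

lemma cauchy_dynkin:
  assumes x: "tpt N x" and y: "tpt N y" and q: "0 \<le> q" "q < 1" and N: "N > 0"
  defines "h \<equiv> \<lambda>n. schur N (dynkin N n) x * schur N (dynkin N n) y * of_real (q ^ (\<Sum>j\<in>{1..<N}. j * n j))"
  shows "h summable_on ({1..<N} \<rightarrow>\<^sub>E UNIV)"
    and "(\<Prod>j<N. \<Prod>i<N. 1 / (1 - of_real q * x i * y j)) = 1 / of_real (1 - q ^ N) * infsum h ({1..<N} \<rightarrow>\<^sub>E UNIV)"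
proof -
  let ?E = "{1..<N} \<rightarrow>\<^sub>E (UNIV :: nat set)" and ?T = "\<Prod>j<N. \<Prod>i<N. 1 / (1 - of_real q * x i * y j)"
  let ?j = "\<lambda>kn. restrict (\<lambda>i. dynkin N (snd kn) i + fst kn) {..<N}"
  \<comment> \<open>The last entry counts the full columns, and the Dynkin labels are the gaps
    between neighbours, less one for the staircase.\<close>
  let ?i = "\<lambda>l. (l (N - 1), restrict (\<lambda>m. l (m - 1) - l m - 1) {1..<N})"
  have dyn: "dynkin N n (m - 1) = dynkin N n m + n m + 1" if "m \<in> {1..<N}" for n m
  proof -
    have "{Suc (m - 1)..<N} = insert m {Suc m..<N}" "stair N (m - 1) = stair N m + 1" using that by (auto simp: stair_def)
    thus ?thesis unfolding dynkin_def by simp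
  qed
  have dl: "dynkin N n (N - 1) = 0" for n using N by (simp add: dynkin_def stair_def)
  have trm: "cauchy_term N q x y (?j kn) = of_real (q ^ (N * fst kn)) * h (snd kn)" for kn
  proof -
    have s: "schur N (?j kn) z = schur N (dynkin N (snd kn)) z" if "tpt N z" for z
    proof -
      have "schur N (?j kn) z = schur N (\<lambda>i. dynkin N (snd kn) i + fst kn) z" by (rule fun_cong[OF schur_label_cong]) simp
      thus ?thesis unfolding schur_shift using that by (simp add: tpt_def)
    qed
    have "(\<Sum>i<N. \<Sum>k\<in>{Suc i..<N}. snd kn k) = (\<Sum>j\<in>{1..<N}. j * snd kn j)"
    proof -
      have "(\<Sum>i<N. \<Sum>k\<in>{Suc i..<N}. snd kn k) = (\<Sum>i<N. \<Sum>k\<in>{1..<N}. if i < k then snd kn k else 0)"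
        by (rule sum.cong[OF refl], rule sum.mono_neutral_cong_left) auto
      also have "... = (\<Sum>k\<in>{1..<N}. \<Sum>i<N. if i < k then snd kn k else 0)" by (rule sum.swap)
      also have "... = (\<Sum>k\<in>{1..<N}. k * snd kn k)"
      proof (rule sum.cong[OF refl])
        fix k assume k: "k \<in> {1..<N}"
        have "(\<Sum>i<N. if i < k then snd kn k else 0) = (\<Sum>i<k. snd kn k)"
          by (rule sum.mono_neutral_cong_right) (use k in auto)
        thus "(\<Sum>i<N. if i < k then snd kn k else 0) = k * snd kn k" by simp
      qed
      finally show ?thesis .
    qed
    hence "(\<Sum>i<N. ?j kn i) - (\<Sum>i<N. stair N i) = (\<Sum>j\<in>{1..<N}. j * snd kn j) + N * fst kn"
      by (simp add: dynkin_def sum.distrib)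
    thus ?thesis unfolding cauchy_term_def s[OF x] s[OF y] by (simp add: h_def power_add)
  qed
  have ij: "?i (?j kn) = kn" if "kn \<in> UNIV \<times> ?E" for kn
  proof (rule prod_eqI)
    show "fst (?i (?j kn)) = fst kn" using N dl[of "snd kn"] by simp
    show "snd (?i (?j kn)) = snd kn"
    proof
      fix m show "snd (?i (?j kn)) m = snd kn m"
        using that dyn[of m "snd kn"] by (cases "m \<in> {1..<N}") (auto simp: PiE_iff extensional_def)
    qed
  qed
  have jT: "?j kn \<in> strict_labels N" for kn
  proof -
    have step: "dynkin N n j < dynkin N n i" if "i < j" "j < N" for n i j
    proof -
      have "(\<Sum>k\<in>{Suc j..<N}. n k) \<le> (\<Sum>k\<in>{Suc i..<N}. n k)" using that by (intro sum_mono2) auto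
      moreover have "stair N j < stair N i" using that by (simp add: stair_def)
      ultimately show ?thesis by (simp add: dynkin_def)
    qed
    thus ?thesis by (auto simp: strict_labels_def strict_def)
  qed
  have ji: "?j (?i l) = l" if l: "l \<in> strict_labels N" for l
  proof
    define n where "n = restrict (\<lambda>m. l (m - 1) - l m - 1) {1..<N}"
    fix i show "?j (?i l) i = l i"
    proof (cases "i < N")
      case True
      have "m < N ==> dynkin N n (N - Suc m) + l (N - 1) = l (N - Suc m)" for m
      proof (induction m)
        case 0
        show ?case using dl by simp
      next
        case (Suc m)
        have m: "N - Suc m \<in> {1..<N}" "N - Suc m - 1 = N - Suc (Suc m)" using Suc.prems by auto
        have "l (N - Suc m) < l (N - Suc (Suc m))" using l m by (auto simp: strict_labels_def strict_def)
        moreover have "n (N - Suc m) = l (N - Suc (Suc m)) - l (N - Suc m) - 1" using m by (simp add: n_def)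
        moreover have "dynkin N n (N - Suc (Suc m)) = dynkin N n (N - Suc m) + n (N - Suc m) + 1"
          using dyn[OF m(1), of n] unfolding m(2) .
        moreover have "dynkin N n (N - Suc m) + l (N - 1) = l (N - Suc m)" using Suc by simp
        ultimately show ?case by linarith
      qed
      from this[of "N - Suc i"] have "dynkin N n i + l (N - 1) = l i" using True by simp
      thus ?thesis using True unfolding n_def by simp
    next
      case False
      thus ?thesis using l by (simp add: strict_labels_def PiE_iff extensional_def)
    qed
  qed
  have all: "((\<lambda>kn. of_real (q ^ (N * fst kn)) * h (snd kn)) has_sum ?T) (UNIV \<times> ?E)"
  proof (subst has_sum_reindex_bij_witness[where j = ?j and i = ?i and T = "strict_labels N" and h = "cauchy_term N q x y"])
    show "(cauchy_term N q x y has_sum ?T) (strict_labels N)"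
      by (rule cauchy_identity) (use x y q in \<open>auto simp: tpt_def\<close>)
  qed (use ij ji jT trm in auto)
  \<comment> \<open>The slice without full columns inherits summability from the whole
    family.\<close>
  have "(\<lambda>kn. of_real (q ^ (N * fst kn)) * h (snd kn)) summable_on (Pair 0 ` ?E)"
    by (rule summable_on_subset_banach[OF has_sum_imp_summable[OF all]]) auto
  hence "((\<lambda>kn. of_real (q ^ (N * fst kn)) * h (snd kn)) \<circ> Pair 0) summable_on ?E"
    by (subst (asm) summable_on_reindex) (auto simp: inj_on_def)
  thus sh: "h summable_on ?E" by (simp add: o_def)
  have "((\<lambda>k. of_real (q ^ (N * k)) * infsum h ?E) has_sum ?T) UNIV"
  proof (rule has_sum_SigmaD[OF all])
    fix k :: nat
    show "((\<lambda>n. of_real (q ^ (N * fst (k,n))) * h (snd (k,n))) has_sum of_real (q ^ (N * k)) * infsum h ?E) ?E"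
      unfolding fst_conv snd_conv by (rule has_sum_cmult_right[OF has_sum_infsum[OF sh]])
  qed
  hence "(\<lambda>k. of_real (q ^ (N * k)) * infsum h ?E) sums ?T" by (rule has_sum_imp_sums)
  moreover have "(\<lambda>k. of_real (q ^ (N * k)) * infsum h ?E) sums (1 / of_real (1 - q ^ N) * infsum h ?E)"
  proof -
    have "norm (complex_of_real (q ^ N)) < 1" using q N by (simp add: norm_power power_less_one_iff)
    from sums_mult2[OF geometric_sums[OF this], of "infsum h ?E"]
    show ?thesis by (simp add: power_mult)
  qed
  ultimately show "?T = 1 / of_real (1 - q ^ N) * infsum h ?E" by (rule sums_unique2)
qed

subsection \<open>The fundamental character and its plethystic exponential\<close>

text \<open>The Jacobi--Trudi matrix is triangular; its diagonal is h_1 followed by ones.\<close>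

lemma schur_fundamental:
  assumes z: "tpt N z" and N: "N > 0"
  shows "schur N (dynkin N fundamental_label) z = (\<Sum>i<N. z i)"
proof (cases "N = 1")
  \<comment> \<open>For N = 1 the label is out of range, and the only eigenvalue is 1.\<close>
  case True
  have "schur N (dynkin N fundamental_label) = schur N (stair N)"
    by (rule schur_label_cong) (simp add: dynkin_def True)
  thus ?thesis using z True by (simp add: schur_stair tpt_def)
next
  case False
  let ?l = "dynkin N fundamental_label"
  have l: "?l j = stair N j + (if j = 0 then 1 else 0)" if "j < N" for j
  proof -
    have "(\<Sum>k\<in>{Suc j..<N}. fundamental_label k) = (\<Sum>k\<in>{Suc j..<N} \<inter> {1}. 1)"
      unfolding fundamental_label_def by (rule sum.mono_neutral_cong_right) auto
    also have "{Suc j..<N} \<inter> {1} = (if j = 0 then {1} else {})" using N False by auto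
    finally show ?thesis by (simp add: dynkin_def)
  qed
  let ?A = "mat N N (\<lambda>(j,i). if stair N i \<le> ?l j then hsum {..<N} (?l j - stair N i) z else 0)"
  have "upper_triangular ?A" by (auto simp: upper_triangular_def l stair_def)
  hence "schur N ?l z = prod_list (diag_mat ?A)" unfolding schur_def by (rule det_upper_triangular[of _ N]) simp
  also have "... = (\<Prod>j<N. ?A $$ (j,j))" by (simp add: diag_mat_def prod.list_conv_set_nth atLeast0LessThan)
  also have "... = (\<Prod>j<N. if j = 0 then hsum {..<N} (Suc 0) z else 1)"
    by (rule prod.cong[OF refl]) (auto simp: l)
  also have "... = (\<Sum>i<N. z i)" using N by (simp add: hsum_1)
  finally show ?thesis .
qed

lemma exp_geometric_log:
  assumes "cmod w < 1"
  shows "(\<lambda>r. w ^ Suc r / of_nat (Suc r)) sums (- ln (1 - w))" "exp (- ln (1 - w)) = 1 / (1 - w)"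
proof -
  have "(\<lambda>n. - (w ^ n / of_nat n)) sums ln (1 - w)" using Ln_series'[of "- w"] assms by simp
  hence "(\<lambda>n. w ^ n / of_nat n) sums (- ln (1 - w))" using sums_minus by fastforce
  thus "(\<lambda>r. w ^ Suc r / of_nat (Suc r)) sums (- ln (1 - w))" by (subst sums_Suc_iff) simp
  have "1 - w \<noteq> 0" using assms by auto
  thus "exp (- ln (1 - w)) = 1 / (1 - w)" by (simp add: exp_minus divide_inverse)
qed

lemma PE_sum:
  fixes q :: complex
  assumes fin: "finite A" and w: "!!a. a \<in> A ==> cmod (w a) < 1"
  shows "exp (\<Sum>r. (\<Sum>a\<in>A. w a ^ Suc r) / of_nat (Suc r)) = (\<Prod>a\<in>A. 1 / (1 - w a))"
proof -
  have "(\<lambda>r. \<Sum>a\<in>A. w a ^ Suc r / of_nat (Suc r)) sums (\<Sum>a\<in>A. - ln (1 - w a))"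
    by (intro sums_sum exp_geometric_log(1) w)
  hence "(\<Sum>r. (\<Sum>a\<in>A. w a ^ Suc r) / of_nat (Suc r)) = (\<Sum>a\<in>A. - ln (1 - w a))"
    by (simp add: sums_unique[symmetric] sum_divide_distrib del: of_nat_Suc power_Suc)
  thus ?thesis using fin w by (simp add: exp_sum exp_geometric_log(2))
qed

lemma torus_coord_power: "torus_coord N (\<lambda>k. x k ^ r) i = torus_coord N x i ^ r"
  by (simp add: torus_coord_def power_divide)

text \<open>Because b reverses a, duality lets both factors carry the label of a with the second
  evaluated at inverse coordinates, which is the shape of the Cauchy identity.\<close>

lemma irrep_character:
  assumes N: "N > 0" and irr: "irrep_with_dynkin_labels N a b \<rho>"
    and haar: "normalised_haar_measure N (special_unitary_group N) \<nu>"
    and b: "!!k. k \<in> {1..<N} ==> b k = a (N - k)"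
    and x: "fugacities N x" and y: "fugacities N y"
  shows "rep_character N \<rho> x y = schur N (dynkin N a) (\<lambda>i. torus_coord N x (Suc i)) *
    schur N (dynkin N a) (\<lambda>i. inverse (torus_coord N y (Suc i)))"
proof -
  obtain d where d: "irreducible_representation N d \<rho>" "is_weight N d \<rho> (\<lambda>k. int (a k)) (\<lambda>k. int (b k))"
    and dom: "!!m l. is_weight N d \<rho> m l ==> weight_le N m (\<lambda>k. int (a k)) \<and> weight_le N l (\<lambda>k. int (b k))"
    using irr unfolding irrep_with_dynkin_labels_def by blast
  interpret SU_irrep_haar N d \<rho> \<nu>
    by unfold_locales (use d haar in \<open>auto simp: irreducible_representation_def\<close>)
  have "rep_character N \<rho> x y = schur N (dynkin N a) (\<lambda>i. torus_coord N x (Suc i)) * schur N (dynkin N b) (\<lambda>i. torus_coord N y (Suc i))"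
    unfolding rep_character_def torus_element_def dynkin_def[abs_def]
    by (intro irreducible_character N d dom tpt_torus_coord x y)
  also have "schur N (dynkin N b) = schur N (dynkin N (\<lambda>k. a (N - k)))"
    by (rule schur_label_cong) (simp add: dynkin_def b)
  finally show ?thesis unfolding schur_dynkin_dual[OF tpt_torus_coord[OF y N] N] .
qed

section \<open>Assembly of the Hilbert series, the plethystic exponential and the character
  sum\<close>

theorem mainTheorem7:
  fixes Nc Nf :: nat
    and t u :: real
    and x y :: "nat \<Rightarrow> complex"
    and \<mu>SU \<mu>U :: "complex mat measure"
    and \<rho> :: "(nat \<Rightarrow> nat) \<Rightarrow> (nat \<Rightarrow> nat) \<Rightarrow> complex mat \<times> complex mat \<Rightarrow> complex mat"
  assumes "Nc \<ge> 2" and "1 \<le> Nf" and "Nf \<le> Nc - 1"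
    and "0 \<le> t" and "t < 1" and "0 \<le> u" and "u < 1"
    and "fugacities Nf x" and "fugacities Nf y"
    and "normalised_haar_measure Nc (special_unitary_group Nc) \<mu>SU"
    and "normalised_haar_measure Nc (unitary_group Nc) \<mu>U"
    and "\<And>a b. irrep_with_dynkin_labels Nf a b (\<rho> a b)"
  shows "(hilbert_series \<mu>SU Nf (of_real t) (of_real u) x y =
           hilbert_series \<mu>U Nf (of_real t) (of_real u) x y) \<and>
         (hilbert_series \<mu>SU Nf (of_real t) (of_real u) x y =
           PE (\<lambda>t u x y.
                 rep_character Nf (\<rho> fundamental_label (antifundamental_label Nf)) x y * t * u)
             (of_real t) (of_real u) x y) \<and>
         ((\<lambda>n. rep_character Nf (\<rho> n (\<lambda>k. n (Nf - k))) x y *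
               of_real ((t * u) ^ (\<Sum>j\<in>{1..<Nf}. j * n j)))
           summable_on ({1..<Nf} \<rightarrow>\<^sub>E (UNIV :: nat set))) \<and>
         (PE (\<lambda>t u x y.
                 rep_character Nf (\<rho> fundamental_label (antifundamental_label Nf)) x y * t * u)
             (of_real t) (of_real u) x y =
           1 / of_real (1 - (t * u) ^ Nf) *
           (\<Sum>\<^sub>\<infinity>n\<in>{1..<Nf} \<rightarrow>\<^sub>E (UNIV :: nat set).
              rep_character Nf (\<rho> n (\<lambda>k. n (Nf - k))) x y *
              of_real ((t * u) ^ (\<Sum>j\<in>{1..<Nf}. j * n j)))) \<and>
         (hilbert_series \<mu>SU Nf (of_real t) (of_real u) (\<lambda>_. 1) (\<lambda>_. 1) =
           of_real (1 / (1 - t * u) ^ (Nf ^ 2)))"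
  proof -
  have N: "Nf > 0" "Nf < Nc" "Nf \<le> Nc" using assms by auto
  define q where "q = t * u"
  have q: "0 \<le> q" "q < 1" using assms(4-7) mult_strict_mono[of t 1 u 1] by (auto simp: q_def)
  \<comment> \<open>Orthogonality of the flavour characters is over SU(N_f), for which a Haar
    measure is obtained from that of SU(N_c).\<close>
  obtain \<nu> where \<nu>: "normalised_haar_measure Nf (special_unitary_group Nf) \<nu>"
    using haar_SU_smaller[OF assms(10) N(3)] by blast
  have mean: "unitary_mean \<mu>SU Nc" "unitary_mean \<mu>U Nc"
    using haar_unitary_mean[OF assms(10)] haar_unitary_mean[OF assms(11)] by auto
  let ?x = "\<lambda>i. torus_coord Nf x (Suc i)" and ?y = "\<lambda>i. inverse (torus_coord Nf y (Suc i))"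
  have tx: "tpt Nf ?x" by (rule tpt_torus_coord[OF assms(8) N(1)])
  have ty: "tpt Nf ?y" by (intro tpt_inverse tpt_torus_coord[OF assms(9) N(1)])
  let ?P = "\<Prod>j<Nf. \<Prod>i<Nf. 1 / (1 - of_real q * ?x i * ?y j)"
  have hs: "hilbert_series \<mu> Nf (of_real t) (of_real u) x y = (\<Prod>j<Nf. \<Prod>i<Nf. 1 / (1 - of_real q * torus_coord Nf x (Suc i) * inverse (torus_coord Nf y (Suc j))))"
    if "unitary_mean \<mu> Nc" and xy: "fugacities Nf x" "fugacities Nf y" for \<mu> x y
  proof -
    have u: "cmod (torus_coord Nf z j) = 1" if z: "fugacities Nf z" and j: "j \<in> {1..Nf}" for z j
      using tpt_torus_coord[OF z N(1)] j by (cases j) (auto simp: tpt_def)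
    have "hilbert_series \<mu> Nf (of_real t) (of_real u) x y =
      (\<Prod>i=1..Nf. \<Prod>j=1..Nf. 1 / (1 - of_real t * of_real u * torus_coord Nf x i * inverse (torus_coord Nf y j)))"
      using assms(4-7) by (intro hilbert_series_eq[OF that(1) N(2)] u xy) auto
    also have "... = (\<Prod>i<Nf. \<Prod>j<Nf. 1 / (1 - of_real q * torus_coord Nf x (Suc i) * inverse (torus_coord Nf y (Suc j))))"
      by (simp add: prod.atLeast1_atMost_eq q_def)
    finally show ?thesis by (subst (asm) prod.swap)
  qed
  have char: "rep_character Nf (\<rho> n (\<lambda>k. n (Nf - k))) x y = schur Nf (dynkin Nf n) ?x * schur Nf (dynkin Nf n) ?y" for n
    by (rule irrep_character[OF N(1) assms(12) \<nu> _ assms(8,9)]) simp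
  \<comment> \<open>General fugacities are needed because the plethystic exponential evaluates the
    character at all powers of x and y.\<close>
  have fund: "rep_character Nf (\<rho> fundamental_label (antifundamental_label Nf)) x' y' =
      (\<Sum>i<Nf. torus_coord Nf x' (Suc i)) * (\<Sum>j<Nf. inverse (torus_coord Nf y' (Suc j)))"
    if xy: "fugacities Nf x'" "fugacities Nf y'" for x' y'
  proof -
    have t: "tpt Nf (\<lambda>i. torus_coord Nf x' (Suc i))" "tpt Nf (\<lambda>i. inverse (torus_coord Nf y' (Suc i)))"
      by (intro tpt_inverse tpt_torus_coord[OF xy(1) N(1)] tpt_torus_coord[OF xy(2) N(1)])+
    \<comment> \<open>Reversing the fundamental label gives the antifundamental one, so the case
      falls under \<open>irrep_character\<close>.\<close>
    have "antifundamental_label Nf k = fundamental_label (Nf - k)" if "k \<in> {1..<Nf}" for k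
      using that by (auto simp: antifundamental_label_def fundamental_label_def)
    from irrep_character[where a = fundamental_label and b = "antifundamental_label Nf", OF N(1) assms(12) \<nu> this xy]
    show ?thesis by (simp only: schur_fundamental[OF t(1) N(1)] schur_fundamental[OF t(2) N(1)])
  qed
  have PE: "PE (\<lambda>t u x y. rep_character Nf (\<rho> fundamental_label (antifundamental_label Nf)) x y * t * u)
      (of_real t) (of_real u) x y = ?P"
  proof -
    let ?A = "{..<Nf} \<times> {..<Nf}" and ?w = "\<lambda>a. of_real q * ?x (snd a) * ?y (fst a)"
    have "rep_character Nf (\<rho> fundamental_label (antifundamental_label Nf)) (\<lambda>k. x k ^ Suc r) (\<lambda>k. y k ^ Suc r) *
        of_real t ^ Suc r * of_real u ^ Suc r = (\<Sum>a\<in>?A. ?w a ^ Suc r)" for r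
    proof -
      have "fugacities Nf (\<lambda>k. x k ^ Suc r)" "fugacities Nf (\<lambda>k. y k ^ Suc r)"
        using assms(8,9) by (auto simp: fugacities_def norm_power norm_mult)
      from fund[OF this] have "rep_character Nf (\<rho> fundamental_label (antifundamental_label Nf)) (\<lambda>k. x k ^ Suc r) (\<lambda>k. y k ^ Suc r) *
        of_real t ^ Suc r * of_real u ^ Suc r = (\<Sum>i<Nf. ?x i ^ Suc r) * (\<Sum>j<Nf. ?y j ^ Suc r) * of_real q ^ Suc r"
        by (simp only: torus_coord_power power_inverse q_def of_real_mult power_mult_distrib mult.assoc)
      also have "... = (\<Sum>i<Nf. \<Sum>j<Nf. ?x i ^ Suc r * ?y j ^ Suc r) * of_real q ^ Suc r"
        by (simp only: sum_product)
      also have "(\<Sum>i<Nf. \<Sum>j<Nf. ?x i ^ Suc r * ?y j ^ Suc r) = (\<Sum>j<Nf. \<Sum>i<Nf. ?x i ^ Suc r * ?y j ^ Suc r)"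
        by (rule sum.swap)
      also have "... * of_real q ^ Suc r = (\<Sum>j<Nf. \<Sum>i<Nf. (of_real q * ?x i * ?y j) ^ Suc r)"
        by (simp only: sum_distrib_left power_mult_distrib mult_ac)
      finally show ?thesis by (simp only: sum.cartesian_product case_prod_unfold)
    qed
    moreover have "cmod (?w a) < 1" if "a \<in> ?A" for a
    proof -
      have "cmod (?x (snd a)) = 1" "cmod (?y (fst a)) = 1" using that tx ty unfolding tpt_def by auto
      thus ?thesis using q by (simp add: norm_mult)
    qed
    ultimately show ?thesis
      using PE_sum[of ?A ?w] by (simp add: PE_def prod.cartesian_product case_prod_unfold del: power_Suc of_nat_Suc)
  qed
  note C = cauchy_dynkin[OF tx ty q N(1)]
  have one: "hilbert_series \<mu>SU Nf (of_real t) (of_real u) (\<lambda>_. 1) (\<lambda>_. 1) = of_real (1 / (1 - t * u) ^ (Nf ^ 2))"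
    by (subst hs[OF mean(1)]) (simp_all add: fugacities_def torus_coord_def q_def power_mult[symmetric] power2_eq_square power_one_over)
  show ?thesis
  proof (intro conjI)
    show "hilbert_series \<mu>SU Nf (of_real t) (of_real u) x y = hilbert_series \<mu>U Nf (of_real t) (of_real u) x y"
      by (simp only: hs[OF mean(1) assms(8,9)] hs[OF mean(2) assms(8,9)])
    show "hilbert_series \<mu>SU Nf (of_real t) (of_real u) x y =
       PE (\<lambda>t u x y. rep_character Nf (\<rho> fundamental_label (antifundamental_label Nf)) x y * t * u) (of_real t) (of_real u) x y"
      by (simp only: hs[OF mean(1) assms(8,9)] PE)
  qed (use C one in \<open>simp_all only: char PE q_def\<close>)
qed

end
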